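(* Assume Conjecture UFM$_p$. Let $K$ be a number field, $S$ a finite set of primes of $K$ containing no prime above $p$, $\mathbb{F}$ a finite field of characteristic $p$, and $\overline{\rho}:G_{K,S}\to\mathrm{GL}_n(\mathbb{F})$ a continuous absolutely irreducible representation. Then the universal deformation ring $R_{\overline{\rho}}$ of $\overline{\rho}$ is finite over $W(\mathbb{F})$.
   Context: $G_{K,S}$ is the Galois group of the maximal extension of $K$ unramified outside $S$. Conjecture UFM$_p$: for every number field $K'$, every finite set $S'$ of primes of $K'$ containing no prime above $p$, every non-Archimedean local field $F$ of characteristic $p$ and every $m\ge1$, every continuous representation $G_{K',S'}\to\mathrm{GL}_m(F)$ has finite image. $W(\mathbb{F})$ is the ring of Witt vectors of $\mathbb{F}$; $R_{\overline{\rho}}$ is the complete Noetherian local $W(\mathbb{F})$-algebra with residue field $\mathbb{F}$ pro-representing the functor of deformations of $\overline{\rho}$ (isomorphism classes of free rank-$n$ modules over complete Noetherian local $W(\mathbb{F})$-algebras $A$ with residue field $\mathbb{F}$, with continuous $G_{K,S}$-action and a $G_{K,S}$-equivariant isomorphism of the reduction with $\mathbb{F}^n$ carrying $\overline{\rho}$). *)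

theory Defs
  imports
    "HOL-Algebra.Algebra"
    "HOL-Algebra.Algebraic_Closure_Type"
    "HOL-Analysis.Analysis"
    "HOL-Library.Poly_Mapping"
begin

section \<open>Number fields and their primes\<close>

text \<open>A number field is taken inside the complex numbers; up to isomorphism this loses nothing,
  and it allows quantifying over all number fields within one formula.\<close>

abbreviation CC :: "complex ring"
  where "CC \<equiv> ring_of_type_algebra"

definition finite_extension :: "complex set \<Rightarrow> complex set \<Rightarrow> bool"
  where "finite_extension K L \<longleftrightarrow>
    subfield K CC \<and> subfield L CC \<and> K \<subseteq> L \<and> ring.finite_dimension CC K L"

definition number_field :: "complex set \<Rightarrow> bool"
  where "number_field K \<longleftrightarrow> finite_extension \<rat> K"

definition ring_of_integers :: "complex set \<Rightarrow> complex ring"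
  where "ring_of_integers K = CC \<lparr> carrier := {x \<in> K. algebraic_int x} \<rparr>"

definition embeddings :: "complex set \<Rightarrow> (complex \<Rightarrow> complex) set"
  where "embeddings K = ring_hom (CC \<lparr> carrier := K \<rparr>) CC \<inter> extensional K"

text \<open>A finite prime is a nonzero prime ideal of the ring of integers, an infinite prime is a
  pair of complex conjugate embeddings (one embedding if it is real).\<close>

datatype nf_prime =
    Finite_Prime "complex set"
  | Infinite_Prime "(complex \<Rightarrow> complex) set"

definition finite_primes :: "complex set \<Rightarrow> complex set set"
  where "finite_primes K =
    {P. primeideal P (ring_of_integers K) \<and> P \<noteq> {0}}"

definition primes_of :: "complex set \<Rightarrow> nf_prime set"
  where "primes_of K =
    Finite_Prime ` finite_primes K \<union>
    (\<lambda>\<sigma>. Infinite_Prime {\<sigma>, restrict (cnj \<circ> \<sigma>) K}) ` embeddings K"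

definition prime_above :: "nat \<Rightarrow> nf_prime \<Rightarrow> bool"
  where "prime_above p v \<longleftrightarrow> (\<exists>P. v = Finite_Prime P \<and> of_nat p \<in> P)"

definition ramification_index :: "complex set \<Rightarrow> complex set \<Rightarrow> complex set \<Rightarrow> nat"
  where "ramification_index L P Q =
    (GREATEST e. P \<subseteq> Q [^]\<^bsub>ideals_set (ring_of_integers L)\<^esub> e)"

text \<open>Residue fields at finite primes are finite, so separability of residue extensions is automatic.
  An infinite prime ramifies in \<open>L\<close> iff it is real and some prime of \<open>L\<close> above it is complex.\<close>

fun unramified_at :: "complex set \<Rightarrow> complex set \<Rightarrow> nf_prime \<Rightarrow> bool"
  where
    "unramified_at K L (Finite_Prime P) \<longleftrightarrow>
      (\<forall>Q \<in> finite_primes L. P \<subseteq> Q \<longrightarrow> ramification_index L P Q = 1)"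
  | "unramified_at K L (Infinite_Prime v) \<longleftrightarrow>
      (\<forall>\<tau> \<in> embeddings L. restrict \<tau> K \<in> v \<longrightarrow> \<tau> ` K \<subseteq> \<real> \<longrightarrow> \<tau> ` L \<subseteq> \<real>)"

text \<open>The maximal extension of \<open>K\<close> unramified outside \<open>S\<close>: the compositum of all finite ones.\<close>

definition max_unramified_outside :: "complex set \<Rightarrow> nf_prime set \<Rightarrow> complex set"
  where "max_unramified_outside K S = generate_field CC
    (\<Union>{L. finite_extension K L \<and> (\<forall>v \<in> primes_of K - S. unramified_at K L v)})"

definition galois_group :: "complex set \<Rightarrow> complex set \<Rightarrow> (complex \<Rightarrow> complex) monoid"
  where "galois_group K E = (BijGroup E) \<lparr> carrier :=
    {\<sigma> \<in> Bij E. \<sigma> \<in> ring_hom (CC \<lparr> carrier := E \<rparr>) (CC \<lparr> carrier := E \<rparr>) \<and> (\<forall>x \<in> K. \<sigma> x = x)} \<rparr>"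

definition krull_topology :: "complex set \<Rightarrow> complex set \<Rightarrow> (complex \<Rightarrow> complex) topology"
  where "krull_topology K E =
    subtopology (product_topology (\<lambda>_. discrete_topology E) E) (carrier (galois_group K E))"

definition GKS :: "complex set \<Rightarrow> nf_prime set \<Rightarrow> (complex \<Rightarrow> complex) monoid"
  where "GKS K S = galois_group K (max_unramified_outside K S)"

definition GKS_topology :: "complex set \<Rightarrow> nf_prime set \<Rightarrow> (complex \<Rightarrow> complex) topology"
  where "GKS_topology K S = krull_topology K (max_unramified_outside K S)"


section \<open>Matrix representations\<close>

text \<open>An \<open>n\<close> by \<open>n\<close> matrix is an extensional function on \<open>{..<n} \<times> {..<n}\<close>.\<close>

definition mat_monoid :: "nat \<Rightarrow> ('a, 'b) ring_scheme \<Rightarrow> (nat \<times> nat \<Rightarrow> 'a) monoid"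
  where "mat_monoid n A =
    \<lparr> carrier = ({..<n} \<times> {..<n}) \<rightarrow>\<^sub>E carrier A,
      monoid.mult = (\<lambda>M N. \<lambda>(i, j) \<in> {..<n} \<times> {..<n}. \<Oplus>\<^bsub>A\<^esub>k\<in>{..<n}. M (i, k) \<otimes>\<^bsub>A\<^esub> N (k, j)),
      one = (\<lambda>(i, j) \<in> {..<n} \<times> {..<n}. if i = j then \<one>\<^bsub>A\<^esub> else \<zero>\<^bsub>A\<^esub>) \<rparr>"

definition GL :: "nat \<Rightarrow> ('a, 'b) ring_scheme \<Rightarrow> (nat \<times> nat \<Rightarrow> 'a) monoid"
  where "GL n A = units_of (mat_monoid n A)"

text \<open>Used only over topological fields, where inversion is continuous and hence the topology
  induced from the space of matrices is the topology of \<open>GL\<close>.\<close>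

definition GL_topology ::
    "nat \<Rightarrow> ('a, 'b) ring_scheme \<Rightarrow> 'a topology \<Rightarrow> (nat \<times> nat \<Rightarrow> 'a) topology"
  where "GL_topology n A T =
    subtopology (product_topology (\<lambda>_. T) ({..<n} \<times> {..<n})) (carrier (GL n A))"

definition continuous_rep ::
    "('g, 'c) monoid_scheme \<Rightarrow> 'g topology \<Rightarrow> nat \<Rightarrow> ('a, 'b) ring_scheme \<Rightarrow> 'a topology \<Rightarrow>
      ('g \<Rightarrow> nat \<times> nat \<Rightarrow> 'a) \<Rightarrow> bool"
  where "continuous_rep G TG n A T \<rho> \<longleftrightarrow>
    \<rho> \<in> hom G (GL n A) \<and> continuous_map TG (GL_topology n A T) \<rho>"

text \<open>The free module \<open>A\<^sup>n\<close>. The record type \<^typ>\<open>('a, 'b) module\<close> has fields for a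
  ring structure on the module; the locale \<^locale>\<open>module\<close> ignores \<open>mult\<close> and \<open>one\<close>.\<close>

definition vec_module :: "nat \<Rightarrow> ('a, 'b) ring_scheme \<Rightarrow> ('a, nat \<Rightarrow> 'a) module"
  where "vec_module n A =
    \<lparr> carrier = {..<n} \<rightarrow>\<^sub>E carrier A,
      monoid.mult = (\<lambda>_ _. undefined),
      one = undefined,
      ring.zero = (\<lambda>i \<in> {..<n}. \<zero>\<^bsub>A\<^esub>),
      add = (\<lambda>x y. \<lambda>i \<in> {..<n}. x i \<oplus>\<^bsub>A\<^esub> y i),
      module.smult = (\<lambda>a x. \<lambda>i \<in> {..<n}. a \<otimes>\<^bsub>A\<^esub> x i) \<rparr>"

definition mat_vec ::
    "nat \<Rightarrow> ('a, 'b) ring_scheme \<Rightarrow> (nat \<times> nat \<Rightarrow> 'a) \<Rightarrow> (nat \<Rightarrow> 'a) \<Rightarrow> nat \<Rightarrow> 'a"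
  where "mat_vec n A M x = (\<lambda>i \<in> {..<n}. \<Oplus>\<^bsub>A\<^esub>j\<in>{..<n}. M (i, j) \<otimes>\<^bsub>A\<^esub> x j)"

definition irreducible_rep ::
    "('g, 'c) monoid_scheme \<Rightarrow> nat \<Rightarrow> ('a, 'b) ring_scheme \<Rightarrow> ('g \<Rightarrow> nat \<times> nat \<Rightarrow> 'a) \<Rightarrow> bool"
  where "irreducible_rep G n E \<rho> \<longleftrightarrow> 0 < n \<and>
    (\<forall>V. submodule V E (vec_module n E) \<and> (\<forall>g \<in> carrier G. \<forall>x \<in> V. mat_vec n E (\<rho> g) x \<in> V) \<longrightarrow>
      V = {\<zero>\<^bsub>vec_module n E\<^esub>} \<or> V = carrier (vec_module n E))"

text \<open>\<^term>\<open>ring.indexed_const F\<close> is the library's embedding of \<open>F\<close> into its algebraic closure.\<close>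

definition absolutely_irreducible_rep ::
    "('g, 'c) monoid_scheme \<Rightarrow> nat \<Rightarrow> 'f ring \<Rightarrow> ('g \<Rightarrow> nat \<times> nat \<Rightarrow> 'f) \<Rightarrow> bool"
  where "absolutely_irreducible_rep G n F \<rho> \<longleftrightarrow>
    irreducible_rep G n (field.alg_closure F)
      (\<lambda>g. \<lambda>ij \<in> {..<n} \<times> {..<n}. ring.indexed_const F (\<rho> g ij))"


section \<open>Non-Archimedean local fields\<close>

text \<open>A type with the cardinality of the continuum. Non-Archimedean local fields and complete
  Noetherian local rings with finite residue field have at most this cardinality, so each of them
  is isomorphic to one with carrier in this type.\<close>

type_synonym continuum = "nat \<Rightarrow> nat"

definition valuation_dist :: "('a, 'b) ring_scheme \<Rightarrow> ('a \<Rightarrow> int) \<Rightarrow> 'a \<Rightarrow> 'a \<Rightarrow> real"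
  where "valuation_dist F v x y =
    (if x \<in> carrier F \<and> y \<in> carrier F \<and> x \<noteq> y then 2 powi (- v (x \<ominus>\<^bsub>F\<^esub> y)) else 0)"

text \<open>\<open>F\<close> is complete with respect to the normalised discrete valuation \<open>v\<close> (whose value at zero,
  conventionally infinite, is irrelevant here) and has finite residue field.\<close>

definition nonarch_local_field :: "'a ring \<Rightarrow> ('a \<Rightarrow> int) \<Rightarrow> bool"
  where "nonarch_local_field F v \<longleftrightarrow> field F \<and>
    v ` (carrier F - {\<zero>\<^bsub>F\<^esub>}) = UNIV \<and>
    (\<forall>x \<in> carrier F - {\<zero>\<^bsub>F\<^esub>}. \<forall>y \<in> carrier F - {\<zero>\<^bsub>F\<^esub>}.
      v (x \<otimes>\<^bsub>F\<^esub> y) = v x + v y \<and>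
      (x \<oplus>\<^bsub>F\<^esub> y \<noteq> \<zero>\<^bsub>F\<^esub> \<longrightarrow> min (v x) (v y) \<le> v (x \<oplus>\<^bsub>F\<^esub> y))) \<and>
    Metric_space.mcomplete (carrier F) (valuation_dist F v) \<and>
    finite (carrier ((F \<lparr> carrier := {x \<in> carrier F. x = \<zero>\<^bsub>F\<^esub> \<or> 0 \<le> v x} \<rparr>)
      Quot {x \<in> carrier F. x = \<zero>\<^bsub>F\<^esub> \<or> 0 < v x}))"

definition local_field_topology :: "'a ring \<Rightarrow> ('a \<Rightarrow> int) \<Rightarrow> 'a topology"
  where "local_field_topology F v = Metric_space.mtopology (carrier F) (valuation_dist F v)"

text \<open>For a prime \<open>p\<close> and a field \<open>F\<close> this says that \<open>F\<close> has characteristic \<open>p\<close>.\<close>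

definition has_char :: "('a, 'b) ring_scheme \<Rightarrow> nat \<Rightarrow> bool"
  where "has_char F p \<longleftrightarrow> [p] \<cdot>\<^bsub>F\<^esub> \<one>\<^bsub>F\<^esub> = \<zero>\<^bsub>F\<^esub>"

definition conjecture_UFM :: "nat \<Rightarrow> bool"
  where "conjecture_UFM p \<longleftrightarrow>
    (\<forall>K S (F :: continuum ring) v m \<rho>.
      number_field K \<and> finite S \<and> S \<subseteq> primes_of K \<and> (\<forall>P \<in> S. \<not> prime_above p P) \<and>
      nonarch_local_field F v \<and> has_char F p \<and> 1 \<le> m \<and>
      continuous_rep (GKS K S) (GKS_topology K S) m F (local_field_topology F v) \<rho> \<longrightarrow>
      finite (\<rho> ` carrier (GKS K S)))"


section \<open>Witt vectors\<close>

text \<open>Integer polynomials in the variables \<open>X\<^sub>i\<close> (\<^term>\<open>Inl i\<close>) and \<open>Y\<^sub>i\<close> (\<^term>\<open>Inr i\<close>).\<close>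

type_synonym xy_poly = "((nat + nat) \<Rightarrow>\<^sub>0 nat) \<Rightarrow>\<^sub>0 int"

definition xy_var :: "nat + nat \<Rightarrow> xy_poly"
  where "xy_var v = Poly_Mapping.single (Poly_Mapping.single v 1) 1"

definition xy_eval :: "('a, 'b) ring_scheme \<Rightarrow> (nat + nat \<Rightarrow> 'a) \<Rightarrow> xy_poly \<Rightarrow> 'a"
  where "xy_eval A f P = (\<Oplus>\<^bsub>A\<^esub>m\<in>Poly_Mapping.keys P. add_pow A (Poly_Mapping.lookup P m)
    (finprod A (\<lambda>v. f v [^]\<^bsub>A\<^esub> Poly_Mapping.lookup m v) (Poly_Mapping.keys m)))"

definition ghost :: "nat \<Rightarrow> (nat \<Rightarrow> 'a::comm_ring_1) \<Rightarrow> nat \<Rightarrow> 'a"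
  where "ghost p x n = (\<Sum>i\<le>n. of_nat p ^ i * x i ^ (p ^ (n - i)))"

text \<open>For prime \<open>p\<close>, Witt's theorem gives existence and uniqueness of these integral polynomials.\<close>

definition witt_add_poly :: "nat \<Rightarrow> nat \<Rightarrow> xy_poly"
  where "witt_add_poly p = (THE s. \<forall>n. ghost p s n =
    ghost p (\<lambda>i. xy_var (Inl i)) n + ghost p (\<lambda>i. xy_var (Inr i)) n)"

definition witt_mult_poly :: "nat \<Rightarrow> nat \<Rightarrow> xy_poly"
  where "witt_mult_poly p = (THE s. \<forall>n. ghost p s n =
    ghost p (\<lambda>i. xy_var (Inl i)) n * ghost p (\<lambda>i. xy_var (Inr i)) n)"

definition witt_ring :: "nat \<Rightarrow> ('a, 'b) ring_scheme \<Rightarrow> (nat \<Rightarrow> 'a) ring"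
  where "witt_ring p A =
    \<lparr> carrier = UNIV \<rightarrow> carrier A,
      monoid.mult = (\<lambda>x y n. xy_eval A (case_sum x y) (witt_mult_poly p n)),
      one = (\<lambda>n. if n = 0 then \<one>\<^bsub>A\<^esub> else \<zero>\<^bsub>A\<^esub>),
      ring.zero = (\<lambda>_. \<zero>\<^bsub>A\<^esub>),
      add = (\<lambda>x y n. xy_eval A (case_sum x y) (witt_add_poly p n)) \<rparr>"


section \<open>The coefficient category\<close>

definition local_cring :: "('a, 'b) ring_scheme \<Rightarrow> bool"
  where "local_cring A \<longleftrightarrow> cring A \<and> (\<exists>!I. maximalideal I A)"

definition max_ideal :: "('a, 'b) ring_scheme \<Rightarrow> 'a set"
  where "max_ideal A = (THE I. maximalideal I A)"

definition max_ideal_pow :: "('a, 'b) ring_scheme \<Rightarrow> nat \<Rightarrow> 'a set"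
  where "max_ideal_pow A k = max_ideal A [^]\<^bsub>ideals_set A\<^esub> k"

definition complete_local :: "('a, 'b) ring_scheme \<Rightarrow> bool"
  where "complete_local A \<longleftrightarrow> local_cring A \<and>
    (\<Inter>k. max_ideal_pow A k) = {\<zero>\<^bsub>A\<^esub>} \<and>
    (\<forall>s. (\<forall>k. s k \<in> carrier A \<and> s (Suc k) \<ominus>\<^bsub>A\<^esub> s k \<in> max_ideal_pow A k) \<longrightarrow>
      (\<exists>x \<in> carrier A. \<forall>k. x \<ominus>\<^bsub>A\<^esub> s k \<in> max_ideal_pow A k))"

text \<open>A ring with a structure map from the Witt vectors over \<open>F\<close> and a reduction map to \<open>F\<close>.\<close>

record ('a, 'f) witt_alg = "'a ring" +
  struct_map :: "(nat \<Rightarrow> 'f) \<Rightarrow> 'a"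
  residue_map :: "'a \<Rightarrow> 'f"

text \<open>Complete Noetherian local \<open>W(F)\<close>-algebras with residue field \<open>F\<close>: the identification of the
  residue field with \<open>F\<close> is one of \<open>W(F)\<close>-algebras, where \<open>F\<close> is the residue field of
  \<open>W(F)\<close> via the zeroth Witt component.\<close>

definition coeff_algebra :: "nat \<Rightarrow> 'f ring \<Rightarrow> ('a, 'f) witt_alg \<Rightarrow> bool"
  where "coeff_algebra p F A \<longleftrightarrow> complete_local A \<and> noetherian_ring A \<and>
    struct_map A \<in> ring_hom (witt_ring p F) A \<and>
    residue_map A \<in> ring_hom A F \<and>
    residue_map A ` carrier A = carrier F \<and>
    a_kernel A F (residue_map A) = max_ideal A \<and>
    (\<forall>w \<in> carrier (witt_ring p F). residue_map A (struct_map A w) = w 0)"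

text \<open>Local \<open>W(F)\<close>-algebra homomorphisms, made extensional so that equal maps are equal functions.\<close>

definition coeff_hom ::
    "nat \<Rightarrow> 'f ring \<Rightarrow> ('a, 'f) witt_alg \<Rightarrow> ('b, 'f) witt_alg \<Rightarrow> ('a \<Rightarrow> 'b) set"
  where "coeff_hom p F A B = {h \<in> ring_hom A B \<inter> extensional (carrier A).
    (\<forall>w \<in> carrier (witt_ring p F). h (struct_map A w) = struct_map B w) \<and>
    (\<forall>x \<in> carrier A. residue_map B (h x) = residue_map A x)}"


section \<open>Deformations\<close>

definition semilinear ::
    "('a, 'c) ring_scheme \<Rightarrow> ('a \<Rightarrow> 'b) \<Rightarrow> ('a, 'm) module \<Rightarrow> ('b, 'n) module \<Rightarrow> ('m \<Rightarrow> 'n) \<Rightarrow> bool"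
  where "semilinear A f M N h \<longleftrightarrow> h \<in> carrier M \<rightarrow> carrier N \<and>
    (\<forall>x \<in> carrier M. \<forall>y \<in> carrier M. h (x \<oplus>\<^bsub>M\<^esub> y) = h x \<oplus>\<^bsub>N\<^esub> h y) \<and>
    (\<forall>a \<in> carrier A. \<forall>x \<in> carrier M. h (a \<odot>\<^bsub>M\<^esub> x) = f a \<odot>\<^bsub>N\<^esub> h x)"

definition module_basis ::
    "('a, 'c) ring_scheme \<Rightarrow> ('a, 'm) module \<Rightarrow> nat \<Rightarrow> (nat \<Rightarrow> 'm) \<Rightarrow> bool"
  where "module_basis A M n b \<longleftrightarrow> b \<in> {..<n} \<rightarrow> carrier M \<and>
    (\<forall>x \<in> carrier M. \<exists>!c. c \<in> {..<n} \<rightarrow>\<^sub>E carrier A \<and> x = (\<Oplus>\<^bsub>M\<^esub>i\<in>{..<n}. c i \<odot>\<^bsub>M\<^esub> b i))"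

definition ideal_smult :: "'a set \<Rightarrow> ('a, 'm) module \<Rightarrow> 'm set"
  where "ideal_smult I M = generate (add_monoid M) {a \<odot>\<^bsub>M\<^esub> x | a x. a \<in> I \<and> x \<in> carrier M}"

definition adic_topology :: "('a, 'c) ring_scheme \<Rightarrow> ('a, 'm) module \<Rightarrow> 'm topology"
  where "adic_topology A M = topology (\<lambda>U. U \<subseteq> carrier M \<and>
    (\<forall>x \<in> U. \<exists>k. \<forall>y \<in> ideal_smult (max_ideal_pow A k) M. x \<oplus>\<^bsub>M\<^esub> y \<in> U))"

text \<open>A module with a group action and a reduction map to \<open>F\<^sup>n\<close>.\<close>

record ('a, 'm, 'g, 'f) deformation_data =
  dmod :: "('a, 'm) module"
  dact :: "'g \<Rightarrow> 'm \<Rightarrow> 'm"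
  dred :: "'m \<Rightarrow> nat \<Rightarrow> 'f"

text \<open>The isomorphism of \<open>M / \<mm> M\<close> with \<open>F\<^sup>n\<close> is given by its composition with \<open>M \<rightarrow> M / \<mm> M\<close>,
  that is, a surjection with kernel \<open>\<mm> M\<close>.\<close>

definition deformation ::
    "('g, 'c) monoid_scheme \<Rightarrow> 'g topology \<Rightarrow> nat \<Rightarrow> 'f ring \<Rightarrow> ('g \<Rightarrow> nat \<times> nat \<Rightarrow> 'f) \<Rightarrow>
      ('a, 'f) witt_alg \<Rightarrow> ('a, 'm, 'g, 'f) deformation_data \<Rightarrow> bool"
  where "deformation G TG n F \<rho> A D \<longleftrightarrow>
    (let M = dmod D; \<alpha> = dact D; \<pi> = dred D in
      module A M \<and> (\<exists>b. module_basis A M n b) \<and>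
      (\<forall>g \<in> carrier G. semilinear A (\<lambda>a. a) M M (\<alpha> g)) \<and>
      (\<forall>x \<in> carrier M. \<alpha> \<one>\<^bsub>G\<^esub> x = x) \<and>
      (\<forall>g \<in> carrier G. \<forall>h \<in> carrier G. \<forall>x \<in> carrier M. \<alpha> (g \<otimes>\<^bsub>G\<^esub> h) x = \<alpha> g (\<alpha> h x)) \<and>
      continuous_map (prod_topology TG (adic_topology A M)) (adic_topology A M)
        (\<lambda>(g, x). \<alpha> g x) \<and>
      semilinear A (residue_map A) M (vec_module n F) \<pi> \<and>
      \<pi> ` carrier M = carrier (vec_module n F) \<and>
      {x \<in> carrier M. \<pi> x = \<zero>\<^bsub>vec_module n F\<^esub>} = ideal_smult (max_ideal A) M \<and>
      (\<forall>g \<in> carrier G. \<forall>x \<in> carrier M. \<pi> (\<alpha> g x) = mat_vec n F (\<rho> g) (\<pi> x)))"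

text \<open>For a morphism \<open>f : A \<rightarrow> B\<close>, maps of deformations lying over \<open>f\<close>.\<close>

definition deformation_map ::
    "('g, 'c) monoid_scheme \<Rightarrow> ('a, 'd) ring_scheme \<Rightarrow> ('a \<Rightarrow> 'b) \<Rightarrow>
      ('a, 'm, 'g, 'f) deformation_data \<Rightarrow> ('b, 'n, 'g, 'f) deformation_data \<Rightarrow> ('m \<Rightarrow> 'n) \<Rightarrow> bool"
  where "deformation_map G A f D D' h \<longleftrightarrow>
    semilinear A f (dmod D) (dmod D') h \<and>
    (\<forall>g \<in> carrier G. \<forall>x \<in> carrier (dmod D). h (dact D g x) = dact D' g (h x)) \<and>
    (\<forall>x \<in> carrier (dmod D). dred D' (h x) = dred D x)"

text \<open>Since a free module of rank \<open>n\<close> over \<open>A\<close> embeds into the type \<^typ>\<open>nat \<Rightarrow> 'a\<close>, every deformation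
  to \<open>A\<close> is isomorphic to one whose module has its carrier in that type.\<close>

type_synonym ('a, 'g, 'f) small_deformation = "('a, nat \<Rightarrow> 'a, 'g, 'f) deformation_data"

definition deformation_iso ::
    "('g, 'c) monoid_scheme \<Rightarrow> 'g topology \<Rightarrow> nat \<Rightarrow> 'f ring \<Rightarrow> ('g \<Rightarrow> nat \<times> nat \<Rightarrow> 'f) \<Rightarrow>
      ('a, 'f) witt_alg \<Rightarrow> ('a, 'g, 'f) small_deformation rel"
  where "deformation_iso G TG n F \<rho> A = {(D, D').
    deformation G TG n F \<rho> A D \<and> deformation G TG n F \<rho> A D' \<and>
    (\<exists>h. deformation_map G A (\<lambda>a. a) D D' h \<and> bij_betw h (carrier (dmod D)) (carrier (dmod D')))}"

definition deformation_functor ::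
    "('g, 'c) monoid_scheme \<Rightarrow> 'g topology \<Rightarrow> nat \<Rightarrow> 'f ring \<Rightarrow> ('g \<Rightarrow> nat \<times> nat \<Rightarrow> 'f) \<Rightarrow>
      ('a, 'f) witt_alg \<Rightarrow> ('a, 'g, 'f) small_deformation set set"
  where "deformation_functor G TG n F \<rho> A =
    {D. deformation G TG n F \<rho> A D} // deformation_iso G TG n F \<rho> A"

text \<open>\<open>D'\<close> is the base change of \<open>D\<close> along \<open>f : A \<rightarrow> B\<close>: the \<open>B\<close>-linear map \<open>B \<otimes>\<^sub>A D \<rightarrow> D'\<close> induced
  by \<open>h\<close> is an isomorphism, i.e. \<open>h\<close> maps a basis of \<open>D\<close> to a basis of \<open>D'\<close>.\<close>

definition is_base_change ::
    "('g, 'c) monoid_scheme \<Rightarrow> nat \<Rightarrow> ('a, 'd) ring_scheme \<Rightarrow> ('b, 'e) ring_scheme \<Rightarrow> ('a \<Rightarrow> 'b) \<Rightarrow>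
      ('a, 'm, 'g, 'f) deformation_data \<Rightarrow> ('b, 'n, 'g, 'f) deformation_data \<Rightarrow> bool"
  where "is_base_change G n A B f D D' \<longleftrightarrow>
    (\<exists>h b. deformation_map G A f D D' h \<and>
      module_basis A (dmod D) n b \<and> module_basis B (dmod D') n (h \<circ> b))"

definition deformation_functor_map ::
    "('g, 'c) monoid_scheme \<Rightarrow> 'g topology \<Rightarrow> nat \<Rightarrow> 'f ring \<Rightarrow> ('g \<Rightarrow> nat \<times> nat \<Rightarrow> 'f) \<Rightarrow>
      ('a, 'f) witt_alg \<Rightarrow> ('b, 'f) witt_alg \<Rightarrow> ('a \<Rightarrow> 'b) \<Rightarrow>
      ('a, 'g, 'f) small_deformation set \<Rightarrow> ('b, 'g, 'f) small_deformation set"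
  where "deformation_functor_map G TG n F \<rho> A B f C =
    {D'. deformation G TG n F \<rho> B D' \<and> (\<exists>D \<in> C. is_base_change G n A B f D D')}"

text \<open>\<open>R\<close> pro-represents the deformation functor: there is a natural bijection
  \<open>\<Phi>\<^sub>A : Hom(R, A) \<rightarrow> Def(A)\<close>.\<close>

definition universal_deformation_ring ::
    "nat \<Rightarrow> ('g, 'c) monoid_scheme \<Rightarrow> 'g topology \<Rightarrow> nat \<Rightarrow> 'f ring \<Rightarrow> ('g \<Rightarrow> nat \<times> nat \<Rightarrow> 'f) \<Rightarrow>
      ('r, 'f) witt_alg \<Rightarrow> bool"
  where "universal_deformation_ring p G TG n F \<rho> R \<longleftrightarrow> coeff_algebra p F R \<and>
    (\<exists>\<Phi> :: (continuum, 'f) witt_alg \<Rightarrow> ('r \<Rightarrow> continuum) \<Rightarrow> (continuum, 'g, 'f) small_deformation set.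
      (\<forall>A. coeff_algebra p F A \<longrightarrow>
        bij_betw (\<Phi> A) (coeff_hom p F R A) (deformation_functor G TG n F \<rho> A)) \<and>
      (\<forall>A B f h. coeff_algebra p F A \<and> coeff_algebra p F B \<and>
        f \<in> coeff_hom p F A B \<and> h \<in> coeff_hom p F R A \<longrightarrow>
        \<Phi> B (compose (carrier R) f h) =
          deformation_functor_map G TG n F \<rho> A B f (\<Phi> A h)))"

definition finite_over_witt :: "nat \<Rightarrow> 'f ring \<Rightarrow> ('r, 'f) witt_alg \<Rightarrow> bool"
  where "finite_over_witt p F R \<longleftrightarrow>
    (\<exists>B \<subseteq> carrier R. finite B \<and>
      (\<forall>r \<in> carrier R. \<exists>c \<in> B \<rightarrow> carrier (witt_ring p F).
        r = (\<Oplus>\<^bsub>R\<^esub>x\<in>B. struct_map R (c x) \<otimes>\<^bsub>R\<^esub> x)))"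

end

theory Submission
  imports Defs
begin

text \<open>Suppose \<open>R / p R\<close> is infinite. A maximal element among the ideals of infinite index containing \<open>p\<close> is
  prime, so \<open>R\<close> has a quotient \<open>A\<close> which is an infinite local domain of characteristic \<open>p\<close> all of whose
  proper quotients are finite. For a nonzero \<open>x\<close> in the maximal ideal, the universal deformation over \<open>A\<close> is
  free of finite rank over power series in \<open>x\<close> modulo \<open>p\<close>, so the Galois action gives a continuous
  representation over the field of Laurent series modulo \<open>p\<close>, whose image is finite by the conjecture. A
  finite group of matrices over \<open>A\<close> with absolutely irreducible reduction is conjugate to its
  reduction, embedded by the Teichmueller lift \<open>C\<close> of the residue field: by Burnside's theorem the algebra it spans over
  \<open>C\<close> is isomorphic to the full matrix algebra over the residue field. Hence the deformation
  over \<open>A\<close> comes from one over \<open>C\<close>, and by universality \<open>R \<rightarrow> A\<close> has image in the finite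
  field \<open>C\<close>, a contradiction. So \<open>R / p R\<close> is finite, and \<open>R\<close> is finite over the Witt vectors by completeness.\<close>

text \<open>Just infinite domains take the place of dimension theory: what is needed about a
  complete one-dimensional domain follows from finiteness of its proper quotients. Any nonzero
  \<open>x\<close> of the maximal ideal defines the adic topology, and a local field is reached
  without normalization: the module is viewed over power series modulo \<open>p\<close>, at the
  price of a representation of another, usually larger, dimension that is still faithful.

  The \<open>C\<close>-span of the image is a finite ring, and the kernel of its reduction is killed
  by combining this finiteness with the absence of zero divisors in \<open>A\<close>.

  The theory of Witt vectors is condensed into one identity, w = [w 0] + p u. It gives the digit
  expansions that prove finiteness over the Witt vectors, and in characteristic \<open>p\<close> it
  makes the Teichmueller lift a ring homomorphism.

  Universality is tested on rings carried by the type \<open>continuum\<close>, so \<open>A\<close>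
  has to be coded by its residues modulo the powers of \<open>x\<close>.\<close>

abbreviation (input) add_in :: "'a \<Rightarrow> ('a, 'b) ring_scheme \<Rightarrow> 'a \<Rightarrow> 'a" ("(_ \<oplus>[_] _)" [65, 0, 66] 65)
  where "x \<oplus>[M] y \<equiv> x \<oplus>\<^bsub>M\<^esub> y"
abbreviation (input) mult_in :: "'a \<Rightarrow> ('a, 'b) monoid_scheme \<Rightarrow> 'a \<Rightarrow> 'a" ("(_ \<otimes>[_] _)" [70, 0, 71] 70)
  where "x \<otimes>[M] y \<equiv> x \<otimes>\<^bsub>M\<^esub> y"
abbreviation (input) minus_in :: "'a \<Rightarrow> ('a, 'b) ring_scheme \<Rightarrow> 'a \<Rightarrow> 'a" ("(_ \<ominus>[_] _)" [65, 0, 66] 65)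
  where "x \<ominus>[M] y \<equiv> x \<ominus>\<^bsub>M\<^esub> y"
abbreviation (input) uminus_in :: "('a, 'b) ring_scheme \<Rightarrow> 'a \<Rightarrow> 'a" ("(\<ominus>[_] _)" [0, 81] 80)
  where "\<ominus>[M] x \<equiv> \<ominus>\<^bsub>M\<^esub> x"
abbreviation (input) smult_in :: "'a \<Rightarrow> ('a, 'b, 'c) module_scheme \<Rightarrow> 'b \<Rightarrow> 'b" ("(_ \<odot>[_] _)" [70, 0, 71] 70)
  where "a \<odot>[M] x \<equiv> a \<odot>\<^bsub>M\<^esub> x"
abbreviation (input) one_in :: "('a, 'b) monoid_scheme \<Rightarrow> 'a" ("\<one>[_]")
  where "\<one>[M] \<equiv> \<one>\<^bsub>M\<^esub>"
abbreviation (input) zero_in :: "('a, 'b) ring_scheme \<Rightarrow> 'a" ("\<zero>[_]")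
  where "\<zero>[M] \<equiv> \<zero>\<^bsub>M\<^esub>"

section \<open>Evaluation of integer polynomials\<close>

abbreviation TT :: "xy_poly ring" where "TT \<equiv> ring_of_type_algebra"

lemma TT_simps [simp]:
 "carrier (ring_of_type_algebra :: 'a::comm_ring_1 ring) = UNIV"
 "x \<oplus>[ring_of_type_algebra] y = x + y"
 "x \<otimes>[ring_of_type_algebra] y = x * y"
 "\<zero>[ring_of_type_algebra] = 0" "\<one>[ring_of_type_algebra] = 1"
 for x y :: "'a::comm_ring_1"
 by (simp_all add: ring_of_type_algebra_def)

lemma type_ring_minus [simp]:
 "\<ominus>[ring_of_type_algebra] x = - x" "x \<ominus>[ring_of_type_algebra] y = x - y"
 for x y :: "'a::comm_ring_1"
proof -
 interpret cring "ring_of_type_algebra :: 'a ring" by (rule cring_from_type_algebra)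
 show *: "\<ominus>[ring_of_type_algebra] x = - x" for x :: 'a
  using minus_equality[of "- x" x] by simp
 show "x \<ominus>[ring_of_type_algebra] y = x - y"
  by (simp add: a_minus_def *)
qed

lemma type_ring_pow [simp]: "x [^]\<^bsub>ring_of_type_algebra\<^esub> (n::nat) = x ^ n"
 for x :: "'a::comm_ring_1"
 by (induction n) (simp_all add: nat_pow_def mult.commute)

lemma add_pow_int_0: "add_pow R (0::int) x = \<zero>[R]"
 unfolding add_pow_def by simp

text \<open>The polynomials form the free abelian group on the monomials \<open>frag_of m\<close>,
  so closure under differences covers all integer coefficients and no scalar case arises.\<close>

lemma xy_poly_induct [case_names zero frag diff]:
 fixes P :: xy_poly
 assumes "Q 0" "\<And>m. Q (frag_of m)" "\<And>a b. Q a \<Longrightarrow> Q b \<Longrightarrow> Q (a - b)"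
 shows "Q P"
 by (rule frag_induction[OF subset_UNIV]) (use assms in auto)

lemma ring_hom_nat_pow:
 assumes "h \<in> ring_hom R S" "ring R" "ring S" "x \<in> carrier R"
 shows "h (x [^]\<^bsub>R\<^esub> (n::nat)) = h x [^]\<^bsub>S\<^esub> n"
proof -
 interpret R: ring R by fact
 interpret S: ring S by fact
 show ?thesis
  by (induction n) (use assms in \<open>simp_all add: ring_hom_one ring_hom_mult ring_hom_closed\<close>)
qed

lemma type_ring [simp, intro]: "cring (ring_of_type_algebra :: 'a::comm_ring_1 ring)"
  "ring (ring_of_type_algebra :: 'a::comm_ring_1 ring)"
 by (auto intro: cring_from_type_algebra ring_from_type_algebra)

definition mono_eval :: "('a, 'b) ring_scheme \<Rightarrow> (nat + nat \<Rightarrow> 'a) \<Rightarrow> ((nat + nat) \<Rightarrow>\<^sub>0 nat) \<Rightarrow> 'a"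
 where "mono_eval A f m =
  finprod A (\<lambda>v. f v [^]\<^bsub>A\<^esub> Poly_Mapping.lookup m v) (Poly_Mapping.keys m)"

context cring
begin

lemma mono_eval_superset:
 assumes "f \<in> UNIV \<rightarrow> carrier R" "finite T" "Poly_Mapping.keys m \<subseteq> T"
 shows "mono_eval R f m = finprod R (\<lambda>v. f v [^] Poly_Mapping.lookup m v) T"
 unfolding mono_eval_def
 by (rule finprod_mono_neutral_cong_left)
   (use assms in \<open>auto simp: in_keys_iff Pi_def\<close>)

lemma mono_eval_closed [simp]:
 "f \<in> UNIV \<rightarrow> carrier R \<Longrightarrow> mono_eval R f m \<in> carrier R"
 unfolding mono_eval_def by (auto intro!: finprod_closed)

lemma mono_eval_add:
 assumes f: "f \<in> UNIV \<rightarrow> carrier R"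
 shows "mono_eval R f (a + b) = mono_eval R f a \<otimes> mono_eval R f b"
proof -
 let ?T = "Poly_Mapping.keys a \<union> Poly_Mapping.keys b"
 have *: "f v \<in> carrier R" for v using f by auto
 have "mono_eval R f (a + b) = finprod R (\<lambda>v. f v [^] Poly_Mapping.lookup (a + b) v) ?T"
  using Poly_Mapping.keys_add[of a b] by (intro mono_eval_superset f) auto
 also have "\<dots> = finprod R (\<lambda>v. f v [^] Poly_Mapping.lookup a v \<otimes> f v [^] Poly_Mapping.lookup b v) ?T"
  by (rule finprod_cong') (auto simp: lookup_add nat_pow_mult *)
 also have "\<dots> = finprod R (\<lambda>v. f v [^] Poly_Mapping.lookup a v) ?T \<otimes>
   finprod R (\<lambda>v. f v [^] Poly_Mapping.lookup b v) ?T"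
  by (rule finprod_multf) (auto simp: *)
 also have "\<dots> = mono_eval R f a \<otimes> mono_eval R f b"
  by (subst (1 2) mono_eval_superset[of f ?T]) (use f in auto)
 finally show ?thesis .
qed

lemma xy_eval_superset:
 assumes f: "f \<in> UNIV \<rightarrow> carrier R" and T: "finite T" "Poly_Mapping.keys P \<subseteq> T"
 shows "xy_eval R f P = (\<Oplus>m\<in>T. add_pow R (Poly_Mapping.lookup P m) (mono_eval R f m))"
 unfolding xy_eval_def mono_eval_def[symmetric]
 by (rule add.finprod_mono_neutral_cong_left)
   (use assms in \<open>auto simp: in_keys_iff Pi_def add_pow_int_0\<close>)

lemma xy_eval_closed [simp]:
 "f \<in> UNIV \<rightarrow> carrier R \<Longrightarrow> xy_eval R f P \<in> carrier R"
 unfolding xy_eval_def mono_eval_def[symmetric] by (auto intro!: finsum_closed)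

lemma xy_eval_frag [simp]:
 assumes f: "f \<in> UNIV \<rightarrow> carrier R"
 shows "xy_eval R f (frag_of m) = mono_eval R f m"
 by (subst xy_eval_superset[of _ "{m}"]) (use f in \<open>auto simp: add.int_pow_1\<close>)

lemma xy_eval_0 [simp]: "xy_eval R f 0 = \<zero>"
 unfolding xy_eval_def by simp

lemma xy_eval_add:
 assumes f: "f \<in> UNIV \<rightarrow> carrier R"
 shows "xy_eval R f (P + Q) = xy_eval R f P \<oplus> xy_eval R f Q"
proof -
 let ?T = "Poly_Mapping.keys P \<union> Poly_Mapping.keys Q"
 have "xy_eval R f (P + Q) = (\<Oplus>m\<in>?T. add_pow R (Poly_Mapping.lookup (P + Q) m) (mono_eval R f m))"
  using Poly_Mapping.keys_add[of P Q] by (intro xy_eval_superset f) auto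
 also have "\<dots> = (\<Oplus>m\<in>?T. add_pow R (Poly_Mapping.lookup P m) (mono_eval R f m) \<oplus>
   add_pow R (Poly_Mapping.lookup Q m) (mono_eval R f m))"
  by (rule add.finprod_cong') (use f in \<open>auto simp: lookup_add add.int_pow_mult\<close>)
 also have "\<dots> = (\<Oplus>m\<in>?T. add_pow R (Poly_Mapping.lookup P m) (mono_eval R f m)) \<oplus>
   (\<Oplus>m\<in>?T. add_pow R (Poly_Mapping.lookup Q m) (mono_eval R f m))"
  by (rule add.finprod_multf) (use f in auto)
 also have "\<dots> = xy_eval R f P \<oplus> xy_eval R f Q"
  by (subst (1 2) xy_eval_superset[of f ?T]) (use f in auto)
 finally show ?thesis .
qed

lemma xy_eval_diff:
 assumes f: "f \<in> UNIV \<rightarrow> carrier R"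
 shows "xy_eval R f (P - Q) = xy_eval R f P \<ominus> xy_eval R f Q"
proof -
 have "xy_eval R f (P - Q) \<oplus> xy_eval R f Q = xy_eval R f P"
  by (simp add: xy_eval_add[OF f, symmetric])
 then show ?thesis
  by (metis a_minus_def add.inv_solve_right f xy_eval_closed)
qed

text \<open>Both sides are additive in each factor, so two nested inductions reduce the claim to a
  product of two monomials.\<close>

lemma xy_eval_mult:
 assumes f: "f \<in> UNIV \<rightarrow> carrier R"
 shows "xy_eval R f (P * Q) = xy_eval R f P \<otimes> xy_eval R f Q"
proof -
 have 1: "xy_eval R f (frag_of m * Q) = mono_eval R f m \<otimes> xy_eval R f Q" for m
 proof (induction Q rule: xy_poly_induct)
  case (frag x)
  have "frag_of m * frag_of x = frag_of (m + x)" by (simp add: mult_single)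
  then show ?case using f by (simp add: mono_eval_add)
 next
  case (diff a b)
  then show ?case
   using f by (simp add: right_diff_distrib xy_eval_diff r_distr a_minus_def r_minus)
 qed (use f in auto)
 show ?thesis
 proof (induction P rule: xy_poly_induct)
  case (diff a b)
  then show ?case
   using f by (simp add: left_diff_distrib xy_eval_diff l_distr a_minus_def l_minus)
 qed (use f 1 in auto)
qed

lemma mono_eval_0 [simp]: "mono_eval R f 0 = \<one>"
 by (simp add: mono_eval_def)

lemma xy_eval_1:
 assumes f: "f \<in> UNIV \<rightarrow> carrier R"
 shows "xy_eval R f 1 = \<one>"
proof -
 have "(1 :: xy_poly) = frag_of 0" by simp
 then show ?thesis using f by (metis mono_eval_0 xy_eval_frag)
qed

lemma mono_eval_single:
 assumes f: "f \<in> UNIV \<rightarrow> carrier R"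
 shows "mono_eval R f (Poly_Mapping.single v n) = f v [^] n"
proof -
 have "f v \<in> carrier R" using f by auto
 then show ?thesis by (subst mono_eval_superset[OF f, of "{v}"]) (auto simp: lookup_single)
qed

lemma xy_eval_var:
 assumes f: "f \<in> UNIV \<rightarrow> carrier R"
 shows "xy_eval R f (xy_var v) = f v"
proof -
 have "f v \<in> carrier R" using f by auto
 then show ?thesis using xy_eval_frag[OF f] mono_eval_single[OF f, of v 1] by (simp add: xy_var_def)
qed

lemma xy_eval_hom:
 assumes f: "f \<in> UNIV \<rightarrow> carrier R"
 shows "xy_eval R f \<in> ring_hom TT R"
 by (rule ring_hom_memI) (use f in \<open>simp_all add: xy_eval_add xy_eval_mult xy_eval_1\<close>)

end

lemma xy_monomial_single: "frag_of (Poly_Mapping.single a b) = xy_var a ^ b"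
proof (induction b)
 case (Suc b)
 have "Poly_Mapping.single a (Suc b) = Poly_Mapping.single a 1 + Poly_Mapping.single a b"
  by (simp add: single_add[symmetric])
 then have "frag_of (Poly_Mapping.single a (Suc b)) = xy_var a * frag_of (Poly_Mapping.single a b)"
  by (simp only: xy_var_def mult_single) simp
 then show ?case using Suc by simp
qed auto

lemma poly_mapping_update_new:
 fixes p :: "'a \<Rightarrow>\<^sub>0 'b::comm_monoid_add"
 assumes "a \<notin> Poly_Mapping.keys p"
 shows "Poly_Mapping.update a b p = Poly_Mapping.single a b + p"
 using assms by (intro poly_mapping_eqI) (auto simp: lookup_update lookup_add lookup_single in_keys_iff when_def)

text \<open>The uniqueness half of the universal property of integer polynomials;
  \<open>xy_eval_hom\<close> is the existence half.\<close>

lemma (in cring) hom_xy_eval: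
 assumes h: "h \<in> ring_hom TT R"
 shows "h P = xy_eval R (\<lambda>v. h (xy_var v)) P"
proof -
 interpret h: ring_hom_cring TT R h
  using h by (intro ring_hom_cring.intro ring_hom_cring_axioms.intro cring_from_type_algebra is_cring)
 have cl: "h x \<in> carrier R" for x using h.hom_closed by simp
 let ?f = "\<lambda>v. h (xy_var v)"
 have f: "?f \<in> UNIV \<rightarrow> carrier R" using cl by auto
 have mon: "h (frag_of m) = mono_eval R ?f m" for m
 proof (induction m rule: update_induct)
  case const
  then show ?case using h.hom_one by (simp del: h.hom_one)
 next
  case (update p a b)
  have "frag_of (Poly_Mapping.single a b + p) = frag_of (Poly_Mapping.single a b) * frag_of p"
   by (simp add: mult_single)
  then have "h (frag_of (Poly_Mapping.single a b + p)) = h (frag_of (Poly_Mapping.single a b)) \<otimes> h (frag_of p)"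
   using h.hom_mult by simp
  also have "h (frag_of (Poly_Mapping.single a b)) = ?f a [^] b"
   using ring_hom_nat_pow[OF h, of "xy_var a" b] ring_axioms by (simp add: xy_monomial_single)
  finally show ?case
   using update by (simp add: poly_mapping_update_new mono_eval_add[OF f] mono_eval_single[OF f])
 qed
 show ?thesis
 proof (induction P rule: xy_poly_induct)
  case zero then show ?case using h.hom_zero by simp
 next
  case (frag x) then show ?case by (simp add: mon xy_eval_frag[OF f])
 next
  case (diff a b)
  have "h (a - b) \<oplus> h b = h a" using h.hom_add[of "a - b" b] by simp
  then have "h (a - b) = h a \<ominus> h b"
   by (metis a_minus_def add.inv_solve_right cl)
  then show ?case using diff by (simp add: xy_eval_diff[OF f])
 qed
qed

text \<open>Substitution followed by \<open>h\<close> is again a homomorphism, so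
  \<open>hom_xy_eval\<close> computes it from its values on the variables. Applied to the Witt
  polynomials it gives functoriality.\<close>

lemma (in cring) xy_eval_comp:
 assumes h: "h \<in> ring_hom TT R"
 shows "h (xy_eval TT t P) = xy_eval R (\<lambda>v. h (t v)) P"
proof -
 interpret T: cring TT by (rule cring_from_type_algebra)
 have t: "t \<in> UNIV \<rightarrow> carrier TT" by auto
 have "h \<circ> xy_eval TT t \<in> ring_hom TT R"
  using T.xy_eval_hom[OF t] h by (rule ring_hom_trans)
 from hom_xy_eval[OF this, of P] show ?thesis by (simp add: T.xy_eval_var[OF t])
qed

section \<open>Addition of Witt vectors\<close>

lemma prime_dvd_freshman:
 fixes a b :: "'a::comm_ring_1"
 assumes p: "Factorial_Ring.prime p"
 shows "of_nat p dvd (a + b) ^ p - (a ^ p + b ^ p)"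
proof -
 have p0: "p > 0" using p by (simp add: prime_gt_0_nat)
 have "(a + b) ^ p = (\<Sum>k\<le>p. of_nat (p choose k) * a ^ k * b ^ (p - k))"
  by (rule binomial_ring)
 also have "{..p} = insert 0 (insert p {0<..<p})" using p0 by auto
 also have "(\<Sum>k\<in>\<dots>. of_nat (p choose k) * a ^ k * b ^ (p - k)) =
   b ^ p + (a ^ p + (\<Sum>k\<in>{0<..<p}. of_nat (p choose k) * a ^ k * b ^ (p - k)))"
  using p0 by (subst sum.insert; simp)+
 finally have "(a + b) ^ p - (a ^ p + b ^ p) = (\<Sum>k\<in>{0<..<p}. of_nat (p choose k) * a ^ k * b ^ (p - k))"
  by simp
 also have "of_nat p dvd \<dots>"
 proof (rule dvd_sum)
  fix k assume "k \<in> {0<..<p}"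
  then have "p dvd p choose k" using p by (intro dvd_choose_prime) auto
  then have "(of_nat p :: 'a) dvd of_nat (p choose k)" by (metis dvd_def of_nat_mult)
  then show "of_nat p dvd of_nat (p choose k) * a ^ k * b ^ (p - k)" by simp
 qed
 finally show ?thesis .
qed

text \<open>The cofactor of a - b in a^p - b^p is a sum of p terms, each congruent to b^(p-1)
  because a and b agree modulo p; it contributes the additional factor p.\<close>

lemma dvd_prime_power_diff:
 fixes a b :: "'a::comm_ring_1"
 assumes "of_nat p ^ Suc j dvd a - b"
 shows "of_nat p ^ Suc (Suc j) dvd a ^ p - b ^ p"
proof -
 have eq: "a ^ p - b ^ p = (a - b) * (\<Sum>i<p. b ^ (p - Suc i) * a ^ i)"
  by (rule power_diff_sumr2)
 have ab: "of_nat p dvd a - b" using assms by (metis dvd_mult_left power_Suc)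
 have pw: "of_nat p dvd a ^ i - b ^ i" for i
  using ab by (metis dvd_mult2 power_diff_sumr2)
 have "of_nat p dvd (\<Sum>i<p. b ^ (p - Suc i) * a ^ i) - of_nat p * b ^ (p - 1)"
 proof -
  have "of_nat p * b ^ (p - 1) = (\<Sum>i<p. b ^ (p - Suc i) * b ^ i)"
  proof -
   have "(\<Sum>i<p. b ^ (p - Suc i) * b ^ i) = (\<Sum>i<p. b ^ (p - 1))"
    by (rule sum.cong) (auto simp flip: power_add)
   then show ?thesis by simp
  qed
  then have "(\<Sum>i<p. b ^ (p - Suc i) * a ^ i) - of_nat p * b ^ (p - 1) =
    (\<Sum>i<p. b ^ (p - Suc i) * (a ^ i - b ^ i))"
   by (simp add: sum_subtractf right_diff_distrib)
  also have "of_nat p dvd \<dots>" by (intro dvd_sum dvd_mult pw)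
  finally show ?thesis .
 qed
 then have "of_nat p dvd (\<Sum>i<p. b ^ (p - Suc i) * a ^ i)"
  by (metis dvd_add_left_iff dvd_triv_left diff_add_cancel)
 then show ?thesis unfolding eq using assms
  by (metis mult.commute mult_dvd_mono power_Suc)
qed

lemma dvd_prime_power_pow_diff:
 fixes a b :: "'a::comm_ring_1"
 assumes "of_nat p dvd a - b"
 shows "of_nat p ^ Suc k dvd a ^ (p ^ k) - b ^ (p ^ k)"
proof (induction k)
 case (Suc k)
 from dvd_prime_power_diff[OF this] show ?case
  by (simp add: power_mult[symmetric] mult.commute)
qed (use assms in simp)

text \<open>A lift of Frobenius to characteristic zero: a ring endomorphism that agrees with the
  p-th power map modulo p (\<open>frob_cong\<close>).\<close>

definition frob :: "nat \<Rightarrow> xy_poly \<Rightarrow> xy_poly"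
 where "frob p = xy_eval TT (\<lambda>v. xy_var v ^ p)"

lemma frob_hom: "frob p \<in> ring_hom TT TT"
 unfolding frob_def by (intro cring.xy_eval_hom cring_from_type_algebra) auto

lemma frob_simps:
 "frob p (a + b) = frob p a + frob p b" "frob p (a - b) = frob p a - frob p b"
 "frob p (a * b) = frob p a * frob p b" "frob p 0 = 0" "frob p 1 = 1"
 "frob p (xy_var v) = xy_var v ^ p" "frob p (a ^ n) = frob p a ^ n"
proof -
 show add: "frob p (a + b) = frob p a + frob p b" for a b
  using ring_hom_add[OF frob_hom] by simp
 show mult: "frob p (a * b) = frob p a * frob p b" for a b
  using ring_hom_mult[OF frob_hom] by simp
 show one: "frob p 1 = 1" using ring_hom_one[OF frob_hom] by simp
 show "frob p 0 = 0" using add[of 0 0] by simp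
 show "frob p (a - b) = frob p a - frob p b" using add[of "a - b" b] by simp
 show "frob p (xy_var v) = xy_var v ^ p"
  unfolding frob_def by (subst cring.xy_eval_var) (auto intro: cring_from_type_algebra)
 show "frob p (a ^ n) = frob p a ^ n" by (induction n) (simp_all add: one mult)
qed

lemma frob_of_nat: "frob p (of_nat n) = of_nat n"
 by (induction n) (simp_all add: frob_simps)

lemma frob_sum: "frob p (\<Sum>i\<in>I. f i) = (\<Sum>i\<in>I. frob p (f i))"
 by (induction I rule: infinite_finite_induct) (simp_all add: frob_simps)

lemma frob_monomial: "frob p (frag_of m) = frag_of m ^ p"
proof (induction m rule: update_induct)
 case const
 then show ?case by (simp add: frob_simps)
next
 case (update q a b)
 have "frag_of (Poly_Mapping.single a b + q) = xy_var a ^ b * frag_of q"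
  by (simp add: mult_single flip: xy_monomial_single)
 with update show ?case
  by (simp add: poly_mapping_update_new frob_simps power_mult_distrib power_mult[symmetric] mult.commute)
qed

text \<open>On monomials the two maps coincide; the freshman congruence carries the claim over to
  differences.\<close>

lemma frob_cong:
 assumes p: "Factorial_Ring.prime p"
 shows "of_nat p dvd P ^ p - frob p P"
proof (induction P rule: xy_poly_induct)
 case zero then show ?case using p by (simp add: frob_simps prime_gt_0_nat power_0_left)
next
 case (diff a b)
 have "of_nat p dvd (a ^ p - frob p a) - (b ^ p - frob p b) - (a ^ p - ((a - b) ^ p + b ^ p))"
  using prime_dvd_freshman[OF p, of "a - b" b] by (intro dvd_diff[OF dvd_diff[OF diff]]) simp
 then show ?case by (simp add: frob_simps algebra_simps)
qed (simp_all add: frob_monomial)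

section \<open>The ghost map on vectors of integer polynomials\<close>

lemma lookup_of_nat_mult: "Poly_Mapping.lookup (of_nat n * P) m = int n * Poly_Mapping.lookup P m"
 for P :: xy_poly
 by (induction n) (simp_all add: lookup_add algebra_simps)

lemma xy_poly_of_nat_cancel:
 assumes "of_nat n * P = of_nat n * Q" "n > 0"
 shows "P = (Q :: xy_poly)"
proof (rule poly_mapping_eqI)
 fix m show "Poly_Mapping.lookup P m = Poly_Mapping.lookup Q m"
  using assms lookup_of_nat_mult[of n P m] lookup_of_nat_mult[of n Q m] by simp
qed

lemma ghost_last: "ghost p s n = (\<Sum>i<n. of_nat p ^ i * s i ^ (p ^ (n - i))) + of_nat p ^ n * s n"
 by (simp add: ghost_def lessThan_Suc_atMost[symmetric])

text \<open>The n-th ghost component is p^n times \<open>s n\<close> plus terms in earlier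
  components, and integer polynomials have no torsion, so the components are recovered one after
  another.\<close>

lemma ghost_eq_imp_eq:
 fixes s t :: "nat \<Rightarrow> xy_poly"
 assumes p: "p > 0" and eq: "\<And>n. n < N \<Longrightarrow> ghost p s n = ghost p t n"
 shows "n < N \<Longrightarrow> s n = t n"
proof (induction n rule: less_induct)
 case (less n)
 then have "(\<Sum>i<n. of_nat p ^ i * s i ^ (p ^ (n - i))) = (\<Sum>i<n. of_nat p ^ i * t i ^ (p ^ (n - i)))"
  by (intro sum.cong) auto
 with eq[OF less.prems] have "of_nat (p ^ n) * s n = of_nat (p ^ n) * t n"
  by (simp add: ghost_last)
 then show ?case using p by (rule_tac xy_poly_of_nat_cancel[of "p ^ n"]) auto
qed

text \<open>If earlier components agree modulo p, their powers with exponent p^(n-i) agree modulo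
  p^(n-i+1), and the weight p^i raises this to p^(n+1). What remains of the difference of the ghost
  components is p^n (s n - t n).\<close>

lemma ghost_cong_imp_cong:
 fixes s t :: "nat \<Rightarrow> xy_poly"
 assumes p: "p > 0" and eq: "\<And>n. of_nat p ^ Suc n dvd ghost p s n - ghost p t n"
 shows "of_nat p dvd s n - t n"
proof (induction n rule: less_induct)
 case (less n)
 have "of_nat p ^ Suc n dvd (\<Sum>i<n. of_nat p ^ i * (s i ^ (p ^ (n - i)) - t i ^ (p ^ (n - i))))"
 proof (rule dvd_sum)
  fix i assume i: "i \<in> {..<n}"
  then have "of_nat p ^ Suc (n - i) dvd s i ^ (p ^ (n - i)) - t i ^ (p ^ (n - i))"
   by (intro dvd_prime_power_pow_diff less) auto
  then have "of_nat p ^ i * of_nat p ^ Suc (n - i) dvd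
    of_nat p ^ i * (s i ^ (p ^ (n - i)) - t i ^ (p ^ (n - i)))"
   by (intro mult_dvd_mono) auto
  moreover have "of_nat p ^ i * of_nat p ^ Suc (n - i) = (of_nat p ^ Suc n :: xy_poly)"
   using i by (simp flip: power_add add: power_Suc[symmetric] del: power_Suc)
  ultimately show "of_nat p ^ Suc n dvd of_nat p ^ i * (s i ^ (p ^ (n - i)) - t i ^ (p ^ (n - i)))"
   by simp
 qed
 then have "of_nat p ^ Suc n dvd (ghost p s n - ghost p t n) -
   (\<Sum>i<n. of_nat p ^ i * (s i ^ (p ^ (n - i)) - t i ^ (p ^ (n - i))))"
  by (rule dvd_diff[OF eq])
 then have "of_nat p ^ Suc n dvd of_nat p ^ n * (s n - t n)"
  by (simp add: ghost_last sum_subtractf algebra_simps)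
 then obtain d where "of_nat p ^ n * (s n - t n) = of_nat p ^ Suc n * d" by (auto simp: dvd_def)
 then have "of_nat (p ^ n) * (s n - t n) = of_nat (p ^ n) * (of_nat p * d)"
  by (simp add: mult.assoc mult.left_commute)
 then have "s n - t n = of_nat p * d" using p by (rule_tac xy_poly_of_nat_cancel[of "p ^ n"]) auto
 then show ?case by simp
qed

lemma ghost_Suc_frob:
 "frob p (ghost p s n) = (\<Sum>i\<le>n. of_nat p ^ i * frob p (s i) ^ (p ^ (n - i)))"
 by (simp add: ghost_def frob_sum frob_simps frob_of_nat)

text \<open>Dwork's integrality criterion for ghost vectors. \<open>G N\<close> is congruent to the
  Frobenius twist of the preceding ghost component, hence to the terms already fixed, so what is
  left is divisible by p^N and defines the next component.\<close>

lemma dwork: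
 assumes p: "Factorial_Ring.prime p"
  and G: "\<And>n. of_nat p ^ Suc n dvd G (Suc n) - frob p (G n)"
 shows "\<exists>s. \<forall>n. ghost p s n = G n"
proof -
 have p0: "p > 0" using p by (simp add: prime_gt_0_nat)
 have ex: "\<exists>s. \<forall>k<N. ghost p s k = G k" for N
 proof (induction N)
  case (Suc N)
  then obtain s where s: "\<And>k. k < N \<Longrightarrow> ghost p s k = G k" by auto
  have "of_nat p ^ N dvd G N - (\<Sum>i<N. of_nat p ^ i * s i ^ (p ^ (N - i)))"
  proof (cases N)
   case (Suc n)
   have "of_nat p ^ N dvd (\<Sum>i\<le>n. of_nat p ^ i * (s i ^ (p ^ (N - i)) - frob p (s i) ^ (p ^ (n - i))))"
   proof (rule dvd_sum)
    fix i assume i: "i \<in> {..n}"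
    have "of_nat p ^ Suc (n - i) dvd (s i ^ p) ^ (p ^ (n - i)) - frob p (s i) ^ (p ^ (n - i))"
     by (intro dvd_prime_power_pow_diff frob_cong p)
    moreover have "(s i ^ p) ^ (p ^ (n - i)) = s i ^ (p ^ (N - i))"
     using i Suc by (simp add: power_mult[symmetric] Suc_diff_le)
    ultimately have "of_nat p ^ i * of_nat p ^ Suc (n - i) dvd
      of_nat p ^ i * (s i ^ (p ^ (N - i)) - frob p (s i) ^ (p ^ (n - i)))"
     by (intro mult_dvd_mono) auto
    moreover have "of_nat p ^ i * of_nat p ^ Suc (n - i) = (of_nat p ^ N :: xy_poly)"
     using i Suc by (simp flip: power_add add: power_Suc[symmetric] del: power_Suc)
    ultimately show "of_nat p ^ N dvd of_nat p ^ i * (s i ^ (p ^ (N - i)) - frob p (s i) ^ (p ^ (n - i)))"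
     by simp
   qed
   then have "of_nat p ^ N dvd (\<Sum>i\<le>n. of_nat p ^ i * s i ^ (p ^ (N - i))) - frob p (ghost p s n)"
    by (simp add: ghost_Suc_frob sum_subtractf right_diff_distrib)
   moreover have "ghost p s n = G n" using s Suc by simp
   ultimately have "of_nat p ^ N dvd (G N - frob p (G n)) -
     ((\<Sum>i\<le>n. of_nat p ^ i * s i ^ (p ^ (N - i))) - frob p (G n))"
    unfolding Suc by (intro dvd_diff[OF G]) simp
   then show ?thesis using Suc by (simp add: lessThan_Suc_atMost)
  qed auto
  then obtain d where d: "G N - (\<Sum>i<N. of_nat p ^ i * s i ^ (p ^ (N - i))) = of_nat p ^ N * d"
   by (auto simp: dvd_def)
  have "ghost p (s(N := d)) k = G k" if "k < Suc N" for k
  proof (cases "k = N")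
   case True
   then show ?thesis using d by (simp add: ghost_last algebra_simps)
  next
   case False
   with that have "ghost p (s(N := d)) k = ghost p s k" by (auto simp: ghost_def intro!: sum.cong)
   with s False that show ?thesis by simp
  qed
  then show ?case by blast
 qed auto
 \<comment> \<open>Each \<open>S N\<close> solves only the equations below N. Injectivity of the
   ghost map makes these solutions agree where they overlap, so the diagonal solves all
   equations.\<close>
 define S where "S N = (SOME s. \<forall>k<N. ghost p s k = G k)" for N
 have S: "ghost p (S N) k = G k" if "k < N" for N k
  using someI_ex[OF ex[of N]] that by (auto simp: S_def)
 define s where "s n = S (Suc n) n" for n
 have sS: "s i = S N i" if "i < N" for i N
  unfolding s_def by (rule ghost_eq_imp_eq[OF p0, of "Suc i"]) (use S that in auto)
 have "ghost p s n = ghost p (S (Suc n)) n" for n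
  unfolding ghost_def by (intro sum.cong refl) (simp add: sS[of _ "Suc n"])
 with S show ?thesis by auto
qed

text \<open>This justifies the \<open>THE\<close> in \<open>witt_add_poly\<close>. Frobenius sends
  variables to their p-th powers, so a ghost vector of variables satisfies Dwork's criterion with
  the explicit difference p^(n+1) X_(n+1). Sums inherit the criterion, and uniqueness is
  \<open>ghost_eq_imp_eq\<close>.\<close>

lemma witt_add_poly_ghost:
 assumes p: "Factorial_Ring.prime p"
 shows "ghost p (witt_add_poly p) n =
  ghost p (\<lambda>i. xy_var (Inl i)) n + ghost p (\<lambda>i. xy_var (Inr i)) n"
proof -
 have p0: "p > 0" using p by (simp add: prime_gt_0_nat)
 let ?G = "\<lambda>n. ghost p (\<lambda>i. xy_var (Inl i)) n + ghost p (\<lambda>i. xy_var (Inr i)) n"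
 have *: "ghost p (\<lambda>i. xy_var (c i)) (Suc n) - frob p (ghost p (\<lambda>i. xy_var (c i)) n) =
   of_nat p ^ Suc n * xy_var (c (Suc n))" for c :: "nat \<Rightarrow> nat + nat" and n
 proof -
  have "(\<Sum>i<Suc n. of_nat p ^ i * xy_var (c i) ^ (p ^ (Suc n - i))) =
    frob p (ghost p (\<lambda>i. xy_var (c i)) n)"
   unfolding ghost_Suc_frob lessThan_Suc_atMost
   by (rule sum.cong) (auto simp: frob_simps power_mult[symmetric] Suc_diff_le)
  then show ?thesis by (simp add: ghost_last del: sum.lessThan_Suc)
 qed
 have "\<exists>s. \<forall>n. ghost p s n = ?G n"
 proof (rule dwork[OF p])
  fix n
  have "?G (Suc n) - frob p (?G n) = of_nat p ^ Suc n * (xy_var (Inl (Suc n)) + xy_var (Inr (Suc n)))"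
   using *[of Inl n] *[of Inr n] by (simp add: frob_simps algebra_simps)
  then show "of_nat p ^ Suc n dvd ?G (Suc n) - frob p (?G n)" by simp
 qed
 then obtain s where s: "\<forall>n. ghost p s n = ?G n" by blast
 have "witt_add_poly p = s" unfolding witt_add_poly_def
 proof (rule the_equality)
  fix t assume "\<forall>n. ghost p t n = ?G n"
  with s have "ghost p t n = ghost p s n" for n by simp
  then show "t = s" using ghost_eq_imp_eq[OF p0, of _ t s] by blast
 qed (use s in auto)
 with s show ?thesis by simp
qed

text \<open>Witt addition over integer polynomials, where identities can be checked on ghost
  components before being mapped to a ring of characteristic p, on which the ghost map is no longer
  injective.\<close>

definition wadd :: "nat \<Rightarrow> (nat \<Rightarrow> xy_poly) \<Rightarrow> (nat \<Rightarrow> xy_poly) \<Rightarrow> nat \<Rightarrow> xy_poly"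
 where "wadd p s t n = xy_eval TT (case_sum s t) (witt_add_poly p n)"

lemma ghost_hom:
 assumes h: "h \<in> ring_hom TT TT"
 shows "h (ghost p s n) = ghost p (\<lambda>i. h (s i)) n"
proof -
 have add: "h (a + b) = h a + h b" for a b using ring_hom_add[OF h] by simp
 have mult: "h (a * b) = h a * h b" for a b using ring_hom_mult[OF h] by simp
 have one: "h 1 = 1" using ring_hom_one[OF h] by simp
 have zero: "h 0 = 0" using add[of 0 0] by simp
 have pow: "h (a ^ n) = h a ^ n" for a n by (induction n) (simp_all add: one mult)
 have nat: "h (of_nat n) = of_nat n" for n by (induction n) (simp_all add: zero one add)
 have sum: "h (\<Sum>i\<in>I. f i) = (\<Sum>i\<in>I. h (f i))" for f and I :: "nat set"
  by (induction I rule: infinite_finite_induct) (simp_all add: zero add)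
 show ?thesis by (simp add: ghost_def sum mult pow nat)
qed

lemma ghost_wadd:
 assumes p: "Factorial_Ring.prime p"
 shows "ghost p (wadd p s t) n = ghost p s n + ghost p t n"
proof -
 interpret T: cring TT by (rule cring_from_type_algebra)
 have f: "case_sum s t \<in> UNIV \<rightarrow> carrier TT" by auto
 let ?h = "xy_eval TT (case_sum s t)"
 have "ghost p (wadd p s t) n = ?h (ghost p (witt_add_poly p) n)"
  by (simp add: ghost_hom[OF T.xy_eval_hom[OF f]] wadd_def[abs_def])
 also have "\<dots> = ?h (ghost p (\<lambda>i. xy_var (Inl i)) n) + ?h (ghost p (\<lambda>i. xy_var (Inr i)) n)"
  using T.xy_eval_add[OF f] by (simp add: witt_add_poly_ghost[OF p])
 also have "\<dots> = ghost p s n + ghost p t n"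
  by (simp add: ghost_hom[OF T.xy_eval_hom[OF f]] T.xy_eval_var[OF f])
 finally show ?thesis .
qed

text \<open>Witt addition is given by universal integer polynomials, so it commutes with
  \<open>h\<close>; identities between vectors of polynomials thus descend to every commutative
  ring.\<close>

lemma (in cring) witt_add_hom:
 assumes h: "h \<in> ring_hom TT R"
 shows "(\<lambda>n. h (s n)) \<oplus>[witt_ring p R] (\<lambda>n. h (t n)) = (\<lambda>n. h (wadd p s t n))"
proof
 fix n
 have "case_sum (\<lambda>n. h (s n)) (\<lambda>n. h (t n)) = (\<lambda>v. h (case_sum s t v))"
  by (rule ext) (simp split: sum.split)
 then show "((\<lambda>n. h (s n)) \<oplus>[witt_ring p R] (\<lambda>n. h (t n))) n = h (wadd p s t n)"
  by (simp add: witt_ring_def wadd_def xy_eval_comp[OF h])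
qed

text \<open>The index is shifted: stage k is the (k+1)-fold Witt sum of \<open>s\<close>, which
  avoids starting from a zero vector. Multiplication by p is therefore stage p - 1.\<close>

primrec wmul :: "nat \<Rightarrow> (nat \<Rightarrow> xy_poly) \<Rightarrow> nat \<Rightarrow> nat \<Rightarrow> xy_poly"
 where "wmul p s 0 = s" | "wmul p s (Suc k) = wadd p (wmul p s k) s"

lemma ghost_wmul:
 assumes p: "Factorial_Ring.prime p"
 shows "ghost p (wmul p s k) n = of_nat (Suc k) * ghost p s n"
 by (induction k) (simp_all add: ghost_wadd[OF p] algebra_simps)

section \<open>Teichmueller vectors and multiplication by p\<close>

definition teich :: "('a, 'b) ring_scheme \<Rightarrow> 'a \<Rightarrow> nat \<Rightarrow> 'a"
 where "teich F a n = (if n = 0 then a else \<zero>[F])"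

lemma teich_closed: "ring F \<Longrightarrow> a \<in> carrier F \<Longrightarrow> teich F a \<in> carrier (witt_ring p F)"
 by (auto simp: teich_def witt_ring_def ring.ring_simprules)

text \<open>In characteristic \<open>p\<close> multiplication by \<open>p\<close> on Witt vectors is the Verschiebung composed
 with Frobenius; \<open>u\<close> is the Frobenius preimage of the shift of \<open>w\<close>.\<close>

lemma struct_witt_decomp:
 assumes p: "Factorial_Ring.prime p" and "cring F" "cring B" and char: "has_char F p"
  and h: "h \<in> ring_hom (witt_ring p F) B"
  and w: "w \<in> carrier (witt_ring p F)" and u: "u \<in> carrier (witt_ring p F)"
  and uw: "\<And>i. u i [^]\<^bsub>F\<^esub> p = w (Suc i)"
 shows "h w = h (teich F (w 0)) \<oplus>[B] add_pow B p (h u)"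
proof -
 interpret F: cring F by fact
 interpret B: cring B by fact
 have p0: "p > 0" using p by (simp add: prime_gt_0_nat)
 \<comment> \<open>The evaluation point for the generic identities: the variables
   \<open>Inl i\<close> take the values \<open>u i\<close>, and \<open>Inr 0\<close>, the only other
   variable that occurs, takes the value \<open>w 0\<close>.\<close>
 define f where "f = case_sum u (\<lambda>_::nat. w 0)"
 have f: "f \<in> UNIV \<rightarrow> carrier F" using w u by (fastforce simp: f_def witt_ring_def split: sum.split)
 let ?g = "xy_eval F f"
 have g: "?g \<in> ring_hom TT F" by (rule F.xy_eval_hom[OF f])
 interpret g: ring_hom_cring TT F ?g
  using g by (intro ring_hom_cring.intro ring_hom_cring_axioms.intro cring_from_type_algebra F.is_cring)
 have gcl: "?g a \<in> carrier F" for a using g.hom_closed by simp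
 have Wcl: "(\<lambda>n. ?g (a n)) \<in> carrier (witt_ring p F)" for a using gcl by (auto simp: witt_ring_def)
 have hcl: "h x \<in> carrier B" if "x \<in> carrier (witt_ring p F)" for x using ring_hom_closed[OF h that] .
 \<comment> \<open>Generic versions over the polynomials: \<open>s\<close> lifts u,
   \<open>t0\<close> lifts the Teichmueller vector of \<open>w 0\<close>, and \<open>t\<close> lifts
   w because u consists of p-th roots of the shifted components. The vector \<open>z\<close> is
   \<open>t0\<close> plus p times \<open>s\<close>; the aim is that z and t agree modulo p.\<close>
 define s where "s i = xy_var (Inl i)" for i :: nat
 define t0 where "t0 n = (if n = 0 then xy_var (Inr 0) else 0)" for n :: nat
 define t where "t n = (case n of 0 \<Rightarrow> xy_var (Inr 0) | Suc i \<Rightarrow> s i ^ p)" for n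
 define z where "z = wadd p t0 (wmul p s (p - 1))"
 note ev = F.xy_eval_var[OF f]
 have gs: "(\<lambda>n. ?g (s n)) = u" by (rule ext) (unfold s_def ev, simp add: f_def)
 have gt0: "(\<lambda>n. ?g (t0 n)) = teich F (w 0)"
  by (rule ext) (use ev[of "Inr 0"] in \<open>simp add: t0_def teich_def f_def\<close>)
 have gt: "(\<lambda>n. ?g (t n)) = w"
 proof
  fix n show "?g (t n) = w n"
  proof (cases n)
   case (Suc i)
   then have "?g (t n) = ?g (s i) [^]\<^bsub>F\<^esub> p" using ring_hom_nat_pow[OF g, of "s i" p] F.ring_axioms by (simp add: t_def)
   also have "?g (s i) = u i" using gs by metis
   finally show ?thesis using Suc uw by simp
  qed (use ev[of "Inr 0"] in \<open>simp add: t_def f_def\<close>)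
 qed
 have gz0: "ghost p t0 n = xy_var (Inr 0) ^ (p ^ n)" for n
 proof -
  have "ghost p t0 n = (\<Sum>i\<in>{0}. of_nat p ^ i * t0 i ^ (p ^ (n - i)))"
   unfolding ghost_def
   by (rule sum.mono_neutral_right) (use p0 in \<open>auto simp: t0_def power_0_left\<close>)
  then show ?thesis by (simp add: t0_def)
 qed
 have "of_nat p dvd z n - t n" for n
 proof (rule ghost_cong_imp_cong[OF p0])
  fix n
  have "ghost p t n = xy_var (Inr 0) ^ (p ^ n) + (\<Sum>i<n. of_nat p ^ Suc i * s i ^ (p ^ (n - i)))"
  proof -
   have "(\<Sum>i<n. of_nat p ^ Suc i * t (Suc i) ^ (p ^ (n - Suc i))) =
     (\<Sum>i<n. of_nat p ^ Suc i * s i ^ (p ^ (n - i)))"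
   proof (rule sum.cong)
    fix i assume "i \<in> {..<n}"
    then have "p ^ (n - i) = p * p ^ (n - Suc i)" by (simp flip: power_Suc add: Suc_diff_Suc)
    then show "of_nat p ^ Suc i * t (Suc i) ^ (p ^ (n - Suc i)) = of_nat p ^ Suc i * s i ^ (p ^ (n - i))"
     by (simp add: t_def power_mult[symmetric])
   qed simp
   then show ?thesis
    by (simp add: ghost_def lessThan_Suc_atMost[symmetric] sum.lessThan_Suc_shift t_def
      del: sum.lessThan_Suc power_Suc)
  qed
  moreover have "ghost p z n = xy_var (Inr 0) ^ (p ^ n) + of_nat p * ghost p s n"
   using p0 by (simp add: z_def ghost_wadd[OF p] ghost_wmul[OF p] gz0 del: of_nat_Suc)
  moreover have "of_nat p * ghost p s n =
    (\<Sum>i<n. of_nat p ^ Suc i * s i ^ (p ^ (n - i))) + of_nat p ^ Suc n * s n"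
   by (simp add: ghost_last distrib_left sum_distrib_left mult.assoc)
  \<comment> \<open>The two ghost components differ only in the last term of p times the ghost
    component of \<open>s\<close>. So z and t agree modulo p, although they are different vectors
    over the integers.\<close>
  ultimately have "ghost p z n - ghost p t n = of_nat p ^ Suc n * s n" by simp
  then show "of_nat p ^ Suc n dvd ghost p z n - ghost p t n" by simp
 qed
 moreover have gp: "?g (of_nat p * d) = \<zero>[F]" for d
 proof -
  have "?g (of_nat k) = add_pow F k \<one>[F]" for k
  proof (induction k)
   case (Suc k)
   have "?g (of_nat k + 1) = ?g (of_nat k) \<oplus>[F] ?g 1" using g.hom_add by simp
   with Suc show ?case using g.hom_one by (simp add: add.commute F.a_comm)
  qed simp
  then have "?g (of_nat p) = \<zero>[F]" using char by (simp add: has_char_def)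
  then show ?thesis using g.hom_mult[of "of_nat p" d] gcl by simp
 qed
 ultimately have "?g (z n) = ?g (t n)" for n
 proof -
  obtain d where "z n - t n = of_nat p * d" using \<open>of_nat p dvd z n - t n\<close> by (auto simp: dvd_def)
  then have "z n = t n + of_nat p * d" by (simp add: algebra_simps)
  then show ?thesis using g.hom_add[of "t n" "of_nat p * d"] gp gcl by simp
 qed
 then have weq: "w = (\<lambda>n. ?g (z n))" using gt by auto
 have mul: "h (\<lambda>n. ?g (wmul p s k n)) = add_pow B (Suc k) (h u)" for k
 proof (induction k)
  case (Suc k)
  have "h (\<lambda>n. ?g (wmul p s (Suc k) n)) = h ((\<lambda>n. ?g (wmul p s k n)) \<oplus>[witt_ring p F] (\<lambda>n. ?g (s n)))"
   by (simp add: F.witt_add_hom[OF g])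
  also have "\<dots> = h (\<lambda>n. ?g (wmul p s k n)) \<oplus>[B] h u"
   using ring_hom_add[OF h Wcl[of "wmul p s k"] Wcl[of s]] by (simp add: gs)
  finally show ?case using Suc hcl[OF u] by simp
 qed (use hcl[OF u] in \<open>simp add: gs\<close>)
 have "h w = h ((\<lambda>n. ?g (t0 n)) \<oplus>[witt_ring p F] (\<lambda>n. ?g (wmul p s (p - 1) n)))"
  by (simp add: weq z_def F.witt_add_hom[OF g])
 also have "\<dots> = h (teich F (w 0)) \<oplus>[B] h (\<lambda>n. ?g (wmul p s (p - 1) n))"
  using ring_hom_add[OF h Wcl[of t0] Wcl[of "wmul p s (p - 1)"]] by (simp add: gt0)
 finally show ?thesis using mul[of "p - 1"] p0 by simp
qed

text \<open>Preservation of zero is not part of \<open>ring_hom\<close>. The Witt zero is shown to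
  be additively idempotent through ghost components, and an additive idempotent of the ring
  \<open>B\<close> is zero.\<close>

lemma (in cring) struct_zero:
 assumes p: "Factorial_Ring.prime p" and "cring B" and h: "h \<in> ring_hom (witt_ring p R) B"
 shows "h \<zero>[witt_ring p R] = \<zero>[B]"
proof -
 interpret B: cring B by fact
 define g where "g = xy_eval R (\<lambda>_. \<zero>)"
 have g: "g \<in> ring_hom TT R" unfolding g_def by (rule xy_eval_hom) auto
 have p0: "p > 0" using p by (simp add: prime_gt_0_nat)
 have "ghost p (\<lambda>_. (0 :: xy_poly)) n = 0" for n
  using p0 by (simp add: ghost_def power_0_left)
 then have "ghost p (wadd p (\<lambda>_. 0) (\<lambda>_. 0)) n = ghost p (\<lambda>_. 0) n" for n
  by (simp add: ghost_wadd[OF p])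
 then have "wadd p (\<lambda>_. 0) (\<lambda>_. 0) = (\<lambda>_. 0)"
  using ghost_eq_imp_eq[OF p0, where s = "wadd p (\<lambda>_. 0) (\<lambda>_. 0)" and t = "\<lambda>_. 0"] by blast
 then have "(\<lambda>n. g 0) \<oplus>[witt_ring p R] (\<lambda>n. g 0) = (\<lambda>n. g 0)"
  using witt_add_hom[OF g, where s = "\<lambda>_. 0" and t = "\<lambda>_. 0" and p = p] by simp
 moreover have "(\<lambda>n. g 0) = \<zero>[witt_ring p R]" by (simp add: g_def witt_ring_def)
 ultimately have "\<zero>[witt_ring p R] \<oplus>[witt_ring p R] \<zero>[witt_ring p R] = \<zero>[witt_ring p R]" by simp
 moreover have z: "\<zero>[witt_ring p R] \<in> carrier (witt_ring p R)" by (auto simp: witt_ring_def)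
 ultimately have "h \<zero>[witt_ring p R] \<oplus>[B] h \<zero>[witt_ring p R] = h \<zero>[witt_ring p R]"
  using ring_hom_add[OF h z z] by simp
 then show ?thesis using ring_hom_closed[OF h z] by simp
qed

section \<open>Noetherian local rings\<close>

lemma (in cring) cring_idealI:
 assumes "I \<subseteq> carrier R" "\<zero> \<in> I" "\<And>a b. a \<in> I \<Longrightarrow> b \<in> I \<Longrightarrow> a \<oplus> b \<in> I"
  "\<And>a r. a \<in> I \<Longrightarrow> r \<in> carrier R \<Longrightarrow> r \<otimes> a \<in> I"
 shows "ideal I R"
proof (rule idealI[OF ring_axioms])
 have neg: "\<ominus> a \<in> I" if "a \<in> I" for a
  using assms(4)[OF that, of "\<ominus> \<one>"] assms(1) that by (auto simp: l_minus)
 show "subgroup I (add_monoid R)"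
  by (rule add.subgroupI) (use assms neg in auto)
qed (use assms in \<open>auto simp: m_comm subset_iff\<close>)

lemma (in ideal) diff_closed: "a \<in> I \<Longrightarrow> b \<in> I \<Longrightarrow> a \<ominus> b \<in> I"
 by (simp add: a_minus_def)

lemma (in ideal) diff_sum:
 assumes "a \<ominus> b \<in> I" "b \<ominus> c \<in> I" "a \<in> carrier R" "b \<in> carrier R" "c \<in> carrier R"
 shows "a \<ominus> c \<in> I"
proof -
 have "(a \<ominus> b) \<oplus> (b \<ominus> c) = a \<ominus> c" using assms(3-) by (simp add: a_minus_def add.m_assoc r_neg1)
 then show ?thesis using additive_subgroup.a_closed[OF is_additive_subgroup assms(1,2)] by simp
qed

lemma (in ideal) diff_swap:
 assumes "a \<ominus> b \<in> I" "a \<in> carrier R" "b \<in> carrier R"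
 shows "b \<ominus> a \<in> I"
proof -
 have "\<ominus> (a \<ominus> b) = b \<ominus> a" using assms(2-) by (simp add: a_minus_def minus_add a_comm)
 then show ?thesis using additive_subgroup.a_inv_closed[OF is_additive_subgroup assms(1)] by simp
qed

text \<open>Finiteness of R/I, expressed by finitely many representatives, which may coincide modulo
  I.\<close>

definition fin_index :: "('a, 'b) ring_scheme \<Rightarrow> 'a set \<Rightarrow> bool"
 where "fin_index R I \<longleftrightarrow> (\<exists>T. finite T \<and> T \<subseteq> carrier R \<and> (\<forall>r \<in> carrier R. \<exists>t \<in> T. r \<ominus>[R] t \<in> I))"

definition adjoin :: "('a, 'b) ring_scheme \<Rightarrow> 'a set \<Rightarrow> 'a \<Rightarrow> 'a set"
 where "adjoin R J a = {i \<oplus>[R] a \<otimes>[R] s | i s. i \<in> J \<and> s \<in> carrier R}"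

lemma fin_index_mono: "fin_index R I \<Longrightarrow> I \<subseteq> J \<Longrightarrow> fin_index R J"
 unfolding fin_index_def by (meson subsetD)

context cring
begin

lemma adjoin_ideal:
 assumes J: "ideal J R" and a: "a \<in> carrier R"
 shows "ideal (adjoin R J a) R"
proof -
 interpret J: ideal J R by fact
 show ?thesis
 proof (rule cring_idealI)
  show "adjoin R J a \<subseteq> carrier R" using a by (auto simp: adjoin_def)
  have "\<zero> = \<zero> \<oplus> a \<otimes> \<zero>" using a by simp
  then show "\<zero> \<in> adjoin R J a" unfolding adjoin_def using J.zero_closed by blast
 next
  fix b c assume "b \<in> adjoin R J a" "c \<in> adjoin R J a"
  then obtain i s i' s' where *: "i \<in> J" "s \<in> carrier R" "b = i \<oplus> a \<otimes> s"
   "i' \<in> J" "s' \<in> carrier R" "c = i' \<oplus> a \<otimes> s'" by (auto simp: adjoin_def)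
  have "i \<in> carrier R" "i' \<in> carrier R" using * J.Icarr by auto
  then have "b \<oplus> c = (i \<oplus> i') \<oplus> a \<otimes> (s \<oplus> s')" unfolding * using a *(2,5) by algebra
  then show "b \<oplus> c \<in> adjoin R J a" unfolding adjoin_def using * J.a_closed by blast
 next
  fix b r assume "b \<in> adjoin R J a" and r: "r \<in> carrier R"
  then obtain i s where *: "i \<in> J" "s \<in> carrier R" "b = i \<oplus> a \<otimes> s" by (auto simp: adjoin_def)
  have "i \<in> carrier R" using * J.Icarr by auto
  then have "r \<otimes> b = r \<otimes> i \<oplus> a \<otimes> (r \<otimes> s)" unfolding * using a r *(2) by algebra
  then show "r \<otimes> b \<in> adjoin R J a" unfolding adjoin_def using * r J.I_l_closed by blast
 qed
qed

lemma adjoin_sub: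
 assumes J: "ideal J R" and a: "a \<in> carrier R"
 shows "J \<subseteq> adjoin R J a" "a \<in> adjoin R J a"
proof -
 interpret J: ideal J R by fact
 show "J \<subseteq> adjoin R J a"
 proof
  fix i assume "i \<in> J"
  moreover from this have "i = i \<oplus> a \<otimes> \<zero>" using a J.Icarr by simp
  ultimately show "i \<in> adjoin R J a" unfolding adjoin_def by blast
 qed
 have "a = \<zero> \<oplus> a \<otimes> \<one>" using a by simp
 then show "a \<in> adjoin R J a" unfolding adjoin_def using J.zero_closed by blast
qed

lemma adjoin_mult_sub:
 assumes J: "ideal J R" and a: "a \<in> carrier R" and b: "b \<in> carrier R" and ab: "a \<otimes> b \<in> J"
  and x: "x \<in> adjoin R J a" and y: "y \<in> adjoin R J b"
 shows "x \<otimes> y \<in> J"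
proof -
 interpret J: ideal J R by fact
 obtain i s i' s' where *: "i \<in> J" "s \<in> carrier R" "x = i \<oplus> a \<otimes> s"
   "i' \<in> J" "s' \<in> carrier R" "y = i' \<oplus> b \<otimes> s'" using x y by (auto simp: adjoin_def)
 have c: "i \<in> carrier R" "i' \<in> carrier R" using * J.Icarr by auto
 have "x \<otimes> y = i \<otimes> (i' \<oplus> b \<otimes> s') \<oplus> (i' \<otimes> (a \<otimes> s) \<oplus> (a \<otimes> b) \<otimes> (s \<otimes> s'))"
  unfolding * using a b c *(2,5) by algebra
 then show ?thesis using * c a b ab by (auto intro!: J.a_closed J.I_r_closed)
qed

text \<open>In the chain J \<subseteq> J + aR \<subseteq> R the lower quotient is an image of R/(J +
  bR) under multiplication by a, since ab lies in J. The elements t + a u therefore serve as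
  representatives.\<close>

lemma fin_index_nonprime:
 assumes J: "ideal J R" and ab: "a \<in> carrier R" "b \<in> carrier R" "a \<otimes> b \<in> J"
  and f: "fin_index R (adjoin R J a)" "fin_index R (adjoin R J b)"
 shows "fin_index R J"
proof -
 interpret J: ideal J R by fact
 obtain T where T: "finite T" "T \<subseteq> carrier R" "\<And>r. r \<in> carrier R \<Longrightarrow> \<exists>t\<in>T. r \<ominus> t \<in> adjoin R J a"
  using f(1) unfolding fin_index_def by blast
 obtain U where U: "finite U" "U \<subseteq> carrier R" "\<And>r. r \<in> carrier R \<Longrightarrow> \<exists>t\<in>U. r \<ominus> t \<in> adjoin R J b"
  using f(2) unfolding fin_index_def by blast
 define V where "V = (\<lambda>(t, u). t \<oplus> a \<otimes> u) ` (T \<times> U)"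
 have "\<exists>v\<in>V. r \<ominus> v \<in> J" if r: "r \<in> carrier R" for r
 proof -
  obtain t i s where t: "t \<in> T" "i \<in> J" "s \<in> carrier R" "r \<ominus> t = i \<oplus> a \<otimes> s"
   using T(3)[OF r] by (auto simp: adjoin_def)
  obtain u j w where u: "u \<in> U" "j \<in> J" "w \<in> carrier R" "s \<ominus> u = j \<oplus> b \<otimes> w"
   using U(3)[OF t(3)] by (auto simp: adjoin_def)
  have c: "t \<in> carrier R" "u \<in> carrier R" "i \<in> carrier R" "j \<in> carrier R"
   using t u T U J.Icarr by auto
  have "r \<ominus> (t \<oplus> a \<otimes> u) = (r \<ominus> t) \<ominus> a \<otimes> u" using r c ab by algebra
  also have "\<dots> = i \<oplus> a \<otimes> (s \<ominus> u)" unfolding t using c ab t(3) by algebra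
  also have "\<dots> = i \<oplus> (a \<otimes> j \<oplus> (a \<otimes> b) \<otimes> w)" unfolding u using c ab u(3) by algebra
  finally have eq: "r \<ominus> (t \<oplus> a \<otimes> u) = i \<oplus> (a \<otimes> j \<oplus> (a \<otimes> b) \<otimes> w)" .
  have "r \<ominus> (t \<oplus> a \<otimes> u) \<in> J" unfolding eq
   using t u ab J.I_r_closed[OF ab(3), of w] J.I_l_closed[of j a] by (intro J.a_closed) auto
  then show ?thesis using t(1) u(1) unfolding V_def by force
 qed
 then have "\<forall>r\<in>carrier R. \<exists>v\<in>V. r \<ominus> v \<in> J" by blast
 moreover have "finite V" "V \<subseteq> carrier R" using T(1,2) U(1,2) ab by (auto simp: V_def subset_iff)
 ultimately show ?thesis unfolding fin_index_def by (intro exI[of _ V] conjI)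
qed

end

lemma (in noetherian_ring) exists_maximal_among:
 assumes "\<J> \<noteq> {}" "\<J> \<subseteq> {I. ideal I R}"
 shows "\<exists>I\<in>\<J>. \<forall>J\<in>\<J>. I \<subseteq> J \<longrightarrow> J = I"
proof (rule subset_Zorn_nonempty[OF assms(1)])
 fix C assume C: "C \<noteq> {}" "subset.chain \<J> C"
 have CJ: "C \<subseteq> \<J>" using C(2) by (simp add: pred_on.chain_def)
 then have "subset.chain {I. ideal I R} C"
  using assms(2) C(2) by (simp add: pred_on.chain_def subset_iff)
 then have "\<Union>C \<in> C" by (rule ideal_chain_is_trivial[OF C(1)])
 then show "\<Union>C \<in> \<J>" using CJ by (rule_tac subsetD)
qed

section \<open>Noetherian local rings and the powers of the maximal ideal\<close>

locale noeth_cring = cring R + noetherian_ring R for R (structure)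

locale local_noeth = noeth_cring +
 assumes loc: "\<exists>!I. maximalideal I R"
begin

abbreviation "\<mm> \<equiv> max_ideal R"
abbreviation "mpow \<equiv> max_ideal_pow R"

lemma max_ideal_maximal: "maximalideal \<mm> R"
 unfolding max_ideal_def using loc by (rule theI')

sublocale m: maximalideal \<mm> R by (rule max_ideal_maximal)

lemma max_ideal_unique: "maximalideal I R \<Longrightarrow> I = \<mm>"
 using loc max_ideal_maximal by blast

lemma proper_ideal_sub:
 assumes I: "ideal I R" "\<one> \<notin> I"
 shows "I \<subseteq> \<mm>"
proof -
 let ?J = "{J. ideal J R \<and> I \<subseteq> J \<and> \<one> \<notin> J}"
 have "?J \<noteq> {}" using I by blast
 then obtain J where J: "J \<in> ?J" "\<forall>K\<in>?J. J \<subseteq> K \<longrightarrow> K = J"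
  using exists_maximal_among[of ?J] by blast
 have "maximalideal J R"
 proof (rule maximalidealI)
  show "ideal J R" "carrier R \<noteq> J" using J by auto
  fix K assume K: "ideal K R" "J \<subseteq> K" "K \<subseteq> carrier R"
  show "K = J \<or> K = carrier R"
  proof (cases "\<one> \<in> K")
   case True then show ?thesis using ideal.one_imp_carrier[OF K(1)] by blast
  next
   case False then show ?thesis using J K by auto
  qed
 qed
 then show ?thesis using max_ideal_unique J by auto
qed

lemma one_notin: "\<one> \<notin> \<mm>"
 using m.one_imp_carrier m.I_notcarr by auto

lemma unit_iff: "a \<in> carrier R \<Longrightarrow> a \<notin> \<mm> \<Longrightarrow> a \<in> Units R"
proof -
 assume a: "a \<in> carrier R" "a \<notin> \<mm>"
 have "\<one> \<in> PIdl a"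
  using proper_ideal_sub[OF cgenideal_ideal[OF a(1)]] cgenideal_self[OF a(1)] a by blast
 then obtain b where "b \<in> carrier R" "\<one> = b \<otimes> a" unfolding cgenideal_def by auto
 then show ?thesis using a m_comm unfolding Units_def by auto
qed

lemma one_minus_unit: "t \<in> \<mm> \<Longrightarrow> \<one> \<ominus> t \<in> Units R"
proof (rule unit_iff)
 assume t: "t \<in> \<mm>"
 then have tc: "t \<in> carrier R" by (rule m.Icarr)
 show "\<one> \<ominus> t \<in> carrier R" using tc by simp
 show "\<one> \<ominus> t \<notin> \<mm>"
 proof
  assume "\<one> \<ominus> t \<in> \<mm>"
  then have "(\<one> \<ominus> t) \<oplus> t \<in> \<mm>" using t by (rule m.a_closed)
  moreover have "(\<one> \<ominus> t) \<oplus> t = \<one>" using tc by algebra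
  ultimately show False using one_notin by simp
 qed
qed

lemma mpow_0 [simp]: "mpow 0 = carrier R"
 by (simp add: max_ideal_pow_def ideals_set_def nat_pow_def)

lemma mpow_Suc: "mpow (Suc k) = ideal_prod R (mpow k) \<mm>"
 by (simp add: max_ideal_pow_def ideals_set_def nat_pow_def)

lemma mpow_ideal: "ideal (mpow k) R"
 by (induction k) (auto simp: mpow_Suc oneideal intro!: ideal_prod_is_ideal m.is_ideal)

lemma mpow_carrier: "mpow k \<subseteq> carrier R"
 using ideal.Icarr[OF mpow_ideal] by blast

lemma mpow_1 [simp]: "mpow (Suc 0) = \<mm>"
 by (simp add: mpow_Suc ideal_prod_commute[OF oneideal m.is_ideal] m.is_ideal ideal_prod_one)

lemma mpow_Suc_sub: "mpow (Suc k) \<subseteq> mpow k"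
 unfolding mpow_Suc using ideal_prod_inter[OF mpow_ideal m.is_ideal] by blast

lemma mpow_antimono: "j \<le> k \<Longrightarrow> mpow k \<subseteq> mpow j"
 by (rule lift_Suc_antimono_le[of mpow]) (use mpow_Suc_sub in auto)

lemma mpow_add: "ideal_prod R (mpow j) (mpow k) = mpow (j + k)"
proof -
 interpret I: comm_monoid "ideals_set R" by (rule ideals_set_is_comm_monoid)
 have "\<mm> \<in> carrier (ideals_set R)" using m.is_ideal by (simp add: ideals_set_def)
 from I.nat_pow_mult[OF this, of j k] show ?thesis
  unfolding max_ideal_pow_def by (simp add: ideals_set_def)
qed

lemma mpow_mult: "x \<in> mpow j \<Longrightarrow> y \<in> mpow k \<Longrightarrow> x \<otimes> y \<in> mpow (j + k)"
 unfolding mpow_add[symmetric] by (rule ideal_prod.prod)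

lemma mpow_pow: "x \<in> \<mm> \<Longrightarrow> x [^] k \<in> mpow k"
proof (induction k)
 case (Suc k)
 then show ?case using mpow_mult[of "x [^] k" k x "Suc 0"] by simp
qed simp

text \<open>Among the ideals above \<open>J\<close> that contain no power of \<open>\<mm>\<close> a maximal one would be prime, and a
 prime ideal of finite index is \<open>\<mm>\<close>.\<close>

lemma fin_index_mpow:
 assumes J: "ideal J R" "fin_index R J"
 shows "\<exists>k. mpow k \<subseteq> J"
proof (rule ccontr)
 assume no: "\<nexists>k. mpow k \<subseteq> J"
 let ?J = "{K. ideal K R \<and> J \<subseteq> K \<and> (\<nexists>k. mpow k \<subseteq> K)}"
 have "?J \<noteq> {}" using J no by blast
 then obtain P where P: "P \<in> ?J" "\<forall>K\<in>?J. P \<subseteq> K \<longrightarrow> K = P"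
  using exists_maximal_among[of ?J] by blast
 interpret P: ideal P R using P by blast
 have prime: "a \<in> P \<or> b \<in> P" if ab: "a \<in> carrier R" "b \<in> carrier R" "a \<otimes> b \<in> P" for a b
 proof (rule ccontr)
  assume n: "\<not> (a \<in> P \<or> b \<in> P)"
  \<comment> \<open>By maximality of P the enlarged ideals contain powers of \<mm>; the product of
    these powers lies in P because ab does.\<close>
  have "\<exists>k. mpow k \<subseteq> adjoin R P c" if c: "c \<in> carrier R" "c \<notin> P" for c
  proof (rule ccontr)
   assume "\<nexists>k. mpow k \<subseteq> adjoin R P c"
   then have "adjoin R P c \<in> ?J"
    using P adjoin_sub[OF P.is_ideal c(1)] adjoin_ideal[OF P.is_ideal c(1)] by auto
   then show False using P adjoin_sub[OF P.is_ideal c(1)] c by blast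
  qed
  then obtain k l where kl: "mpow k \<subseteq> adjoin R P a" "mpow l \<subseteq> adjoin R P b"
   using ab n by meson
  have "mpow (k + l) \<subseteq> P"
  proof
   fix x assume "x \<in> mpow (k + l)"
   then have "x \<in> ideal_prod R (mpow k) (mpow l)" by (simp add: mpow_add)
   then show "x \<in> P"
   proof induction
    case (prod i j)
    then show ?case using adjoin_mult_sub[OF P.is_ideal ab] kl by blast
   qed (rule P.a_closed)
  qed
  then show False using P by blast
 qed
 have fP: "fin_index R P" using fin_index_mono J P by blast
 then obtain T where T: "finite T" "T \<subseteq> carrier R" "\<And>r. r \<in> carrier R \<Longrightarrow> \<exists>t\<in>T. r \<ominus> t \<in> P"
  unfolding fin_index_def by blast
 have "\<mm> \<subseteq> P"
 proof
  fix y assume y: "y \<in> \<mm>"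
  then have yc: "y \<in> carrier R" by (rule m.Icarr)
  \<comment> \<open>Pigeonhole: there are finitely many classes modulo P, so y^i and y^j agree for
    some i < j. Then y^i (1 - y^(j-i)) lies in P, its second factor is a unit, and primality puts y
    itself into P.\<close>
  define f where "f i = (SOME t. t \<in> T \<and> y [^] i \<ominus> t \<in> P)" for i :: nat
  have f: "f i \<in> T" "y [^] i \<ominus> f i \<in> P" for i
   using someI_ex[of "\<lambda>t. t \<in> T \<and> y [^] i \<ominus> t \<in> P"] T(3)[of "y [^] i"] yc unfolding f_def by auto
  have "\<not> inj f" using f(1) T(1) by (meson finite_subset image_subsetI range_inj_infinite)
  then obtain i j where ij: "i < j" "f i = f j" by (metis injI nat_neq_iff)
  have "f i \<in> carrier R" using f T by auto
  then have "y [^] i \<ominus> y [^] j \<in> P"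
   using P.diff_sum[OF f(2)[of i], of "y [^] j"] P.diff_swap[OF f(2)[of j]] ij yc by simp
  moreover have "y [^] i \<ominus> y [^] j = y [^] i \<otimes> (\<one> \<ominus> y [^] (j - i))"
  proof -
   have "y [^] j = y [^] i \<otimes> y [^] (j - i)" using ij yc by (simp add: nat_pow_mult)
   then show ?thesis using yc nat_pow_closed[OF yc] by algebra
  qed
  ultimately have "y [^] i \<otimes> (\<one> \<ominus> y [^] (j - i)) \<in> P" by simp
  then have "y [^] i \<in> P \<or> (\<one> \<ominus> y [^] (j - i)) \<in> P" by (intro prime) (use yc in auto)
  moreover have "(\<one> \<ominus> y [^] (j - i)) \<notin> P"
  proof
   assume a: "(\<one> \<ominus> y [^] (j - i)) \<in> P"
   have "y [^] (j - i) \<in> mpow (j - i)" using y by (rule mpow_pow)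
   also have "\<dots> \<subseteq> \<mm>" using mpow_antimono[of "Suc 0" "j - i"] ij by simp
   finally have "\<one> \<ominus> y [^] (j - i) \<in> Units R" by (rule one_minus_unit)
   then have "\<one> \<in> P" using a P.I_l_closed[OF a, of "inv (\<one> \<ominus> y [^] (j - i))"] by simp
   then have "P = carrier R" by (rule P.one_imp_carrier)
   then have "mpow 0 \<subseteq> P" by simp
   then show False using P by blast
  qed
  ultimately have "y [^] i \<in> P" by blast
  then show "y \<in> P"
  proof (induction i)
   case 0
   then show ?case using P.one_imp_carrier yc by simp
  next
   case (Suc i)
   then have "y [^] i \<otimes> y \<in> P" by simp
   then show ?case using prime[of "y [^] i" y] Suc yc by auto
  qed
 qed
 then have "mpow (Suc 0) \<subseteq> P" by simp
 then show False using P by blast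
qed

end

subsection \<open>Surjective homomorphisms\<close>

text \<open>Each axiom for \<open>B\<close> is the image of the same identity for preimages. This
  equips rings whose elements are mere codes with their ring structure.\<close>

lemma (in cring) surj_hom_cring:
 assumes h: "h \<in> ring_hom R B" "h ` carrier R = carrier B" "h \<zero> = \<zero>[B]"
 shows "cring B"
proof -
 have ex: "\<exists>r\<in>carrier R. b = h r" if "b \<in> carrier B" for b using that h(2) by auto
 note hs = ring_hom_add[OF h(1), symmetric] ring_hom_mult[OF h(1), symmetric]
  ring_hom_one[OF h(1), symmetric] h(3)[symmetric]
 note hc = ring_hom_closed[OF h(1)]
 show ?thesis
 proof (rule cringI)
  show "abelian_group B"
  proof (rule abelian_groupI)
   fix x y assume "x \<in> carrier B" "y \<in> carrier B"
   then show "x \<oplus>[B] y \<in> carrier B" "x \<oplus>[B] y = y \<oplus>[B] x"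
    by (auto dest!: ex simp: hs hc a_comm)
  next
   fix x y z assume "x \<in> carrier B" "y \<in> carrier B" "z \<in> carrier B"
   then show "x \<oplus>[B] y \<oplus>[B] z = x \<oplus>[B] (y \<oplus>[B] z)" by (auto dest!: ex simp: hs hc a_assoc)
  next
   show "\<zero>[B] \<in> carrier B" by (simp add: hs hc)
  next
   fix x assume "x \<in> carrier B"
   then obtain r where r: "r \<in> carrier R" "x = h r" by (auto dest: ex)
   then show "\<zero>[B] \<oplus>[B] x = x" by (auto simp: hs hc)
   from r have "h (\<ominus> r) \<in> carrier B" "h (\<ominus> r) \<oplus>[B] x = \<zero>[B]" by (auto simp: hs hc l_neg)
   then show "\<exists>y\<in>carrier B. y \<oplus>[B] x = \<zero>[B]" by blast
  qed
  show "Group.comm_monoid B"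
  proof (rule comm_monoidI)
   fix x y assume "x \<in> carrier B" "y \<in> carrier B"
   then show "x \<otimes>[B] y \<in> carrier B" "x \<otimes>[B] y = y \<otimes>[B] x"
    by (auto dest!: ex simp: hs hc m_comm)
  next
   fix x y z assume "x \<in> carrier B" "y \<in> carrier B" "z \<in> carrier B"
   then show "x \<otimes>[B] y \<otimes>[B] z = x \<otimes>[B] (y \<otimes>[B] z)" by (auto dest!: ex simp: hs hc m_assoc)
  next
   show "\<one>[B] \<in> carrier B" by (simp add: hs hc)
  next
   fix x assume "x \<in> carrier B"
   then show "\<one>[B] \<otimes>[B] x = x" by (auto dest!: ex simp: hs hc)
  qed
 next
  fix x y z assume "x \<in> carrier B" "y \<in> carrier B" "z \<in> carrier B"
  then show "(x \<oplus>[B] y) \<otimes>[B] z = x \<otimes>[B] z \<oplus>[B] y \<otimes>[B] z" by (auto dest!: ex simp: hs hc l_distr)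
 qed
qed

locale surj_hom = ring_hom_cring R S h for R (structure) and S (structure) and h +
 assumes surj: "h ` carrier R = carrier S"
begin

lemma hom_minus: "a \<in> carrier R \<Longrightarrow> b \<in> carrier R \<Longrightarrow> h (a \<ominus> b) = h a \<ominus>[S] h b"
 by (simp add: a_minus_def S.minus_eq)

lemma vimage_ideal:
 assumes "ideal J S"
 shows "ideal {r \<in> carrier R. h r \<in> J} R"
proof -
 interpret J: ideal J S by fact
 show ?thesis by (rule R.cring_idealI) (auto simp: J.I_l_closed)
qed

lemma image_ideal:
 assumes "ideal I R"
 shows "ideal (h ` I) S"
proof -
 interpret I: ideal I R by fact
 show ?thesis
 proof (rule S.cring_idealI)
  show "h ` I \<subseteq> carrier S" using I.Icarr by auto
  show "\<zero>[S] \<in> h ` I" using I.zero_closed hom_zero by (metis imageI)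
 next
  fix a b assume "a \<in> h ` I" "b \<in> h ` I"
  then show "a \<oplus>[S] b \<in> h ` I"
   using I.a_closed I.Icarr by (auto simp: hom_add[symmetric] simp del: hom_add)
 next
  fix a r assume "a \<in> h ` I" "r \<in> carrier S"
  then obtain i s where "i \<in> I" "a = h i" "s \<in> carrier R" "r = h s" by (auto simp: surj[symmetric])
  then show "r \<otimes>[S] a \<in> h ` I"
   using I.I_l_closed I.Icarr by (auto simp: hom_mult[symmetric] simp del: hom_mult)
 qed
qed

lemma image_vimage: "J \<subseteq> carrier S \<Longrightarrow> h ` {r \<in> carrier R. h r \<in> J} = J"
 using surj by (auto 0 3)

lemma noetherian_image:
 assumes "noetherian_ring R"
 shows "noetherian_ring S"
proof (rule S.noetherian_ringI)
 interpret noetherian_ring R by fact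
 fix J assume J: "ideal J S"
 obtain G where G: "G \<subseteq> carrier R" "finite G" "{r \<in> carrier R. h r \<in> J} = Idl G"
  using finetely_gen[OF vimage_ideal[OF J]] by blast
 have sub: "h ` G \<subseteq> carrier S" using G by auto
 have XJ: "h ` G \<subseteq> J" using R.genideal_self[OF G(1)] G(3) by auto
 have "Idl G \<subseteq> {r \<in> carrier R. h r \<in> Idl\<^bsub>S\<^esub> (h ` G)}"
  using S.genideal_self[OF sub] G(1)
  by (intro R.genideal_minimal vimage_ideal S.genideal_ideal[OF sub]) auto
 then have "J \<subseteq> Idl\<^bsub>S\<^esub> (h ` G)"
  using image_vimage[of J] ideal.Icarr[OF J] G(3) by auto
 moreover have "Idl\<^bsub>S\<^esub> (h ` G) \<subseteq> J" using S.genideal_minimal[OF J XJ] .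
 ultimately show "\<exists>A\<subseteq>carrier S. finite A \<and> J = Idl\<^bsub>S\<^esub> A" using sub G(2) by blast
qed

lemma image_ideal_prod:
 assumes "I \<subseteq> carrier R" "J \<subseteq> carrier R" "ideal I R" "ideal J R"
 shows "h ` ideal_prod R I J = ideal_prod S (h ` I) (h ` J)"
proof
 have "h x \<in> ideal_prod S (h ` I) (h ` J)" if "x \<in> ideal_prod R I J" for x
  using that
 proof induction
  case (prod i j)
  then show ?case using assms by (auto simp: subset_iff intro!: ideal_prod.prod)
 next
  case (sum a b)
  then have "a \<in> carrier R" "b \<in> carrier R" using R.ideal_prod_in_carrier[OF assms(3,4)] by auto
  then show ?case using sum by (auto intro!: ideal_prod.sum)
 qed
 then show "h ` ideal_prod R I J \<subseteq> ideal_prod S (h ` I) (h ` J)" by auto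
 have "x \<in> h ` ideal_prod R I J" if "x \<in> ideal_prod S (h ` I) (h ` J)" for x
  using that
 proof induction
  case (prod i j)
  then obtain a b where "a \<in> I" "b \<in> J" "i = h a" "j = h b" by auto
  moreover from this have "i \<otimes>[S] j = h (a \<otimes> b)" using assms by (auto simp: subset_iff)
  ultimately show ?case using ideal_prod.prod[of a I b J R] by auto
 next
  case (sum a b)
  then obtain c d where cd: "c \<in> ideal_prod R I J" "d \<in> ideal_prod R I J" "a = h c" "b = h d" by auto
  then have "a \<oplus>[S] b = h (c \<oplus> d)" using R.ideal_prod_in_carrier[OF assms(3,4)] by (auto simp: subset_iff)
  then show ?case using ideal_prod.sum[OF cd(1,2)] by auto
 qed
 then show "ideal_prod S (h ` I) (h ` J) \<subseteq> h ` ideal_prod R I J" by auto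
qed

end

locale surj_hom_local = surj_hom + local_noeth R +
 assumes nontriv: "\<one>[S] \<noteq> \<zero>[S]"
begin

text \<open>Outside \<mm> every element is a unit, and units map to units, which differ from zero in
  the nontrivial ring \<open>S\<close>.\<close>

lemma ker_sub: "r \<in> carrier R \<Longrightarrow> h r = \<zero>[S] \<Longrightarrow> r \<in> \<mm>"
proof (rule ccontr)
 assume r: "r \<in> carrier R" "h r = \<zero>[S]" "r \<notin> \<mm>"
 then have u: "r \<in> Units R" by (intro unit_iff)
 have "h (inv r \<otimes> r) = h (inv r) \<otimes>[S] h r" using r u by (intro hom_mult) auto
 then show False using r u nontriv by simp
qed

lemma image_max: "b \<in> carrier R \<Longrightarrow> h b \<in> h ` \<mm> \<Longrightarrow> b \<in> \<mm>"
proof -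
 assume b: "b \<in> carrier R" "h b \<in> h ` \<mm>"
 then obtain t where t: "t \<in> \<mm>" "h b = h t" by auto
 have tc: "t \<in> carrier R" using t m.Icarr by simp
 then have "b \<ominus> t \<in> \<mm>" using b t by (intro ker_sub) (auto simp: hom_minus)
 then have "(b \<ominus> t) \<oplus> t \<in> \<mm>" using t m.a_closed by blast
 moreover have "(b \<ominus> t) \<oplus> t = b" using b tc by algebra
 ultimately show ?thesis by simp
qed

lemma maximal_image: "maximalideal J S \<longleftrightarrow> J = h ` \<mm>"
proof -
 have one: "\<one>[S] \<notin> h ` \<mm>" using image_max[of \<one>] one_notin by auto
 have sub: "J \<subseteq> h ` \<mm>" if "ideal J S" "\<one>[S] \<notin> J" for J
 proof -
  have "{r \<in> carrier R. h r \<in> J} \<subseteq> \<mm>" by (rule proper_ideal_sub[OF vimage_ideal]) (use that in auto)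
  then show ?thesis using image_vimage[of J] ideal.Icarr[OF that(1)] by blast
 qed
 have "maximalideal (h ` \<mm>) S"
 proof (rule maximalidealI)
  show "ideal (h ` \<mm>) S" by (rule image_ideal[OF m.is_ideal])
  show "carrier S \<noteq> h ` \<mm>" using one S.one_closed by blast
  fix J assume J: "ideal J S" "h ` \<mm> \<subseteq> J" "J \<subseteq> carrier S"
  show "J = h ` \<mm> \<or> J = carrier S"
  proof (cases "\<one>[S] \<in> J")
   case True then show ?thesis using ideal.one_imp_carrier[OF J(1)] by blast
  next
   case False then show ?thesis using sub J by auto
  qed
 qed
 moreover have "J = h ` \<mm>" if J: "maximalideal J S"
 proof -
  interpret J: maximalideal J S by fact
  have "\<one>[S] \<notin> J" using J.one_imp_carrier J.I_notcarr by blast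
  then have "J \<subseteq> h ` \<mm>" by (intro sub J.is_ideal)
  then have "h ` \<mm> = J \<or> h ` \<mm> = carrier S"
   by (intro J.I_maximal image_ideal m.is_ideal) (auto simp: m.Icarr)
  then show ?thesis using one by auto
 qed
 ultimately show ?thesis by blast
qed

lemma local_image: "local_noeth S"
proof (intro local_noeth.intro noeth_cring.intro local_noeth_axioms.intro)
 show "cring S" by (rule S.is_cring)
 show "noetherian_ring S" by (rule noetherian_image) (rule noetherian_ring_axioms)
 show "\<exists>!I. maximalideal I S" using maximal_image by blast
qed

sublocale S: local_noeth S by (rule local_image)

lemma max_ideal_image: "max_ideal S = h ` \<mm>"
 using maximal_image S.max_ideal_maximal by blast

lemma mpow_image: "max_ideal_pow S k = h ` mpow k"
proof (induction k)
 case 0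
 then show ?case using surj by simp
next
 case (Suc k)
 then show ?case
  using image_ideal_prod[OF mpow_carrier _ mpow_ideal m.is_ideal] m.Icarr
  by (simp add: mpow_Suc S.mpow_Suc max_ideal_image subset_iff)
qed

text \<open>A Cauchy sequence of the image lifts because its differences lift into the corresponding
  powers of \<mm>. Separatedness amounts to closedness of the kernel and enters as the hypothesis
  \<open>sep\<close>.\<close>

lemma complete_image:
 assumes c: "complete_local R" and sep: "(\<Inter>k. max_ideal_pow S k) \<subseteq> {\<zero>[S]}"
 shows "complete_local S"
 unfolding complete_local_def
proof (intro conjI allI impI)
 show "local_cring S" unfolding local_cring_def using S.is_cring S.loc by blast
 show "(\<Inter>k. max_ideal_pow S k) = {\<zero>[S]}"
  using sep additive_subgroup.zero_closed[OF ideal.axioms(1)[OF S.mpow_ideal]] by blast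
 fix s assume s: "\<forall>k. s k \<in> carrier S \<and> s (Suc k) \<ominus>[S] s k \<in> max_ideal_pow S k"
 have "\<exists>d. d \<in> mpow k \<and> h d = s (Suc k) \<ominus>[S] s k" for k
  using s[rule_format, of k] unfolding mpow_image by force
 then obtain d where d: "\<And>k. d k \<in> mpow k" "\<And>k. h (d k) = s (Suc k) \<ominus>[S] s k" by metis
 have dc: "d k \<in> carrier R" for k using d(1) mpow_carrier by blast
 have "s 0 \<in> h ` carrier R" using s surj by simp
 then obtain t0 where t0: "t0 \<in> carrier R" "h t0 = s 0" by auto
 define t where "t = rec_nat t0 (\<lambda>k t. t \<oplus> d k)"
 have t: "t 0 = t0" "t (Suc k) = t k \<oplus> d k" for k by (simp_all add: t_def)
 have tc: "t k \<in> carrier R" for k by (induction k) (auto simp: t t0 dc)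
 have ht: "h (t k) = s k" for k
 proof (induction k)
  case (Suc k)
  have "s k \<oplus>[S] (s (Suc k) \<ominus>[S] s k) = s (Suc k)"
  proof -
   have c: "s k \<in> carrier S" "s (Suc k) \<in> carrier S" using s by auto
   have "s k \<oplus>[S] (s (Suc k) \<ominus>[S] s k) = s (Suc k) \<oplus>[S] (s k \<oplus>[S] \<ominus>[S] s k)"
    using c by (simp only: S.minus_eq S.a_lcomm[of "s k" "s (Suc k)"] S.a_inv_closed)
   then show ?thesis using c by (simp only: S.r_neg S.r_zero)
  qed
  then show ?case using Suc by (simp add: t tc dc d)
 qed (simp add: t t0)
 have "\<forall>k. t k \<in> carrier R \<and> t (Suc k) \<ominus> t k \<in> mpow k"
 proof
  fix k
  have "t (Suc k) \<ominus> t k = d k" unfolding t using tc[of k] dc[of k] by algebra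
  then show "t k \<in> carrier R \<and> t (Suc k) \<ominus> t k \<in> mpow k" using tc d by simp
 qed
 then obtain x where x: "x \<in> carrier R" "\<forall>k. x \<ominus> t k \<in> mpow k"
  using c unfolding complete_local_def by blast
 have "h x \<ominus>[S] s k \<in> max_ideal_pow S k" for k
  using x(2) tc x(1) ht unfolding mpow_image by (metis hom_minus imageI)
 then show "\<exists>x\<in>carrier S. \<forall>k. x \<ominus>[S] s k \<in> max_ideal_pow S k" using x(1) by blast
qed

end

section \<open>Just infinite local domains\<close>

lemma fin_indexE:
 assumes "fin_index R J"
 obtains T where "finite T" "T \<subseteq> carrier R" "\<And>r. r \<in> carrier R \<Longrightarrow> \<exists>t\<in>T. r \<ominus>[R] t \<in> J"
proof -
 from assms obtain T where "finite T \<and> T \<subseteq> carrier R \<and> (\<forall>r\<in>carrier R. \<exists>t\<in>T. r \<ominus>[R] t \<in> J)"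
  unfolding fin_index_def by (rule exE)
 then show thesis by (intro that[of T]) simp_all
qed

lemma fin_indexI:
 assumes "finite T" "T \<subseteq> carrier R" "\<And>r. r \<in> carrier R \<Longrightarrow> \<exists>t\<in>T. r \<ominus>[R] t \<in> J"
 shows "fin_index R J"
 unfolding fin_index_def using assms by (intro exI[of _ T] conjI ballI) simp_all

text \<open>An infinite field also satisfies \<open>infinite_index\<close> and
  \<open>ideal_fin_index\<close>; \<open>finite_residue\<close> excludes it and thereby supplies a
  nonzero element of \<mm>.\<close>

locale just_infinite = local_noeth R + domain R for R (structure) +
 assumes infinite_index: "\<not> fin_index R {\<zero>}"
  and finite_residue: "fin_index R (max_ideal R)"
  and ideal_fin_index: "ideal J R \<Longrightarrow> J \<noteq> {\<zero>} \<Longrightarrow> fin_index R J"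
begin

definition xpow :: "'a \<Rightarrow> nat \<Rightarrow> 'a set"
 where "xpow x k = {x [^] k \<otimes> a | a. a \<in> carrier R}"

lemma infinite_carrier: "infinite (carrier R)"
proof
 assume "finite (carrier R)"
 then have "fin_index R {\<zero>}" unfolding fin_index_def
  by (intro exI[of _ "carrier R"]) (use r_neg in \<open>auto simp: a_minus_def\<close>)
 then show False using infinite_index by blast
qed

lemma exists_parameter: "\<exists>x\<in>\<mm>. x \<noteq> \<zero>"
proof (rule ccontr)
 assume "\<not> (\<exists>x\<in>\<mm>. x \<noteq> \<zero>)"
 then have "\<mm> \<subseteq> {\<zero>}" by auto
 then show False using fin_index_mono[OF finite_residue] infinite_index by blast
qed

context
 fixes x assumes x: "x \<in> \<mm>" and x0: "x \<noteq> \<zero>"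
begin

lemma x_closed [simp]: "x \<in> carrier R" using x m.Icarr by blast

lemma xpow_nonzero: "x [^] (k::nat) \<noteq> \<zero>"
 by (induction k) (use x0 in \<open>auto simp: integral_iff\<close>)

lemma xpow_ideal: "ideal (xpow x k) R"
proof (rule cring_idealI)
 show "xpow x k \<subseteq> carrier R" by (auto simp: xpow_def)
 have "\<zero> = x [^] k \<otimes> \<zero>" by simp
 then show "\<zero> \<in> xpow x k" unfolding xpow_def using zero_closed by blast
next
 fix a b assume "a \<in> xpow x k" "b \<in> xpow x k"
 then obtain c d where "c \<in> carrier R" "d \<in> carrier R" "a = x [^] k \<otimes> c" "b = x [^] k \<otimes> d"
  by (auto simp: xpow_def)
 moreover from this have "a \<oplus> b = x [^] k \<otimes> (c \<oplus> d)" by (simp add: r_distr)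
 ultimately show "a \<oplus> b \<in> xpow x k" unfolding xpow_def by blast
next
 fix a r assume "a \<in> xpow x k" and r: "r \<in> carrier R"
 then obtain c where "c \<in> carrier R" "a = x [^] k \<otimes> c" by (auto simp: xpow_def)
 moreover from this r have "r \<otimes> a = x [^] k \<otimes> (r \<otimes> c)" by (simp add: m_lcomm)
 ultimately show "r \<otimes> a \<in> xpow x k" unfolding xpow_def using r by blast
qed

lemma xpow_fin_index: "fin_index R (xpow x k)"
proof (rule ideal_fin_index[OF xpow_ideal])
 have "x [^] k = x [^] k \<otimes> \<one>" by simp
 then have "x [^] k \<in> xpow x k" unfolding xpow_def by blast
 then show "xpow x k \<noteq> {\<zero>}" using xpow_nonzero by blast
qed

text \<open>The ideal generated by x^k is nonzero, so it has finite index and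
  \<open>fin_index_mpow\<close> applies. Hence the x-adic and the \<mm>-adic topology
  coincide.\<close>

lemma mpow_sub_xpow: "\<exists>j. mpow j \<subseteq> xpow x k"
 by (rule fin_index_mpow[OF xpow_ideal xpow_fin_index])

text \<open>Krull's intersection argument. Writing y = x^k z_k, the ideals generated by the z_k
  increase and become stationary, so z_(K+1) = c z_K = c x z_(K+1); as 1 - c x is a unit, z_(K+1)
  and with it y vanishes.\<close>

lemma xpow_sep:
 assumes y: "\<And>k. y \<in> xpow x k"
 shows "y = \<zero>"
proof (rule ccontr)
 assume y0: "y \<noteq> \<zero>"
 have "\<exists>z. z \<in> carrier R \<and> y = x [^] k \<otimes> z" for k :: nat using y[of k] by (auto simp: xpow_def)
 then obtain z where z: "\<And>k::nat. z k \<in> carrier R" "\<And>k::nat. y = x [^] k \<otimes> z k" by metis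
 have step: "z k = x \<otimes> z (Suc k)" for k
 proof -
  have "x [^] k \<otimes> z k = x [^] k \<otimes> (x \<otimes> z (Suc k))"
   using z(2)[of k] z(2)[of "Suc k"] z(1) by (simp add: m_assoc)
  then show ?thesis using m_lcancel[OF xpow_nonzero] z(1) by simp
 qed
 have "\<exists>I\<in>range (\<lambda>k. PIdl (z k)). \<forall>J\<in>range (\<lambda>k. PIdl (z k)). I \<subseteq> J \<longrightarrow> J = I"
  by (rule exists_maximal_among) (use cgenideal_ideal[OF z(1)] in auto)
 then obtain K where K: "\<And>k. PIdl (z K) \<subseteq> PIdl (z k) \<Longrightarrow> PIdl (z k) = PIdl (z K)" by auto
 have "z K \<in> PIdl (z (Suc K))" using step[of K] x_closed unfolding cgenideal_def by blast
 then have "PIdl (z K) \<subseteq> PIdl (z (Suc K))" by (rule cgenideal_minimal[OF cgenideal_ideal[OF z(1)]])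
 then have "PIdl (z (Suc K)) = PIdl (z K)" by (rule K)
 then have "z (Suc K) \<in> PIdl (z K)" using cgenideal_self[OF z(1)] by metis
 then obtain c where c: "c \<in> carrier R" "z (Suc K) = c \<otimes> z K" by (auto simp: cgenideal_def)
 let ?w = "z (Suc K)"
 have w: "?w \<in> carrier R" by (rule z(1))
 have eq: "?w = c \<otimes> (x \<otimes> ?w)" using c(2) step[of K] by simp
 have "(\<one> \<ominus> c \<otimes> x) \<otimes> ?w = ?w \<ominus> c \<otimes> (x \<otimes> ?w)"
  using w c(1) x_closed by algebra
 also have "\<dots> = \<zero>" using eq w by (metis r_neg a_minus_def)
 finally have 0: "(\<one> \<ominus> c \<otimes> x) \<otimes> ?w = \<zero>" .
 have "c \<otimes> x \<in> \<mm>" using x c(1) by (rule m.I_l_closed)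
 then have "\<one> \<ominus> c \<otimes> x \<noteq> \<zero>" using one_minus_unit[of "c \<otimes> x"] by (metis Units_r_inv l_null one_not_zero Units_inv_closed)
 then have "?w = \<zero>" using 0 integral_iff w c(1) by simp
 then have "y = \<zero>" using z(2)[of "Suc K"] by simp
 then show False using y0 by blast
qed

end

lemma mpow_sep: "(\<Inter>k. mpow k) = {\<zero>}"
proof -
 obtain x where x: "x \<in> \<mm>" "x \<noteq> \<zero>" using exists_parameter by blast
 have "y = \<zero>" if "\<And>k. y \<in> mpow k" for y
  by (rule xpow_sep[OF x]) (use mpow_sub_xpow[OF x] that in blast)
 moreover have "\<zero> \<in> mpow k" for k
  using additive_subgroup.zero_closed[OF ideal.axioms(1)[OF mpow_ideal]] .
 ultimately show ?thesis by blast
qed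

text \<open>Modulo each x^k there are finitely many classes, which can be numbered, and by
  \<open>xpow_sep\<close> the sequence of class numbers determines the element. The code is required
  because \<open>universal_deformation_ring\<close> quantifies over rings carried by
  \<open>continuum\<close>.\<close>

lemma embeds_continuum: "\<exists>e :: 'a \<Rightarrow> continuum. inj_on e (carrier R)"
proof -
 obtain x where x: "x \<in> \<mm>" "x \<noteq> \<zero>" using exists_parameter by blast
 have "\<exists>f :: 'a \<Rightarrow> nat. \<forall>a\<in>carrier R. \<forall>b\<in>carrier R. f a = f b \<longrightarrow> a \<ominus> b \<in> xpow x k" for k
 proof -
  interpret X: ideal "xpow x k" R by (rule xpow_ideal[OF x])
  obtain T where T: "finite T" "T \<subseteq> carrier R" "\<And>r. r \<in> carrier R \<Longrightarrow> \<exists>t\<in>T. r \<ominus> t \<in> xpow x k"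
   by (rule fin_indexE[OF xpow_fin_index[OF x, of k]]) (rule that)
  obtain g :: "'a \<Rightarrow> nat" where g: "inj_on g T" using finite_imp_inj_to_nat_seg[OF T(1)] by blast
  define t where "t r = (SOME t. t \<in> T \<and> r \<ominus> t \<in> xpow x k)" for r
  have t: "t r \<in> T" "r \<ominus> t r \<in> xpow x k" if "r \<in> carrier R" for r
   using someI_ex[of "\<lambda>t. t \<in> T \<and> r \<ominus> t \<in> xpow x k"] T(3)[OF that] unfolding t_def by auto
  have "a \<ominus> b \<in> xpow x k" if ab: "a \<in> carrier R" "b \<in> carrier R" "g (t a) = g (t b)" for a b
  proof -
   have "t a = t b" using ab g t by (meson inj_onD)
   moreover have "t a \<in> carrier R" using t ab T by blast
   ultimately show ?thesis using X.diff_sum[OF t(2)[OF ab(1)], of b] X.diff_swap[OF t(2)[OF ab(2)]] ab by simp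
  qed
  then show ?thesis by (intro exI[of _ "g \<circ> t"]) auto
 qed
 then obtain f :: "nat \<Rightarrow> 'a \<Rightarrow> nat" where
  f: "\<And>k a b. a \<in> carrier R \<Longrightarrow> b \<in> carrier R \<Longrightarrow> f k a = f k b \<Longrightarrow> a \<ominus> b \<in> xpow x k" by metis
 have "inj_on (\<lambda>a k. f k a) (carrier R)"
 proof (rule inj_onI)
  fix a b assume ab: "a \<in> carrier R" "b \<in> carrier R" "(\<lambda>k. f k a) = (\<lambda>k. f k b)"
  then have "a \<ominus> b \<in> xpow x k" for k using f by metis
  then have "a \<ominus> b = \<zero>" by (rule xpow_sep[OF x])
  then show "a = b" using ab by simp
 qed
 then show ?thesis by (intro exI[of _ "\<lambda>a k. f k a"])
qed

end

text \<open>Nonzero ideals of the image pull back to ideals strictly above the kernel, to which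
  \<open>fin\<close> applies.\<close>

lemma (in surj_hom_local) just_infinite_image:
 assumes prime: "\<And>a b. a \<in> carrier R \<Longrightarrow> b \<in> carrier R \<Longrightarrow> h (a \<otimes> b) = \<zero>[S] \<Longrightarrow>
   h a = \<zero>[S] \<or> h b = \<zero>[S]"
  and inf: "\<not> fin_index R {r \<in> carrier R. h r = \<zero>[S]}"
  and fin: "\<And>J. ideal J R \<Longrightarrow> {r \<in> carrier R. h r = \<zero>[S]} \<subset> J \<Longrightarrow> fin_index R J"
  and res: "fin_index R (max_ideal R)"
 shows "just_infinite S"
proof -
 have img: "fin_index S (h ` J)" if fJ: "fin_index R J" for J
 proof -
  obtain T where T: "finite T" "T \<subseteq> carrier R" "\<And>r. r \<in> carrier R \<Longrightarrow> \<exists>t\<in>T. r \<ominus> t \<in> J"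
   by (rule fin_indexE[OF fJ]) (rule that)
  have "\<exists>t\<in>h ` T. s \<ominus>[S] t \<in> h ` J" if "s \<in> carrier S" for s
  proof -
   obtain r where r: "r \<in> carrier R" "s = h r" using \<open>s \<in> carrier S\<close> unfolding surj[symmetric] by auto
   obtain t where t: "t \<in> T" "r \<ominus> t \<in> J" using T(3)[OF r(1)] by blast
   have tc: "t \<in> carrier R" using t(1) T(2) by (rule_tac subsetD)
   have "h r \<ominus>[S] h t \<in> h ` J" using imageI[OF t(2), of h] hom_minus[OF r(1) tc] by simp
   then show ?thesis unfolding r(2) using t(1) by (intro bexI[of _ "h t"] imageI)
  qed
  moreover have "finite (h ` T)" "h ` T \<subseteq> carrier S" using T(1,2) by auto
  ultimately show ?thesis by (intro fin_indexI[of "h ` T"])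
 qed
 have "domain_axioms S"
 proof (rule domain_axioms.intro)
 show "\<one>[S] \<noteq> \<zero>[S]" by (rule nontriv)
 show "a = \<zero>[S] \<or> b = \<zero>[S]" if ab: "a \<otimes>[S] b = \<zero>[S]" "a \<in> carrier S" "b \<in> carrier S" for a b
 proof -
  obtain c d where "c \<in> carrier R" "d \<in> carrier R" "a = h c" "b = h d" using ab surj by (metis imageE)
  then show ?thesis using prime[of c d] ab by simp
 qed
 qed
 then have dom: "domain S" by (rule domain.intro[OF S.is_cring])
 have "just_infinite_axioms S"
 proof (rule just_infinite_axioms.intro)
 show "fin_index S (max_ideal S)" unfolding max_ideal_image by (rule img[OF res])
 show "fin_index S J" if J: "ideal J S" "J \<noteq> {\<zero>[S]}" for J
 proof -
  have 0: "\<zero>[S] \<in> J" using additive_subgroup.zero_closed[OF ideal.axioms(1)[OF J(1)]] .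
  then obtain b where "b \<in> J" "b \<noteq> \<zero>[S]" using J(2) by blast
  moreover from this obtain c where "c \<in> carrier R" "b = h c"
   using ideal.Icarr[OF J(1)] surj by (metis imageE)
  ultimately have "{r \<in> carrier R. h r = \<zero>[S]} \<subset> {r \<in> carrier R. h r \<in> J}" using 0 by auto
  then have "fin_index R {r \<in> carrier R. h r \<in> J}" by (intro fin vimage_ideal J(1))
  then have "fin_index S (h ` {r \<in> carrier R. h r \<in> J})" by (rule img)
  then show ?thesis using image_vimage[of J] ideal.Icarr[OF J(1)] by (simp add: subset_iff)
 qed
 show "\<not> fin_index S {\<zero>[S]}"
 proof
  assume "fin_index S {\<zero>[S]}"
  then obtain T where T: "finite T" "T \<subseteq> carrier S" "\<And>r. r \<in> carrier S \<Longrightarrow> \<exists>t\<in>T. r \<ominus>[S] t \<in> {\<zero>[S]}"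
   by (rule fin_indexE) (rule that)
  define g where "g = inv_into (carrier R) h"
  have g: "g t \<in> carrier R" "h (g t) = t" if "t \<in> carrier S" for t
   unfolding g_def using that by (simp_all add: surj[symmetric] inv_into_into f_inv_into_f)
  have "\<forall>r\<in>carrier R. \<exists>t\<in>g ` T. r \<ominus> t \<in> {r \<in> carrier R. h r = \<zero>[S]}"
  proof
   fix r assume r: "r \<in> carrier R"
   then obtain t where t: "t \<in> T" "h r \<ominus>[S] t = \<zero>[S]" using T(3)[of "h r"] by auto
   then have "t \<in> carrier S" using T(2) by blast
   with t r g[OF this] have "r \<ominus> g t \<in> {r \<in> carrier R. h r = \<zero>[S]}" by (simp add: hom_minus)
   then show "\<exists>t\<in>g ` T. r \<ominus> t \<in> {r \<in> carrier R. h r = \<zero>[S]}" using t(1) by blast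
  qed
  moreover have "finite (g ` T)" "g ` T \<subseteq> carrier R" using T(1,2) g by auto
  ultimately have "fin_index R {r \<in> carrier R. h r = \<zero>[S]}"
   unfolding fin_index_def by (intro exI[of _ "g ` T"] conjI)
  then show False using inf by blast
 qed
 qed
 then show ?thesis by (rule just_infinite.intro[OF local_image dom])
qed

section \<open>Just infinite quotients of coefficient algebras\<close>

lemma coeff_algebra_local_noeth:
 assumes "coeff_algebra p F A"
 shows "local_noeth A"
 using assms unfolding coeff_algebra_def complete_local_def local_cring_def
 by (intro local_noeth.intro noeth_cring.intro local_noeth_axioms.intro) auto

lemma coeff_algebra_finite_residue:
 assumes A: "coeff_algebra p F A" and F: "field F" "finite (carrier F)"
 shows "fin_index A (max_ideal A)"
proof -
 interpret A: local_noeth A by (rule coeff_algebra_local_noeth[OF A])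
 interpret F: field F by fact
 let ?\<pi> = "residue_map A"
 have hom: "?\<pi> \<in> ring_hom A F" and im: "?\<pi> ` carrier A = carrier F"
  and ker: "a_kernel A F ?\<pi> = max_ideal A"
  using A unfolding coeff_algebra_def by auto
 interpret \<pi>: surj_hom A F ?\<pi>
  using hom im A.is_cring F.is_cring
  by (intro surj_hom.intro surj_hom_axioms.intro ring_hom_cring.intro ring_hom_cring_axioms.intro)
 define g where "g = inv_into (carrier A) ?\<pi>"
 have g: "g f \<in> carrier A" "?\<pi> (g f) = f" if "f \<in> carrier F" for f
  unfolding g_def using that by (simp_all add: im[symmetric] inv_into_into f_inv_into_f)
 have "\<forall>r\<in>carrier A. \<exists>t\<in>g ` carrier F. r \<ominus>[A] t \<in> max_ideal A"
 proof
  fix r assume r: "r \<in> carrier A"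
  have f: "?\<pi> r \<in> carrier F" using r im by blast
  have "?\<pi> (r \<ominus>[A] g (?\<pi> r)) = \<zero>[F]" using r g[OF f] f by (simp add: \<pi>.hom_minus F.r_neg F.minus_eq)
  then have "r \<ominus>[A] g (?\<pi> r) \<in> max_ideal A"
   using r g[OF f] unfolding ker[symmetric] a_kernel_def' by simp
  then show "\<exists>t\<in>g ` carrier F. r \<ominus>[A] t \<in> max_ideal A" using f by blast
 qed
 moreover have "finite (g ` carrier F)" "g ` carrier F \<subseteq> carrier A" using F(2) g by auto
 ultimately show ?thesis unfolding fin_index_def by (intro exI[of _ "g ` carrier F"] conjI)
qed

text \<open>If neither a nor b lies in I, maximality gives finite index to I + aR and I + bR, and
  \<open>fin_index_nonprime\<close> passes it on to I.\<close>

lemma (in cring) prime_of_maximal_index: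
 assumes I: "ideal I R" "\<not> fin_index R I"
  and max: "\<And>J. ideal J R \<Longrightarrow> I \<subset> J \<Longrightarrow> fin_index R J"
 shows "primeideal I R"
proof (rule primeidealI)
 interpret I: ideal I R by (rule I)
 show "ideal I R" by (rule I)
 show "cring R" by (rule is_cring)
 show "carrier R \<noteq> I"
 proof
  assume eq: "carrier R = I"
  have "fin_index R I"
   by (rule fin_indexI[of "{\<zero>}"]) (auto simp: eq[symmetric])
  then show False using I by simp
 qed
 fix a b assume ab: "a \<in> carrier R" "b \<in> carrier R" "a \<otimes> b \<in> I"
 show "a \<in> I \<or> b \<in> I"
 proof (rule ccontr)
  assume n: "\<not> (a \<in> I \<or> b \<in> I)"
  have "fin_index R (adjoin R I c)" if c: "c \<in> carrier R" "c \<notin> I" for c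
   using adjoin_sub[OF I(1) c(1)] c(2) by (intro max adjoin_ideal[OF I(1) c(1)]) auto
  then have "fin_index R I" using ab n by (intro fin_index_nonprime[OF I(1) ab]) simp_all
  then show False using I by simp
 qed
qed

lemma (in cring) quotient_surj_hom:
 assumes I: "ideal I R"
 shows "surj_hom R (R Quot I) ((+>) I)"
  and "{r \<in> carrier R. I +> r = \<zero>[R Quot I]} = I"
proof -
 interpret I: ideal I R by (rule I)
 have car: "carrier (R Quot I) = (+>) I ` carrier R"
  by (auto simp: FactRing_def A_RCOSETS_def')
 show sh: "surj_hom R (R Quot I) ((+>) I)"
  by (intro surj_hom.intro surj_hom_axioms.intro ring_hom_cring.intro ring_hom_cring_axioms.intro
    is_cring I.quotient_is_cring I.rcos_ring_hom car[symmetric])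
 interpret h: surj_hom R "R Quot I" "(+>) I" by (rule sh)
 have "I +> r = \<zero>[R Quot I] \<longleftrightarrow> r \<in> I" if r: "r \<in> carrier R" for r
 proof -
  have "I +> r = \<zero>[R Quot I] \<longleftrightarrow> I +> r = I +> \<zero>" using h.hom_zero by simp
  also have "\<dots> \<longleftrightarrow> r \<ominus> \<zero> \<in> I" using quotient_eq_iff_same_a_r_cos[OF I r zero_closed] by simp
  also have "r \<ominus> \<zero> = r" using r by (simp add: a_minus_def)
  finally show ?thesis .
 qed
 note * = this
 show "{r \<in> carrier R. I +> r = \<zero>[R Quot I]} = I"
 proof (rule Set.set_eqI)
  fix r show "r \<in> {r \<in> carrier R. I +> r = \<zero>[R Quot I]} \<longleftrightarrow> r \<in> I"
   using *[of r] I.Icarr[of r] unfolding mem_Collect_eq by blast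
 qed
qed

lemma ring_hom_add_pow_one:
 assumes h: "h \<in> ring_hom R S" and R: "ring R" and S: "ring S"
 shows "h (add_pow R (n::nat) \<one>[R]) = add_pow S n \<one>[S]"
proof -
 interpret R: ring R by fact
 interpret S: ring S by fact
 interpret h: ring_hom_ring R S h by (rule ring_hom_ring.intro[OF R S ring_hom_ring_axioms.intro[OF h]])
 show ?thesis by (induction n) simp_all
qed

lemma exists_just_infinite_quotient:
 fixes R :: "('r, 'f) witt_alg"
 assumes R: "coeff_algebra p F R" and F: "field F" "finite (carrier F)"
  and inf: "\<not> fin_index R (PIdl\<^bsub>R\<^esub> (add_pow R p \<one>[R]))"
 shows "\<exists>(A :: (continuum, 'f) witt_alg) h. coeff_algebra p F A \<and> just_infinite A \<and> has_char A p \<and>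
  h \<in> ring_hom R A \<and> h ` carrier R = carrier A \<and>
  (\<forall>w\<in>carrier (witt_ring p F). h (struct_map R w) = struct_map A w) \<and>
  (\<forall>x\<in>carrier R. residue_map A (h x) = residue_map R x)"
proof -
 interpret R: local_noeth R by (rule coeff_algebra_local_noeth[OF R])
 interpret F: field F by fact
 let ?c = "add_pow R p \<one>[R]" and ?\<rho> = "residue_map R"
 have cc: "?c \<in> carrier R" by simp
 have Rc: "complete_local R" and Rs: "struct_map R \<in> ring_hom (witt_ring p F) R"
  and \<rho>: "?\<rho> \<in> ring_hom R F" "?\<rho> ` carrier R = carrier F" "a_kernel R F ?\<rho> = max_ideal R"
  and \<rho>s: "\<And>w. w \<in> carrier (witt_ring p F) \<Longrightarrow> ?\<rho> (struct_map R w) = w 0"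
  using R unfolding coeff_algebra_def by simp_all
 interpret \<rho>: surj_hom R F ?\<rho>
  using \<rho> R.is_cring F.is_cring
  by (intro surj_hom.intro surj_hom_axioms.intro ring_hom_cring.intro ring_hom_cring_axioms.intro)
 define \<J> where "\<J> = {J. ideal J R \<and> ?c \<in> J \<and> \<not> fin_index R J}"
 have "PIdl\<^bsub>R\<^esub> ?c \<in> \<J>" using inf R.cgenideal_ideal[OF cc] R.cgenideal_self[OF cc] by (simp add: \<J>_def)
 then have "\<J> \<noteq> {}" by auto
 moreover have "\<J> \<subseteq> {I. ideal I R}" by (auto simp: \<J>_def)
 ultimately have "\<exists>I\<in>\<J>. \<forall>J\<in>\<J>. I \<subseteq> J \<longrightarrow> J = I" by (rule R.exists_maximal_among)
 then obtain I where I: "I \<in> \<J>" "\<And>J. J \<in> \<J> \<Longrightarrow> I \<subseteq> J \<Longrightarrow> J = I" by auto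
 have Iid: "ideal I R" and cI: "?c \<in> I" and Ninf: "\<not> fin_index R I" using I(1) by (simp_all add: \<J>_def)
 have Imax: "fin_index R J" if J: "ideal J R" "I \<subset> J" for J
 proof (rule ccontr)
  assume "\<not> fin_index R J"
  then have "J \<in> \<J>" using J cI by (auto simp: \<J>_def)
  then show False using I(2)[of J] J(2) by blast
 qed
 interpret I: primeideal I R by (rule R.prime_of_maximal_index[OF Iid Ninf Imax])
 let ?Q = "R Quot I" and ?q = "(+>\<^bsub>R\<^esub>) I"
 interpret Q: domain ?Q by (rule I.quotient_is_domain)
 interpret q: surj_hom R ?Q ?q by (rule R.quotient_surj_hom[OF Iid])
 interpret q: surj_hom_local R ?Q ?q
  by unfold_locales simp
 note ker = R.quotient_surj_hom(2)[OF Iid]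
 have fr: "fin_index R (max_ideal R)" by (rule coeff_algebra_finite_residue[OF R F])
 have kiff: "?q r = \<zero>[?Q] \<longleftrightarrow> r \<in> I" if "r \<in> carrier R" for r
 proof -
  have "r \<in> {r \<in> carrier R. ?q r = \<zero>[?Q]} \<longleftrightarrow> r \<in> I" by (simp only: ker)
  then show ?thesis using that by (simp only: mem_Collect_eq simp_thms)
 qed
 \<comment> \<open>The quotient consists of cosets, hence has the wrong type. It is shown to be just
   infinite in order to obtain the code \<open>e\<close>; the coded copy \<open>A\<close> is
   afterwards treated directly as an image of R.\<close>
 have ji: "just_infinite ?Q"
 proof (rule q.just_infinite_image)
  fix a b assume ab: "a \<in> carrier R" "b \<in> carrier R" "?q (a \<otimes>[R] b) = \<zero>[?Q]"
  then have "a \<otimes>[R] b \<in> I" using kiff[of "a \<otimes>[R] b"] by simp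
  then have "a \<in> I \<or> b \<in> I" using I.I_prime ab by simp
  then show "?q a = \<zero>[?Q] \<or> ?q b = \<zero>[?Q]" using kiff[OF ab(1)] kiff[OF ab(2)] by simp
 qed (use Ninf Imax fr in \<open>simp_all add: ker\<close>)
 then obtain e :: "'r set \<Rightarrow> continuum" where e: "inj_on e (carrier ?Q)"
  using just_infinite.embeds_continuum by blast
 define A0 where "A0 = image_ring e ?Q"
 have e0: "e \<in> ring_hom ?Q A0" "e ` carrier ?Q = carrier A0"
  using inj_imp_image_ring_iso[OF e] by (auto simp: A0_def ring_iso_def bij_betw_def)
 define h where "h = e \<circ> ?q"
 \<comment> \<open>The residue map uses an arbitrary preimage under \<open>h\<close>. The choice
   does not matter because the kernel of \<open>h\<close> lies in the maximal ideal of R, on which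
   the residue map of R vanishes (\<open>res\<close>).\<close>
 define A where "A = \<lparr> carrier = carrier A0, monoid.mult = monoid.mult A0, one = \<one>[A0],
  ring.zero = \<zero>[A0], add = add A0, struct_map = h \<circ> struct_map R,
  residue_map = (\<lambda>a. ?\<rho> (inv_into (carrier R) h a)) \<rparr>"
 have "h \<in> ring_hom R A0" unfolding h_def by (rule ring_hom_trans[OF q.homh e0(1)])
 then have hom: "h \<in> ring_hom R A" by (simp add: ring_hom_def A_def)
 have "h ` carrier R = carrier A0" unfolding h_def image_comp[symmetric] q.surj by (rule e0(2))
 then have im: "h ` carrier R = carrier A" by (simp add: A_def)
 have h0: "h \<zero>[R] = \<zero>[A]" by (simp add: h_def A_def A0_def image_ring_zero q.hom_zero)
 have Ac: "cring A" by (rule R.surj_hom_cring[OF hom im h0])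
 interpret A: cring A by (rule Ac)
 interpret h: surj_hom R A h
  by (intro surj_hom.intro surj_hom_axioms.intro ring_hom_cring.intro ring_hom_cring_axioms.intro
    R.is_cring Ac hom im)
 have hker: "h r = \<zero>[A] \<longleftrightarrow> r \<in> I" if r: "r \<in> carrier R" for r
 proof -
  have "h r = \<zero>[A] \<longleftrightarrow> e (?q r) = e (?q \<zero>[R])" using h0 by (simp add: h_def)
  also have "\<dots> \<longleftrightarrow> ?q r = ?q \<zero>[R]" using r by (intro inj_on_eq_iff[OF e] q.hom_closed) simp_all
  also have "\<dots> \<longleftrightarrow> ?q r = \<zero>[?Q]" using q.hom_zero by simp
  also have "\<dots> \<longleftrightarrow> r \<in> I" by (rule kiff[OF r])
  finally show ?thesis .
 qed
 have "\<one>[A] \<noteq> \<zero>[A]" using hker[of "\<one>[R]"] h.hom_one I.one_imp_carrier I.I_notcarr by auto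
 then interpret h: surj_hom_local R A h by unfold_locales
 have kerA: "{r \<in> carrier R. h r = \<zero>[A]} = I" using hker I.Icarr by auto
 have jA: "just_infinite A"
 proof (rule h.just_infinite_image)
  fix a b assume ab: "a \<in> carrier R" "b \<in> carrier R" "h (a \<otimes>[R] b) = \<zero>[A]"
  then have "a \<otimes>[R] b \<in> I" using hker[of "a \<otimes>[R] b"] by simp
  then have "a \<in> I \<or> b \<in> I" using I.I_prime ab by simp
  then show "h a = \<zero>[A] \<or> h b = \<zero>[A]" using ab hker by simp
 qed (use Ninf Imax fr in \<open>simp_all add: kerA\<close>)
 have res: "residue_map A (h x) = ?\<rho> x" if x: "x \<in> carrier R" for x
 proof -
  let ?y = "inv_into (carrier R) h (h x)"
  have y: "?y \<in> carrier R" "h ?y = h x" using x by (simp_all add: inv_into_into f_inv_into_f)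
  have "h (?y \<ominus>[R] x) = \<zero>[A]" using x y by (simp add: h.hom_minus A.r_neg A.minus_eq)
  then have "?y \<ominus>[R] x \<in> max_ideal R" using x y by (intro h.ker_sub) simp_all
  then have "?\<rho> (?y \<ominus>[R] x) = \<zero>[F]" unfolding \<rho>(3)[symmetric] a_kernel_def' by simp
  then have "?\<rho> ?y = ?\<rho> x" using x y by (simp add: \<rho>.hom_minus)
  then show ?thesis by (simp add: A_def)
 qed
 have strA: "struct_map A w = h (struct_map R w)" for w by (simp add: A_def)
 have Wc: "struct_map R w \<in> carrier R" if "w \<in> carrier (witt_ring p F)" for w
  using ring_hom_closed[OF Rs that] .
 have "coeff_algebra p F A"
  unfolding coeff_algebra_def
 proof (intro conjI ballI)
  \<comment> \<open>Separatedness of the image comes from the x-adic argument in the domain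
    \<open>A\<close> itself.\<close>
  show "complete_local A"
   by (rule h.complete_image[OF Rc]) (simp add: just_infinite.mpow_sep[OF jA])
  show "noetherian_ring A" by (rule h.noetherian_image[OF R.noetherian_ring_axioms])
  have "h \<circ> struct_map R \<in> ring_hom (witt_ring p F) A" by (rule ring_hom_trans[OF Rs hom])
  then show "struct_map A \<in> ring_hom (witt_ring p F) A" by (simp add: A_def)
  show "residue_map A \<in> ring_hom A F"
  proof (rule ring_hom_memI)
   fix x assume "x \<in> carrier A"
   then obtain r where "r \<in> carrier R" "x = h r" unfolding im[symmetric] by blast
   then show "residue_map A x \<in> carrier F" by (simp add: res)
   fix y assume "y \<in> carrier A"
   then obtain s where "s \<in> carrier R" "y = h s" unfolding im[symmetric] by blast
   with \<open>r \<in> carrier R\<close> \<open>x = h r\<close> 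
   show "residue_map A (x \<otimes>[A] y) = residue_map A x \<otimes>[F] residue_map A y"
    "residue_map A (x \<oplus>[A] y) = residue_map A x \<oplus>[F] residue_map A y"
    by (simp_all add: res h.hom_mult[symmetric] h.hom_add[symmetric] del: h.hom_mult h.hom_add)
  next
   show "residue_map A \<one>[A] = \<one>[F]"
    using res[of "\<one>[R]"] by simp
  qed
  show "residue_map A ` carrier A = carrier F"
   unfolding im[symmetric] image_image using res \<rho>(2) by (simp cong: image_cong_simp)
  show "a_kernel A F (residue_map A) = max_ideal A"
   unfolding h.max_ideal_image \<rho>(3)[symmetric] a_kernel_def' im[symmetric] using res by auto
  fix w assume "w \<in> carrier (witt_ring p F)"
  then show "residue_map A (struct_map A w) = w 0" by (simp add: strA res Wc \<rho>s)
 qed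
 moreover have "has_char A p"
  unfolding has_char_def using ring_hom_add_pow_one[OF hom R.ring_axioms A.ring_axioms, of p] hker[OF cc] cI by simp
 ultimately show ?thesis using jA hom im strA res by (intro exI[of _ A] exI[of _ h]) simp
qed

section \<open>The structure map\<close>

lemma (in cring) affine_diff:
 "\<lbrakk>a \<in> carrier R; b \<in> carrier R; c \<in> carrier R; d \<in> carrier R\<rbrakk> \<Longrightarrow>
  (d \<oplus> c \<otimes> a) \<ominus> (d \<oplus> c \<otimes> b) = (a \<ominus> b) \<otimes> c"
 by algebra

text \<open>Additivity of the p-th power map is the freshman congruence evaluated in
  \<open>F\<close>, and injectivity follows since a field has no nilpotents; on a finite set an
  injective self-map is onto.\<close>

lemma finite_field_frob_surj:
 assumes p: "Factorial_Ring.prime p" and F: "field F" "finite (carrier F)" and char: "has_char F p"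
  and a: "a \<in> carrier F"
 shows "\<exists>b\<in>carrier F. b [^]\<^bsub>F\<^esub> p = a"
proof -
 interpret F: field F by fact
 let ?f = "\<lambda>b. b [^]\<^bsub>F\<^esub> p"
 have p0: "p > 0" using p by (simp add: prime_gt_0_nat)
 have add: "?f (x \<oplus>[F] y) = ?f x \<oplus>[F] ?f y" if xy: "x \<in> carrier F" "y \<in> carrier F" for x y
 proof -
  \<comment> \<open>Two variables with the values x and y are enough: \<open>Inl 0\<close> goes to x
    and every other variable to y.\<close>
  define f where "f = (\<lambda>v :: nat + nat. if v = Inl 0 then x else y) "
  have f: "f \<in> (UNIV :: (nat + nat) set) \<rightarrow> carrier F" using xy by (simp add: f_def)
  let ?g = "xy_eval F f"
  have g: "?g \<in> ring_hom TT F" by (rule F.xy_eval_hom[OF f])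
  let ?X = "xy_var (Inl 0)" and ?Y = "xy_var (Inr 0)"
  have XY: "?g ?X = x" "?g ?Y = y" using F.xy_eval_var[OF f, of "Inl 0"] F.xy_eval_var[OF f, of "Inr 0"] by (simp_all add: f_def)
  have gadd: "?g (P + Q) = ?g P \<oplus>[F] ?g Q" for P Q using ring_hom_add[OF g] by simp
  have gmult: "?g (P * Q) = ?g P \<otimes>[F] ?g Q" for P Q using ring_hom_mult[OF g] by simp
  have gpow: "?g (P ^ n) = ?g P [^]\<^bsub>F\<^esub> n" for P n
   using ring_hom_nat_pow[OF g type_ring(2) F.ring_axioms, of P n] by simp
  obtain d where d: "(?X + ?Y) ^ p - (?X ^ p + ?Y ^ p) = of_nat p * d"
   using prime_dvd_freshman[OF p, of ?X ?Y] by (auto simp: dvd_def)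
  have "?g (of_nat p) = \<zero>[F]"
  proof -
   have "add_pow TT p \<one>[TT] = of_nat p" by (induction p) (simp_all add: add_pow_def nat_pow_def ring_of_type_algebra_def add.commute)
   then show ?thesis
    using ring_hom_add_pow_one[OF g type_ring(2) F.ring_axioms, of p] char by (simp add: has_char_def)
  qed
  then have "?g (of_nat p * d) = \<zero>[F]" using f by (simp add: gmult)
  moreover have "(?X + ?Y) ^ p = (?X ^ p + ?Y ^ p) + of_nat p * d" using d by (simp add: algebra_simps)
  then have "?g ((?X + ?Y) ^ p) = ?g ((?X ^ p + ?Y ^ p) + of_nat p * d)" by simp
  ultimately show ?thesis using xy by (simp add: gadd gpow XY)
 qed
 have "inj_on ?f (carrier F)"
 proof (rule inj_onI)
  fix x y assume xy: "x \<in> carrier F" "y \<in> carrier F" "?f x = ?f y"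
  have "?f (x \<ominus>[F] y) \<oplus>[F] ?f y = ?f x"
   using add[of "x \<ominus>[F] y" y] xy by (simp add: F.minus_eq F.a_assoc F.l_neg)
  then have "?f (x \<ominus>[F] y) = \<zero>[F]" using xy by simp
  then have "x \<ominus>[F] y = \<zero>[F]"
  proof (rule contrapos_pp)
   assume "x \<ominus>[F] y \<noteq> \<zero>[F]"
   then have "(x \<ominus>[F] y) [^]\<^bsub>F\<^esub> n \<noteq> \<zero>[F]" for n :: nat
    using xy by (induction n) (simp_all add: F.integral_iff)
   then show "?f (x \<ominus>[F] y) \<noteq> \<zero>[F]" by blast
  qed
  then show "x = y" using xy by simp
 qed
 then have "?f ` carrier F = carrier F"
  by (intro endo_inj_surj F) auto
 with a have "a \<in> ?f ` carrier F" by simp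
 then show ?thesis by auto
qed

context
 fixes p :: nat and F :: "'f ring" and A :: "('a, 'f) witt_alg"
 assumes p: "Factorial_Ring.prime p" and F: "field F" "finite (carrier F)" and char: "has_char F p"
  and A: "coeff_algebra p F A"
begin

interpretation A: local_noeth A by (rule coeff_algebra_local_noeth[OF A])
interpretation F: field F by (rule F)

lemma struct_hom: "struct_map A \<in> ring_hom (witt_ring p F) A"
 using A by (simp add: coeff_algebra_def)

lemma struct_closed: "w \<in> carrier (witt_ring p F) \<Longrightarrow> struct_map A w \<in> carrier A"
 by (rule ring_hom_closed[OF struct_hom])

text \<open>Finite fields are perfect, so the shifted vector has a componentwise p-th root
  \<open>u\<close>, as \<open>struct_witt_decomp\<close> requires.\<close>

lemma struct_decomp:
 assumes w: "w \<in> carrier (witt_ring p F)"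
 shows "\<exists>u\<in>carrier (witt_ring p F). (\<forall>i. u i [^]\<^bsub>F\<^esub> p = w (Suc i)) \<and>
  struct_map A w = struct_map A (teich F (w 0)) \<oplus>[A] add_pow A p (struct_map A u)"
proof -
 have "\<exists>b\<in>carrier F. b [^]\<^bsub>F\<^esub> p = w (Suc i)" for i
  using w by (intro finite_field_frob_surj[OF p F char]) (auto simp: witt_ring_def)
 then obtain u where u: "\<And>i. u i \<in> carrier F" "\<And>i. u i [^]\<^bsub>F\<^esub> p = w (Suc i)" by metis
 then have uW: "u \<in> carrier (witt_ring p F)" by (auto simp: witt_ring_def)
 then show ?thesis
  using struct_witt_decomp[OF p F.is_cring A.is_cring char struct_hom w uW u(2)] u(2) by blast
qed

lemma struct_zero_one:
 "struct_map A (teich F \<zero>[F]) = \<zero>[A]" "struct_map A (teich F \<one>[F]) = \<one>[A]"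
proof -
 have "teich F \<zero>[F] = \<zero>[witt_ring p F]" by (auto simp: teich_def witt_ring_def)
 then show "struct_map A (teich F \<zero>[F]) = \<zero>[A]"
  using F.struct_zero[OF p A.is_cring struct_hom] by simp
 have "teich F \<one>[F] = \<one>[witt_ring p F]" by (auto simp: teich_def witt_ring_def)
 then show "struct_map A (teich F \<one>[F]) = \<one>[A]" using ring_hom_one[OF struct_hom] by simp
qed

lemma add_pow_p_mult: "a \<in> carrier A \<Longrightarrow> add_pow A p a = add_pow A p \<one>[A] \<otimes>[A] a"
 using A.add_pow_ldistr[of "\<one>[A]" a p] by simp

lemma p_in_max: "add_pow A p \<one>[A] \<in> max_ideal A"
proof -
 have r: "residue_map A \<in> ring_hom A F" and k: "a_kernel A F (residue_map A) = max_ideal A"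
  using A by (simp_all add: coeff_algebra_def)
 have "residue_map A (add_pow A p \<one>[A]) = \<zero>[F]"
  using ring_hom_add_pow_one[OF r A.ring_axioms F.ring_axioms, of p] char by (simp add: has_char_def)
 then show ?thesis unfolding k[symmetric] a_kernel_def' by simp
qed

text \<open>For representatives \<open>b\<close> of \<open>A/pA\<close> every element is \<open>\<Sum> p\<^sup>k b\<^sub>k\<close>; collecting equal \<open>b\<^sub>k\<close> gives
 coefficients \<open>\<Sum> p\<^sup>k\<close> over subsets of the naturals, which are images of Witt vectors with components
 \<open>0\<close> and \<open>1\<close>.\<close>

lemma finite_over_witt_of_fin_index:
 assumes fin: "fin_index A (PIdl\<^bsub>A\<^esub> (add_pow A p \<one>[A]))"
 shows "finite_over_witt p F A"
proof -
 let ?c = "add_pow A p \<one>[A]"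
 have cc: "?c \<in> carrier A" by simp
 obtain B where B: "finite B" "B \<subseteq> carrier A" "\<And>r. r \<in> carrier A \<Longrightarrow> \<exists>t\<in>B. r \<ominus>[A] t \<in> PIdl\<^bsub>A\<^esub> ?c"
  by (rule fin_indexE[OF fin]) (rule that)
 have "\<exists>b s. b \<in> B \<and> s \<in> carrier A \<and> r = b \<oplus>[A] ?c \<otimes>[A] s" if r: "r \<in> carrier A" for r
 proof -
  obtain t where t: "t \<in> B" "r \<ominus>[A] t \<in> PIdl\<^bsub>A\<^esub> ?c" using B(3)[OF r] by (rule bexE)
  then obtain s where s: "s \<in> carrier A" "r \<ominus>[A] t = s \<otimes>[A] ?c" by (auto simp: cgenideal_def)
  have tc: "t \<in> carrier A" using t(1) B(2) by (rule_tac subsetD)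
  have "r = t \<oplus>[A] (r \<ominus>[A] t)" using r tc by (simp add: A.minus_eq A.a_lcomm A.r_neg)
  then have "r = t \<oplus>[A] ?c \<otimes>[A] s" using s A.m_comm[OF s(1) cc] by simp
  then show ?thesis using t s by blast
 qed
 \<comment> \<open>Division by p with remainder in B: \<open>dg\<close> is the digit and
   \<open>rm\<close> the quotient, so iterating \<open>rm\<close> lists the digits of r.\<close>
 then obtain dg rm where dg: "\<And>r. r \<in> carrier A \<Longrightarrow> dg r \<in> B" "\<And>r. r \<in> carrier A \<Longrightarrow> rm r \<in> carrier A"
  "\<And>r. r \<in> carrier A \<Longrightarrow> r = dg r \<oplus>[A] ?c \<otimes>[A] rm r" by metis
 \<comment> \<open>The Witt vector \<open>w r b\<close> marks by 0 and 1 the positions at which the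
   digit of r is b. As 0 and 1 are their own p-th powers, the vector u of
   \<open>struct_witt_decomp\<close> is just the marking of \<open>rm r\<close>.\<close>
 define w where "w r b n = (if dg ((rm ^^ n) r) = b then \<one>[F] else \<zero>[F])" for r b n
 have wW: "w r b \<in> carrier (witt_ring p F)" for r b by (auto simp: w_def witt_ring_def)
 have rmc: "(rm ^^ n) r \<in> carrier A" if "r \<in> carrier A" for n r using that dg by (induction n) simp_all
 have step: "struct_map A (w r b) =
   (if dg r = b then \<one>[A] else \<zero>[A]) \<oplus>[A] ?c \<otimes>[A] struct_map A (w (rm r) b)" for r b
 proof -
  have p0: "p \<noteq> 0" using p by auto
  have "w (rm r) b i [^]\<^bsub>F\<^esub> p = w r b (Suc i)" for i
   using p0 by (simp add: w_def funpow_swap1 F.nat_pow_zero)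
  from struct_witt_decomp[OF p F.is_cring A.is_cring char struct_hom wW wW this]
  have "struct_map A (w r b) = struct_map A (teich F (w r b 0)) \<oplus>[A] add_pow A p (struct_map A (w (rm r) b))" .
  moreover have "struct_map A (teich F (w r b 0)) = (if dg r = b then \<one>[A] else \<zero>[A])"
   by (simp add: w_def struct_zero_one)
  ultimately show ?thesis using add_pow_p_mult[OF struct_closed[OF wW]] by simp
 qed
 let ?S = "\<lambda>r. \<Oplus>\<^bsub>A\<^esub>b\<in>B. struct_map A (w r b) \<otimes>[A] b"
 have Bc: "b \<in> carrier A" if "b \<in> B" for b using that B(2) by (rule_tac subsetD)
 have Sc: "?S r \<in> carrier A" for r by (intro A.finsum_closed) (auto simp: Bc struct_closed[OF wW])
 have S: "?S r = dg r \<oplus>[A] ?c \<otimes>[A] ?S (rm r)" if r: "r \<in> carrier A" for r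
 proof -
  have "?S r = (\<Oplus>\<^bsub>A\<^esub>b\<in>B. (if dg r = b then b else \<zero>[A]) \<oplus>[A] ?c \<otimes>[A] (struct_map A (w (rm r) b) \<otimes>[A] b))"
  proof (rule A.finsum_cong')
   fix b assume b: "b \<in> B"
   note c = Bc[OF b] struct_closed[OF wW, of "rm r" b]
   show "struct_map A (w r b) \<otimes>[A] b =
     (if dg r = b then b else \<zero>[A]) \<oplus>[A] ?c \<otimes>[A] (struct_map A (w (rm r) b) \<otimes>[A] b)"
    unfolding step[of r b] using c by (simp add: A.l_distr A.m_assoc)
  qed (auto simp: Bc struct_closed[OF wW])
  also have "\<dots> = (\<Oplus>\<^bsub>A\<^esub>b\<in>B. (if dg r = b then b else \<zero>[A])) \<oplus>[A]
    (\<Oplus>\<^bsub>A\<^esub>b\<in>B. ?c \<otimes>[A] (struct_map A (w (rm r) b) \<otimes>[A] b))"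
   by (rule A.finsum_addf) (auto simp: Bc struct_closed[OF wW])
  also have "(\<Oplus>\<^bsub>A\<^esub>b\<in>B. (if dg r = b then b else \<zero>[A])) = dg r"
   using A.finsum_singleton[of "dg r" B "\<lambda>b. b"] dg(1)[OF r] B(1,2) by (simp add: Bc Pi_def)
  also have "(\<Oplus>\<^bsub>A\<^esub>b\<in>B. ?c \<otimes>[A] (struct_map A (w (rm r) b) \<otimes>[A] b)) = ?c \<otimes>[A] ?S (rm r)"
   by (rule A.finsum_rdistr[symmetric]) (use B in \<open>auto simp: Bc struct_closed[OF wW]\<close>)
  finally show ?thesis .
 qed
 \<comment> \<open>Both r and \<open>?S r\<close> arise as \<open>dg r\<close> plus p times the
   corresponding element for \<open>rm r\<close>. The error for r is therefore p times the error for
   \<open>rm r\<close>, and every step gains a factor in the maximal ideal.\<close>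
 have diff: "r \<ominus>[A] ?S r \<in> max_ideal_pow A k" if r: "r \<in> carrier A" for r k
  using r
 proof (induction k arbitrary: r)
  case 0
  then show ?case using Sc[of r] by simp
 next
  case (Suc k)
  note c = Sc[of "rm r"] Suc.prems dg(2)[OF Suc.prems] Bc[OF dg(1)[OF Suc.prems]]
  have "r \<ominus>[A] ?S r = (dg r \<oplus>[A] ?c \<otimes>[A] rm r) \<ominus>[A] (dg r \<oplus>[A] ?c \<otimes>[A] ?S (rm r))"
   using S[OF Suc.prems] dg(3)[OF Suc.prems] by simp
  also have "\<dots> = (rm r \<ominus>[A] ?S (rm r)) \<otimes>[A] ?c"
   by (rule A.affine_diff) (use c cc in simp_all)
  finally show ?case
   using A.mpow_mult[OF Suc.IH[OF c(3)], of ?c "Suc 0"] p_in_max by simp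
 qed
 have sep: "(\<Inter>k. max_ideal_pow A k) = {\<zero>[A]}" using A by (simp add: coeff_algebra_def complete_local_def)
 show ?thesis unfolding finite_over_witt_def
 proof (intro exI[of _ B] conjI ballI B)
  fix r assume r: "r \<in> carrier A"
  have "r \<ominus>[A] ?S r \<in> (\<Inter>k. max_ideal_pow A k)" using diff[OF r] by blast
  then have "r \<ominus>[A] ?S r = \<zero>[A]" unfolding sep by simp
  then have "r = ?S r" using r Sc[of r] by simp
  then show "\<exists>c\<in>B \<rightarrow> carrier (witt_ring p F). r = (\<Oplus>\<^bsub>A\<^esub>x\<in>B. struct_map A (c x) \<otimes>[A] x)"
   using wW by (intro bexI[of _ "w r"]) auto
 qed
qed

text \<open>The summand p u in \<open>struct_decomp\<close> vanishes, so the structure map sees only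
  the zeroth component; this produces a copy of the residue field inside \<open>A\<close>.\<close>

lemma struct_char_p:
 assumes Ap: "has_char A p" and w: "w \<in> carrier (witt_ring p F)"
 shows "struct_map A w = struct_map A (teich F (w 0))"
proof -
 obtain u where u: "u \<in> carrier (witt_ring p F)"
  "struct_map A w = struct_map A (teich F (w 0)) \<oplus>[A] add_pow A p (struct_map A u)"
  using struct_decomp[OF w] by blast
 have "add_pow A p (struct_map A u) = \<zero>[A]"
  using add_pow_p_mult[OF struct_closed[OF u(1)]] Ap struct_closed[OF u(1)] by (simp add: has_char_def)
 moreover have "struct_map A (teich F (w 0)) \<in> carrier A"
  using w by (intro struct_closed teich_closed F.ring_axioms) (auto simp: witt_ring_def)
 ultimately show ?thesis using u by simp
qed

end

section \<open>Matrices over commutative rings\<close>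

lemma (in abelian_monoid) finsum_exchange:
 assumes "finite I" "finite J" "\<And>i j. i \<in> I \<Longrightarrow> j \<in> J \<Longrightarrow> f i j \<in> carrier G"
 shows "(\<Oplus>i\<in>I. \<Oplus>j\<in>J. f i j) = (\<Oplus>j\<in>J. \<Oplus>i\<in>I. f i j)"
 using assms(1,3)
proof (induction I)
 case empty
 then show ?case by (simp add: add.finprod_one_eqI)
next
 case (insert x I)
 have "(\<Oplus>i\<in>insert x I. \<Oplus>j\<in>J. f i j) = (\<Oplus>j\<in>J. f x j) \<oplus> (\<Oplus>i\<in>I. \<Oplus>j\<in>J. f i j)"
  using insert by (intro finsum_insert) (auto intro!: finsum_closed)
 also have "\<dots> = (\<Oplus>j\<in>J. f x j) \<oplus> (\<Oplus>j\<in>J. \<Oplus>i\<in>I. f i j)" using insert by simp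
 also have "\<dots> = (\<Oplus>j\<in>J. f x j \<oplus> (\<Oplus>i\<in>I. f i j))"
  using insert by (intro finsum_addf[symmetric]) (auto intro!: finsum_closed)
 also have "\<dots> = (\<Oplus>j\<in>J. \<Oplus>i\<in>insert x I. f i j)"
  using insert by (intro finsum_cong') (auto intro!: finsum_closed finsum_insert[symmetric])
 finally show ?case .
qed

text \<open>Multiplication and unit are those of \<open>mat_monoid\<close>, so the units are exactly
  the elements of \<open>GL\<close> (\<open>units_mat_monoid\<close>), while ring arguments become
  available.\<close>

definition Mat :: "nat \<Rightarrow> ('a, 'b) ring_scheme \<Rightarrow> (nat \<times> nat \<Rightarrow> 'a) ring"
 where "Mat n A =
  \<lparr> carrier = carrier (mat_monoid n A), monoid.mult = monoid.mult (mat_monoid n A),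
   one = \<one>[mat_monoid n A],
   ring.zero = (\<lambda>ij \<in> {..<n} \<times> {..<n}. \<zero>[A]),
   add = (\<lambda>M N. \<lambda>ij \<in> {..<n} \<times> {..<n}. M ij \<oplus>[A] N ij) \<rparr>"

definition mat_smult :: "nat \<Rightarrow> ('a, 'b) ring_scheme \<Rightarrow> 'a \<Rightarrow> (nat \<times> nat \<Rightarrow> 'a) \<Rightarrow> nat \<times> nat \<Rightarrow> 'a"
 where "mat_smult n A c M = (\<lambda>ij \<in> {..<n} \<times> {..<n}. c \<otimes>[A] M ij)"

lemma mat_carrier: "carrier (Mat n A) = ({..<n} \<times> {..<n}) \<rightarrow>\<^sub>E carrier A"
 by (simp add: Mat_def mat_monoid_def)

lemma mat_entry: "M \<in> carrier (Mat n A) \<Longrightarrow> i < n \<Longrightarrow> j < n \<Longrightarrow> M (i, j) \<in> carrier A"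
 by (auto simp: mat_carrier)

lemma mat_eqI:
 assumes "M \<in> carrier (Mat n A)" "N \<in> carrier (Mat n A)"
  "\<And>i j. i < n \<Longrightarrow> j < n \<Longrightarrow> M (i, j) = N (i, j)"
 shows "M = N"
 by (rule PiE_ext[of _ "{..<n} \<times> {..<n}" "\<lambda>_. carrier A"]) (use assms in \<open>auto simp: mat_carrier\<close>)

lemma mat_carrierI:
 "M \<in> extensional ({..<n} \<times> {..<n}) \<Longrightarrow> (\<And>i j. i < n \<Longrightarrow> j < n \<Longrightarrow> M (i, j) \<in> carrier A) \<Longrightarrow>
  M \<in> carrier (Mat n A)"
 by (auto simp: mat_carrier PiE_def)

lemma mat_entries:
 assumes "i < n" "j < n"
 shows "(M \<otimes>[Mat n A] N) (i, j) = (\<Oplus>\<^bsub>A\<^esub>k\<in>{..<n}. M (i, k) \<otimes>[A] N (k, j))"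
  and "(M \<oplus>[Mat n A] N) (i, j) = M (i, j) \<oplus>[A] N (i, j)"
  and "\<one>[Mat n A] (i, j) = (if i = j then \<one>[A] else \<zero>[A])"
  and "\<zero>[Mat n A] (i, j) = \<zero>[A]"
  and "mat_smult n A c M (i, j) = c \<otimes>[A] M (i, j)"
 using assms by (simp_all add: Mat_def mat_monoid_def mat_smult_def)

lemma mat_extensional:
 "M \<otimes>[Mat n A] N \<in> extensional ({..<n} \<times> {..<n})"
 "M \<oplus>[Mat n A] N \<in> extensional ({..<n} \<times> {..<n})"
 "\<one>[Mat n A] \<in> extensional ({..<n} \<times> {..<n})"
 "\<zero>[Mat n A] \<in> extensional ({..<n} \<times> {..<n})"
 "mat_smult n A c M \<in> extensional ({..<n} \<times> {..<n})"
 by (auto simp: Mat_def mat_monoid_def mat_smult_def extensional_def)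

lemma units_mat_monoid: "Units (mat_monoid n A) = Units (Mat n A)"
 by (simp add: Units_def Mat_def)

context cring
begin

lemma mat_closed:
 assumes "M \<in> carrier (Mat n R)" "N \<in> carrier (Mat n R)"
 shows "M \<otimes>[Mat n R] N \<in> carrier (Mat n R)"
  and "M \<oplus>[Mat n R] N \<in> carrier (Mat n R)"
 by (rule mat_carrierI; use assms in \<open>auto simp: mat_extensional mat_entries mat_entry intro!: finsum_closed\<close>)+

lemma mat_const_closed:
 "\<one>[Mat n R] \<in> carrier (Mat n R)" "\<zero>[Mat n R] \<in> carrier (Mat n R)"
 by (rule mat_carrierI; auto simp: mat_extensional mat_entries)+

lemma mat_smult_closed:
 "c \<in> carrier R \<Longrightarrow> M \<in> carrier (Mat n R) \<Longrightarrow> mat_smult n R c M \<in> carrier (Mat n R)"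
 by (rule mat_carrierI) (auto simp: mat_extensional mat_entries mat_entry)

lemma finsum_delta:
 assumes "finite I" "i \<in> I" "f \<in> I \<rightarrow> carrier R"
 shows "(\<Oplus>k\<in>I. (if i = k then \<one> else \<zero>) \<otimes> f k) = f i"
  and "(\<Oplus>k\<in>I. f k \<otimes> (if k = i then \<one> else \<zero>)) = f i"
proof -
 have fc: "k \<in> I \<Longrightarrow> f k \<in> carrier R" for k using assms(3) by auto
 have "(\<Oplus>k\<in>I. (if i = k then \<one> else \<zero>) \<otimes> f k) = (\<Oplus>k\<in>I. if i = k then f k else \<zero>)"
  by (rule finsum_cong') (use assms(1,2) fc in auto)
 then show 1: "(\<Oplus>k\<in>I. (if i = k then \<one> else \<zero>) \<otimes> f k) = f i"
  using finsum_singleton[OF assms(2,1,3)] by simp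
 have "(\<Oplus>k\<in>I. f k \<otimes> (if k = i then \<one> else \<zero>)) = (\<Oplus>k\<in>I. (if i = k then \<one> else \<zero>) \<otimes> f k)"
  by (rule finsum_cong') (use assms(1,2) fc in \<open>auto simp: m_comm\<close>)
 with 1 show "(\<Oplus>k\<in>I. f k \<otimes> (if k = i then \<one> else \<zero>)) = f i" by simp
qed

lemma mat_assoc:
 assumes M: "M \<in> carrier (Mat n R)" and N: "N \<in> carrier (Mat n R)" and P: "P \<in> carrier (Mat n R)"
 shows "M \<otimes>[Mat n R] N \<otimes>[Mat n R] P = M \<otimes>[Mat n R] (N \<otimes>[Mat n R] P)"
proof (rule mat_eqI[of _ n R])
 fix i j assume ij: "i < n" "j < n"
 note e = mat_entry[OF M] mat_entry[OF N] mat_entry[OF P]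
 have "(M \<otimes>[Mat n R] N \<otimes>[Mat n R] P) (i, j) =
   (\<Oplus>k\<in>{..<n}. (\<Oplus>l\<in>{..<n}. M (i, l) \<otimes> N (l, k)) \<otimes> P (k, j))"
  unfolding mat_entries(1)[OF ij]
  by (rule finsum_cong') (use ij e in \<open>auto simp: mat_entries intro!: finsum_closed\<close>)
 also have "\<dots> = (\<Oplus>k\<in>{..<n}. \<Oplus>l\<in>{..<n}. M (i, l) \<otimes> (N (l, k) \<otimes> P (k, j)))"
 proof (rule finsum_cong')
  fix k assume k: "k \<in> {..<n}"
  have "(\<Oplus>l\<in>{..<n}. M (i, l) \<otimes> N (l, k)) \<otimes> P (k, j) = (\<Oplus>l\<in>{..<n}. M (i, l) \<otimes> N (l, k) \<otimes> P (k, j))"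
   by (rule finsum_ldistr) (use ij k e in auto)
  also have "\<dots> = (\<Oplus>l\<in>{..<n}. M (i, l) \<otimes> (N (l, k) \<otimes> P (k, j)))"
   by (rule finsum_cong') (use ij k e in \<open>auto simp: m_assoc\<close>)
  finally show "(\<Oplus>l\<in>{..<n}. M (i, l) \<otimes> N (l, k)) \<otimes> P (k, j) =
   (\<Oplus>l\<in>{..<n}. M (i, l) \<otimes> (N (l, k) \<otimes> P (k, j)))" .
 qed (use ij e in \<open>auto intro!: finsum_closed\<close>)
 also have "\<dots> = (\<Oplus>l\<in>{..<n}. \<Oplus>k\<in>{..<n}. M (i, l) \<otimes> (N (l, k) \<otimes> P (k, j)))"
  by (rule finsum_exchange) (use ij e in auto)
 also have "\<dots> = (\<Oplus>l\<in>{..<n}. M (i, l) \<otimes> (N \<otimes>[Mat n R] P) (l, j))"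
 proof (rule finsum_cong')
  fix l assume l: "l \<in> {..<n}"
  then have "(N \<otimes>[Mat n R] P) (l, j) = (\<Oplus>k\<in>{..<n}. N (l, k) \<otimes> P (k, j))"
   using ij by (simp add: mat_entries)
  moreover have "M (i, l) \<otimes> (\<Oplus>k\<in>{..<n}. N (l, k) \<otimes> P (k, j)) =
    (\<Oplus>k\<in>{..<n}. M (i, l) \<otimes> (N (l, k) \<otimes> P (k, j)))"
   by (rule finsum_rdistr) (use ij l e in auto)
  ultimately show "(\<Oplus>k\<in>{..<n}. M (i, l) \<otimes> (N (l, k) \<otimes> P (k, j))) = M (i, l) \<otimes> (N \<otimes>[Mat n R] P) (l, j)"
   by simp
 qed (use ij e mat_entry[OF mat_closed(1)[OF N P]] in auto)
 also have "\<dots> = (M \<otimes>[Mat n R] (N \<otimes>[Mat n R] P)) (i, j)"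
  using ij by (simp add: mat_entries(1))
 finally show "(M \<otimes>[Mat n R] N \<otimes>[Mat n R] P) (i, j) =
  (M \<otimes>[Mat n R] (N \<otimes>[Mat n R] P)) (i, j)" .
qed (use assms in \<open>auto intro!: mat_closed\<close>)

lemma Mat: "ring (Mat n R)"
proof (rule ringI)
 show "abelian_group (Mat n R)"
 proof (rule abelian_groupI)
  fix M assume M: "M \<in> carrier (Mat n R)"
  show "\<exists>N\<in>carrier (Mat n R). N \<oplus>[Mat n R] M = \<zero>[Mat n R]"
  proof (rule bexI[of _ "\<lambda>ij\<in>{..<n} \<times> {..<n}. \<ominus> M ij"])
   show *: "(\<lambda>ij\<in>{..<n} \<times> {..<n}. \<ominus> M ij) \<in> carrier (Mat n R)"
    using M by (auto simp: mat_carrier)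
   show "(\<lambda>ij\<in>{..<n} \<times> {..<n}. \<ominus> M ij) \<oplus>[Mat n R] M = \<zero>[Mat n R]"
    using mat_entry[OF M] mat_closed(2)[OF * M]
    by (intro mat_eqI[of _ n R]) (auto simp: mat_entries mat_const_closed l_neg)
  qed
 qed (auto intro!: mat_closed mat_const_closed mat_eqI[of _ n R] simp: mat_entries mat_entry a_ac)
 show "Group.monoid (Mat n R)"
 proof (rule monoidI)
  fix M assume M: "M \<in> carrier (Mat n R)"
  show "\<one>[Mat n R] \<otimes>[Mat n R] M = M"
  proof (rule mat_eqI[of _ n R])
   fix i j assume ij: "i < n" "j < n"
   have "(\<one>\<^bsub>Mat n R\<^esub> \<otimes>[Mat n R] M) (i, j) = (\<Oplus>k\<in>{..<n}. (if i = k then \<one> else \<zero>) \<otimes> M (k, j))"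
    unfolding mat_entries(1)[OF ij]
    by (rule finsum_cong') (use ij mat_entry[OF M] in \<open>auto simp: mat_entries\<close>)
   also have "\<dots> = M (i, j)" by (rule finsum_delta(1)) (use ij mat_entry[OF M] in auto)
   finally show "(\<one>\<^bsub>Mat n R\<^esub> \<otimes>[Mat n R] M) (i, j) = M (i, j)" .
  qed (use M in \<open>auto intro!: mat_closed mat_const_closed\<close>)
  show "M \<otimes>[Mat n R] \<one>[Mat n R] = M"
  proof (rule mat_eqI[of _ n R])
   fix i j assume ij: "i < n" "j < n"
   have "(M \<otimes>[Mat n R] \<one>[Mat n R]) (i, j) = (\<Oplus>k\<in>{..<n}. M (i, k) \<otimes> (if k = j then \<one> else \<zero>))"
    unfolding mat_entries(1)[OF ij]
    by (rule finsum_cong') (use ij mat_entry[OF M] in \<open>auto simp: mat_entries\<close>)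
   also have "\<dots> = M (i, j)" by (rule finsum_delta(2)) (use ij mat_entry[OF M] in auto)
   finally show "(M \<otimes>[Mat n R] \<one>[Mat n R]) (i, j) = M (i, j)" .
  qed (use M in \<open>auto intro!: mat_closed mat_const_closed\<close>)
 qed (auto intro!: mat_closed mat_const_closed mat_assoc)
next
 fix M N P assume c: "M \<in> carrier (Mat n R)" "N \<in> carrier (Mat n R)" "P \<in> carrier (Mat n R)"
 note e = mat_entry[OF c(1)] mat_entry[OF c(2)] mat_entry[OF c(3)]
 show "(M \<oplus>[Mat n R] N) \<otimes>[Mat n R] P = M \<otimes>[Mat n R] P \<oplus>[Mat n R] N \<otimes>[Mat n R] P"
 proof (rule mat_eqI[of _ n R])
  fix i j assume ij: "i < n" "j < n"
  have "((M \<oplus>[Mat n R] N) \<otimes>[Mat n R] P) (i, j) =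
    (\<Oplus>k\<in>{..<n}. M (i, k) \<otimes> P (k, j) \<oplus> N (i, k) \<otimes> P (k, j))"
   unfolding mat_entries(1)[OF ij]
   by (rule finsum_cong') (use ij e in \<open>auto simp: mat_entries l_distr\<close>)
  also have "\<dots> = (M \<otimes>[Mat n R] P \<oplus>[Mat n R] N \<otimes>[Mat n R] P) (i, j)"
   unfolding mat_entries[OF ij] by (rule finsum_addf) (use ij e in auto)
  finally show "((M \<oplus>[Mat n R] N) \<otimes>[Mat n R] P) (i, j) =
   (M \<otimes>[Mat n R] P \<oplus>[Mat n R] N \<otimes>[Mat n R] P) (i, j)" .
 qed (use c in \<open>auto intro!: mat_closed\<close>)
 show "P \<otimes>[Mat n R] (M \<oplus>[Mat n R] N) = P \<otimes>[Mat n R] M \<oplus>[Mat n R] P \<otimes>[Mat n R] N"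
 proof (rule mat_eqI[of _ n R])
  fix i j assume ij: "i < n" "j < n"
  have "(P \<otimes>[Mat n R] (M \<oplus>[Mat n R] N)) (i, j) =
    (\<Oplus>k\<in>{..<n}. P (i, k) \<otimes> M (k, j) \<oplus> P (i, k) \<otimes> N (k, j))"
   unfolding mat_entries(1)[OF ij]
   by (rule finsum_cong') (use ij e in \<open>auto simp: mat_entries r_distr\<close>)
  also have "\<dots> = (P \<otimes>[Mat n R] M \<oplus>[Mat n R] P \<otimes>[Mat n R] N) (i, j)"
   unfolding mat_entries[OF ij] by (rule finsum_addf) (use ij e in auto)
  finally show "(P \<otimes>[Mat n R] (M \<oplus>[Mat n R] N)) (i, j) =
   (P \<otimes>[Mat n R] M \<oplus>[Mat n R] P \<otimes>[Mat n R] N) (i, j)" .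
 qed (use c in \<open>auto intro!: mat_closed\<close>)
qed

lemma mat_minus_entry:
 assumes M: "M \<in> carrier (Mat n R)" and N: "N \<in> carrier (Mat n R)" and ij: "i < n" "j < n"
 shows "(M \<ominus>[Mat n R] N) (i, j) = M (i, j) \<ominus> N (i, j)"
proof -
 interpret M: ring "Mat n R" by (rule Mat)
 have "(M \<ominus>[Mat n R] N) \<oplus>[Mat n R] N = M"
  using M N by (simp add: M.minus_eq M.a_assoc M.l_neg)
 then have "(M \<ominus>[Mat n R] N) (i, j) \<oplus> N (i, j) = M (i, j)"
  using mat_entries(2)[OF ij, where M = "M \<ominus>[Mat n R] N" and A = R and N = N] by simp
 then show ?thesis
  using mat_entry[OF M ij] mat_entry[OF N ij] mat_entry[OF M.minus_closed[OF M N] ij]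
  by (metis add.inv_solve_right minus_eq)
qed

lemma mat_smult_mult:
 assumes c: "c \<in> carrier R" and M: "M \<in> carrier (Mat n R)" and N: "N \<in> carrier (Mat n R)"
 shows "mat_smult n R c M \<otimes>[Mat n R] N = mat_smult n R c (M \<otimes>[Mat n R] N)"
  and "M \<otimes>[Mat n R] mat_smult n R c N = mat_smult n R c (M \<otimes>[Mat n R] N)"
proof -
 note e = mat_entry[OF M] mat_entry[OF N]
 have *: "(\<Oplus>k\<in>{..<n}. c \<otimes> (M (i, k) \<otimes> N (k, j))) = mat_smult n R c (M \<otimes>[Mat n R] N) (i, j)"
  if ij: "i < n" "j < n" for i j
  unfolding mat_entries[OF ij] by (rule finsum_rdistr[symmetric]) (use ij e c in auto)
 show "mat_smult n R c M \<otimes>[Mat n R] N = mat_smult n R c (M \<otimes>[Mat n R] N)"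
 proof (rule mat_eqI[of _ n R])
  fix i j assume ij: "i < n" "j < n"
  have "(mat_smult n R c M \<otimes>[Mat n R] N) (i, j) = (\<Oplus>k\<in>{..<n}. c \<otimes> (M (i, k) \<otimes> N (k, j)))"
   unfolding mat_entries(1)[OF ij]
   by (rule finsum_cong') (use ij e c in \<open>auto simp: mat_entries m_assoc\<close>)
  then show "(mat_smult n R c M \<otimes>[Mat n R] N) (i, j) = mat_smult n R c (M \<otimes>[Mat n R] N) (i, j)"
   using *[OF ij] by simp
 qed (use assms in \<open>auto intro!: mat_closed mat_smult_closed\<close>)
 show "M \<otimes>[Mat n R] mat_smult n R c N = mat_smult n R c (M \<otimes>[Mat n R] N)"
 proof (rule mat_eqI[of _ n R])
  fix i j assume ij: "i < n" "j < n"
  have "(M \<otimes>[Mat n R] mat_smult n R c N) (i, j) = (\<Oplus>k\<in>{..<n}. c \<otimes> (M (i, k) \<otimes> N (k, j)))"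
   unfolding mat_entries(1)[OF ij]
   by (rule finsum_cong') (use ij e c in \<open>auto simp: mat_entries m_lcomm\<close>)
  then show "(M \<otimes>[Mat n R] mat_smult n R c N) (i, j) = mat_smult n R c (M \<otimes>[Mat n R] N) (i, j)"
   using *[OF ij] by simp
 qed (use assms in \<open>auto intro!: mat_closed mat_smult_closed\<close>)
qed

end

lemma ring_hom_finsum:
 assumes h: "h \<in> ring_hom R S" and R: "cring R" and S: "cring S" and f: "f \<in> I \<rightarrow> carrier R"
 shows "h (\<Oplus>\<^bsub>R\<^esub>i\<in>I. f i) = (\<Oplus>\<^bsub>S\<^esub>i\<in>I. h (f i))"
proof -
 interpret h: ring_hom_cring R S h
  by (intro ring_hom_cring.intro ring_hom_cring_axioms.intro R S h)
 show ?thesis using h.hom_finsum[OF f] by (simp add: comp_def)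
qed

definition mat_map :: "nat \<Rightarrow> ('a \<Rightarrow> 'b) \<Rightarrow> (nat \<times> nat \<Rightarrow> 'a) \<Rightarrow> nat \<times> nat \<Rightarrow> 'b"
 where "mat_map n h M = (\<lambda>ij \<in> {..<n} \<times> {..<n}. h (M ij))"

lemma mat_map_entry [simp]: "i < n \<Longrightarrow> j < n \<Longrightarrow> mat_map n h M (i, j) = h (M (i, j))"
 by (simp add: mat_map_def)

lemma mat_map_hom:
 assumes h: "h \<in> ring_hom R S" and R: "cring R" and S: "cring S"
 shows "mat_map n h \<in> ring_hom (Mat n R) (Mat n S)"
proof (rule ring_hom_memI)
 interpret R: cring R by (rule R)
 interpret S: cring S by (rule S)
 interpret h: ring_hom_cring R S h
  by (intro ring_hom_cring.intro ring_hom_cring_axioms.intro R S h)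
 have cl: "mat_map n h M \<in> carrier (Mat n S)" if "M \<in> carrier (Mat n R)" for M
  by (rule mat_carrierI) (use mat_entry[OF that] in \<open>auto simp: mat_map_def\<close>)
 then show "mat_map n h M \<in> carrier (Mat n S)" if "M \<in> carrier (Mat n R)" for M using that .
 show "mat_map n h \<one>[Mat n R] = \<one>[Mat n S]"
  by (rule mat_eqI[of _ n S]) (auto simp: mat_entries cl R.mat_const_closed S.mat_const_closed)
 fix M N assume MN: "M \<in> carrier (Mat n R)" "N \<in> carrier (Mat n R)"
 note e = mat_entry[OF MN(1)] mat_entry[OF MN(2)]
 show "mat_map n h (M \<oplus>[Mat n R] N) = mat_map n h M \<oplus>[Mat n S] mat_map n h N"
  by (rule mat_eqI[of _ n S]) (use MN e in \<open>auto simp: mat_entries cl R.mat_closed S.mat_closed\<close>)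
 show "mat_map n h (M \<otimes>[Mat n R] N) = mat_map n h M \<otimes>[Mat n S] mat_map n h N"
 proof (rule mat_eqI[of _ n S])
  fix i j assume ij: "i < n" "j < n"
  have "h (\<Oplus>\<^bsub>R\<^esub>k\<in>{..<n}. M (i, k) \<otimes>[R] N (k, j)) = (\<Oplus>\<^bsub>S\<^esub>k\<in>{..<n}. h (M (i, k) \<otimes>[R] N (k, j)))"
   by (rule ring_hom_finsum[OF h R S]) (use ij e in auto)
  also have "\<dots> = (\<Oplus>\<^bsub>S\<^esub>k\<in>{..<n}. mat_map n h M (i, k) \<otimes>[S] mat_map n h N (k, j))"
   by (rule S.finsum_cong') (use ij e in auto)
  finally show "mat_map n h (M \<otimes>[Mat n R] N) (i, j) =
    (mat_map n h M \<otimes>[Mat n S] mat_map n h N) (i, j)"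
   using ij by (simp add: mat_entries)
 qed (use MN in \<open>auto intro!: cl R.mat_closed S.mat_closed\<close>)
qed

subsection \<open>Spans of sets of matrices\<close>

text \<open>Terms are added one at a time, so the same h may occur repeatedly. The coefficients
  range over a subset C of the ring: the whole residue field in one application, the coefficient
  field inside \<open>A\<close> in another.\<close>

inductive_set mat_span :: "nat \<Rightarrow> ('a, 'b) ring_scheme \<Rightarrow> 'a set \<Rightarrow> (nat \<times> nat \<Rightarrow> 'a) set \<Rightarrow> (nat \<times> nat \<Rightarrow> 'a) set"
 for n A C H where
 zero: "\<zero>[Mat n A] \<in> mat_span n A C H"
| add: "c \<in> C \<Longrightarrow> h \<in> H \<Longrightarrow> x \<in> mat_span n A C H \<Longrightarrow> mat_smult n A c h \<oplus>[Mat n A] x \<in> mat_span n A C H"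

locale mat_subalgebra = cring R for R (structure) +
 fixes n :: nat and C :: "'a set" and H :: "(nat \<times> nat \<Rightarrow> 'a) set"
 assumes C: "C \<subseteq> carrier R" "\<one> \<in> C" "\<And>a b. a \<in> C \<Longrightarrow> b \<in> C \<Longrightarrow> a \<otimes> b \<in> C"
  "\<And>a b. a \<in> C \<Longrightarrow> b \<in> C \<Longrightarrow> a \<oplus> b \<in> C"
  and H: "H \<subseteq> carrier (Mat n R)" "\<And>g h. g \<in> H \<Longrightarrow> h \<in> H \<Longrightarrow> g \<otimes>[Mat n R] h \<in> H"
begin

abbreviation "MR \<equiv> Mat n R"
abbreviation "\<Lambda> \<equiv> mat_span n R C H"

sublocale MR: ring MR by (rule Mat)

lemma Cc: "c \<in> C \<Longrightarrow> c \<in> carrier R" using C(1) by (rule subsetD)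
lemma Hc: "h \<in> H \<Longrightarrow> h \<in> carrier MR" using H(1) by (rule subsetD)

lemma span_closed: "x \<in> \<Lambda> \<Longrightarrow> x \<in> carrier MR"
 by (induction rule: mat_span.induct) (auto intro!: MR.a_closed mat_smult_closed simp: Cc Hc)

lemma span_add: "x \<in> \<Lambda> \<Longrightarrow> y \<in> \<Lambda> \<Longrightarrow> x \<oplus>[MR] y \<in> \<Lambda>"
proof (induction rule: mat_span.induct)
 case zero then show ?case by (simp add: span_closed)
next
 case (add c h x)
 then show ?case
  using mat_span.add[of c C h H "x \<oplus>[MR] y" n R]
  by (simp add: MR.a_assoc mat_smult_closed Cc Hc span_closed)
qed

lemma smult_distr:
 assumes "c \<in> carrier R" "x \<in> carrier MR" "y \<in> carrier MR"
 shows "mat_smult n R c (x \<oplus>[MR] y) = mat_smult n R c x \<oplus>[MR] mat_smult n R c y"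
 by (rule mat_eqI[of _ n R]) (use assms in \<open>auto simp: mat_entries mat_entry r_distr mat_smult_closed\<close>)

lemma smult_assoc:
 assumes "c \<in> carrier R" "d \<in> carrier R" "x \<in> carrier MR"
 shows "mat_smult n R c (mat_smult n R d x) = mat_smult n R (c \<otimes> d) x"
 by (rule mat_eqI[of _ n R]) (use assms in \<open>auto simp: mat_entries mat_entry m_assoc mat_smult_closed\<close>)

lemma smult_zero: "c \<in> carrier R \<Longrightarrow> mat_smult n R c \<zero>[MR] = \<zero>[MR]"
 by (rule mat_eqI[of _ n R]) (auto simp: mat_entries mat_smult_closed)

lemma smult_one: "x \<in> carrier MR \<Longrightarrow> mat_smult n R \<one> x = x"
 by (rule mat_eqI[of _ n R]) (auto simp: mat_entries mat_smult_closed mat_entry)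

lemma span_smult:
 assumes c: "c \<in> C"
 shows "x \<in> \<Lambda> \<Longrightarrow> mat_smult n R c x \<in> \<Lambda>"
proof (induction rule: mat_span.induct)
 case zero show ?case using c by (simp add: smult_zero Cc mat_span.zero)
next
 case (add d h x)
 with c show ?case
  using mat_span.add[of "c \<otimes> d" C h H "mat_smult n R c x" n R]
  by (simp add: smult_distr smult_assoc Cc Hc C mat_smult_closed span_closed)
qed

lemma span_base: "h \<in> H \<Longrightarrow> h \<in> \<Lambda>"
 using mat_span.add[OF C(2) _ mat_span.zero, of h H n R] by (simp add: smult_one Hc)

lemma span_mult: "x \<in> \<Lambda> \<Longrightarrow> y \<in> \<Lambda> \<Longrightarrow> x \<otimes>[MR] y \<in> \<Lambda>"
proof (induction x rule: mat_span.induct)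
 case zero then show ?case by (simp add: span_closed mat_span.zero)
next
 case (add c h x)
 have hy: "h \<otimes>[MR] y \<in> \<Lambda>" using \<open>y \<in> \<Lambda>\<close>
 proof (induction y rule: mat_span.induct)
  case zero then show ?case using add by (simp add: Hc mat_span.zero)
 next
  case (add c' h' y)
  have "h \<otimes>[MR] (mat_smult n R c' h' \<oplus>[MR] y) = mat_smult n R c' (h \<otimes>[MR] h') \<oplus>[MR] h \<otimes>[MR] y"
   using \<open>h \<in> H\<close> add by (simp add: MR.r_distr mat_smult_mult Cc Hc mat_smult_closed span_closed)
  then show ?case using mat_span.add[OF add(1) H(2)[OF \<open>h \<in> H\<close> add(2)] add(4)] by simp
 qed
 have "(mat_smult n R c h \<oplus>[MR] x) \<otimes>[MR] y = mat_smult n R c (h \<otimes>[MR] y) \<oplus>[MR] x \<otimes>[MR] y"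
  using add by (simp add: MR.l_distr mat_smult_mult Cc Hc mat_smult_closed span_closed)
 then show ?case using span_add[OF span_smult[OF add(1) hy]] add by simp
qed

text \<open>Terms with equal h can be merged because C is closed under addition, which leaves one
  coefficient for each element of H.\<close>

lemma span_finite:
 assumes "finite C" "finite H" "\<zero> \<in> C"
 shows "finite \<Lambda>"
proof -
 define S where "S = (\<lambda>c. \<Oplus>\<^bsub>MR\<^esub>h\<in>H. mat_smult n R (c h) h) ` (H \<rightarrow>\<^sub>E C)"
 have "\<Lambda> \<subseteq> S"
 proof
  fix x assume "x \<in> \<Lambda>"
  then show "x \<in> S"
  proof (induction rule: mat_span.induct)
   case zero
   have "mat_smult n R \<zero> h = \<zero>[MR]" if "h \<in> H" for h
    using Hc[OF that] by (intro mat_eqI[of _ n R]) (auto simp: mat_entries mat_smult_closed mat_entry)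
   then have "(\<Oplus>\<^bsub>MR\<^esub>h\<in>H. mat_smult n R ((\<lambda>h\<in>H. \<zero>) h) h) = \<zero>[MR]"
    by (intro MR.add.finprod_one_eqI) simp
   then show ?case unfolding S_def using assms(3) by (intro image_eqI[of _ _ "\<lambda>h\<in>H. \<zero>"]) auto
  next
   case (add c h x)
   then obtain d where d: "d \<in> H \<rightarrow>\<^sub>E C" "x = (\<Oplus>\<^bsub>MR\<^esub>h\<in>H. mat_smult n R (d h) h)" by (auto simp: S_def)
   have dc: "g \<in> H \<Longrightarrow> d g \<in> C" for g using d(1) by auto
   let ?f = "\<lambda>d g. mat_smult n R (d g) g"
   have fc: "?f d g \<in> carrier MR" if "g \<in> H" "d g \<in> C" for d g using that by (simp add: mat_smult_closed Cc Hc)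
   define d' where "d' = d(h := c \<oplus> d h)"
   have eq: "mat_smult n R c h \<oplus>[MR] ?f d h = ?f d' h"
    using add(1,2) dc[OF add(2)] Hc[OF add(2)]
    by (intro mat_eqI[of _ n R]) (auto simp: mat_entries mat_entry d'_def Cc mat_smult_closed l_distr)
   have "x = (\<Oplus>\<^bsub>MR\<^esub>g\<in>insert h (H - {h}). ?f d g)" using d(2) add(2) by (simp add: insert_absorb)
   also have "\<dots> = ?f d h \<oplus>[MR] (\<Oplus>\<^bsub>MR\<^esub>g\<in>H - {h}. ?f d g)"
    using assms add(2) by (intro MR.finsum_insert) (auto intro!: fc dc)
   finally have "mat_smult n R c h \<oplus>[MR] x = ?f d' h \<oplus>[MR] (\<Oplus>\<^bsub>MR\<^esub>g\<in>H - {h}. ?f d g)"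
    using add(1,2) dc eq
    by (simp add: MR.a_assoc[symmetric] mat_smult_closed Cc Hc fc MR.finsum_closed Pi_def)
   also have "(\<Oplus>\<^bsub>MR\<^esub>g\<in>H - {h}. ?f d g) = (\<Oplus>\<^bsub>MR\<^esub>g\<in>H - {h}. ?f d' g)"
    by (rule MR.finsum_cong') (auto simp: d'_def intro!: fc dc)
   also have "?f d' h \<oplus>[MR] \<dots> = (\<Oplus>\<^bsub>MR\<^esub>g\<in>insert h (H - {h}). ?f d' g)"
    using assms add(1,2) by (intro MR.finsum_insert[symmetric]) (auto simp: d'_def intro!: fc dc C(4))
   finally have "mat_smult n R c h \<oplus>[MR] x = (\<Oplus>\<^bsub>MR\<^esub>g\<in>H. ?f d' g)" using add(2) by (simp add: insert_absorb)
   moreover have "d' \<in> H \<rightarrow>\<^sub>E C" using d(1) add(1,2) dc by (auto simp: d'_def C(4) PiE_def extensional_def)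
   ultimately show ?case unfolding S_def by blast
  qed
 qed
 moreover have "finite S" unfolding S_def using assms by (intro finite_imageI finite_PiE) auto
 ultimately show ?thesis by (rule finite_subset)
qed

end

section \<open>Vectors\<close>

definition unit_vec :: "nat \<Rightarrow> ('a, 'b) ring_scheme \<Rightarrow> nat \<Rightarrow> nat \<Rightarrow> 'a"
 where "unit_vec n A j = (\<lambda>i \<in> {..<n}. if i = j then \<one>[A] else \<zero>[A])"

lemma vec_carrier: "carrier (vec_module n A) = {..<n} \<rightarrow>\<^sub>E carrier A"
 by (simp add: vec_module_def)

lemma vec_entry: "x \<in> carrier (vec_module n A) \<Longrightarrow> i < n \<Longrightarrow> x i \<in> carrier A"
 by (auto simp: vec_carrier)

lemma vec_eqI:
 assumes "x \<in> carrier (vec_module n A)" "y \<in> carrier (vec_module n A)" "\<And>i. i < n \<Longrightarrow> x i = y i"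
 shows "x = y"
 by (rule PiE_ext[of _ "{..<n}" "\<lambda>_. carrier A"]) (use assms in \<open>auto simp: vec_carrier\<close>)

lemma vec_carrierI:
 "x \<in> extensional {..<n} \<Longrightarrow> (\<And>i. i < n \<Longrightarrow> x i \<in> carrier A) \<Longrightarrow> x \<in> carrier (vec_module n A)"
 by (auto simp: vec_carrier PiE_def)

lemma vec_entries:
 assumes "i < n"
 shows "(x \<oplus>[vec_module n A] y) i = x i \<oplus>[A] y i" "(a \<odot>[vec_module n A] x) i = a \<otimes>[A] x i"
  "\<zero>[vec_module n A] i = \<zero>[A]" "unit_vec n A j i = (if i = j then \<one>[A] else \<zero>[A])"
  "mat_vec n A M x i = (\<Oplus>\<^bsub>A\<^esub>j\<in>{..<n}. M (i, j) \<otimes>[A] x j)"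
 using assms by (simp_all add: vec_module_def unit_vec_def mat_vec_def)

lemma vec_extensional:
 "(x \<oplus>[vec_module n A] y) \<in> extensional {..<n}" "(a \<odot>[vec_module n A] x) \<in> extensional {..<n}"
  "\<zero>[vec_module n A] \<in> extensional {..<n}" "unit_vec n A j \<in> extensional {..<n}"
  "mat_vec n A M x \<in> extensional {..<n}"
 by (auto simp: vec_module_def unit_vec_def mat_vec_def extensional_def)

context cring
begin

lemma vec_closed:
 assumes "x \<in> carrier (vec_module n R)"
 shows "y \<in> carrier (vec_module n R) \<Longrightarrow> (x \<oplus>[vec_module n R] y) \<in> carrier (vec_module n R)"
  and "a \<in> carrier R \<Longrightarrow> (a \<odot>[vec_module n R] x) \<in> carrier (vec_module n R)"
  and "M \<in> carrier (Mat n R) \<Longrightarrow> mat_vec n R M x \<in> carrier (vec_module n R)"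
 by (rule vec_carrierI; use assms in \<open>auto simp: vec_extensional vec_entries vec_entry mat_entry intro!: finsum_closed\<close>)+

lemma vec_const_closed: "\<zero>[vec_module n R] \<in> carrier (vec_module n R)" "unit_vec n R j \<in> carrier (vec_module n R)"
 by (rule vec_carrierI; auto simp: vec_extensional vec_entries)+

lemma vec_module: "module R (vec_module n R)"
proof (rule moduleI)
 show "cring R" by (rule is_cring)
 show "abelian_group (vec_module n R)"
 proof (rule abelian_groupI)
  fix x assume x: "x \<in> carrier (vec_module n R)"
  show "\<exists>y\<in>carrier (vec_module n R). y \<oplus>[vec_module n R] x = \<zero>[vec_module n R]"
  proof (rule bexI[of _ "\<lambda>i\<in>{..<n}. \<ominus> x i"])
   show *: "(\<lambda>i\<in>{..<n}. \<ominus> x i) \<in> carrier (vec_module n R)"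
    using x by (auto simp: vec_carrier)
   show "(\<lambda>i\<in>{..<n}. \<ominus> x i) \<oplus>[vec_module n R] x = \<zero>[vec_module n R]"
    using vec_entry[OF x] vec_closed(1)[OF * x]
    by (intro vec_eqI[of _ n R]) (auto simp: vec_entries vec_const_closed l_neg)
  qed
 qed (auto intro!: vec_closed vec_const_closed vec_eqI[of _ n R] simp: vec_entries vec_entry a_ac)
qed (auto intro!: vec_closed vec_const_closed vec_eqI[of _ n R] simp: vec_entries vec_entry l_distr r_distr m_assoc)

lemma mat_vec_linear:
 assumes M: "M \<in> carrier (Mat n R)" and x: "x \<in> carrier (vec_module n R)" and y: "y \<in> carrier (vec_module n R)"
 shows "mat_vec n R M (x \<oplus>[vec_module n R] y) = mat_vec n R M x \<oplus>[vec_module n R] mat_vec n R M y"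
  and "a \<in> carrier R \<Longrightarrow> mat_vec n R M (a \<odot>[vec_module n R] x) = a \<odot>[vec_module n R] mat_vec n R M x"
proof -
 note e = mat_entry[OF M] vec_entry[OF x] vec_entry[OF y]
 show "mat_vec n R M (x \<oplus>[vec_module n R] y) = mat_vec n R M x \<oplus>[vec_module n R] mat_vec n R M y"
 proof (rule vec_eqI[of _ n R])
  fix i assume i: "i < n"
  have "(\<Oplus>j\<in>{..<n}. M (i, j) \<otimes> (x \<oplus>[vec_module n R] y) j) = (\<Oplus>j\<in>{..<n}. M (i, j) \<otimes> x j \<oplus> M (i, j) \<otimes> y j)"
   by (rule finsum_cong') (use e i in \<open>auto simp: vec_entries r_distr\<close>)
  also have "\<dots> = (\<Oplus>j\<in>{..<n}. M (i, j) \<otimes> x j) \<oplus> (\<Oplus>j\<in>{..<n}. M (i, j) \<otimes> y j)"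
   by (rule finsum_addf) (use e i in auto)
  finally show "mat_vec n R M (x \<oplus>[vec_module n R] y) i =
    (mat_vec n R M x \<oplus>[vec_module n R] mat_vec n R M y) i" using i by (simp add: vec_entries)
 qed (use assms in \<open>auto intro!: vec_closed\<close>)
 assume a: "a \<in> carrier R"
 show "mat_vec n R M (a \<odot>[vec_module n R] x) = a \<odot>[vec_module n R] mat_vec n R M x"
 proof (rule vec_eqI[of _ n R])
  fix i assume i: "i < n"
  have "(\<Oplus>j\<in>{..<n}. M (i, j) \<otimes> (a \<odot>[vec_module n R] x) j) = (\<Oplus>j\<in>{..<n}. a \<otimes> (M (i, j) \<otimes> x j))"
   by (rule finsum_cong') (use e i a in \<open>auto simp: vec_entries m_lcomm\<close>)
  also have "\<dots> = a \<otimes> (\<Oplus>j\<in>{..<n}. M (i, j) \<otimes> x j)"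
   by (rule finsum_rdistr[symmetric]) (use e i a in auto)
  finally show "mat_vec n R M (a \<odot>[vec_module n R] x) i = (a \<odot>[vec_module n R] mat_vec n R M x) i"
   using i by (simp add: vec_entries)
 qed (use assms a in \<open>auto intro!: vec_closed\<close>)
qed

lemma mat_vec_unit:
 assumes M: "M \<in> carrier (Mat n R)" and i: "i < n" and j: "j < n"
 shows "mat_vec n R M (unit_vec n R j) i = M (i, j)"
proof -
 have "(\<Oplus>k\<in>{..<n}. M (i, k) \<otimes> unit_vec n R j k) = (\<Oplus>k\<in>{..<n}. M (i, k) \<otimes> (if k = j then \<one> else \<zero>))"
  by (rule finsum_cong') (use i mat_entry[OF M] in \<open>auto simp: vec_entries\<close>)
 also have "\<dots> = M (i, j)" by (rule finsum_delta(2)) (use i j mat_entry[OF M] in auto)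
 finally show ?thesis using i by (simp add: vec_entries)
qed

lemma mat_vec_mult:
 assumes M: "M \<in> carrier (Mat n R)" and N: "N \<in> carrier (Mat n R)" and x: "x \<in> carrier (vec_module n R)"
 shows "mat_vec n R (M \<otimes>[Mat n R] N) x = mat_vec n R M (mat_vec n R N x)"
proof (rule vec_eqI[of _ n R])
 note e = mat_entry[OF M] mat_entry[OF N] vec_entry[OF x]
 fix i assume i: "i < n"
 have "mat_vec n R (M \<otimes>[Mat n R] N) x i = (\<Oplus>k\<in>{..<n}. \<Oplus>l\<in>{..<n}. M (i, l) \<otimes> (N (l, k) \<otimes> x k))"
  unfolding vec_entries(5)[OF i]
 proof (rule finsum_cong')
  fix k assume k: "k \<in> {..<n}"
  have "(M \<otimes>[Mat n R] N) (i, k) \<otimes> x k = (\<Oplus>l\<in>{..<n}. M (i, l) \<otimes> N (l, k)) \<otimes> x k"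
   using i k by (simp add: mat_entries)
  also have "\<dots> = (\<Oplus>l\<in>{..<n}. M (i, l) \<otimes> N (l, k) \<otimes> x k)"
   by (rule finsum_ldistr) (use i k e in auto)
  also have "\<dots> = (\<Oplus>l\<in>{..<n}. M (i, l) \<otimes> (N (l, k) \<otimes> x k))"
   by (rule finsum_cong') (use i k e in \<open>auto simp: m_assoc\<close>)
  finally show "(M \<otimes>[Mat n R] N) (i, k) \<otimes> x k = (\<Oplus>l\<in>{..<n}. M (i, l) \<otimes> (N (l, k) \<otimes> x k))" .
 qed (use i e in \<open>auto intro!: finsum_closed\<close>)
 also have "\<dots> = (\<Oplus>l\<in>{..<n}. \<Oplus>k\<in>{..<n}. M (i, l) \<otimes> (N (l, k) \<otimes> x k))"
  by (rule finsum_exchange) (use i e in auto)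
 also have "\<dots> = (\<Oplus>l\<in>{..<n}. M (i, l) \<otimes> mat_vec n R N x l)"
 proof (rule finsum_cong')
  fix l assume l: "l \<in> {..<n}"
  then have "mat_vec n R N x l = (\<Oplus>k\<in>{..<n}. N (l, k) \<otimes> x k)" by (simp add: vec_entries)
  moreover have "M (i, l) \<otimes> (\<Oplus>k\<in>{..<n}. N (l, k) \<otimes> x k) = (\<Oplus>k\<in>{..<n}. M (i, l) \<otimes> (N (l, k) \<otimes> x k))"
   by (rule finsum_rdistr) (use i l e in auto)
  ultimately show "(\<Oplus>k\<in>{..<n}. M (i, l) \<otimes> (N (l, k) \<otimes> x k)) = M (i, l) \<otimes> mat_vec n R N x l" by simp
 qed (use i e vec_entry[OF vec_closed(3)[OF x N]] in auto)
 finally show "mat_vec n R (M \<otimes>[Mat n R] N) x i = mat_vec n R M (mat_vec n R N x) i"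
  using i by (simp add: vec_entries)
qed (use assms in \<open>auto intro!: vec_closed mat_closed\<close>)

lemma mat_vec_mat:
 assumes M: "M \<in> carrier (Mat n R)" and N: "N \<in> carrier (Mat n R)" and x: "x \<in> carrier (vec_module n R)"
 shows "mat_vec n R (M \<oplus>[Mat n R] N) x = mat_vec n R M x \<oplus>[vec_module n R] mat_vec n R N x"
  and "c \<in> carrier R \<Longrightarrow> mat_vec n R (mat_smult n R c M) x = c \<odot>[vec_module n R] mat_vec n R M x"
  and "mat_vec n R \<one>[Mat n R] x = x"
  and "mat_vec n R \<zero>[Mat n R] x = \<zero>[vec_module n R]"
proof -
 note e = mat_entry[OF M] mat_entry[OF N] vec_entry[OF x]
 show "mat_vec n R (M \<oplus>[Mat n R] N) x = mat_vec n R M x \<oplus>[vec_module n R] mat_vec n R N x"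
 proof (rule vec_eqI[of _ n R])
  fix i assume i: "i < n"
  have "(\<Oplus>j\<in>{..<n}. (M \<oplus>[Mat n R] N) (i, j) \<otimes> x j) = (\<Oplus>j\<in>{..<n}. M (i, j) \<otimes> x j \<oplus> N (i, j) \<otimes> x j)"
   by (rule finsum_cong') (use e i in \<open>auto simp: mat_entries l_distr\<close>)
  also have "\<dots> = (\<Oplus>j\<in>{..<n}. M (i, j) \<otimes> x j) \<oplus> (\<Oplus>j\<in>{..<n}. N (i, j) \<otimes> x j)"
   by (rule finsum_addf) (use e i in auto)
  finally show "mat_vec n R (M \<oplus>[Mat n R] N) x i = (mat_vec n R M x \<oplus>[vec_module n R] mat_vec n R N x) i"
   using i by (simp add: vec_entries)
 qed (use assms in \<open>auto intro!: vec_closed mat_closed\<close>)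
 show "mat_vec n R (mat_smult n R c M) x = c \<odot>[vec_module n R] mat_vec n R M x" if c: "c \<in> carrier R"
 proof (rule vec_eqI[of _ n R])
  fix i assume i: "i < n"
  have "(\<Oplus>j\<in>{..<n}. mat_smult n R c M (i, j) \<otimes> x j) = (\<Oplus>j\<in>{..<n}. c \<otimes> (M (i, j) \<otimes> x j))"
   by (rule finsum_cong') (use e i c in \<open>auto simp: mat_entries m_assoc\<close>)
  also have "\<dots> = c \<otimes> (\<Oplus>j\<in>{..<n}. M (i, j) \<otimes> x j)"
   by (rule finsum_rdistr[symmetric]) (use e i c in auto)
  finally show "mat_vec n R (mat_smult n R c M) x i = (c \<odot>[vec_module n R] mat_vec n R M x) i"
   using i by (simp add: vec_entries)
 qed (use assms c in \<open>auto intro!: vec_closed mat_smult_closed\<close>)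
 show "mat_vec n R \<one>[Mat n R] x = x"
 proof (rule vec_eqI[of _ n R])
  fix i assume i: "i < n"
  have "(\<Oplus>j\<in>{..<n}. \<one>[Mat n R] (i, j) \<otimes> x j) = (\<Oplus>j\<in>{..<n}. (if i = j then \<one> else \<zero>) \<otimes> x j)"
   by (rule finsum_cong') (use e i in \<open>auto simp: mat_entries\<close>)
  also have "\<dots> = x i" by (rule finsum_delta(1)) (use e i in auto)
  finally show "mat_vec n R \<one>[Mat n R] x i = x i" using i by (simp add: vec_entries)
 qed (use assms in \<open>auto intro!: vec_closed mat_const_closed\<close>)
 show "mat_vec n R \<zero>[Mat n R] x = \<zero>[vec_module n R]"
 proof (rule vec_eqI[of _ n R])
  fix i assume i: "i < n"
  have "(\<Oplus>j\<in>{..<n}. \<zero>[Mat n R] (i, j) \<otimes> x j) = \<zero>"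
   by (rule add.finprod_one_eqI) (use e i in \<open>auto simp: mat_entries\<close>)
  then show "mat_vec n R \<zero>[Mat n R] x i = \<zero>[vec_module n R] i" using i by (simp add: vec_entries)
 qed (use assms in \<open>auto intro!: vec_closed vec_const_closed mat_const_closed\<close>)
qed

lemma vec_finsum_entry:
 assumes f: "\<And>b. b \<in> I \<Longrightarrow> f b \<in> carrier (vec_module n R)" and i: "i < n" and I: "finite I"
 shows "(\<Oplus>\<^bsub>vec_module n R\<^esub>b\<in>I. f b) i = (\<Oplus>b\<in>I. f b i)"
proof -
 interpret V: module R "vec_module n R" by (rule vec_module)
 show ?thesis using I f
 proof (induction I)
  case empty then show ?case using i by (simp add: vec_entries)
 next
  case (insert b I)
  have "(\<Oplus>\<^bsub>vec_module n R\<^esub>b\<in>insert b I. f b) = f b \<oplus>[vec_module n R] (\<Oplus>\<^bsub>vec_module n R\<^esub>b\<in>I. f b)"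
   using insert by (intro V.M.finsum_insert) auto
  moreover have c: "f b' i \<in> carrier R" if "b' \<in> insert b I" for b'
   by (rule vec_entry[OF insert.prems[OF that] i])
  have "(\<Oplus>b\<in>insert b I. f b i) = f b i \<oplus> (\<Oplus>b\<in>I. f b i)"
   using insert.hyps c by (intro finsum_insert) auto
  ultimately show ?case using insert i by (simp add: vec_entries)
 qed
qed

lemma linear_map_matrix:
 assumes f: "\<And>x. x \<in> carrier (vec_module n R) \<Longrightarrow> f x \<in> carrier (vec_module n R)"
  "\<And>x y. x \<in> carrier (vec_module n R) \<Longrightarrow> y \<in> carrier (vec_module n R) \<Longrightarrow>
   f (x \<oplus>[vec_module n R] y) = f x \<oplus>[vec_module n R] f y"
  "\<And>a x. a \<in> carrier R \<Longrightarrow> x \<in> carrier (vec_module n R) \<Longrightarrow>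
   f (a \<odot>[vec_module n R] x) = a \<odot>[vec_module n R] f x"
 shows "\<exists>D\<in>carrier (Mat n R). \<forall>x\<in>carrier (vec_module n R). mat_vec n R D x = f x"
proof (intro bexI ballI)
 interpret V: module R "vec_module n R" by (rule vec_module)
 let ?V = "vec_module n R" and ?e = "unit_vec n R"
 define D where "D = (\<lambda>(i, j) \<in> {..<n} \<times> {..<n}. f (?e j) i)"
 have ec: "?e j \<in> carrier ?V" for j by (rule vec_const_closed)
 show D: "D \<in> carrier (Mat n R)"
  by (rule mat_carrierI) (auto simp: D_def extensional_def intro!: vec_entry[OF f(1)[OF ec]])
 fix x assume x: "x \<in> carrier ?V"
 note xc = vec_entry[OF x]
 have f0: "f \<zero>[?V] = \<zero>[?V]" using f(3)[OF zero_closed vec_const_closed(1)[of n]] f(1)[OF vec_const_closed(1)] by simp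
 have fs: "f (\<Oplus>\<^bsub>?V\<^esub>b\<in>I. x b \<odot>[?V] ?e b) = (\<Oplus>\<^bsub>?V\<^esub>b\<in>I. x b \<odot>[?V] f (?e b))"
  if "finite I" "I \<subseteq> {..<n}" for I using that
 proof (induction I)
  case (insert b I)
  have 1: "(\<Oplus>\<^bsub>?V\<^esub>b\<in>insert b I. x b \<odot>[?V] ?e b) = x b \<odot>[?V] ?e b \<oplus>[?V] (\<Oplus>\<^bsub>?V\<^esub>b\<in>I. x b \<odot>[?V] ?e b)"
   using insert by (intro V.M.finsum_insert) (auto simp: xc ec subset_iff)
  have 2: "(\<Oplus>\<^bsub>?V\<^esub>b\<in>insert b I. x b \<odot>[?V] f (?e b)) = x b \<odot>[?V] f (?e b) \<oplus>[?V] (\<Oplus>\<^bsub>?V\<^esub>b\<in>I. x b \<odot>[?V] f (?e b))"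
   using insert by (intro V.M.finsum_insert) (auto simp: xc ec f(1) subset_iff)
  have "(\<Oplus>\<^bsub>?V\<^esub>b\<in>I. x b \<odot>[?V] ?e b) \<in> carrier ?V"
   using insert by (intro V.M.finsum_closed) (auto simp: xc ec subset_iff)
  then show ?case unfolding 1 2 using insert by (simp add: f xc ec)
 qed (simp add: f0)
 have xe: "x = (\<Oplus>\<^bsub>?V\<^esub>b\<in>{..<n}. x b \<odot>[?V] ?e b)"
 proof (rule vec_eqI[of _ n R])
  fix i assume i: "i < n"
  have "(\<Oplus>\<^bsub>?V\<^esub>b\<in>{..<n}. x b \<odot>[?V] ?e b) i = (\<Oplus>b\<in>{..<n}. (x b \<odot>[?V] ?e b) i)"
   by (rule vec_finsum_entry) (auto simp: i xc ec)
  also have "\<dots> = (\<Oplus>b\<in>{..<n}. (if i = b then \<one> else \<zero>) \<otimes> x b)"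
   by (rule finsum_cong') (auto simp: vec_entries i xc m_comm)
  also have "\<dots> = x i" by (rule finsum_delta(1)) (auto simp: i xc)
  finally show "x i = (\<Oplus>\<^bsub>?V\<^esub>b\<in>{..<n}. x b \<odot>[?V] ?e b) i" by simp
 qed (auto simp: x xc ec intro!: V.M.finsum_closed)
 have fx: "f x = (\<Oplus>\<^bsub>?V\<^esub>b\<in>{..<n}. x b \<odot>[?V] f (?e b))" by (subst xe) (rule fs; simp)
 show "mat_vec n R D x = f x"
 proof (rule vec_eqI[of _ n R])
  fix i assume i: "i < n"
  have "f x i = (\<Oplus>b\<in>{..<n}. (x b \<odot>[?V] f (?e b)) i)"
   unfolding fx by (rule vec_finsum_entry) (auto simp: i xc ec f)
  also have "\<dots> = (\<Oplus>b\<in>{..<n}. D (i, b) \<otimes> x b)"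
   by (rule finsum_cong') (use i xc vec_entry[OF f(1)[OF ec]] in \<open>auto simp: vec_entries D_def m_comm\<close>)
  finally show "mat_vec n R D x i = f x i" using i by (simp add: vec_entries)
 qed (auto intro!: vec_closed D x f)
qed

end

section \<open>Absolutely irreducible matrix algebras over finite fields\<close>

subsection \<open>Eigenvectors\<close>

context module
begin

definition lin_op :: "('c \<Rightarrow> 'c) \<Rightarrow> bool"
 where "lin_op D \<longleftrightarrow> (\<forall>x\<in>carrier M. D x \<in> carrier M) \<and>
  (\<forall>x\<in>carrier M. \<forall>y\<in>carrier M. D (x \<oplus>[M] y) = D x \<oplus>[M] D y) \<and>
  (\<forall>a\<in>carrier R. \<forall>x\<in>carrier M. D (a \<odot>[M] x) = a \<odot>[M] D x)"

text \<open>Polynomials are lists with leading coefficient first, as in the library; \<open>hquot\<close> and \<open>hrem\<close>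
 are quotient and remainder of Horner's division of \<open>b # q\<close> by \<open>X - c\<close>.\<close>

fun poly_op :: "('c \<Rightarrow> 'c) \<Rightarrow> 'a list \<Rightarrow> 'c \<Rightarrow> 'c"
 where "poly_op D [] v = \<zero>[M]"
 | "poly_op D (a # q) v = a \<odot>[M] (D ^^ length q) v \<oplus>[M] poly_op D q v"

fun hquot :: "'a \<Rightarrow> 'a \<Rightarrow> 'a list \<Rightarrow> 'a list"
 where "hquot c b [] = []"
 | "hquot c b (a # q) = b # hquot c (a \<oplus>[R] c \<otimes>[R] b) q"

fun hrem :: "'a \<Rightarrow> 'a \<Rightarrow> 'a list \<Rightarrow> 'a"
 where "hrem c b [] = b"
 | "hrem c b (a # q) = hrem c (a \<oplus>[R] c \<otimes>[R] b) q"

lemma hquot_length: "length (hquot c b q) = length q"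
 by (induction q arbitrary: b) auto

lemma hquot_closed: "c \<in> carrier R \<Longrightarrow> b \<in> carrier R \<Longrightarrow> set q \<subseteq> carrier R \<Longrightarrow> set (hquot c b q) \<subseteq> carrier R"
 by (induction q arbitrary: b) auto

lemma hrem_eval:
 "c \<in> carrier R \<Longrightarrow> b \<in> carrier R \<Longrightarrow> set q \<subseteq> carrier R \<Longrightarrow> R.eval (b # q) c = hrem c b q"
proof (induction q arbitrary: b)
 case (Cons a q)
 have e: "R.eval q c \<in> carrier R" using Cons by (intro R.eval_in_carrier) auto
 have "R.eval (b # a # q) c = R.eval ((a \<oplus>[R] c \<otimes>[R] b) # q) c"
  using Cons.prems e by (simp add: R.l_distr R.r_distr R.a_ac R.m_ac)
 then show ?case using Cons by simp
qed simp

lemma funpow_closed: "lin_op D \<Longrightarrow> v \<in> carrier M \<Longrightarrow> (D ^^ k) v \<in> carrier M"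
 by (induction k) (auto simp: lin_op_def)

lemma poly_op_closed: "lin_op D \<Longrightarrow> v \<in> carrier M \<Longrightarrow> set q \<subseteq> carrier R \<Longrightarrow> poly_op D q v \<in> carrier M"
 by (induction q) (auto simp: funpow_closed)

text \<open>The operator form of P = (X - c) Q + P(c), evaluated at \<open>D\<close>; the term c Q
  stands on the left so that no subtraction in the module occurs.\<close>

lemma horner_op:
 assumes D: "lin_op D" and v: "v \<in> carrier M" and c: "c \<in> carrier R"
 shows "b \<in> carrier R \<Longrightarrow> set q \<subseteq> carrier R \<Longrightarrow>
  poly_op D (b # q) v \<oplus>[M] c \<odot>[M] poly_op D (hquot c b q) v = D (poly_op D (hquot c b q) v) \<oplus>[M] hrem c b q \<odot>[M] v"
proof (induction q arbitrary: b)
 case Nil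
 have "D \<zero>[M] = \<zero>[M]"
 proof -
  have "D (\<zero>\<^bsub>R\<^esub> \<odot>[M] \<zero>[M]) = \<zero>[R] \<odot>[M] D \<zero>[M]"
   using D R.zero_closed M.zero_closed unfolding lin_op_def by blast
  moreover have "D \<zero>[M] \<in> carrier M" using D by (simp add: lin_op_def)
  ultimately show ?thesis by simp
 qed
 then show ?case using Nil v c by simp
next
 case (Cons a q)
 let ?b = "a \<oplus>[R] c \<otimes>[R] b" and ?m = "length q"
 define Q where "Q = poly_op D (hquot c ?b q) v"
 define P where "P = poly_op D q v"
 define z where "z = (D ^^ ?m) v"
 have b: "?b \<in> carrier R" "a \<in> carrier R" using Cons.prems c by auto
 have cl: "Q \<in> carrier M" "P \<in> carrier M" "z \<in> carrier M" "D z \<in> carrier M" "D Q \<in> carrier M"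
   "hrem c ?b q \<odot>[M] v \<in> carrier M"
 proof -
  show Q: "Q \<in> carrier M" unfolding Q_def by (rule poly_op_closed[OF D v hquot_closed]) (use b c Cons.prems in auto)
  show "P \<in> carrier M" unfolding P_def by (rule poly_op_closed[OF D v]) (use Cons.prems in auto)
  show z: "z \<in> carrier M" unfolding z_def by (rule funpow_closed[OF D v])
  show "D z \<in> carrier M" "D Q \<in> carrier M" using D z Q by (auto simp: lin_op_def)
  have "R.eval (?b # q) c \<in> carrier R" using b c Cons.prems by (intro R.eval_in_carrier) auto
  then have "hrem c ?b q \<in> carrier R" using hrem_eval[OF c b(1)] Cons.prems by auto
  then show "hrem c ?b q \<odot>[M] v \<in> carrier M" using v by simp
 qed
 have IH: "?b \<odot>[M] z \<oplus>[M] P \<oplus>[M] c \<odot>[M] Q = D Q \<oplus>[M] hrem c ?b q \<odot>[M] v"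
  using Cons.IH[OF b(1)] Cons.prems by (simp add: Q_def P_def z_def)
 have "poly_op D (b # a # q) v \<oplus>[M] c \<odot>[M] poly_op D (hquot c b (a # q)) v =
   b \<odot>[M] D z \<oplus>[M] (a \<odot>[M] z \<oplus>[M] P) \<oplus>[M] c \<odot>[M] (b \<odot>[M] z \<oplus>[M] Q)"
  by (simp add: Q_def P_def z_def hquot_length)
 also have "\<dots> = b \<odot>[M] D z \<oplus>[M] (?b \<odot>[M] z \<oplus>[M] P \<oplus>[M] c \<odot>[M] Q)"
  using cl b c Cons.prems by (simp add: smult_l_distr smult_r_distr smult_assoc1 M.a_ac)
 also have "\<dots> = (b \<odot>[M] D z \<oplus>[M] D Q) \<oplus>[M] hrem c ?b q \<odot>[M] v"
  unfolding IH using cl Cons.prems by (simp add: M.a_assoc)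
 also have "b \<odot>[M] D z \<oplus>[M] D Q = D (b \<odot>[M] z \<oplus>[M] Q)"
  using D cl Cons.prems by (simp add: lin_op_def)
 finally show ?case by (simp add: Q_def z_def hquot_length)
qed

text \<open>The hypothesis makes the monic polynomial X^j - X^i kill v. In a monic polynomial of
  least degree killing v split off a root c: by minimality the quotient does not kill v, and its
  value at v is an eigenvector for c.\<close>

lemma exists_eigenvector:
 assumes ac: "algebraically_closed R" and D: "lin_op D" and v: "v \<in> carrier M" "v \<noteq> \<zero>[M]"
  and ij: "i < j" "(D ^^ i) v = (D ^^ j) v"
 shows "\<exists>c\<in>carrier R. \<exists>w\<in>carrier M. w \<noteq> \<zero>[M] \<and> D w = c \<odot>[M] w"
proof -
 interpret ac: algebraically_closed R by (rule ac)
 \<comment> \<open>Monic polynomials are stored without their leading one, so the length of the list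
   is the degree.\<close>
 define good where "good q \<longleftrightarrow> set q \<subseteq> carrier R \<and> poly_op D (\<one>\<^bsub>R\<^esub> # q) v = \<zero>[M]" for q
 note pc = funpow_closed[OF D v(1)]
 have z: "poly_op D (replicate k \<zero>[R] @ q) v = poly_op D q v" if "set q \<subseteq> carrier R" for k q
  using poly_op_closed[OF D v(1) that] by (induction k) (auto simp: pc)
 \<comment> \<open>\<open>?q\<close> is -X^i; with j - i - 1 zeros in front it lists the
   coefficients of X^j - X^i below the leading one.\<close>
 let ?q = "(\<ominus>\<^bsub>R\<^esub> \<one>[R]) # replicate i \<zero>[R]"
 have rc: "set (replicate k \<zero>[R]) \<subseteq> carrier R" for k by auto
 have qs: "set ?q \<subseteq> carrier R" by auto
 have "poly_op D ?q v = \<ominus>[M] (D ^^ i) v"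
  using z[of "[]" i] pc[of i] by (simp add: smult_l_minus)
 then have pq: "poly_op D (replicate (j - Suc i) \<zero>[R] @ ?q) v = \<ominus>[M] (D ^^ i) v"
  by (simp only: z[OF qs])
 have len: "length (replicate (j - Suc i) \<zero>[R] @ ?q) = j" using ij(1) by simp
 have "poly_op D (\<one>\<^bsub>R\<^esub> # (replicate (j - Suc i) \<zero>[R] @ ?q)) v = \<zero>[M]"
  unfolding poly_op.simps(2) len pq using ij(2) pc[of j] by (simp add: M.r_neg)
 then have "good (replicate (j - Suc i) \<zero>[R] @ ?q)"
  unfolding good_def using rc qs by auto
 from ex_has_least_nat[of good, OF this, of length]
 obtain q where q: "good q" "\<And>q'. good q' \<Longrightarrow> length q \<le> length q'" by auto
 have qc: "set q \<subseteq> carrier R" and q0: "poly_op D (\<one>\<^bsub>R\<^esub> # q) v = \<zero>[M]" using q(1) by (auto simp: good_def)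
 have ne: "q \<noteq> []" using q0 v by auto
 have pol: "\<one>[R] # q \<in> carrier (poly_ring R)"
  using qc by (simp add: univ_poly_carrier[symmetric] polynomial_def)
 have "size (R.roots (\<one>\<^bsub>R\<^esub> # q)) = length q"
  using ac.roots_over_carrier[OF pol] by (simp add: R.splitted_def)
 then have "R.roots (\<one>\<^bsub>R\<^esub> # q) \<noteq> {#}" using ne by auto
 then obtain c where "c \<in># R.roots (\<one>\<^bsub>R\<^esub> # q)" by blast
 then have "R.is_root (\<one>\<^bsub>R\<^esub> # q) c" using ac.roots_mem_iff_is_root[OF pol] by simp
 then have c: "c \<in> carrier R" "R.eval (\<one>\<^bsub>R\<^esub> # q) c = \<zero>[R]" by (auto simp: R.is_root_def simp del: R.eval.simps)
 have h0: "hrem c \<one>[R] q = \<zero>[R]" using hrem_eval[OF c(1) _ qc, of "\<one>[R]"] c(2) by simp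
 define w where "w = poly_op D (hquot c \<one>[R] q) v"
 have hc: "set (hquot c \<one>[R] q) \<subseteq> carrier R" by (rule hquot_closed[OF c(1) _ qc]) simp
 have w: "w \<in> carrier M" unfolding w_def by (rule poly_op_closed[OF D v(1) hc])
 have "w \<noteq> \<zero>[M]"
 proof
  assume w0: "w = \<zero>[M]"
  obtain a r where ar: "q = a # r" using ne by (cases q) auto
  have "good (hquot c (a \<oplus>[R] c \<otimes>[R] \<one>[R]) r)" using w0 hc by (simp add: good_def w_def ar del: poly_op.simps)
  from q(2)[OF this] show False by (simp add: hquot_length ar)
 qed
 moreover have "D w = c \<odot>[M] w"
  using horner_op[OF D v(1) c(1) _ qc, of "\<one>[R]"] q0 h0 w v c D
  by (simp add: w_def[symmetric] lin_op_def del: poly_op.simps)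
 ultimately show ?thesis using w c by blast
qed

end

lemma (in abelian_group) diff_zero_eq:
 assumes "x \<in> carrier G" "y \<in> carrier G" "x \<ominus> y = \<zero>"
 shows "x = y"
proof -
 have "x = (x \<ominus> y) \<oplus> y" using assms(1,2) by (simp add: minus_eq a_assoc l_neg)
 then show ?thesis using assms by simp
qed

subsection \<open>Burnside's theorem\<close>

text \<open>Finiteness of the field replaces dimension theory: maximal subspaces exist, and orbits
  of an operator repeat, because the space of vectors is finite. The condition \<open>irr\<close> is
  irreducibility after extension of scalars to \<Omega>.\<close>

locale abs_irr = field R + mat_subalgebra R n "carrier R" H for R (structure) and n H +
 fixes \<Omega> :: "'o ring" and \<iota> :: "'a \<Rightarrow> 'o"
 assumes finR: "finite (carrier R)" and npos: "0 < n" and oneH: "\<one>[Mat n R] \<in> H"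
  and \<Omega>: "algebraically_closed \<Omega>" and \<iota>: "\<iota> \<in> ring_hom R \<Omega>"
  and irr: "\<And>V. submodule V \<Omega> (vec_module n \<Omega>) \<Longrightarrow>
   (\<And>h x. h \<in> H \<Longrightarrow> x \<in> V \<Longrightarrow> mat_vec n \<Omega> (mat_map n \<iota> h) x \<in> V) \<Longrightarrow>
   V = {\<zero>\<^bsub>vec_module n \<Omega>\<^esub>} \<or> V = carrier (vec_module n \<Omega>)"
begin

abbreviation "V \<equiv> vec_module n R"
abbreviation "VO \<equiv> vec_module n \<Omega>"
abbreviation "act \<equiv> mat_vec n R"
abbreviation "e \<equiv> unit_vec n R"
abbreviation "eO \<equiv> unit_vec n \<Omega>"
definition "\<iota>v x = (\<lambda>i\<in>{..<n}. \<iota> (x i))"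

sublocale \<Omega>: algebraically_closed \<Omega> by (rule \<Omega>)
sublocale \<iota>: ring_hom_cring R \<Omega> \<iota>
 by (intro ring_hom_cring.intro ring_hom_cring_axioms.intro is_cring \<Omega>.is_cring \<iota>)
sublocale V: module R V by (rule vec_module)
sublocale VO: module \<Omega> VO by (rule \<Omega>.vec_module)

lemma \<iota>_inj: "a \<in> carrier R \<Longrightarrow> \<iota> a = \<zero>\<^bsub>\<Omega>\<^esub> \<Longrightarrow> a = \<zero>"
proof (rule ccontr)
 assume a: "a \<in> carrier R" "\<iota> a = \<zero>\<^bsub>\<Omega>\<^esub>" "a \<noteq> \<zero>"
 then have u: "a \<in> Units R" by (simp add: field_Units)
 have "\<iota> (inv a \<otimes> a) = \<iota> (inv a) \<otimes>\<^bsub>\<Omega>\<^esub> \<iota> a" using a u by (intro \<iota>.hom_mult) auto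
 then show False using a u \<Omega>.one_not_zero by simp
qed

lemma mO: "h \<in> carrier MR \<Longrightarrow> mat_map n \<iota> h \<in> carrier (Mat n \<Omega>)"
 using ring_hom_closed[OF mat_map_hom[OF \<iota> is_cring \<Omega>.is_cring]] .

lemma \<iota>v_closed: "x \<in> carrier V \<Longrightarrow> \<iota>v x \<in> carrier VO"
 by (rule vec_carrierI) (auto simp: \<iota>v_def intro!: \<iota>.hom_closed dest: vec_entry)

lemma \<iota>v_entry: "i < n \<Longrightarrow> \<iota>v x i = \<iota> (x i)" by (simp add: \<iota>v_def)

lemma \<iota>v_act:
 assumes h: "h \<in> carrier MR" and x: "x \<in> carrier V"
 shows "mat_vec n \<Omega> (mat_map n \<iota> h) (\<iota>v x) = \<iota>v (act h x)"
proof (rule vec_eqI[of _ n \<Omega>])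
 fix i assume i: "i < n"
 note c = mat_entry[OF h] vec_entry[OF x]
 have "\<iota> (\<Oplus>j\<in>{..<n}. h (i, j) \<otimes> x j) = (\<Oplus>\<^bsub>\<Omega>\<^esub>j\<in>{..<n}. \<iota> (h (i, j) \<otimes> x j))"
  by (rule ring_hom_finsum[OF \<iota> is_cring \<Omega>.is_cring]) (use c i in auto)
 also have "\<dots> = (\<Oplus>\<^bsub>\<Omega>\<^esub>j\<in>{..<n}. mat_map n \<iota> h (i, j) \<otimes>\<^bsub>\<Omega>\<^esub> \<iota>v x j)"
  by (rule \<Omega>.finsum_cong') (use c i in \<open>auto simp: \<iota>v_entry\<close>)
 finally show "mat_vec n \<Omega> (mat_map n \<iota> h) (\<iota>v x) i = \<iota>v (act h x) i"
  using i by (simp add: vec_entries \<iota>v_entry)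
qed (use assms in \<open>auto intro!: \<Omega>.vec_closed \<iota>v_closed mO vec_closed\<close>)

text \<open>A nonzero proper subspace is annihilated by a nonzero functional, whose kernel over \<open>\<Omega>\<close> contains
 the \<open>\<Omega>\<close>-span of the subspace.\<close>

lemma subspace_functional:
 assumes U: "submodule U R V" and ne: "U \<noteq> carrier V"
 shows "\<exists>\<phi>. (\<forall>i<n. \<phi> i \<in> carrier R) \<and> (\<exists>i<n. \<phi> i \<noteq> \<zero>) \<and>
  (\<forall>u\<in>U. (\<Oplus>i\<in>{..<n}. \<phi> i \<otimes> u i) = \<zero>)"
proof -
 have finV: "finite (carrier V)" unfolding vec_carrier by (intro finite_PiE) (auto simp: finR)
 \<comment> \<open>A maximal proper subspace W above U exists by finiteness. For any w outside it, W
   and w together span everything, so the coordinate along w is a functional with kernel W.\<close>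
 let ?P = "{W. submodule W R V \<and> U \<subseteq> W \<and> W \<noteq> carrier V}"
 have subc: "W \<subseteq> carrier V" if "submodule W R V" for W using V.submoduleE(1)[OF that] .
 have "?P \<subseteq> Pow (carrier V)" using subc by auto
 then have "finite ?P" using finV by (simp add: finite_subset)
 moreover have "U \<in> ?P" using U ne by simp
 ultimately have "\<exists>W\<in>?P. \<forall>W'\<in>?P. W \<subseteq> W' \<longrightarrow> W = W'"
  by (intro finite_has_maximal) auto
 then obtain W where W: "W \<in> ?P" "\<And>W'. W' \<in> ?P \<Longrightarrow> W \<subseteq> W' \<Longrightarrow> W' = W"
  by (elim bexE) (rule that, auto)
 have Ws: "submodule W R V" and UW: "U \<subseteq> W" and Wne: "W \<noteq> carrier V" using W(1) by auto
 interpret W: submodule W R V by (rule Ws)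
 note WE = V.submoduleE[OF Ws]
 have Wc: "u \<in> W \<Longrightarrow> u \<in> carrier V" for u using WE(1) by blast
 obtain w where w: "w \<in> carrier V" "w \<notin> W" using Wne WE(1) by blast
 define W' where "W' = {u \<oplus>[V] c \<odot>[V] w | u c. u \<in> W \<and> c \<in> carrier R}"
 have "submodule W' R V"
 proof (rule V.submoduleI)
  show "W' \<subseteq> carrier V" using Wc w by (auto simp: W'_def)
  have z: "\<zero>[V] \<in> W" using W.one_closed by simp
  have "\<zero>[V] = \<zero>[V] \<oplus>[V] \<zero> \<odot>[V] w" using w by simp
  then show "\<zero>[V] \<in> W'" unfolding W'_def using z zero_closed by blast
  show sm: "a \<odot>[V] x \<in> W'" if a: "a \<in> carrier R" and x: "x \<in> W'" for a x
  proof -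
   obtain u c where uc: "u \<in> W" "c \<in> carrier R" "x = u \<oplus>[V] c \<odot>[V] w" using x by (auto simp: W'_def)
   have "a \<odot>[V] x = a \<odot>[V] u \<oplus>[V] (a \<otimes> c) \<odot>[V] w"
    using uc a w Wc by (simp add: V.smult_r_distr V.smult_assoc1)
   then show ?thesis unfolding W'_def using WE(4)[OF a uc(1)] m_closed[OF a uc(2)] by blast
  qed
  show "\<ominus>[V] x \<in> W'" if x: "x \<in> W'" for x
  proof -
   have "x \<in> carrier V" using x Wc w by (auto simp: W'_def)
   then have "\<ominus>[V] x = (\<ominus> \<one>) \<odot>[V] x" by (simp add: V.smult_l_minus)
   then show ?thesis using sm[OF _ x, of "\<ominus> \<one>"] by simp
  qed
  fix x y assume "x \<in> W'" "y \<in> W'"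
  then obtain u c u' c' where uc: "u \<in> W" "c \<in> carrier R" "x = u \<oplus>[V] c \<odot>[V] w"
   "u' \<in> W" "c' \<in> carrier R" "y = u' \<oplus>[V] c' \<odot>[V] w" by (auto simp: W'_def)
  have "x \<oplus>[V] y = (u \<oplus>[V] u') \<oplus>[V] (c \<oplus> c') \<odot>[V] w"
   unfolding uc using uc(1,2,4,5) w Wc by (simp add: V.smult_l_distr V.M.a_ac)
  then show "x \<oplus>[V] y \<in> W'" unfolding W'_def using WE(5)[OF uc(1,4)] a_closed[OF uc(2,5)] by blast
 qed
 moreover have "W \<subseteq> W'"
 proof
  fix u assume u: "u \<in> W"
  then have "u = u \<oplus>[V] \<zero> \<odot>[V] w" using w Wc by simp
  then show "u \<in> W'" unfolding W'_def using u zero_closed by blast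
 qed
 moreover have wW': "w \<in> W'"
 proof -
  have z: "\<zero>[V] \<in> W" using W.one_closed by simp
  have "w = \<zero>[V] \<oplus>[V] \<one> \<odot>[V] w" using w by simp
  then show ?thesis unfolding W'_def using z one_closed by blast
 qed
 ultimately have "W' = carrier V" using W(2)[of W'] UW w(2) by blast
 then have ex: "\<exists>c u. c \<in> carrier R \<and> u \<in> W \<and> y = u \<oplus>[V] c \<odot>[V] w" if "y \<in> carrier V" for y
  using that unfolding W'_def by blast
 have uniq: "c = d" if cd: "c \<in> carrier R" "d \<in> carrier R" "u \<in> W" "t \<in> W"
  "u \<oplus>[V] c \<odot>[V] w = t \<oplus>[V] d \<odot>[V] w" for c d u t
 proof (rule ccontr)
  assume "c \<noteq> d"
  then have ne0: "c \<ominus> d \<noteq> \<zero>" using cd by simp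
  then have un: "c \<ominus> d \<in> Units R" using cd by (simp add: field_Units)
  have uc: "u \<in> carrier V" "t \<in> carrier V" using cd Wc by auto
  have "(c \<ominus> d) \<odot>[V] w = t \<oplus>[V] \<ominus>[V] u"
  proof -
   have "(c \<ominus> d) \<odot>[V] w = c \<odot>[V] w \<oplus>[V] \<ominus>[V] (d \<odot>[V] w)"
    using cd w by (simp add: a_minus_def V.smult_l_distr V.smult_l_minus)
   also have "\<dots> = \<ominus>[V] u \<oplus>[V] (u \<oplus>[V] c \<odot>[V] w) \<oplus>[V] \<ominus>[V] (d \<odot>[V] w)"
    using uc cd(1) w by (simp add: V.M.a_assoc[symmetric] V.M.l_neg)
   also have "\<dots> = \<ominus>[V] u \<oplus>[V] t" unfolding cd(5) using uc cd(2) w by (simp add: V.M.a_assoc V.M.r_neg)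
   finally show ?thesis using uc by (simp add: V.M.a_comm)
  qed
  then have "(c \<ominus> d) \<odot>[V] w \<in> W" using WE(5)[OF cd(4) WE(3)[OF cd(3)]] by simp
  then have "inv (c \<ominus> d) \<odot>[V] ((c \<ominus> d) \<odot>[V] w) \<in> W" using un by (rule_tac WE(4)) simp_all
  moreover have "inv (c \<ominus> d) \<odot>[V] ((c \<ominus> d) \<odot>[V] w) = w"
   using V.smult_assoc1[of "inv (c \<ominus> d)" "c \<ominus> d" w] un w(1) cd(1,2) by simp
  ultimately have "w \<in> W" by (simp only:)
  then show False using w by simp
 qed
 define f where "f y = (SOME c. c \<in> carrier R \<and> (\<exists>u\<in>W. y = u \<oplus>[V] c \<odot>[V] w))" for y
 have f: "f y \<in> carrier R" "\<exists>u\<in>W. y = u \<oplus>[V] f y \<odot>[V] w" if "y \<in> carrier V" for y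
  using someI_ex[of "\<lambda>c. c \<in> carrier R \<and> (\<exists>u\<in>W. y = u \<oplus>[V] c \<odot>[V] w)"] ex[OF that]
  unfolding f_def by blast+
 have feq: "f y = c" if "u \<in> W" "c \<in> carrier R" "y = u \<oplus>[V] c \<odot>[V] w" for y u c
 proof -
  have y: "y \<in> carrier V" using that w Wc by simp
  obtain t where "t \<in> W" "y = t \<oplus>[V] f y \<odot>[V] w" using f(2)[OF y] by blast
  then show ?thesis using uniq[OF f(1)[OF y] that(2), of t u] that by simp
 qed
 \<comment> \<open>The functional is turned into an endomorphism all of whose coordinates are equal
   to it; \<open>linear_map_matrix\<close> then delivers its coefficients as row 0 of a
   matrix.\<close>
 define g where "g y = (\<lambda>i\<in>{..<n}. f y)" for y
 have "\<exists>D\<in>carrier MR. \<forall>x\<in>carrier V. act D x = g x"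
 proof (rule linear_map_matrix)
  show "g x \<in> carrier V" if "x \<in> carrier V" for x using f(1)[OF that] by (intro vec_carrierI) (auto simp: g_def)
  show "g (x \<oplus>[V] y) = g x \<oplus>[V] g y" if xy: "x \<in> carrier V" "y \<in> carrier V" for x y
  proof -
   obtain u where u: "u \<in> W" "x = u \<oplus>[V] f x \<odot>[V] w" using f(2)[OF xy(1)] by (rule bexE)
   obtain t where t: "t \<in> W" "y = t \<oplus>[V] f y \<odot>[V] w" using f(2)[OF xy(2)] by (rule bexE)
   note ut = u t
   have "x \<oplus>[V] y = (u \<oplus>[V] f x \<odot>[V] w) \<oplus>[V] (t \<oplus>[V] f y \<odot>[V] w)"
    using u(2) t(2) by (rule arg_cong2)
   also have "\<dots> = (u \<oplus>[V] t) \<oplus>[V] (f x \<oplus> f y) \<odot>[V] w"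
    using ut(1,3) f(1) xy w Wc by (simp add: V.smult_l_distr V.M.a_ac)
   finally have "f (x \<oplus>[V] y) = f x \<oplus> f y"
    using WE(5)[OF u(1) t(1)] a_closed[OF f(1)[OF xy(1)] f(1)[OF xy(2)]] by (rule_tac feq)
   then show ?thesis by (auto simp: g_def vec_module_def)
  qed
  show "g (a \<odot>[V] x) = a \<odot>[V] g x" if ax: "a \<in> carrier R" "x \<in> carrier V" for a x
  proof -
   obtain u where u: "u \<in> W" "x = u \<oplus>[V] f x \<odot>[V] w" using f(2)[OF ax(2)] by (rule bexE)
   have "a \<odot>[V] x = a \<odot>[V] (u \<oplus>[V] f x \<odot>[V] w)" using u(2) by (rule arg_cong)
   also have "\<dots> = a \<odot>[V] u \<oplus>[V] (a \<otimes> f x) \<odot>[V] w"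
    using u(1) f(1) ax w Wc by (simp add: V.smult_r_distr V.smult_assoc1)
   finally have "f (a \<odot>[V] x) = a \<otimes> f x"
    using WE(4)[OF ax(1) u(1)] m_closed[OF ax(1) f(1)[OF ax(2)]] by (rule_tac feq)
   then show ?thesis by (auto simp: g_def vec_module_def)
  qed
 qed
 then obtain D where D: "D \<in> carrier MR" "\<And>x. x \<in> carrier V \<Longrightarrow> act D x = g x" by auto
 define \<phi> where "\<phi> i = D (0, i)" for i
 have \<phi>: "(\<Oplus>i\<in>{..<n}. \<phi> i \<otimes> x i) = f x" if "x \<in> carrier V" for x
  using D(2)[OF that] vec_entries(5)[OF npos, of R D x] npos by (simp add: \<phi>_def g_def)
 have \<phi>c: "\<phi> i \<in> carrier R" if "i < n" for i using mat_entry[OF D(1) npos that] by (simp add: \<phi>_def)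
 have fw: "f w = \<one>" by (rule feq[of "\<zero>[V]"]) (use w W.one_closed in auto)
 have "\<exists>i<n. \<phi> i \<noteq> \<zero>"
 proof (rule ccontr)
  assume "\<not> (\<exists>i<n. \<phi> i \<noteq> \<zero>)"
  then have "(\<Oplus>i\<in>{..<n}. \<phi> i \<otimes> w i) = \<zero>"
   by (intro add.finprod_one_eqI) (use vec_entry[OF w(1)] in auto)
  then show False using \<phi>[OF w(1)] fw by simp
 qed
 moreover have "(\<Oplus>i\<in>{..<n}. \<phi> i \<otimes> u i) = \<zero>" if u: "u \<in> U" for u
 proof -
  have uW: "u \<in> W" using u UW by blast
  have "f u = \<zero>" by (rule feq[OF uW]) (use Wc[OF uW] w in auto)
  then show ?thesis using \<phi>[OF Wc[OF uW]] by simp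
 qed
 ultimately show ?thesis using \<phi>c by blast
qed

text \<open>A proper nonzero stable subspace would span a proper nonzero stable subspace over
  \<Omega>: the span is annihilated by the functional of \<open>subspace_functional\<close>, which
  remains nonzero after extension of scalars.\<close>

lemma irreducible_base:
 assumes U: "submodule U R V" and st: "\<And>h x. h \<in> H \<Longrightarrow> x \<in> U \<Longrightarrow> act h x \<in> U"
 shows "U = {\<zero>[V]} \<or> U = carrier V"
proof (rule ccontr)
 assume n: "\<not> (U = {\<zero>[V]} \<or> U = carrier V)"
 note UE = V.submoduleE[OF U]
 interpret U: submodule U R V by (rule U)
 obtain \<phi> where \<phi>: "\<forall>i<n. \<phi> i \<in> carrier R" "\<exists>i<n. \<phi> i \<noteq> \<zero>" "\<forall>u\<in>U. (\<Oplus>i\<in>{..<n}. \<phi> i \<otimes> u i) = \<zero>"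
  using subspace_functional[OF U] n by blast
 define \<Phi> where "\<Phi> x = (\<Oplus>\<^bsub>\<Omega>\<^esub>i\<in>{..<n}. \<iota> (\<phi> i) \<otimes>\<^bsub>\<Omega>\<^esub> x i)" for x
 \<comment> \<open>The \<Omega>-span of U, taken as an intersection of submodules; every containment
   below is then an instance of its minimality \<open>Wmin\<close>.\<close>
 define W where "W = \<Inter>{W. submodule W \<Omega> VO \<and> \<iota>v ` U \<subseteq> W}"
 have Uc: "u \<in> U \<Longrightarrow> u \<in> carrier V" for u using UE(1) by blast
 have top: "carrier VO \<in> {W. submodule W \<Omega> VO \<and> \<iota>v ` U \<subseteq> W}"
  using VO.carrier_is_submodule \<iota>v_closed Uc by auto
 have Wmin: "W \<subseteq> W'" if "submodule W' \<Omega> VO" "\<iota>v ` U \<subseteq> W'" for W' using that by (auto simp: W_def)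
 have "submodule W \<Omega> VO"
 proof (rule VO.submoduleI)
  show "W \<subseteq> carrier VO" using Wmin top by simp
  have z: "\<zero>[VO] \<in> W'" if "submodule W' \<Omega> VO" for W'
   using subgroup.one_closed[OF submodule.axioms(1)[OF that]] by simp
  then show "\<zero>[VO] \<in> W" by (auto simp: W_def)
  show "\<ominus>[VO] a \<in> W" if "a \<in> W" for a using that VO.submoduleE(3) by (auto simp: W_def)
  show "a \<oplus>[VO] b \<in> W" if "a \<in> W" "b \<in> W" for a b using that VO.submoduleE(5) by (auto simp: W_def)
  show "a \<odot>[VO] x \<in> W" if "a \<in> carrier \<Omega>" "x \<in> W" for a x using that VO.submoduleE(4) by (auto simp: W_def)
 qed
 then have WE: "W = {\<zero>[VO]} \<or> W = carrier VO"
 proof (rule irr)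
  fix h x assume h: "h \<in> H" and x: "x \<in> W"
  note hO = mO[OF Hc[OF h]]
  let ?h = "mat_vec n \<Omega> (mat_map n \<iota> h)"
  show "?h x \<in> W" unfolding W_def
  proof (rule InterI)
   fix W' assume "W' \<in> {W. submodule W \<Omega> VO \<and> \<iota>v ` U \<subseteq> W}"
   then have W': "submodule W' \<Omega> VO" "\<iota>v ` U \<subseteq> W'" by auto
   note E = VO.submoduleE[OF W'(1)]
   \<comment> \<open>Stability of the span: the preimage of W' under h is a submodule that contains
     the image of U, hence it contains W.\<close>
   have "submodule {x \<in> carrier VO. ?h x \<in> W'} \<Omega> VO"
   proof (rule VO.submoduleI)
    have h0: "?h \<zero>[VO] = \<zero>[VO]"
     using \<Omega>.mat_vec_linear(2)[OF hO \<Omega>.vec_const_closed(1) \<Omega>.vec_const_closed(1) \<Omega>.zero_closed]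
      \<Omega>.vec_closed(3)[OF \<Omega>.vec_const_closed(1) hO] by simp
    then show "\<zero>[VO] \<in> {x \<in> carrier VO. ?h x \<in> W'}"
     using subgroup.one_closed[OF submodule.axioms(1)[OF W'(1)]] by simp
    show sm: "a \<odot>[VO] x \<in> {x \<in> carrier VO. ?h x \<in> W'}"
     if "a \<in> carrier \<Omega>" "x \<in> {x \<in> carrier VO. ?h x \<in> W'}" for a x
     using that \<Omega>.mat_vec_linear(2)[OF hO, of x x a] E(4) by simp
    show "\<ominus>[VO] x \<in> {x \<in> carrier VO. ?h x \<in> W'}" if "x \<in> {x \<in> carrier VO. ?h x \<in> W'}" for x
     using sm[OF _ that, of "\<ominus>\<^bsub>\<Omega>\<^esub> \<one>\<^bsub>\<Omega>\<^esub>"] that by (simp add: VO.smult_l_minus)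
    show "x \<oplus>[VO] y \<in> {x \<in> carrier VO. ?h x \<in> W'}"
     if "x \<in> {x \<in> carrier VO. ?h x \<in> W'}" "y \<in> {x \<in> carrier VO. ?h x \<in> W'}" for x y
     using that \<Omega>.mat_vec_linear(1)[OF hO, of x y] E(5) by simp
   qed auto
   moreover have "\<iota>v ` U \<subseteq> {x \<in> carrier VO. ?h x \<in> W'}"
    using \<iota>v_closed Uc \<iota>v_act[OF Hc[OF h]] st[OF h] W'(2) by auto
   ultimately show "?h x \<in> W'" using Wmin x by blast
  qed
 qed
 have \<phi>O: "\<iota> (\<phi> i) \<in> carrier \<Omega>" if "i < n" for i using \<phi>(1) that by simp
 have "submodule {x \<in> carrier VO. \<Phi> x = \<zero>\<^bsub>\<Omega>\<^esub>} \<Omega> VO"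
 proof (rule VO.submoduleI)
  have "\<Phi> \<zero>[VO] = \<zero>\<^bsub>\<Omega>\<^esub>" unfolding \<Phi>_def by (rule \<Omega>.add.finprod_one_eqI) (use \<phi>O in \<open>auto simp: vec_entries\<close>)
  then show "\<zero>[VO] \<in> {x \<in> carrier VO. \<Phi> x = \<zero>\<^bsub>\<Omega>\<^esub>}" by simp
  show sm: "a \<odot>[VO] x \<in> {x \<in> carrier VO. \<Phi> x = \<zero>\<^bsub>\<Omega>\<^esub>}"
   if a: "a \<in> carrier \<Omega>" and x: "x \<in> {x \<in> carrier VO. \<Phi> x = \<zero>\<^bsub>\<Omega>\<^esub>}" for a x
  proof -
   have xc: "x \<in> carrier VO" using x by simp
   have "\<Phi> (a \<odot>[VO] x) = (\<Oplus>\<^bsub>\<Omega>\<^esub>i\<in>{..<n}. a \<otimes>\<^bsub>\<Omega>\<^esub> (\<iota> (\<phi> i) \<otimes>\<^bsub>\<Omega>\<^esub> x i))" unfolding \<Phi>_def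
    by (rule \<Omega>.finsum_cong') (use \<phi>O a vec_entry[OF xc] in \<open>auto simp: vec_entries \<Omega>.m_lcomm\<close>)
   also have "\<dots> = a \<otimes>\<^bsub>\<Omega>\<^esub> \<Phi> x" unfolding \<Phi>_def
    by (rule \<Omega>.finsum_rdistr[symmetric]) (use \<phi>O a vec_entry[OF xc] in auto)
   finally show ?thesis using x a by simp
  qed
  show "\<ominus>[VO] x \<in> {x \<in> carrier VO. \<Phi> x = \<zero>\<^bsub>\<Omega>\<^esub>}" if "x \<in> {x \<in> carrier VO. \<Phi> x = \<zero>\<^bsub>\<Omega>\<^esub>}" for x
   using sm[OF _ that, of "\<ominus>\<^bsub>\<Omega>\<^esub> \<one>\<^bsub>\<Omega>\<^esub>"] that by (simp add: VO.smult_l_minus)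
  show "x \<oplus>[VO] y \<in> {x \<in> carrier VO. \<Phi> x = \<zero>\<^bsub>\<Omega>\<^esub>}"
   if xy: "x \<in> {x \<in> carrier VO. \<Phi> x = \<zero>\<^bsub>\<Omega>\<^esub>}" "y \<in> {x \<in> carrier VO. \<Phi> x = \<zero>\<^bsub>\<Omega>\<^esub>}" for x y
  proof -
   have xc: "x \<in> carrier VO" "y \<in> carrier VO" using xy by auto
   have "\<Phi> (x \<oplus>[VO] y) = (\<Oplus>\<^bsub>\<Omega>\<^esub>i\<in>{..<n}. \<iota> (\<phi> i) \<otimes>\<^bsub>\<Omega>\<^esub> x i \<oplus>\<^bsub>\<Omega>\<^esub> \<iota> (\<phi> i) \<otimes>\<^bsub>\<Omega>\<^esub> y i)" unfolding \<Phi>_def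
    by (rule \<Omega>.finsum_cong') (use \<phi>O vec_entry[OF xc(1)] vec_entry[OF xc(2)] in \<open>auto simp: vec_entries \<Omega>.r_distr\<close>)
   also have "\<dots> = \<Phi> x \<oplus>\<^bsub>\<Omega>\<^esub> \<Phi> y" unfolding \<Phi>_def
    by (rule \<Omega>.finsum_addf) (use \<phi>O vec_entry[OF xc(1)] vec_entry[OF xc(2)] in auto)
   finally show ?thesis using xy by simp
  qed
 qed auto
 moreover have "\<iota>v ` U \<subseteq> {x \<in> carrier VO. \<Phi> x = \<zero>\<^bsub>\<Omega>\<^esub>}"
 proof
  fix y assume "y \<in> \<iota>v ` U"
  then obtain u where u: "u \<in> U" "y = \<iota>v u" by auto
  note uc = Uc[OF u(1)]
  have "\<iota> (\<Oplus>i\<in>{..<n}. \<phi> i \<otimes> u i) = (\<Oplus>\<^bsub>\<Omega>\<^esub>i\<in>{..<n}. \<iota> (\<phi> i \<otimes> u i))"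
   by (rule ring_hom_finsum[OF \<iota> is_cring \<Omega>.is_cring]) (use \<phi>(1) vec_entry[OF uc] in auto)
  also have "\<dots> = \<Phi> y" unfolding \<Phi>_def
   by (rule \<Omega>.finsum_cong') (use \<phi>(1) vec_entry[OF uc] in \<open>auto simp: u \<iota>v_entry\<close>)
  finally have "\<Phi> y = \<iota> \<zero>" using \<phi>(3) u by simp
  then show "y \<in> {x \<in> carrier VO. \<Phi> x = \<zero>\<^bsub>\<Omega>\<^esub>}" using \<iota>v_closed[OF uc] u by simp
 qed
 ultimately have Wsub: "W \<subseteq> {x \<in> carrier VO. \<Phi> x = \<zero>\<^bsub>\<Omega>\<^esub>}" by (rule Wmin)
 obtain u where u: "u \<in> U" "u \<noteq> \<zero>[V]" using n UE(2) by blast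
 have "\<iota>v u \<noteq> \<zero>[VO]"
 proof
  assume z: "\<iota>v u = \<zero>[VO]"
  have "u i = \<zero>" if i: "i < n" for i
  proof -
   have "\<iota> (u i) = \<zero>\<^bsub>\<Omega>\<^esub>" using arg_cong[OF z, of "\<lambda>f. f i"] i by (simp add: \<iota>v_entry vec_entries)
   then show ?thesis using \<iota>_inj vec_entry[OF Uc[OF u(1)] i] by simp
  qed
  then have "u = \<zero>[V]" using Uc[OF u(1)] by (intro vec_eqI[of _ n R]) (auto simp: vec_entries vec_const_closed)
  then show False using u by simp
 qed
 moreover have "\<iota>v u \<in> W" using u(1) by (auto simp: W_def)
 ultimately have Wall: "W = carrier VO" using WE by auto
 obtain i where i: "i < n" "\<phi> i \<noteq> \<zero>" using \<phi>(2) by auto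
 have "\<Phi> (eO i) = (\<Oplus>\<^bsub>\<Omega>\<^esub>k\<in>{..<n}. \<iota> (\<phi> k) \<otimes>\<^bsub>\<Omega>\<^esub> (if k = i then \<one>\<^bsub>\<Omega>\<^esub> else \<zero>\<^bsub>\<Omega>\<^esub>))"
  unfolding \<Phi>_def by (rule \<Omega>.finsum_cong') (use \<phi>O in \<open>auto simp: vec_entries\<close>)
 also have "\<dots> = \<iota> (\<phi> i)" by (rule \<Omega>.finsum_delta(2)) (use \<phi>O i in auto)
 finally have "\<Phi> (eO i) \<noteq> \<zero>\<^bsub>\<Omega>\<^esub>" using i \<iota>_inj \<phi>(1) by auto
 then show False using Wsub \<Omega>.vec_const_closed(2)[of n i] unfolding Wall by auto
qed

text \<open>Powers of D repeat on a vector of the finite space, which gives an eigenvector over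
  \<Omega>. Its eigenspace is H-stable because D commutes with H, so it is everything and D is
  scalar.\<close>

lemma schur:
 assumes D: "D \<in> carrier MR" and comm: "\<And>h. h \<in> H \<Longrightarrow> D \<otimes>[MR] h = h \<otimes>[MR] D"
 shows "\<And>a b. a < n \<Longrightarrow> b < n \<Longrightarrow> a \<noteq> b \<Longrightarrow> D (a, b) = \<zero>"
proof -
 let ?D = "mat_vec n \<Omega> (mat_map n \<iota> D)"
 note DO = mO[OF D]
 have lin: "VO.lin_op ?D"
  unfolding VO.lin_op_def using \<Omega>.mat_vec_linear[OF DO] \<Omega>.vec_closed(3)[OF _ DO] by blast
 have finV: "finite (carrier V)" unfolding vec_carrier by (intro finite_PiE) (auto simp: finR)
 have pw: "(act D ^^ k) (e 0) \<in> carrier V" "(?D ^^ k) (\<iota>v (e 0)) = \<iota>v ((act D ^^ k) (e 0))" for k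
  by (induction k) (simp_all add: vec_const_closed vec_closed D \<iota>v_act)
 have "\<not> inj (\<lambda>k. (act D ^^ k) (e 0))"
  using pw(1) finV by (meson finite_subset image_subsetI range_inj_infinite)
 then obtain i j where "i \<noteq> j" "(act D ^^ i) (e 0) = (act D ^^ j) (e 0)" by (auto simp: inj_def)
 then obtain i j where ij: "i < j" "(act D ^^ i) (e 0) = (act D ^^ j) (e 0)" by (metis nat_neq_iff)
 have ne: "\<iota>v (e 0) \<noteq> \<zero>[VO]"
 proof
  assume "\<iota>v (e 0) = \<zero>[VO]"
  from arg_cong[OF this, of "\<lambda>f. f 0"] show False using npos \<Omega>.one_not_zero by (simp add: \<iota>v_entry vec_entries)
 qed
 obtain c w where c: "c \<in> carrier \<Omega>" "w \<in> carrier VO" "w \<noteq> \<zero>[VO]" "?D w = c \<odot>[VO] w"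
  using VO.exists_eigenvector[OF \<Omega> lin \<iota>v_closed[OF vec_const_closed(2)] ne ij(1)] ij(2) pw(2) by auto
 define W where "W = {x \<in> carrier VO. ?D x = c \<odot>[VO] x}"
 have "submodule W \<Omega> VO"
 proof (rule VO.submoduleI)
  show "\<zero>[VO] \<in> W"
   using \<Omega>.mat_vec_linear(2)[OF DO \<Omega>.vec_const_closed(1) \<Omega>.vec_const_closed(1) \<Omega>.zero_closed]
    \<Omega>.vec_closed(3)[OF \<Omega>.vec_const_closed(1) DO] c(1) by (simp add: W_def)
  show sm: "a \<odot>[VO] x \<in> W" if "a \<in> carrier \<Omega>" "x \<in> W" for a x
   using that c(1) \<Omega>.mat_vec_linear(2)[OF DO, of x x a]
   by (simp add: W_def VO.smult_assoc1[symmetric] \<Omega>.m_comm)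
  show "\<ominus>[VO] x \<in> W" if "x \<in> W" for x
   using sm[OF _ that, of "\<ominus>\<^bsub>\<Omega>\<^esub> \<one>\<^bsub>\<Omega>\<^esub>"] that by (simp add: VO.smult_l_minus W_def)
  show "x \<oplus>[VO] y \<in> W" if "x \<in> W" "y \<in> W" for x y
   using that c(1) \<Omega>.mat_vec_linear(1)[OF DO, of x y] by (simp add: W_def VO.smult_r_distr)
 qed (auto simp: W_def)
 then have "W = {\<zero>[VO]} \<or> W = carrier VO"
 proof (rule irr)
  fix h x assume h: "h \<in> H" and x: "x \<in> W"
  note hO = mO[OF Hc[OF h]]
  let ?h = "mat_vec n \<Omega> (mat_map n \<iota> h)"
  note hm = mat_map_hom[OF \<iota> is_cring \<Omega>.is_cring, of n]
  have xc: "x \<in> carrier VO" using x by (simp add: W_def)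
  have "?D (?h x) = mat_vec n \<Omega> (mat_map n \<iota> (D \<otimes>[MR] h)) x"
   using \<Omega>.mat_vec_mult[OF DO hO xc] ring_hom_mult[OF hm D Hc[OF h]] by simp
  also have "\<dots> = ?h (?D x)"
   unfolding comm[OF h] using \<Omega>.mat_vec_mult[OF hO DO xc] ring_hom_mult[OF hm Hc[OF h] D] by simp
  also have "\<dots> = c \<odot>[VO] ?h x" using x \<Omega>.mat_vec_linear(2)[OF hO xc xc c(1)] by (simp add: W_def)
  finally show "?h x \<in> W" using \<Omega>.vec_closed(3)[OF xc hO] by (simp add: W_def)
 qed
 then have Wall: "W = carrier VO" using c by (auto simp: W_def)
 fix a b assume ab: "a < n" "b < n" "a \<noteq> b"
 have "eO b \<in> W" unfolding Wall by (rule \<Omega>.vec_const_closed(2))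
 then have "?D (eO b) a = (c \<odot>[VO] eO b) a" by (simp add: W_def)
 then have "\<iota> (D (a, b)) = \<zero>\<^bsub>\<Omega>\<^esub>" using ab c(1) \<Omega>.mat_vec_unit[OF DO ab(1,2)] by (simp add: vec_entries)
 then show "D (a, b) = \<zero>" using \<iota>_inj mat_entry[OF D ab(1,2)] by simp
qed

lemma act_closed: "\<mu> \<in> \<Lambda> \<Longrightarrow> x \<in> carrier V \<Longrightarrow> act \<mu> x \<in> carrier V"
 using vec_closed(3) span_closed by blast

lemma span_neg: "\<mu> \<in> \<Lambda> \<Longrightarrow> mat_smult n R (\<ominus> \<one>) \<mu> \<in> \<Lambda>"
 by (rule span_smult) auto

lemma act_neg: "\<mu> \<in> \<Lambda> \<Longrightarrow> x \<in> carrier V \<Longrightarrow> act (mat_smult n R (\<ominus> \<one>) \<mu>) x = \<ominus>[V] act \<mu> x"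
 using mat_vec_mat(2)[OF span_closed span_closed, of \<mu> \<mu> x "\<ominus> \<one>"] act_closed[of \<mu> x] by (simp add: V.smult_l_minus)

text \<open>Jacobson density for the standard basis, by induction on the number of prescribed columns. If the
 elements killing the first \<open>r\<close> basis vectors also killed the next one, its image would be an
 equivariant function of the first \<open>r\<close> columns, hence by Schur's lemma diagonal.\<close>

lemma density:
 "r \<le> n \<Longrightarrow> (\<And>i. i < r \<Longrightarrow> w i \<in> carrier V) \<Longrightarrow> \<exists>\<mu>\<in>\<Lambda>. \<forall>i<r. act \<mu> (e i) = w i"
proof (induction r arbitrary: w)
 case 0
 then show ?case using mat_span.zero by blast
next
 case (Suc r)
 have rn: "r < n" using Suc.prems by simp
 have ec: "e i \<in> carrier V" for i by (rule vec_const_closed)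
 have IH: "\<exists>\<mu>\<in>\<Lambda>. \<forall>i<r. act \<mu> (e i) = w i" if "\<And>i. i < r \<Longrightarrow> w i \<in> carrier V" for w
  by (rule Suc.IH) (use that rn in auto)
 have add: "act (\<mu> \<oplus>[MR] \<nu>) x = act \<mu> x \<oplus>[V] act \<nu> x" if "\<mu> \<in> \<Lambda>" "\<nu> \<in> \<Lambda>" "x \<in> carrier V" for \<mu> \<nu> x
  using mat_vec_mat(1) span_closed that by blast
 have mult: "act (\<mu> \<otimes>[MR] \<nu>) x = act \<mu> (act \<nu> x)" if "\<mu> \<in> \<Lambda>" "\<nu> \<in> \<Lambda>" "x \<in> carrier V" for \<mu> \<nu> x
  using mat_vec_mult span_closed that by blast
 have smult: "act (mat_smult n R c \<mu>) x = c \<odot>[V] act \<mu> x" if "c \<in> carrier R" "\<mu> \<in> \<Lambda>" "x \<in> carrier V" for c \<mu> x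
  using mat_vec_mat(2) span_closed that by blast
 have act0: "act \<mu> \<zero>[V] = \<zero>[V]" if \<mu>: "\<mu> \<in> \<Lambda>" for \<mu>
  using mat_vec_linear(2)[OF span_closed[OF \<mu>] vec_const_closed(1) vec_const_closed(1) zero_closed]
   act_closed[OF \<mu> vec_const_closed(1)] by simp
 \<comment> \<open>U consists of the values at \<open>e r\<close> of those elements that kill the
   preceding basis vectors. It is H-stable, hence zero or everything.\<close>
 define L0 where "L0 = {\<mu> \<in> \<Lambda>. \<forall>i<r. act \<mu> (e i) = \<zero>[V]}"
 define U where "U = (\<lambda>\<mu>. act \<mu> (e r)) ` L0"
 have "submodule U R V"
 proof (rule V.submoduleI)
  show "U \<subseteq> carrier V" using act_closed ec by (auto simp: U_def L0_def)
  have "\<zero>[MR] \<in> L0" using mat_span.zero mat_vec_mat(4)[OF MR.zero_closed MR.zero_closed ec] by (auto simp: L0_def)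
  moreover have "act \<zero>[MR] (e r) = \<zero>[V]" by (rule mat_vec_mat(4)[OF MR.zero_closed MR.zero_closed ec])
  ultimately show "\<zero>[V] \<in> U" unfolding U_def by (metis imageI)
  show sm: "a \<odot>[V] x \<in> U" if a: "a \<in> carrier R" and x: "x \<in> U" for a x
  proof -
   obtain \<mu> where \<mu>: "\<mu> \<in> L0" "x = act \<mu> (e r)" using x by (auto simp: U_def)
   have "mat_smult n R a \<mu> \<in> L0" using \<mu> a ec span_smult[OF a] by (auto simp: L0_def smult)
   moreover have "act (mat_smult n R a \<mu>) (e r) = a \<odot>[V] x" using \<mu> a ec by (simp add: L0_def smult)
   ultimately show ?thesis unfolding U_def by (metis imageI)
  qed
  show "\<ominus>[V] x \<in> U" if x: "x \<in> U" for x
  proof -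
   have "x \<in> carrier V" using x act_closed ec by (auto simp: U_def L0_def)
   then show ?thesis using sm[OF _ x, of "\<ominus> \<one>"] by (simp add: V.smult_l_minus)
  qed
  fix x y assume "x \<in> U" "y \<in> U"
  then obtain \<mu> \<nu> where \<mu>: "\<mu> \<in> L0" "x = act \<mu> (e r)" "\<nu> \<in> L0" "y = act \<nu> (e r)" by (auto simp: U_def)
  have "\<mu> \<oplus>[MR] \<nu> \<in> L0" using \<mu> ec span_add by (auto simp: L0_def add)
  moreover have "act (\<mu> \<oplus>[MR] \<nu>) (e r) = x \<oplus>[V] y" using \<mu> ec by (simp add: L0_def add)
  ultimately show "x \<oplus>[V] y \<in> U" unfolding U_def by (metis imageI)
 qed
 then have cases: "U = {\<zero>[V]} \<or> U = carrier V"
 proof (rule irreducible_base)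
  fix h x assume h: "h \<in> H" and "x \<in> U"
  then obtain \<mu> where \<mu>: "\<mu> \<in> L0" "x = act \<mu> (e r)" by (auto simp: U_def)
  note hL = span_base[OF h]
  have "h \<otimes>[MR] \<mu> \<in> L0" using \<mu> span_mult[OF hL] ec by (auto simp: L0_def mult[OF hL] act0[OF hL])
  moreover have "act (h \<otimes>[MR] \<mu>) (e r) = act h x" using \<mu> ec by (simp add: L0_def mult[OF hL])
  ultimately show "act h x \<in> U" unfolding U_def by (metis imageI)
 qed
 show ?case
 proof (cases "U = carrier V")
  case True
  \<comment> \<open>An element with the prescribed values on the first r vectors is corrected at
    \<open>e r\<close> by an element of \<open>L0\<close>, which leaves those values
    unchanged.\<close>
  obtain \<mu> where \<mu>: "\<mu> \<in> \<Lambda>" "\<forall>i<r. act \<mu> (e i) = w i" using IH[of w] Suc.prems(2) by auto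
  have wc: "w r \<in> carrier V" "act \<mu> (e r) \<in> carrier V" using Suc.prems(2)[of r] act_closed[OF \<mu>(1) ec] by auto
  then have "w r \<ominus>[V] act \<mu> (e r) \<in> U" unfolding True by simp
  then obtain \<nu> where \<nu>: "\<nu> \<in> L0" "act \<nu> (e r) = w r \<ominus>[V] act \<mu> (e r)" by (auto simp: U_def)
  have \<nu>L: "\<nu> \<in> \<Lambda>" using \<nu> by (simp add: L0_def)
  have "act (\<mu> \<oplus>[MR] \<nu>) (e i) = w i" if i: "i < Suc r" for i
  proof (cases "i = r")
   case True
   have "act \<mu> (e r) \<oplus>[V] (w r \<ominus>[V] act \<mu> (e r)) = w r"
    using wc by (simp add: V.M.minus_eq V.M.a_lcomm V.M.r_neg)
   then show ?thesis using True \<nu>(2) add[OF \<mu>(1) \<nu>L ec] by simp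
  next
   case False
   then have "i < r" using i by simp
   then show ?thesis using \<mu>(2) \<nu>(1) add[OF \<mu>(1) \<nu>L ec] Suc.prems(2)[of i] by (simp add: L0_def)
  qed
  then show ?thesis using span_add[OF \<mu>(1) \<nu>L] by blast
 next
  case False
  then have U0: "U = {\<zero>[V]}" using cases by blast
  \<comment> \<open>If U is zero, the value at \<open>e r\<close> is determined by the values at the
    preceding basis vectors.\<close>
  have star: "act \<mu> (e r) = act \<nu> (e r)"
   if \<mu>: "\<mu> \<in> \<Lambda>" and \<nu>: "\<nu> \<in> \<Lambda>" and eq: "\<And>i. i < r \<Longrightarrow> act \<mu> (e i) = act \<nu> (e i)" for \<mu> \<nu>
  proof -
   let ?\<delta> = "\<mu> \<oplus>[MR] mat_smult n R (\<ominus> \<one>) \<nu>"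
   have d: "act ?\<delta> (e i) = act \<mu> (e i) \<ominus>[V] act \<nu> (e i)" for i
    using add[OF \<mu> span_neg[OF \<nu>] ec] act_neg[OF \<nu> ec] by (simp add: V.M.minus_eq)
   have "?\<delta> \<in> L0" using span_add[OF \<mu> span_neg[OF \<nu>]] eq act_closed[OF \<nu> ec]
    by (simp add: L0_def d V.M.minus_eq V.M.r_neg)
   then have "act ?\<delta> (e r) \<in> {\<zero>[V]}" unfolding U0[symmetric] U_def by (rule imageI)
   then show ?thesis using d[of r] V.M.diff_zero_eq[OF act_closed[OF \<mu> ec] act_closed[OF \<nu> ec]] by simp
  qed
  \<comment> \<open>Prescribing x at \<open>e i\<close> and zero at the other vectors makes the
    value at \<open>e r\<close> a linear H-equivariant function of x. By Schur's lemma its matrix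
    vanishes at (r, i), as i < r.\<close>
  have off: "act \<mu> (e r) r = \<zero>"
   if i: "i < r" and \<mu>: "\<mu> \<in> \<Lambda>" "act \<mu> (e i) = e i" "\<And>k. k < r \<Longrightarrow> k \<noteq> i \<Longrightarrow> act \<mu> (e k) = \<zero>[V]" for i \<mu>
  proof -
   define g where "g x = (SOME \<mu>. \<mu> \<in> \<Lambda> \<and> (\<forall>k<r. act \<mu> (e k) = (if k = i then x else \<zero>[V])))" for x
   have g: "g x \<in> \<Lambda>" "\<And>k. k < r \<Longrightarrow> act (g x) (e k) = (if k = i then x else \<zero>[V])" if x: "x \<in> carrier V" for x
   proof -
    have "\<exists>\<mu>\<in>\<Lambda>. \<forall>k<r. act \<mu> (e k) = (if k = i then x else \<zero>[V])" by (rule IH) (use x in auto)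
    then have "\<exists>\<mu>. \<mu> \<in> \<Lambda> \<and> (\<forall>k<r. act \<mu> (e k) = (if k = i then x else \<zero>[V]))" by blast
    from someI_ex[OF this] show "g x \<in> \<Lambda>" "\<And>k. k < r \<Longrightarrow> act (g x) (e k) = (if k = i then x else \<zero>[V])"
     by (auto simp: g_def)
   qed
   let ?f = "\<lambda>x. act (g x) (e r)"
   have fuse: "?f x = act \<nu> (e r)" if "x \<in> carrier V" "\<nu> \<in> \<Lambda>"
    "\<And>k. k < r \<Longrightarrow> act \<nu> (e k) = (if k = i then x else \<zero>[V])" for x \<nu>
    by (rule star) (use that g in auto)
   have fc: "?f x \<in> carrier V" if "x \<in> carrier V" for x by (rule act_closed[OF g(1)[OF that] ec])
   have fadd: "?f (x \<oplus>[V] y) = ?f x \<oplus>[V] ?f y" if xy: "x \<in> carrier V" "y \<in> carrier V" for x y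
   proof -
    have "?f (x \<oplus>[V] y) = act (g x \<oplus>[MR] g y) (e r)"
     by (rule fuse) (use xy g in \<open>auto simp: add ec span_add\<close>)
    then show ?thesis using xy g ec by (simp add: add)
   qed
   have fsm: "?f (a \<odot>[V] x) = a \<odot>[V] ?f x" if ax: "a \<in> carrier R" "x \<in> carrier V" for a x
   proof -
    have "?f (a \<odot>[V] x) = act (mat_smult n R a (g x)) (e r)"
     by (rule fuse) (use ax g in \<open>auto simp: smult ec span_smult\<close>)
    then show ?thesis using ax g ec by (simp add: smult)
   qed
   have fH: "?f (act h x) = act h (?f x)" if h: "h \<in> H" and x: "x \<in> carrier V" for h x
   proof -
    note hL = span_base[OF h]
    have "?f (act h x) = act (h \<otimes>[MR] g x) (e r)"
     by (rule fuse) (use x g hL in \<open>auto simp: mult ec span_mult act_closed act0\<close>)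
    then show ?thesis using x g ec hL by (simp add: mult)
   qed
   obtain D where D: "D \<in> carrier MR" "\<And>x. x \<in> carrier V \<Longrightarrow> act D x = ?f x"
    using linear_map_matrix[of n ?f, OF fc fadd fsm] by auto
   have "D \<otimes>[MR] h = h \<otimes>[MR] D" if h: "h \<in> H" for h
   proof (rule mat_eqI[of _ n R])
    fix a b assume ab: "a < n" "b < n"
    note hc = Hc[OF h]
    have "act (D \<otimes>[MR] h) (e b) = act (h \<otimes>[MR] D) (e b)"
     using mat_vec_mult[OF D(1) hc ec] mat_vec_mult[OF hc D(1) ec] D(2) ec fH[OF h ec] vec_closed(3)[OF ec hc] by simp
    then show "(D \<otimes>[MR] h) (a, b) = (h \<otimes>[MR] D) (a, b)"
     using mat_vec_unit[OF mat_closed(1)[OF D(1) hc] ab] mat_vec_unit[OF mat_closed(1)[OF hc D(1)] ab] by simp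
   qed (use D(1) Hc[OF h] in auto)
   then have "D (r, i) = \<zero>" by (rule schur[OF D(1)]) (use i rn in auto)
   moreover have "act \<mu> (e r) = ?f (e i)" by (rule fuse[symmetric]) (use \<mu> ec in auto)
   ultimately show ?thesis using mat_vec_unit[OF D(1) rn, of i] D(2)[OF ec, of i] i rn by simp
  qed
  \<comment> \<open>Summing such elements over i < r gives one that fixes the first r vectors and
    whose value at \<open>e r\<close> has r-th coordinate zero. The identity fixes the same vectors,
    so \<open>star\<close> leads to 1 = 0.\<close>
  have diag: "s \<le> r \<Longrightarrow> \<exists>\<mu>\<in>\<Lambda>. (\<forall>k<r. act \<mu> (e k) = (if k < s then e k else \<zero>[V])) \<and> act \<mu> (e r) r = \<zero>" for s
  proof (induction s)
   case 0
   have "act \<zero>[MR] (e k) = \<zero>[V]" for k by (rule mat_vec_mat(4)[OF MR.zero_closed MR.zero_closed ec])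
   then show ?case using mat_span.zero rn by (intro bexI[of _ "\<zero>[MR]"]) (auto simp: vec_entries)
  next
   case (Suc s)
   then obtain \<mu> where \<mu>: "\<mu> \<in> \<Lambda>" "\<And>k. k < r \<Longrightarrow> act \<mu> (e k) = (if k < s then e k else \<zero>[V])" "act \<mu> (e r) r = \<zero>" by auto
   have "\<exists>\<nu>\<in>\<Lambda>. \<forall>k<r. act \<nu> (e k) = (if k = s then e k else \<zero>[V])"
    by (rule IH) (simp add: ec)
   then obtain \<nu> where \<nu>: "\<nu> \<in> \<Lambda>" "\<And>k. k < r \<Longrightarrow> act \<nu> (e k) = (if k = s then e k else \<zero>[V])"
    by (elim bexE, rule_tac that) blast+
   have "act \<nu> (e r) r = \<zero>" by (rule off[of s]) (use \<nu> Suc.prems in auto)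
   then have "act (\<mu> \<oplus>[MR] \<nu>) (e r) r = \<zero>" using \<mu>(3) rn add[OF \<mu>(1) \<nu>(1) ec] by (simp add: vec_entries)
   moreover have "act (\<mu> \<oplus>[MR] \<nu>) (e k) = (if k < Suc s then e k else \<zero>[V])" if k: "k < r" for k
    using add[OF \<mu>(1) \<nu>(1) ec, of k] \<mu>(2)[OF k] \<nu>(2)[OF k] ec by (auto simp: less_Suc_eq)
   ultimately show ?case using span_add[OF \<mu>(1) \<nu>(1)] by blast
  qed
  obtain \<mu> where \<mu>: "\<mu> \<in> \<Lambda>" "\<And>k. k < r \<Longrightarrow> act \<mu> (e k) = (if k < r then e k else \<zero>[V])" "act \<mu> (e r) r = \<zero>"
   using diag[OF order_refl] by blast
  have "act \<mu> (e r) = act \<one>[MR] (e r)"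
   by (rule star[OF \<mu>(1) span_base[OF oneH]]) (simp add: \<mu>(2) mat_vec_mat(3)[OF MR.one_closed MR.one_closed ec])
  then have "act \<mu> (e r) = e r" by (simp add: mat_vec_mat(3)[OF MR.one_closed MR.one_closed ec])
  then show ?thesis using \<mu>(3) rn one_not_zero by (simp add: vec_entries)
 qed
qed

text \<open>Density with r = n prescribes every column of a matrix.\<close>

theorem burnside: "carrier MR \<subseteq> \<Lambda>"
proof
 fix M assume M: "M \<in> carrier MR"
 have "\<exists>\<mu>\<in>\<Lambda>. \<forall>i<n. act \<mu> (e i) = act M (e i)"
  by (rule density) (auto intro!: vec_closed M vec_const_closed)
 then obtain \<mu> where \<mu>: "\<mu> \<in> \<Lambda>" "\<And>i. i < n \<Longrightarrow> act \<mu> (e i) = act M (e i)" by auto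
 have "\<mu> = M"
 proof (rule mat_eqI[of _ n R])
  fix a b assume ab: "a < n" "b < n"
  show "\<mu> (a, b) = M (a, b)"
   using mat_vec_unit[OF span_closed[OF \<mu>(1)] ab] mat_vec_unit[OF M ab] \<mu>(2)[OF ab(2)] by simp
 qed (use span_closed[OF \<mu>(1)] M in auto)
 then show "M \<in> \<Lambda>" using \<mu> by simp
qed

end

section \<open>Lifting a finite matrix algebra\<close>

definition mat_in :: "nat \<Rightarrow> ('a, 'b) ring_scheme \<Rightarrow> 'a set \<Rightarrow> (nat \<times> nat \<Rightarrow> 'a) \<Rightarrow> bool"
 where "mat_in n A J M \<longleftrightarrow> M \<in> carrier (Mat n A) \<and> (\<forall>i<n. \<forall>j<n. M (i, j) \<in> J)"

definition mat_unit :: "nat \<Rightarrow> ('a, 'b) ring_scheme \<Rightarrow> nat \<Rightarrow> nat \<Rightarrow> nat \<times> nat \<Rightarrow> 'a"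
 where "mat_unit n A i j = (\<lambda>(a, b) \<in> {..<n} \<times> {..<n}. if a = i \<and> b = j then \<one>[A] else \<zero>[A])"

lemma mat_unit_entry: "a < n \<Longrightarrow> b < n \<Longrightarrow> mat_unit n A i j (a, b) = (if a = i \<and> b = j then \<one>[A] else \<zero>[A])"
 by (simp add: mat_unit_def)

lemma (in ideal) ideal_finsum: "finite T \<Longrightarrow> (\<And>i. i \<in> T \<Longrightarrow> f i \<in> I) \<Longrightarrow> (\<Oplus>i\<in>T. f i) \<in> I"
proof (induction T rule: finite_induct)
 case (insert x T)
 then have "(\<Oplus>i\<in>insert x T. f i) = f x \<oplus> (\<Oplus>i\<in>T. f i)" by (intro finsum_insert) (auto simp: Icarr)
 then show ?case using insert additive_subgroup.a_closed[OF is_additive_subgroup] by simp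
qed (simp add: additive_subgroup.zero_closed[OF is_additive_subgroup])

context cring
begin

lemma mat_unit_closed: "mat_unit n R i j \<in> carrier (Mat n R)"
 by (rule mat_carrierI) (auto simp: mat_unit_def extensional_def)

lemma mat_in_mult:
 assumes J: "ideal J R" and M: "mat_in n R J M" and N: "N \<in> carrier (Mat n R)"
 shows "mat_in n R J (M \<otimes>[Mat n R] N)" "mat_in n R J (N \<otimes>[Mat n R] M)"
proof -
 interpret J: ideal J R by (rule J)
 have c: "M \<in> carrier (Mat n R)" using M by (simp add: mat_in_def)
 have e: "M (i, j) \<in> J" if "i < n" "j < n" for i j using M that by (simp add: mat_in_def)
 have "(\<Oplus>k\<in>{..<n}. M (i, k) \<otimes> N (k, j)) \<in> J" if "i < n" "j < n" for i j
  by (rule J.ideal_finsum) (use e mat_entry[OF N] that in \<open>auto intro: J.I_r_closed\<close>)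
 then show "mat_in n R J (M \<otimes>[Mat n R] N)"
  using mat_closed(1)[OF c N] by (simp add: mat_in_def mat_entries)
 have "(\<Oplus>k\<in>{..<n}. N (i, k) \<otimes> M (k, j)) \<in> J" if "i < n" "j < n" for i j
  by (rule J.ideal_finsum) (use e mat_entry[OF N] that in \<open>auto intro: J.I_l_closed\<close>)
 then show "mat_in n R J (N \<otimes>[Mat n R] M)"
  using mat_closed(1)[OF N c] by (simp add: mat_in_def mat_entries)
qed

lemma mat_in_add:
 assumes J: "ideal J R" and M: "mat_in n R J M" and N: "mat_in n R J N"
 shows "mat_in n R J (M \<oplus>[Mat n R] N)" "mat_in n R J (M \<ominus>[Mat n R] N)"
proof -
 interpret J: ideal J R by (rule J)
 interpret M: ring "Mat n R" by (rule Mat)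
 have c: "M \<in> carrier (Mat n R)" "N \<in> carrier (Mat n R)" using M N by (auto simp: mat_in_def)
 show "mat_in n R J (M \<oplus>[Mat n R] N)"
  using M N mat_closed(2)[OF c] by (auto simp: mat_in_def mat_entries)
 show "mat_in n R J (M \<ominus>[Mat n R] N)"
  using M N M.minus_closed[OF c] by (auto simp: mat_in_def mat_minus_entry[OF c] J.diff_closed)
qed

lemma mat_finsum_entry:
 assumes f: "\<And>b. b \<in> I \<Longrightarrow> f b \<in> carrier (Mat n R)" and ij: "i < n" "j < n" and I: "finite I"
 shows "(\<Oplus>\<^bsub>Mat n R\<^esub>b\<in>I. f b) (i, j) = (\<Oplus>b\<in>I. f b (i, j))"
proof -
 interpret M: ring "Mat n R" by (rule Mat)
 show ?thesis using I f
 proof (induction I)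
  case empty then show ?case using ij by (simp add: mat_entries)
 next
  case (insert b I)
  have "(\<Oplus>\<^bsub>Mat n R\<^esub>b\<in>insert b I. f b) = f b \<oplus>[Mat n R] (\<Oplus>\<^bsub>Mat n R\<^esub>b\<in>I. f b)"
   using insert by (intro M.finsum_insert) auto
  moreover have c: "f b' (i, j) \<in> carrier R" if "b' \<in> insert b I" for b'
   by (rule mat_entry[OF insert.prems[OF that] ij])
  have "(\<Oplus>b\<in>insert b I. f b (i, j)) = f b (i, j) \<oplus> (\<Oplus>b\<in>I. f b (i, j))"
   using insert.hyps c by (intro finsum_insert) auto
  ultimately show ?case using insert ij by (simp add: mat_entries)
 qed
qed

end

context local_noeth
begin

lemma mat_in_mpow_mult:
 assumes M: "mat_in n R (mpow j) M" and N: "mat_in n R (mpow k) N"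
 shows "mat_in n R (mpow (j + k)) (M \<otimes>[Mat n R] N)"
proof -
 interpret J: ideal "mpow (j + k)" R by (rule mpow_ideal)
 have c: "M \<in> carrier (Mat n R)" "N \<in> carrier (Mat n R)" using M N by (auto simp: mat_in_def)
 then show ?thesis using M N mat_closed(1)[OF c]
  by (auto simp: mat_in_def mat_entries intro!: J.ideal_finsum mpow_mult)
qed

lemma mat_in_mono: "mat_in n R (mpow k) M \<Longrightarrow> j \<le> k \<Longrightarrow> mat_in n R (mpow j) M"
 unfolding mat_in_def using mpow_antimono[of j k] by blast

text \<open>The inverse is the Neumann series.\<close>

lemma neumann:
 assumes comp: "complete_local R" and U: "U \<in> carrier (Mat n R)"
  and Um: "mat_in n R \<mm> (\<one>\<^bsub>Mat n R\<^esub> \<ominus>[Mat n R] U)"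
 shows "U \<in> Units (Mat n R)"
proof -
 let ?M = "Mat n R"
 interpret M: ring ?M by (rule Mat)
 have sep: "(\<Inter>k. mpow k) = {\<zero>}" using comp by (simp add: complete_local_def)
 have matsep: "M = N" if MN: "M \<in> carrier ?M" "N \<in> carrier ?M" "\<And>k. mat_in n R (mpow k) (M \<ominus>[?M] N)" for M N
 proof (rule mat_eqI[OF MN(1,2)])
  fix i j assume ij: "i < n" "j < n"
  have "M (i, j) \<ominus> N (i, j) \<in> mpow k" for k
   unfolding mat_minus_entry[OF MN(1,2) ij, symmetric] using MN(3)[of k] ij unfolding mat_in_def by blast
  then have "M (i, j) \<ominus> N (i, j) \<in> (\<Inter>k. mpow k)" by blast
  then have "M (i, j) \<ominus> N (i, j) = \<zero>" unfolding sep by simp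
  then show "M (i, j) = N (i, j)" using mat_entry[OF MN(1) ij] mat_entry[OF MN(2) ij] by simp
 qed
 define T where "T = \<one>[?M] \<ominus>[?M] U"
 have T: "T \<in> carrier ?M" using U by (simp add: T_def)
 have UT: "U = \<one>[?M] \<ominus>[?M] T" using U by (simp add: T_def M.minus_eq M.minus_add M.a_assoc[symmetric] M.r_neg)
 have Tp: "mat_in n R (mpow k) (T [^]\<^bsub>?M\<^esub> k)" for k
 proof (induction k)
  case 0 then show ?case using mat_entry[OF M.one_closed] by (auto simp: mat_in_def)
 next
  case (Suc k)
  from mat_in_mpow_mult[OF this, of "Suc 0" T] Um show ?case by (simp add: T_def)
 qed
 \<comment> \<open>The partial sums 1 + T + ... + T^k with T = 1 - U. They commute with T, so the
   same estimate serves the left and the right inverse.\<close>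
 define S where "S = rec_nat \<one>[?M] (\<lambda>k S. S \<oplus>[?M] T [^]\<^bsub>?M\<^esub> (Suc k))"
 have S: "S 0 = \<one>[?M]" "S (Suc k) = S k \<oplus>[?M] T [^]\<^bsub>?M\<^esub> (Suc k)" for k by (simp_all add: S_def)
 have Sc: "S k \<in> carrier ?M" for k by (induction k) (use T in \<open>auto simp: S simp del: M.nat_pow_Suc\<close>)
 have comm: "T \<otimes>[?M] S k = S k \<otimes>[?M] T" for k
 proof (induction k)
  case (Suc k)
  have "T \<otimes>[?M] T [^]\<^bsub>?M\<^esub> (Suc k) = T [^]\<^bsub>?M\<^esub> (Suc k) \<otimes>[?M] T" using T M.nat_pow_Suc2[OF T, of "Suc k"] by simp
  then show ?case using Suc T Sc by (simp add: S M.l_distr M.r_distr del: M.nat_pow_Suc)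
 qed (use T in \<open>simp add: S\<close>)
 have TS: "S k \<otimes>[?M] T \<oplus>[?M] \<one>[?M] = S k \<oplus>[?M] T [^]\<^bsub>?M\<^esub> (Suc k)" for k
 proof (induction k)
  case 0 then show ?case using T by (simp add: S M.a_comm)
 next
  case (Suc k)
  have "S (Suc k) \<otimes>[?M] T \<oplus>[?M] \<one>[?M] = (S k \<otimes>[?M] T \<oplus>[?M] \<one>[?M]) \<oplus>[?M] T [^]\<^bsub>?M\<^esub> (Suc (Suc k))"
   using T Sc by (simp add: S M.l_distr M.a_ac M.m_assoc)
  then show ?case using Suc by (simp add: S)
 qed
 have US: "U \<otimes>[?M] S k \<ominus>[?M] \<one>[?M] = \<ominus>[?M] (T [^]\<^bsub>?M\<^esub> (Suc k))"
   "S k \<otimes>[?M] U \<ominus>[?M] \<one>[?M] = \<ominus>[?M] (T [^]\<^bsub>?M\<^esub> (Suc k))" for k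
 proof -
  note [simp del] = M.nat_pow_Suc
  have 1: "U \<otimes>[?M] S k = S k \<ominus>[?M] S k \<otimes>[?M] T" "S k \<otimes>[?M] U = S k \<ominus>[?M] S k \<otimes>[?M] T"
   unfolding UT using T Sc comm[of k] by (simp_all add: M.minus_eq M.l_distr M.r_distr M.l_minus M.r_minus)
  have "S k \<ominus>[?M] S k \<otimes>[?M] T \<ominus>[?M] \<one>[?M] = S k \<ominus>[?M] (S k \<otimes>[?M] T \<oplus>[?M] \<one>[?M])"
   using T Sc by (simp add: M.minus_eq M.minus_add M.a_assoc)
  also have "\<dots> = \<ominus>[?M] (T [^]\<^bsub>?M\<^esub> (Suc k))"
   unfolding TS using T Sc by (simp add: M.minus_eq M.minus_add M.a_assoc[symmetric] M.r_neg del: M.nat_pow_Suc)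
  finally show "U \<otimes>[?M] S k \<ominus>[?M] \<one>[?M] = \<ominus>[?M] (T [^]\<^bsub>?M\<^esub> (Suc k))"
   "S k \<otimes>[?M] U \<ominus>[?M] \<one>[?M] = \<ominus>[?M] (T [^]\<^bsub>?M\<^esub> (Suc k))" by (simp_all only: 1)
 qed
 \<comment> \<open>The partial sums are Cauchy in each entry, since consecutive ones differ by a
   power of T; completeness provides the entries of the inverse.\<close>
 have "\<exists>x\<in>carrier R. \<forall>k. x \<ominus> S k (i, j) \<in> mpow k" if ij: "i < n" "j < n" for i j
 proof -
  have "S k (i, j) \<in> carrier R \<and> S (Suc k) (i, j) \<ominus> S k (i, j) \<in> mpow k" for k
  proof -
   have t: "(T [^]\<^bsub>?M\<^esub> (Suc k)) (i, j) \<in> mpow k"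
    using Tp[of "Suc k"] ij mpow_Suc_sub[of k] by (auto simp: mat_in_def simp del: M.nat_pow_Suc)
   then have tc: "(T [^]\<^bsub>?M\<^esub> (Suc k)) (i, j) \<in> carrier R" using mpow_carrier by blast
   have "S (Suc k) (i, j) = S k (i, j) \<oplus> (T [^]\<^bsub>?M\<^esub> (Suc k)) (i, j)" unfolding S mat_entries(2)[OF ij] ..
   then have "S (Suc k) (i, j) \<ominus> S k (i, j) = (T [^]\<^bsub>?M\<^esub> (Suc k)) (i, j)"
    using mat_entry[OF Sc ij, of k] tc by (simp add: minus_eq a_comm[of "S k (i, j)"] a_assoc r_neg del: M.nat_pow_Suc)
   then show ?thesis using t mat_entry[OF Sc ij, of k] by simp
  qed
  then have "\<forall>k. S k (i, j) \<in> carrier R \<and> S (Suc k) (i, j) \<ominus> S k (i, j) \<in> mpow k" by (rule allI)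
  then show ?thesis by (rule comp[unfolded complete_local_def, THEN conjunct2, THEN conjunct2, THEN spec, THEN mp])
 qed
 then obtain s where s: "\<And>i j. i < n \<Longrightarrow> j < n \<Longrightarrow> s i j \<in> carrier R"
  "\<And>i j k. i < n \<Longrightarrow> j < n \<Longrightarrow> s i j \<ominus> S k (i, j) \<in> mpow k" by metis
 define W where "W = (\<lambda>(i, j) \<in> {..<n} \<times> {..<n}. s i j)"
 have W: "W \<in> carrier ?M" by (rule mat_carrierI) (auto simp: W_def extensional_def s)
 have Wij: "W (i, j) = s i j" if "i < n" "j < n" for i j using that by (simp add: W_def)
 have WS: "mat_in n R (mpow k) (W \<ominus>[?M] S k)" for k
  using M.minus_closed[OF W Sc[of k]] by (simp add: mat_in_def mat_minus_entry[OF W Sc] Wij s)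
 have negT: "mat_in n R (mpow k) (\<ominus>\<^bsub>?M\<^esub> (T [^]\<^bsub>?M\<^esub> (Suc k)))" for k
 proof -
  have z: "mat_in n R (mpow k) \<zero>[?M]"
   using additive_subgroup.zero_closed[OF ideal.axioms(1)[OF mpow_ideal[of k]]] by (auto simp: mat_in_def mat_entries)
  have "\<ominus>[?M] (T [^]\<^bsub>?M\<^esub> (Suc k)) = \<zero>[?M] \<ominus>[?M] (T [^]\<^bsub>?M\<^esub> (Suc k))" using T by (simp add: M.minus_eq)
  then show ?thesis using mat_in_add(2)[OF mpow_ideal z mat_in_mono[OF Tp[of "Suc k"], of k]] by simp
 qed
 have "U \<otimes>[?M] W = \<one>[?M]"
 proof (rule matsep)
  fix k
  have "U \<otimes>[?M] W \<ominus>[?M] \<one>[?M] = U \<otimes>[?M] (W \<ominus>[?M] S k) \<oplus>[?M] (U \<otimes>[?M] S k \<ominus>[?M] \<one>[?M])"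
   using U W Sc[of k] by (simp add: M.minus_eq M.r_distr M.r_minus M.a_assoc M.r_neg1)
  then show "mat_in n R (mpow k) (U \<otimes>[?M] W \<ominus>[?M] \<one>[?M])"
   using mat_in_add(1)[OF mpow_ideal mat_in_mult(2)[OF mpow_ideal WS U] negT[of k]] US(1) by simp
 qed (use U W in auto)
 moreover have "W \<otimes>[?M] U = \<one>[?M]"
 proof (rule matsep)
  fix k
  have "W \<otimes>[?M] U \<ominus>[?M] \<one>[?M] = (W \<ominus>[?M] S k) \<otimes>[?M] U \<oplus>[?M] (S k \<otimes>[?M] U \<ominus>[?M] \<one>[?M])"
   using U W Sc[of k] by (simp add: M.minus_eq M.l_distr M.l_minus M.a_assoc M.r_neg1)
  then show "mat_in n R (mpow k) (W \<otimes>[?M] U \<ominus>[?M] \<one>[?M])"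
   using mat_in_add(1)[OF mpow_ideal mat_in_mult(1)[OF mpow_ideal WS U] negT[of k]] US(2) by simp
 qed (use U W in auto)
 ultimately show ?thesis using U W unfolding Units_def by blast
qed

end

subsection \<open>The coefficient field\<close>

lemma (in cring) witt_closed:
 assumes "x \<in> carrier (witt_ring p R)" "y \<in> carrier (witt_ring p R)"
 shows "x \<oplus>[witt_ring p R] y \<in> carrier (witt_ring p R)" "x \<otimes>[witt_ring p R] y \<in> carrier (witt_ring p R)"
proof -
 have "case_sum x y \<in> UNIV \<rightarrow> carrier R" using assms by (fastforce simp: witt_ring_def split: sum.split)
 then show "x \<oplus>[witt_ring p R] y \<in> carrier (witt_ring p R)" "x \<otimes>[witt_ring p R] y \<in> carrier (witt_ring p R)"
  by (auto simp: witt_ring_def)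
qed

locale char_p_coeff =
 fixes p :: nat and F :: "'f ring" and A :: "('a, 'f) witt_alg" (structure)
 assumes p: "Factorial_Ring.prime p" and Ff: "field F" and finF: "finite (carrier F)" and char: "has_char F p"
  and A: "coeff_algebra p F A" and Ap: "has_char A p" and ji: "just_infinite A"
begin

sublocale F: field F by (rule Ff)
sublocale just_infinite A by (rule ji)

abbreviation "res \<equiv> residue_map A"
definition "\<tau> a = struct_map A (teich F a)"
text \<open>The image of the whole Witt ring. By \<open>C_eq\<close> it is the Teichmueller image of
  \<open>F\<close>, hence finite, and the span of finitely many matrices over it is finite
  too.\<close>

definition "C = struct_map A ` carrier (witt_ring p F)"

lemma complete: "complete_local A" using A by (simp add: coeff_algebra_def)
lemma res_hom: "res \<in> ring_hom A F" using A by (simp add: coeff_algebra_def)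
lemma res_struct: "w \<in> carrier (witt_ring p F) \<Longrightarrow> res (struct_map A w) = w 0"
 using A by (simp add: coeff_algebra_def)

sublocale res: ring_hom_cring A F res
 by (intro ring_hom_cring.intro ring_hom_cring_axioms.intro is_cring F.is_cring res_hom)

lemma res_zero_iff: "a \<in> carrier A \<Longrightarrow> res a = \<zero>[F] \<longleftrightarrow> a \<in> \<mm>"
proof -
 have "a_kernel A F res = \<mm>" using A by (simp add: coeff_algebra_def)
 then show "a \<in> carrier A \<Longrightarrow> res a = \<zero>[F] \<longleftrightarrow> a \<in> \<mm>" unfolding a_kernel_def' by auto
qed

lemma teichW: "a \<in> carrier F \<Longrightarrow> teich F a \<in> carrier (witt_ring p F)"
 by (rule teich_closed[OF F.ring_axioms])

lemma struct_tau: "w \<in> carrier (witt_ring p F) \<Longrightarrow> struct_map A w = \<tau> (w 0)"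
 unfolding \<tau>_def by (rule struct_char_p[OF p Ff finF char A Ap])

lemma W0: "w \<in> carrier (witt_ring p F) \<Longrightarrow> w 0 \<in> carrier F" by (auto simp: witt_ring_def)

lemma C_eq: "C = \<tau> ` carrier F"
proof
 show "C \<subseteq> \<tau> ` carrier F" using struct_tau W0 by (auto simp: C_def)
 show "\<tau> ` carrier F \<subseteq> C" using teichW by (auto simp: C_def \<tau>_def)
qed

lemma C_finite: "finite C" unfolding C_eq using finF by simp

lemma res_tau: "a \<in> carrier F \<Longrightarrow> res (\<tau> a) = a"
 unfolding \<tau>_def by (subst res_struct[OF teichW]) (simp_all add: teich_def)

text \<open>The structure map sends a Witt sum or product to \<tau> of its zeroth component, and
  that component is found by applying the residue map, without computing any Witt
  polynomial.\<close>

lemma tau_hom: "\<tau> \<in> ring_hom F A"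
proof (rule ring_hom_memI)
 note h = struct_hom[OF p Ff finF char A]
 show cl: "\<tau> a \<in> carrier A" if "a \<in> carrier F" for a unfolding \<tau>_def by (rule ring_hom_closed[OF h teichW[OF that]])
 show "\<tau> \<one>[F] = \<one>" unfolding \<tau>_def by (rule struct_zero_one(2)[OF p Ff finF char A])
 fix a b assume ab: "a \<in> carrier F" "b \<in> carrier F"
 note t = teichW[OF ab(1)] teichW[OF ab(2)]
 have add: "struct_map A (teich F a \<oplus>[witt_ring p F] teich F b) = \<tau> a \<oplus> \<tau> b"
  unfolding \<tau>_def by (rule ring_hom_add[OF h t])
 have "(teich F a \<oplus>[witt_ring p F] teich F b) 0 = a \<oplus>[F] b"
  using res_struct[OF F.witt_closed(1)[OF t]] add cl ab by (simp add: res_tau)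
 then show "\<tau> (a \<oplus>[F] b) = \<tau> a \<oplus> \<tau> b"
  using struct_tau[OF F.witt_closed(1)[OF t]] add by simp
 have mult: "struct_map A (teich F a \<otimes>[witt_ring p F] teich F b) = \<tau> a \<otimes> \<tau> b"
  unfolding \<tau>_def by (rule ring_hom_mult[OF h t])
 have "(teich F a \<otimes>[witt_ring p F] teich F b) 0 = a \<otimes>[F] b"
  using res_struct[OF F.witt_closed(2)[OF t]] mult cl ab by (simp add: res_tau)
 then show "\<tau> (a \<otimes>[F] b) = \<tau> a \<otimes> \<tau> b"
  using struct_tau[OF F.witt_closed(2)[OF t]] mult by simp
qed

sublocale \<tau>: ring_hom_cring F A \<tau>
 by (intro ring_hom_cring.intro ring_hom_cring_axioms.intro is_cring F.is_cring tau_hom)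

lemma tau_C: "a \<in> carrier F \<Longrightarrow> \<tau> a \<in> C" by (simp add: C_eq)

lemma C_closed: "C \<subseteq> carrier A" "\<one> \<in> C" "\<zero> \<in> C" "a \<in> C \<Longrightarrow> b \<in> C \<Longrightarrow> a \<otimes> b \<in> C"
  "a \<in> C \<Longrightarrow> b \<in> C \<Longrightarrow> a \<oplus> b \<in> C" "a \<in> C \<Longrightarrow> \<ominus> a \<in> C"
proof -
 show "C \<subseteq> carrier A" by (auto simp: C_eq)
 show "\<one> \<in> C" "\<zero> \<in> C" using tau_C[OF F.one_closed] tau_C[OF F.zero_closed] by simp_all
 show "a \<in> C \<Longrightarrow> b \<in> C \<Longrightarrow> a \<otimes> b \<in> C" "a \<in> C \<Longrightarrow> b \<in> C \<Longrightarrow> a \<oplus> b \<in> C"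
  using tau_C by (auto simp: C_eq simp flip: \<tau>.hom_mult \<tau>.hom_add)
 show "a \<in> C \<Longrightarrow> \<ominus> a \<in> C" using tau_C[OF F.a_inv_closed] by (auto simp: C_eq simp flip: \<tau>.hom_a_inv)
qed

lemma C_res: "a \<in> C \<Longrightarrow> \<tau> (res a) = a" by (auto simp: C_eq res_tau)

subsection \<open>Descent of a finite matrix monoid to the coefficient field\<close>

text \<open>The reduction map is injective on the \<open>C\<close>-algebra \<open>\<Lambda>\<close> generated by \<open>H\<close>: for a nonzero kernel
 element \<open>\<nu>\<close> of maximal \<open>\<mm>\<close>-adic level all \<open>\<nu> l \<nu>\<close> with \<open>l \<in> \<Lambda>\<close> vanish, and since \<open>\<Lambda>\<close> contains lifts of all
 matrix units this forces \<open>\<nu>\<^sub>c\<^sub>d\<^sup>2\<close> into every power of \<open>\<mm>\<close>. So the matrix units of the residue algebra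
 have lifts in \<open>\<Lambda>\<close> multiplying in the same way.\<close>

lemma descend_finite_matrices:
 assumes npos: "0 < n" and H: "H \<subseteq> carrier (Mat n A)" "finite H" "\<one>[Mat n A] \<in> H"
  "\<And>g h. g \<in> H \<Longrightarrow> h \<in> H \<Longrightarrow> g \<otimes>[Mat n A] h \<in> H"
  and full: "carrier (Mat n F) \<subseteq> mat_span n F (carrier F) (mat_map n res ` H)"
 shows "\<exists>U\<in>Units (Mat n A). mat_map n res U = \<one>[Mat n F] \<and>
  (\<forall>h\<in>H. h \<otimes>[Mat n A] U = U \<otimes>[Mat n A] mat_map n \<tau> (mat_map n res h))"
proof -
 interpret L: mat_subalgebra A n C H
  by (intro mat_subalgebra.intro mat_subalgebra_axioms.intro is_cring C_closed H) auto
 let ?M = "Mat n A" and ?MF = "Mat n F" and ?r = "mat_map n res"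
 interpret MF: ring ?MF by (rule F.Mat)
 interpret r: ring_hom_ring ?M ?MF ?r
  by (intro ring_hom_ring.intro ring_hom_ring_axioms.intro L.MR.ring_axioms MF.ring_axioms
    mat_map_hom res_hom is_cring F.is_cring)
 define \<Lambda> where "\<Lambda> = mat_span n A C H"
 note Lc = L.span_closed[folded \<Lambda>_def] and Ladd = L.span_add[folded \<Lambda>_def]
  and Lsm = L.span_smult[folded \<Lambda>_def] and Lm = L.span_mult[folded \<Lambda>_def]
 have rsm: "?r (mat_smult n A c x) = mat_smult n F (res c) (?r x)" if "c \<in> carrier A" "x \<in> carrier ?M" for c x
  by (rule mat_eqI[of _ n F]) (use that mat_entry[OF that(2)] r.hom_closed[OF that(2)] r.hom_closed[OF mat_smult_closed[OF that]]
   in \<open>auto simp: mat_entries F.mat_smult_closed\<close>)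
 \<comment> \<open>By \<open>full\<close> every residue matrix is a combination of reductions of
   elements of H; lifting the coefficients by \<tau> gives a preimage in \<Lambda>.\<close>
 have lift: "\<exists>u\<in>\<Lambda>. ?r u = m" if "m \<in> carrier ?MF" for m
 proof -
  have "m \<in> mat_span n F (carrier F) (?r ` H)" using full that by blast
  then show ?thesis
  proof (induction rule: mat_span.induct)
   case zero
   have "?r \<zero>[?M] = \<zero>[?MF]" by (rule r.hom_zero)
   then show ?case using mat_span.zero unfolding \<Lambda>_def by blast
  next
   case (add c h x)
   then obtain g u where gu: "g \<in> H" "h = ?r g" "u \<in> \<Lambda>" "?r u = x" by auto
   have gc: "g \<in> carrier ?M" using gu H(1) by blast
   have "mat_smult n A (\<tau> c) g \<oplus>[?M] u \<in> \<Lambda>"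
    unfolding \<Lambda>_def using gu(3) by (intro mat_span.add tau_C add gu(1)) (simp add: \<Lambda>_def)
   moreover have "?r (mat_smult n A (\<tau> c) g \<oplus>[?M] u) = mat_smult n F c h \<oplus>[?MF] x"
    using gu gc add(1) Lc by (simp add: rsm res_tau mat_smult_closed)
   ultimately show ?case by blast
  qed
 qed
 have fin: "finite \<Lambda>" unfolding \<Lambda>_def by (rule L.span_finite[OF C_finite H(2) C_closed(3)])
 have in0: "mat_in n A (mpow (Suc 0)) x" if "x \<in> carrier ?M" "?r x = \<zero>[?MF]" for x
 proof -
  have "res (x (i, j)) = \<zero>[F]" if "i < n" "j < n" for i j
   using arg_cong[OF \<open>?r x = \<zero>[?MF]\<close>, of "\<lambda>f. f (i, j)"] that by (simp add: mat_entries)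
  then show ?thesis using that(1) mat_entry[OF that(1)] by (simp add: mat_in_def res_zero_iff)
 qed
 have ker: "x = \<zero>[?M]" if x: "x \<in> \<Lambda>" "?r x = \<zero>[?MF]" for x
 proof (rule ccontr)
  assume x0: "x \<noteq> \<zero>[?M]"
  have ex: "\<exists>k. \<not> mat_in n A (mpow k) y" if y: "y \<in> \<Lambda>" "y \<noteq> \<zero>[?M]" for y
  proof (rule ccontr)
   assume "\<nexists>k. \<not> mat_in n A (mpow k) y"
   then have "y (i, j) \<in> (\<Inter>k. mpow k)" if "i < n" "j < n" for i j using that by (auto simp: mat_in_def)
   then have "y = \<zero>[?M]" using Lc[OF y(1)] mpow_sep by (intro mat_eqI[of _ n A]) (auto simp: mat_entries)
   then show False using y by simp
  qed
  \<comment> \<open>Every nonzero element of \<Lambda> lies outside some power of \<mm>. Since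
    \<Lambda> is finite, the sum of these exponents bounds the \<mm>-adic levels of all of them, so
    there is a largest level k, and k \<ge> 1 because of x.\<close>
  define bd where "bd y = (SOME k. \<not> mat_in n A (mpow k) y)" for y
  have bd: "\<not> mat_in n A (mpow (bd y)) y" if "y \<in> \<Lambda>" "y \<noteq> \<zero>[?M]" for y
   unfolding bd_def using someI_ex[OF ex[OF that]] .
  define P where "P k \<longleftrightarrow> (\<exists>y\<in>\<Lambda>. y \<noteq> \<zero>[?M] \<and> mat_in n A (mpow k) y)" for k
  have P1: "P 1" unfolding P_def using x x0 in0[OF Lc[OF x(1)] x(2)] by auto
  have "k \<le> (\<Sum>y\<in>\<Lambda>. bd y)" if "P k" for k
  proof -
   obtain y where y: "y \<in> \<Lambda>" "y \<noteq> \<zero>[?M]" "mat_in n A (mpow k) y" using \<open>P k\<close> by (auto simp: P_def)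
   have "k \<le> bd y" using bd[OF y(1,2)] mat_in_mono[OF y(3), of "bd y"] by (meson nat_le_linear)
   also have "bd y \<le> (\<Sum>y\<in>\<Lambda>. bd y)" using fin y(1) by (intro member_le_sum) auto
   finally show ?thesis .
  qed
  then obtain k where k: "P k" "\<And>l. P l \<Longrightarrow> l \<le> k" using P1 ex_has_greatest_nat[of P 1 "\<lambda>k. k"] by (metis le_imp_less_Suc)
  then obtain \<nu> where \<nu>: "\<nu> \<in> \<Lambda>" "\<nu> \<noteq> \<zero>[?M]" "mat_in n A (mpow k) \<nu>" by (auto simp: P_def)
  have k1: "k \<ge> 1" using k P1 by simp
  note \<nu>c = Lc[OF \<nu>(1)]
  \<comment> \<open>Such a product belongs to \<Lambda> and has level at least 2k > k, so it must
    vanish.\<close>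
  have sq: "\<nu> \<otimes>[?M] l \<otimes>[?M] \<nu> = \<zero>[?M]" if l: "l \<in> \<Lambda>" for l
  proof (rule ccontr)
   assume ne: "\<nu> \<otimes>[?M] l \<otimes>[?M] \<nu> \<noteq> \<zero>[?M]"
   have "mat_in n A (mpow (k + k)) (\<nu> \<otimes>[?M] l \<otimes>[?M] \<nu>)"
    by (rule mat_in_mpow_mult[OF mat_in_mult(1)[OF mpow_ideal \<nu>(3) Lc[OF l]] \<nu>(3)])
   then have "P (k + k)" unfolding P_def using ne Lm[OF Lm[OF \<nu>(1) l] \<nu>(1)] by blast
   then show False using k(2) k1 by fastforce
  qed
  \<comment> \<open>Let u in \<Lambda> lift the matrix unit E_ij and let T = E_ij - u, with entries
    in \<mm>. As \<nu> u \<nu> = 0, the matrices \<nu> E_ij \<nu> and \<nu> T \<nu> coincide. Read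
    at (c, d), this writes a product of two entries of \<nu> as a combination of such products with
    coefficients in \<mm>, so the order rises with each induction step.\<close>
  have prod: "\<nu> (c, i) \<otimes> \<nu> (j, d) \<in> mpow l" if "c < n" "i < n" "j < n" "d < n" for c i j d l
   using that
  proof (induction l arbitrary: c i j d)
   case 0
   then show ?case using mat_entry[OF \<nu>c] by simp
  next
   case (Suc l)
   note lt = Suc.prems
   interpret J: ideal "mpow (Suc l)" A by (rule mpow_ideal)
   let ?E = "mat_unit n A i j"
   note Ec = mat_unit_closed[of n i j]
   obtain u where u: "u \<in> \<Lambda>" "?r u = mat_unit n F i j" using lift[OF F.mat_unit_closed] by blast
   note uc = Lc[OF u(1)]
   define T where "T = ?E \<ominus>[?M] u"
   have Tc: "T \<in> carrier ?M" using Ec uc by (simp add: T_def)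
   have "?r ?E = mat_unit n F i j"
    by (rule mat_eqI[OF r.hom_closed[OF Ec] F.mat_unit_closed]) (auto simp: mat_unit_entry)
   then have "?r T = \<zero>[?MF]"
    using u Ec uc MF.r_neg[OF F.mat_unit_closed[of n i j]] by (simp add: T_def L.MR.minus_eq)
   from in0[OF Tc this] have Tm: "T (a, b) \<in> \<mm>" if "a < n" "b < n" for a b using that by (simp add: mat_in_def)
   have "\<nu> \<otimes>[?M] T \<otimes>[?M] \<nu> = \<nu> \<otimes>[?M] ?E \<otimes>[?M] \<nu> \<ominus>[?M] \<nu> \<otimes>[?M] u \<otimes>[?M] \<nu>"
    using \<nu>c Ec uc by (simp add: T_def L.MR.minus_eq L.MR.l_distr L.MR.r_distr L.MR.l_minus L.MR.r_minus)
   then have eq: "\<nu> \<otimes>[?M] T \<otimes>[?M] \<nu> = \<nu> \<otimes>[?M] ?E \<otimes>[?M] \<nu>"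
    using \<nu>c Ec uc by (simp add: sq[OF u(1)] L.MR.minus_eq)
   have "(\<nu> \<otimes>[?M] T \<otimes>[?M] \<nu>) (c, d) \<in> mpow (Suc l)"
    unfolding mat_entries(1)[OF lt(1,4)]
   proof (rule J.ideal_finsum)
    fix b assume b: "b \<in> {..<n}"
    have "(\<nu> \<otimes>[?M] T) (c, b) \<otimes> \<nu> (b, d) = (\<Oplus>a\<in>{..<n}. \<nu> (c, a) \<otimes> T (a, b)) \<otimes> \<nu> (b, d)"
     using lt b by (simp add: mat_entries)
    also have "\<dots> = (\<Oplus>a\<in>{..<n}. \<nu> (c, a) \<otimes> T (a, b) \<otimes> \<nu> (b, d))"
     by (rule finsum_ldistr) (use lt b mat_entry[OF \<nu>c] mat_entry[OF Tc] in auto)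
    also have "\<dots> \<in> mpow (Suc l)"
    proof (rule J.ideal_finsum)
     fix a assume a: "a \<in> {..<n}"
     have "(\<nu> (c, a) \<otimes> \<nu> (b, d)) \<otimes> T (a, b) \<in> mpow (l + Suc 0)"
      by (rule mpow_mult[OF Suc.IH]) (use lt a b Tm in auto)
     moreover have "\<nu> (c, a) \<otimes> T (a, b) \<otimes> \<nu> (b, d) = (\<nu> (c, a) \<otimes> \<nu> (b, d)) \<otimes> T (a, b)"
      using lt a b mat_entry[OF \<nu>c] mat_entry[OF Tc] by (simp add: m_ac)
     ultimately show "\<nu> (c, a) \<otimes> T (a, b) \<otimes> \<nu> (b, d) \<in> mpow (Suc l)" by simp
    qed simp
    finally show "(\<nu> \<otimes>[?M] T) (c, b) \<otimes> \<nu> (b, d) \<in> mpow (Suc l)" .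
   qed simp
   moreover have "(\<nu> \<otimes>[?M] ?E \<otimes>[?M] \<nu>) (c, d) = \<nu> (c, i) \<otimes> \<nu> (j, d)"
   proof -
    have nE: "(\<nu> \<otimes>[?M] ?E) (c, b) = (if j = b then \<nu> (c, i) else \<zero>)" if b: "b < n" for b
    proof -
     have "(\<Oplus>a\<in>{..<n}. \<nu> (c, a) \<otimes> ?E (a, b)) = (\<Oplus>a\<in>{..<n}. if i = a then (if j = b then \<nu> (c, a) else \<zero>) else \<zero>)"
      by (rule finsum_cong') (use lt b mat_entry[OF \<nu>c] in \<open>auto simp: mat_unit_entry\<close>)
     also have "\<dots> = (if j = b then \<nu> (c, i) else \<zero>)"
      by (rule finsum_singleton) (use lt mat_entry[OF \<nu>c] in auto)
     finally show ?thesis using lt b by (simp add: mat_entries)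
    qed
    have "(\<Oplus>b\<in>{..<n}. (\<nu> \<otimes>[?M] ?E) (c, b) \<otimes> \<nu> (b, d)) = (\<Oplus>b\<in>{..<n}. if j = b then \<nu> (c, i) \<otimes> \<nu> (b, d) else \<zero>)"
     by (rule finsum_cong') (use lt nE mat_entry[OF \<nu>c] in auto)
    also have "\<dots> = \<nu> (c, i) \<otimes> \<nu> (j, d)"
     by (rule finsum_singleton) (use lt mat_entry[OF \<nu>c] in auto)
    finally show ?thesis using lt by (simp add: mat_entries(1))
   qed
   ultimately show ?case using eq by simp
  qed
  \<comment> \<open>With i = d and j = c the square of an entry lies in every power of \<mm>;
    separatedness and the domain property finish.\<close>
  have "\<nu> (c, d) = \<zero>" if cd: "c < n" "d < n" for c d
  proof -
   have "\<nu> (c, d) \<otimes> \<nu> (c, d) \<in> (\<Inter>l. mpow l)" using prod cd by blast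
   then show ?thesis unfolding mpow_sep using mat_entry[OF \<nu>c cd] by (simp add: integral_iff)
  qed
  then have "\<nu> = \<zero>[?M]" using \<nu>c by (intro mat_eqI[of _ n A]) (auto simp: mat_entries)
  then show False using \<nu>(2) by simp
 qed
 have inj: "x = y" if xy: "x \<in> \<Lambda>" "y \<in> \<Lambda>" "?r x = ?r y" for x y
 proof -
  have m1: "\<ominus> \<one> \<in> C" by (rule C_closed(6)[OF C_closed(2)])
  let ?d = "x \<oplus>[?M] mat_smult n A (\<ominus> \<one>) y"
  have "mat_smult n A (\<ominus> \<one>) y = \<ominus>[?M] y"
  proof -
   have "y \<oplus>[?M] mat_smult n A (\<ominus> \<one>) y = \<zero>[?M]"
    using Lc[OF xy(2)] by (intro mat_eqI[of _ n A]) (auto simp: mat_entries mat_entry mat_smult_closed l_minus r_neg)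
   then have "mat_smult n A (\<ominus> \<one>) y \<oplus>[?M] y = \<zero>[?M]"
    using Lc[OF xy(2)] by (simp add: L.MR.a_comm mat_smult_closed)
   then show ?thesis using L.MR.minus_equality[of "mat_smult n A (\<ominus> \<one>) y" y] Lc[OF xy(2)]
    by (simp add: mat_smult_closed)
  qed
  moreover have "?d \<in> \<Lambda>" by (rule Ladd[OF xy(1) Lsm[OF m1 xy(2)]])
  ultimately have d: "x \<ominus>[?M] y \<in> \<Lambda>" by (simp add: L.MR.minus_eq)
  have "?r (x \<ominus>[?M] y) = \<zero>[?MF]" using xy(3) Lc[OF xy(1)] Lc[OF xy(2)] by (simp add: L.MR.minus_eq MF.r_neg)
  then have "x \<ominus>[?M] y = \<zero>[?M]" by (rule ker[OF d])
  then show ?thesis using Lc[OF xy(1)] Lc[OF xy(2)] by simp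
 qed
 have "\<exists>E. \<forall>j. E j \<in> \<Lambda> \<and> ?r (E j) = mat_unit n F j 0"
  using lift[OF F.mat_unit_closed] by (intro choice) blast
 then obtain E where E: "\<And>j. E j \<in> \<Lambda>" "\<And>j. ?r (E j) = mat_unit n F j 0" by blast
 note Ec = Lc[OF E(1)]
 \<comment> \<open>Column j of U is column 0 of the lift \<open>E j\<close> of a matrix unit. The
   relation expressing h times \<open>E j\<close> through the \<open>E i\<close>, with \<tau> of the
   entries of the reduced h as coefficients, holds after reduction and hence in \<Lambda> by
   \<open>inj\<close>; its column 0 is the intertwining relation.\<close>
 define U where "U = (\<lambda>(i, j) \<in> {..<n} \<times> {..<n}. E j (i, 0))"
 have Uc: "U \<in> carrier ?M" by (rule mat_carrierI) (auto simp: U_def extensional_def mat_entry[OF Ec] npos)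
 have Ur: "?r U = \<one>[?MF]"
 proof (rule mat_eqI[OF r.hom_closed[OF Uc] MF.one_closed])
  fix i j assume ij: "i < n" "j < n"
  have "res (E j (i, 0)) = mat_unit n F j 0 (i, 0)" using E(2)[of j] ij npos mat_map_entry[of i n 0 res "E j"] by simp
  then show "?r U (i, j) = \<one>[?MF] (i, j)" using ij npos by (simp add: U_def mat_unit_entry mat_entries)
 qed
 have "mat_in n A \<mm> (\<one>\<^bsub>?M\<^esub> \<ominus>[?M] U)"
  using in0[of "\<one>[?M] \<ominus>[?M] U"] Uc Ur by (simp add: L.MR.minus_eq MF.r_neg)
 then have Uu: "U \<in> Units ?M" by (rule neumann[OF complete Uc])
 have "h \<otimes>[?M] U = U \<otimes>[?M] mat_map n \<tau> (?r h)" if h: "h \<in> H" for h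
 proof (rule mat_eqI[of _ n A])
  have hc: "h \<in> carrier ?M" using h H(1) by blast
  have hL: "h \<in> \<Lambda>" unfolding \<Lambda>_def by (rule L.span_base[OF h])
  have rhc: "?r h \<in> carrier ?MF" by (rule r.hom_closed[OF hc])
  have tc: "mat_map n \<tau> (?r h) \<in> carrier ?M"
   by (rule ring_hom_closed[OF mat_map_hom[OF tau_hom F.is_cring is_cring] rhc])
  show "h \<otimes>[?M] U \<in> carrier ?M" "U \<otimes>[?M] mat_map n \<tau> (?r h) \<in> carrier ?M" using hc Uc tc by auto
  fix a j assume aj: "a < n" "j < n"
  let ?f = "\<lambda>i. mat_smult n A (\<tau> (?r h (i, j))) (E i)"
  have cC: "\<tau> (?r h (i, j)) \<in> C" if "i < n" for i by (rule tau_C[OF mat_entry[OF rhc that aj(2)]])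
  have fL: "?f i \<in> \<Lambda>" if "i < n" for i by (rule Lsm[OF cC[OF that] E(1)])
  have sumL: "(\<Oplus>\<^bsub>?M\<^esub>i\<in>I. ?f i) \<in> \<Lambda>" if "finite I" "I \<subseteq> {..<n}" for I using that
  proof (induction I)
   case empty then show ?case using mat_span.zero by (simp add: \<Lambda>_def)
  next
   case (insert i I)
   have "(\<Oplus>\<^bsub>?M\<^esub>i\<in>insert i I. ?f i) = ?f i \<oplus>[?M] (\<Oplus>\<^bsub>?M\<^esub>i\<in>I. ?f i)"
    using insert fL Lc by (intro L.MR.finsum_insert) auto
   then show ?case using insert fL Ladd by simp
  qed
  have fe: "(\<Oplus>\<^bsub>?M\<^esub>i\<in>{..<n}. ?f i) (b, c) = (\<Oplus>i\<in>{..<n}. \<tau> (?r h (i, j)) \<otimes> E i (b, c))" if bc: "b < n" "c < n" for b c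
  proof -
   have "(\<Oplus>\<^bsub>?M\<^esub>i\<in>{..<n}. ?f i) (b, c) = (\<Oplus>i\<in>{..<n}. ?f i (b, c))"
    by (rule mat_finsum_entry) (use fL Lc bc in auto)
   also have "\<dots> = (\<Oplus>i\<in>{..<n}. \<tau> (?r h (i, j)) \<otimes> E i (b, c))"
    by (rule finsum_cong') (use bc mat_entry[OF Ec bc] mat_entry[OF rhc _ aj(2)] in \<open>auto simp: mat_entries\<close>)
   finally show ?thesis .
  qed
  have "h \<otimes>[?M] E j = (\<Oplus>\<^bsub>?M\<^esub>i\<in>{..<n}. ?f i)"
  proof (rule inj[OF Lm[OF hL E(1)] sumL])
   show "?r (h \<otimes>[?M] E j) = ?r (\<Oplus>\<^bsub>?M\<^esub>i\<in>{..<n}. ?f i)"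
   proof (rule mat_eqI[of _ n F])
    fix b c assume bc: "b < n" "c < n"
    have "?r (h \<otimes>[?M] E j) (b, c) = (?r h \<otimes>[?MF] mat_unit n F j 0) (b, c)" using hc Ec E(2) by simp
    also have "\<dots> = (\<Oplus>\<^bsub>F\<^esub>k\<in>{..<n}. if j = k then (if c = 0 then ?r h (b, k) else \<zero>[F]) else \<zero>[F])"
     unfolding mat_entries(1)[OF bc]
     by (rule F.finsum_cong') (use bc mat_entry[OF rhc bc(1)] in \<open>auto simp: mat_unit_entry\<close>)
    also have "\<dots> = (if c = 0 then ?r h (b, j) else \<zero>[F])"
     by (rule F.finsum_singleton) (use aj mat_entry[OF rhc bc(1)] in auto)
    finally have l: "?r (h \<otimes>[?M] E j) (b, c) = (if c = 0 then ?r h (b, j) else \<zero>[F])" .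
    have "?r (\<Oplus>\<^bsub>?M\<^esub>i\<in>{..<n}. ?f i) (b, c) = res (\<Oplus>i\<in>{..<n}. \<tau> (?r h (i, j)) \<otimes> E i (b, c))"
     using bc fe by simp
    also have "\<dots> = (\<Oplus>\<^bsub>F\<^esub>i\<in>{..<n}. res (\<tau> (?r h (i, j)) \<otimes> E i (b, c)))"
     by (rule ring_hom_finsum[OF res_hom is_cring F.is_cring]) (use mat_entry[OF Ec bc] mat_entry[OF rhc _ aj(2)] in auto)
    also have "\<dots> = (\<Oplus>\<^bsub>F\<^esub>i\<in>{..<n}. if b = i then (if c = 0 then ?r h (i, j) else \<zero>[F]) else \<zero>[F])"
    proof (rule F.finsum_cong')
     fix i assume i: "i \<in> {..<n}"
     have "res (E i (b, c)) = mat_unit n F i 0 (b, c)" using E(2)[of i] bc mat_map_entry[of b n c res "E i"] by simp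
     then show "res (\<tau> (?r h (i, j)) \<otimes> E i (b, c)) = (if b = i then (if c = 0 then ?r h (i, j) else \<zero>[F]) else \<zero>[F])"
      using i bc mat_entry[OF Ec bc] mat_entry[OF rhc _ aj(2), of i] by (simp add: res_tau mat_unit_entry)
    qed (use mat_entry[OF rhc _ aj(2)] in auto)
    also have "\<dots> = (if c = 0 then ?r h (b, j) else \<zero>[F])"
     by (rule F.finsum_singleton) (use bc mat_entry[OF rhc _ aj(2)] in auto)
    finally show "?r (h \<otimes>[?M] E j) (b, c) = ?r (\<Oplus>\<^bsub>?M\<^esub>i\<in>{..<n}. ?f i) (b, c)" using l by simp
   qed (use hc Ec Lc[OF sumL] in auto)
  qed auto
  then have "(h \<otimes>[?M] E j) (a, 0) = (\<Oplus>i\<in>{..<n}. \<tau> (?r h (i, j)) \<otimes> E i (a, 0))"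
   using fe[OF aj(1) npos] by simp
  moreover have "(h \<otimes>[?M] U) (a, j) = (h \<otimes>[?M] E j) (a, 0)"
   unfolding mat_entries(1)[OF aj] mat_entries(1)[OF aj(1) npos]
   by (rule finsum_cong') (use aj npos mat_entry[OF hc aj(1)] mat_entry[OF Ec _ npos] in \<open>auto simp: U_def\<close>)
  moreover have "(U \<otimes>[?M] mat_map n \<tau> (?r h)) (a, j) = (\<Oplus>i\<in>{..<n}. \<tau> (?r h (i, j)) \<otimes> E i (a, 0))"
   unfolding mat_entries(1)[OF aj]
   by (rule finsum_cong') (use aj npos mat_entry[OF rhc _ aj(2)] mat_entry[OF Ec aj(1) npos] in \<open>auto simp: U_def m_comm\<close>)
  ultimately show "(h \<otimes>[?M] U) (a, j) = (U \<otimes>[?M] mat_map n \<tau> (?r h)) (a, j)" by simp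
 qed
 then show ?thesis using Uu Ur by blast
qed

end

section \<open>The local field of Laurent series\<close>

notation fls_nth (infixl "$$" 75)

abbreviation ZT :: "int fls ring" where "ZT \<equiv> ring_of_type_algebra"

text \<open>Coefficients are indexed by the integers; \<open>int_decode\<close> relists them along
  the naturals, so that residues modulo p become elements of \<open>continuum\<close>, the type over
  which \<open>conjecture_UFM\<close> quantifies.\<close>

definition laurent_code :: "nat \<Rightarrow> int fls \<Rightarrow> continuum"
 where "laurent_code p f = (\<lambda>k. nat (fls_nth f (int_decode k) mod int p))"

text \<open>\<open>\<int>((X))/p\<close>, with residue classes coded by their reduced coefficients.\<close>

definition laurent_field :: "nat \<Rightarrow> continuum ring"
 where "laurent_field p = image_ring (laurent_code p) ZT"

definition laurent_val :: "continuum \<Rightarrow> int"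
 where "laurent_val z = (THE n. z (int_encode n) \<noteq> 0 \<and> (\<forall>m<n. z (int_encode m) = 0))"

definition laurent_ideal :: "nat \<Rightarrow> int fls set"
 where "laurent_ideal p = {f. \<forall>n. int p dvd f $$ n}"

section \<open>Arithmetic and valuation of the Laurent field\<close>

locale laurent =
 fixes p :: nat assumes p: "Factorial_Ring.prime p"
begin

abbreviation "cd \<equiv> laurent_code p"
abbreviation "LF \<equiv> laurent_field p"
abbreviation "PI \<equiv> laurent_ideal p"

sublocale ZT: cring ZT by simp

lemma p_pos: "int p > 0" using p by (simp add: prime_gt_0_nat)
lemma p_prime_int: "Factorial_Ring.prime (int p)" using p by simp

lemma code_nth: "cd f (int_encode n) = nat (f $$ n mod int p)"
 by (simp add: laurent_code_def)

lemma code_zero: "cd f (int_encode n) = 0 \<longleftrightarrow> int p dvd f $$ n"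
 using p_pos pos_mod_sign[of "int p" "f $$ n"] by (auto simp: code_nth dvd_eq_mod_eq_0)

lemma code_eq_nth: "cd f (int_encode n) = cd g (int_encode n) \<longleftrightarrow> int p dvd f $$ n - g $$ n"
 using p_pos by (simp add: code_nth nat_eq_iff mod_eq_dvd_iff)

lemma code_eq: "cd f = cd g \<longleftrightarrow> f - g \<in> PI"
proof -
 have "cd f = cd g \<longleftrightarrow> (\<forall>n. cd f (int_encode n) = cd g (int_encode n))"
  by (metis ext int_decode_inverse)
 then show ?thesis by (simp add: laurent_ideal_def code_eq_nth)
qed

lemma ideal_conv: "f \<in> PI \<longleftrightarrow> (\<exists>g. f = fls_const (int p) * g)"
proof
 assume f: "f \<in> PI"
 have "Abs_fls (\<lambda>n. f $$ n div int p) $$ n = f $$ n div int p" for n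
  by (rule nth_Abs_fls_ex_lower_bound) (auto intro!: exI[of _ "fls_subdegree f"])
 then have "f = fls_const (int p) * Abs_fls (\<lambda>n. f $$ n div int p)"
  using f by (intro fls_eqI) (simp add: laurent_ideal_def)
 then show "\<exists>g. f = fls_const (int p) * g" by blast
qed (auto simp: laurent_ideal_def)

lemma PI_ideal: "ideal PI ZT"
proof (rule ZT.cring_idealI)
 fix a r assume "a \<in> PI"
 then obtain g where "a = fls_const (int p) * g" by (auto simp: ideal_conv)
 then have "r * a = fls_const (int p) * (r * g)" by (simp add: mult_ac)
 then show "r \<otimes>[ZT] a \<in> PI" unfolding ideal_conv by auto
qed (auto simp: laurent_ideal_def)

text \<open>By \<open>code_eq\<close> the fibres of the code are the cosets of \<open>PI\<close>, so
  the ring transported along the code is the quotient by \<open>PI\<close>.\<close>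

lemma weak: "weak_ring_morphism cd PI ZT"
 by (rule weak_ring_morphismI[OF PI_ideal]) (simp add: code_eq)

lemma code_hom: "cd \<in> ring_hom ZT LF"
 unfolding laurent_field_def by (rule ZT.weak_ring_morphism_is_hom[OF weak])

lemma LF_carrier: "carrier LF = range cd"
 by (simp add: laurent_field_def image_ring_carrier)

lemma LF_zero: "\<zero>[LF] = cd 0"
 by (simp add: laurent_field_def image_ring_zero)

lemma LF_cring: "cring LF"
 by (rule ZT.surj_hom_cring[OF code_hom]) (auto simp: LF_carrier LF_zero)

sublocale LF: cring LF by (rule LF_cring)
sublocale cd: surj_hom ZT LF cd
 by (intro surj_hom.intro surj_hom_axioms.intro ring_hom_cring.intro ring_hom_cring_axioms.intro
   ZT.is_cring LF.is_cring code_hom) (auto simp: LF_carrier)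

lemma code_add: "cd (f + g) = cd f \<oplus>[LF] cd g" using cd.hom_add[of f g] by simp
lemma code_mult: "cd (f * g) = cd f \<otimes>[LF] cd g" using cd.hom_mult[of f g] by simp
lemma code_diff: "cd (f - g) = cd f \<ominus>[LF] cd g" using cd.hom_minus[of f g] by simp
lemma code_one: "cd 1 = \<one>[LF]" using cd.hom_one by simp
lemma code_in: "cd f \<in> carrier LF" by (simp add: LF_carrier)
lemma code_zero_iff: "cd f = \<zero>[LF] \<longleftrightarrow> f \<in> PI" by (simp add: LF_zero code_eq)

lemma val_eq:
 assumes "\<not> int p dvd f $$ n" "\<And>m. m < n \<Longrightarrow> int p dvd f $$ m"
 shows "laurent_val (cd f) = n"
 unfolding laurent_val_def
 by (rule the_equality) (use assms in \<open>auto simp: code_zero\<close>, metis linorder_neqE_linordered_idom)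

text \<open>Reducing all coefficients modulo p yields a representative whose lowest nonzero
  coefficient is prime to p; for it the subdegree is the valuation.\<close>

lemma normal_form:
 assumes "f \<notin> PI"
 obtains g where "cd g = cd f" "g \<noteq> 0" "\<not> int p dvd g $$ fls_subdegree g"
proof -
 define g where "g = Abs_fls (\<lambda>n. f $$ n mod int p)"
 have g: "g $$ n = f $$ n mod int p" for n
  unfolding g_def by (rule nth_Abs_fls_ex_lower_bound) (auto intro!: exI[of _ "fls_subdegree f"])
 have "g - f \<in> PI" by (auto simp: laurent_ideal_def g mod_eq_dvd_iff[symmetric])
 then have "cd g = cd f" by (simp add: code_eq)
 moreover obtain n where "\<not> int p dvd f $$ n" using assms by (auto simp: laurent_ideal_def)
 then have g0: "g \<noteq> 0" using g[of n] by (auto simp: dvd_eq_mod_eq_0)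
 moreover have "\<not> int p dvd g $$ fls_subdegree g"
  using nth_fls_subdegree_nonzero[OF g0] by (simp add: g dvd_eq_mod_eq_0)
 ultimately show thesis by (rule that)
qed

lemma val_normal: "\<not> int p dvd g $$ fls_subdegree g \<Longrightarrow> laurent_val (cd g) = fls_subdegree g"
 by (rule val_eq) auto

lemma val_spec:
 assumes "f \<notin> PI"
 shows "\<not> int p dvd f $$ laurent_val (cd f)" "\<And>m. m < laurent_val (cd f) \<Longrightarrow> int p dvd f $$ m"
proof -
 obtain g where g: "cd g = cd f" "g \<noteq> 0" "\<not> int p dvd g $$ fls_subdegree g"
  using assms by (rule normal_form)
 have v: "laurent_val (cd f) = fls_subdegree g" using val_normal[OF g(3)] g(1) by simp
 have eq: "int p dvd f $$ m \<longleftrightarrow> int p dvd g $$ m" for m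
  using code_zero[of f m] code_zero[of g m] g(1) by simp
 show "\<not> int p dvd f $$ laurent_val (cd f)" using v g(3) eq by simp
 show "int p dvd f $$ m" if "m < laurent_val (cd f)" for m using that v eq by simp
qed

lemma LF_field: "field LF"
proof (rule LF.cring_fieldI)
 have one0: "\<one>[LF] \<noteq> \<zero>[LF]"
 proof -
  have "(1 :: int fls) \<notin> PI" using p_prime_int not_prime_unit by (auto simp: laurent_ideal_def intro!: exI[of _ 0])
  then show ?thesis unfolding code_one[symmetric] by (simp add: code_zero_iff)
 qed
 have "z \<in> Units LF" if z: "z \<in> carrier LF" "z \<noteq> \<zero>[LF]" for z
 proof -
  obtain f where f: "z = cd f" using z by (auto simp: LF_carrier)
  then have "f \<notin> PI" using z by (simp add: code_zero_iff)
  then obtain g where g: "cd g = cd f" "g \<noteq> 0" "\<not> int p dvd g $$ fls_subdegree g" by (rule normal_form)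
  let ?n = "fls_subdegree g" and ?a = "g $$ fls_subdegree g"
  have "coprime ?a (int p)" using g(3) p_prime_int by (meson coprime_commute prime_imp_coprime)
  then obtain b v where "b * ?a + v * int p = 1" using bezout_int[of ?a "int p"] by auto
  then have c0: "?a * b - 1 = int p * (- v)" by (simp add: algebra_simps)
  define c where "c = - v"
  have c: "?a * b - 1 = int p * c" using c0 by (simp add: c_def)
  \<comment> \<open>Modulo p, h is g times the inverse b of its leading coefficient. The subtracted
    multiple of p makes the leading coefficient equal to 1 over the integers, so h is invertible as
    an integral Laurent series.\<close>
  define h where "h = g * fls_const b - fls_const (int p) * (fls_const c * fls_X_intpow ?n)"
  have hn: "h $$ ?n = 1" using c by (simp add: h_def)
  have "h $$ m = 0" if "m < ?n" for m using that by (simp add: h_def)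
  then have sub: "fls_subdegree h = ?n" using hn by (intro fls_subdegree_eqI) auto
  have ch: "cd h = cd (g * fls_const b)"
   unfolding code_eq ideal_conv by (rule exI[of _ "- (fls_const c * fls_X_intpow ?n)"]) (simp add: h_def)
  have "fls_left_inverse h 1 * h = 1" by (rule fls_left_inverse) (simp add: sub hn)
  then obtain li where inv: "li * h = 1" by blast
  let ?y = "cd (li * fls_const b)"
  have "?y \<otimes>[LF] z = cd li \<otimes>[LF] cd (g * fls_const b)"
   unfolding f g(1)[symmetric] code_mult using code_in by (simp add: LF.m_ac)
  also have "\<dots> = cd (li * h)" unfolding code_mult[of _ h] ch by simp
  finally have "?y \<otimes>[LF] z = \<one>[LF]" by (simp add: inv code_one)
  moreover have "z \<otimes>[LF] ?y = \<one>[LF]" using calculation z code_in by (simp add: LF.m_comm)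
  ultimately show ?thesis using z code_in unfolding Units_def by blast
 qed
 moreover have "z \<noteq> \<zero>[LF]" if z: "z \<in> Units LF" for z
 proof
  assume "z = \<zero>[LF]"
  then have "\<one>[LF] = \<zero>[LF]" using LF.Units_l_inv[OF z] LF.Units_inv_closed[OF z] by simp
  then show False using one0 by blast
 qed
 ultimately show "Units LF = carrier LF - {\<zero>[LF]}"
  using LF.Units_closed by blast
qed

lemma val_mult:
 assumes "x \<in> carrier LF" "y \<in> carrier LF" "x \<noteq> \<zero>[LF]" "y \<noteq> \<zero>[LF]"
 shows "laurent_val (x \<otimes>[LF] y) = laurent_val x + laurent_val y"
proof -
 obtain f0 g0 where "x = cd f0" "y = cd g0" using assms by (auto simp: LF_carrier)
 then have "f0 \<notin> PI" "g0 \<notin> PI" using assms by (auto simp: code_zero_iff)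
 then obtain f g where f: "cd f = x" "f \<noteq> 0" "\<not> int p dvd f $$ fls_subdegree f"
  and g: "cd g = y" "g \<noteq> 0" "\<not> int p dvd g $$ fls_subdegree g"
  using normal_form[of f0] normal_form[of g0] \<open>x = cd f0\<close> \<open>y = cd g0\<close> by metis
 have "\<not> int p dvd (f * g) $$ fls_subdegree (f * g)"
  using f g p_prime_int by (simp add: fls_times_base prime_dvd_mult_iff)
 from val_normal[OF this] show ?thesis
  using f g val_normal[OF f(3)] val_normal[OF g(3)] by (simp add: code_mult)
qed

lemma val_add:
 assumes "x \<in> carrier LF" "y \<in> carrier LF" "x \<noteq> \<zero>[LF]" "y \<noteq> \<zero>[LF]" "x \<oplus>[LF] y \<noteq> \<zero>[LF]"
 shows "min (laurent_val x) (laurent_val y) \<le> laurent_val (x \<oplus>[LF] y)"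
proof (rule ccontr)
 obtain f g where fg: "x = cd f" "y = cd g" using assms by (auto simp: LF_carrier)
 then have n: "f \<notin> PI" "g \<notin> PI" "f + g \<notin> PI" using assms by (auto simp: code_zero_iff code_add[symmetric])
 let ?n = "laurent_val (cd (f + g))"
 assume "\<not> min (laurent_val x) (laurent_val y) \<le> laurent_val (x \<oplus>[LF] y)"
 then have "?n < laurent_val (cd f)" "?n < laurent_val (cd g)" using fg by (auto simp: code_add)
 then have "int p dvd f $$ ?n" "int p dvd g $$ ?n" using val_spec(2) n by auto
 then show False using val_spec(1)[OF n(3)] by simp
qed

subsection \<open>The valuation metric\<close>

abbreviation "vd \<equiv> valuation_dist LF laurent_val"

text \<open>The bridge between valuation and digits: the valuation of a difference is the first
  index at which the digits disagree. All metric statements below become comparisons of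
  digits.\<close>

lemma agree_iff:
 assumes "x \<in> carrier LF" "y \<in> carrier LF"
 shows "x = y \<or> k \<le> laurent_val (x \<ominus>[LF] y) \<longleftrightarrow> (\<forall>m<k. x (int_encode m) = y (int_encode m))"
proof -
 obtain f g where fg: "x = cd f" "y = cd g" using assms by (auto simp: LF_carrier)
 show ?thesis
 proof (cases "x = y")
  case False
  then have n: "f - g \<notin> PI" using fg code_eq by simp
  have "k \<le> laurent_val (cd (f - g)) \<longleftrightarrow> (\<forall>m<k. int p dvd (f - g) $$ m)"
   using val_spec[OF n] by (meson less_le_trans linorder_not_le)
  then show ?thesis using False unfolding fg code_eq_nth by (simp add: code_diff)
 qed simp
qed

lemma powi_le_iff: "(2::real) powi a \<le> 2 powi b \<longleftrightarrow> a \<le> b"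
 using power_int_increasing[of a b "2::real"] power_int_strict_increasing[of b a "2::real"]
 by (cases "a \<le> b") auto

lemma vd_le:
 assumes "x \<in> carrier LF" "y \<in> carrier LF"
 shows "vd x y \<le> 2 powi (- k) \<longleftrightarrow> (\<forall>m<k. x (int_encode m) = y (int_encode m))"
 using agree_iff[OF assms, of k] assms by (auto simp: valuation_dist_def powi_le_iff)

lemma vd_metric: "Metric_space (carrier LF) vd"
proof
 show nonneg: "0 \<le> vd x y" for x y by (simp add: valuation_dist_def)
 show "vd x y = vd y x" for x y
 proof (cases "x \<in> carrier LF \<and> y \<in> carrier LF \<and> x \<noteq> y")
  case True
  then have c: "x \<in> carrier LF" "y \<in> carrier LF" by auto
  obtain k l where kl: "vd x y = 2 powi (- k)" "vd y x = 2 powi (- l)"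
   using True by (auto simp: valuation_dist_def)
  have "vd y x \<le> 2 powi (- k)" "vd x y \<le> 2 powi (- l)"
   using vd_le[OF c, of k] vd_le[OF c(2,1), of k] vd_le[OF c, of l] vd_le[OF c(2,1), of l] kl by auto
  then show ?thesis using kl by simp
 qed (auto simp: valuation_dist_def)
 show "vd x y = 0 \<longleftrightarrow> x = y" if "x \<in> carrier LF" "y \<in> carrier LF" for x y
  using that by (simp add: valuation_dist_def)
 fix x y z assume c: "x \<in> carrier LF" "y \<in> carrier LF" "z \<in> carrier LF"
 have "vd x z \<le> max (vd x y) (vd y z)"
 proof (cases "x = y \<or> y = z")
  case True then show ?thesis using nonneg by (auto simp: valuation_dist_def)
 next
  case False
  then obtain k l where kl: "vd x y = 2 powi (- k)" "vd y z = 2 powi (- l)"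
   using c by (auto simp: valuation_dist_def)
  have "\<forall>m<min k l. x (int_encode m) = z (int_encode m)"
   using vd_le[OF c(1,2), of k] vd_le[OF c(2,3), of l] kl by auto
  then have "vd x z \<le> 2 powi (- min k l)" using vd_le[OF c(1,3)] by simp
  then show ?thesis using kl by (auto simp: min_def split: if_splits)
 qed
 then show "vd x z \<le> vd x y + vd y z" using nonneg[of x y] nonneg[of y z] by linarith
qed

sublocale vd: Metric_space "carrier LF" vd by (rule vd_metric)

lemma small_power: "\<epsilon> > 0 \<Longrightarrow> \<exists>k::int. 2 powi (- k) < (\<epsilon> :: real)"
proof -
 assume "\<epsilon> > 0"
 then obtain n :: nat where "(1/2) ^ n < \<epsilon>" using real_arch_pow_inv[of \<epsilon> "1/2"] by auto
 then show ?thesis by (intro exI[of _ "int n"]) (simp add: power_int_minus power_one_over inverse_eq_divide)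
qed

text \<open>With the field described by its digit sequences, a limit can be assembled digit by
  digit.\<close>

lemma LF_carrier_iff:
 "z \<in> carrier LF \<longleftrightarrow> (\<forall>j. z j < p) \<and> (\<exists>B. \<forall>m<B. z (int_encode m) = 0)"
proof
 assume "z \<in> carrier LF"
 then obtain f where f: "z = cd f" by (auto simp: LF_carrier)
 have "z j < p" for j using p_pos by (simp add: f laurent_code_def nat_less_iff)
 moreover have "\<forall>m<fls_subdegree f. z (int_encode m) = 0" by (simp add: f code_nth)
 ultimately show "(\<forall>j. z j < p) \<and> (\<exists>B. \<forall>m<B. z (int_encode m) = 0)" by blast
next
 assume z: "(\<forall>j. z j < p) \<and> (\<exists>B. \<forall>m<B. z (int_encode m) = 0)"
 define f where "f = Abs_fls (\<lambda>n. int (z (int_encode n)))"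
 have f: "f $$ n = int (z (int_encode n))" for n
  unfolding f_def using z by (intro nth_Abs_fls_ex_lower_bound) auto
 have "z = cd f"
 proof
  fix j show "z j = cd f j" using z by (simp add: laurent_code_def f nat_mod_distrib)
 qed
 then show "z \<in> carrier LF" by (simp add: LF_carrier)
qed

lemma LF_complete: "vd.mcomplete"
 unfolding vd.mcomplete_def
proof (intro allI impI)
 fix \<sigma> assume "vd.MCauchy \<sigma>"
 then have \<sigma>: "\<And>n. \<sigma> n \<in> carrier LF"
  and C: "\<And>\<epsilon>. \<epsilon> > 0 \<Longrightarrow> \<exists>N. \<forall>n n'. N \<le> n \<longrightarrow> N \<le> n' \<longrightarrow> vd (\<sigma> n) (\<sigma> n') < \<epsilon>"
  by (auto simp: vd.MCauchy_def)
 have "\<exists>N. \<forall>n n'. N \<le> n \<longrightarrow> N \<le> n' \<longrightarrow> (\<forall>m<k. \<sigma> n (int_encode m) = \<sigma> n' (int_encode m))" for k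
 proof -
  obtain N where "\<forall>n n'. N \<le> n \<longrightarrow> N \<le> n' \<longrightarrow> vd (\<sigma> n) (\<sigma> n') < 2 powi (- k)" using C[of "2 powi (- k)"] by auto
  then show ?thesis using vd_le[OF \<sigma> \<sigma>] by (intro exI[of _ N]) (meson less_imp_le)
 qed
 then obtain N where N: "\<And>k n n' m. N k \<le> n \<Longrightarrow> N k \<le> n' \<Longrightarrow> m < k \<Longrightarrow> \<sigma> n (int_encode m) = \<sigma> n' (int_encode m)"
  by metis
 \<comment> \<open>The digit at index m is stable from stage \<open>N (m + 1)\<close> on, since
   \<open>N k\<close> controls the indices strictly below k.\<close>
 define z where "z j = \<sigma> (N (int_decode j + 1)) j" for j
 have agree: "\<sigma> n (int_encode m) = z (int_encode m)" if "N k \<le> n" "m < k" for n m k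
 proof -
  define n' where "n' = max n (N (m + 1))"
  have "\<sigma> n (int_encode m) = \<sigma> n' (int_encode m)" by (rule N[of k]) (use that in \<open>auto simp: n'_def\<close>)
  also have "\<dots> = \<sigma> (N (m + 1)) (int_encode m)" by (rule N[of "m + 1"]) (auto simp: n'_def)
  finally show ?thesis by (simp add: z_def)
 qed
 have z: "z \<in> carrier LF" unfolding LF_carrier_iff
 proof (intro conjI allI)
  show "z j < p" for j using \<sigma> unfolding LF_carrier_iff z_def by blast
  \<comment> \<open>One bound is enough: all digits below index 0 of the limit agree with those at
    stage \<open>N 0\<close>.\<close>
  obtain B where B: "\<forall>m<B. \<sigma> (N 0) (int_encode m) = 0" using \<sigma> unfolding LF_carrier_iff by blast
  have "z (int_encode m) = 0" if "m < min B 0" for m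
   using B agree[of 0 "N 0" m] that by simp
  then have "\<forall>m<min B 0. z (int_encode m) = 0" by blast
  then show "\<exists>B. \<forall>m<B. z (int_encode m) = 0" by blast
 qed
 have "\<forall>\<^sub>F n in sequentially. \<sigma> n \<in> carrier LF \<and> vd (\<sigma> n) z < \<epsilon>" if \<epsilon>: "\<epsilon> > 0" for \<epsilon>
 proof -
  obtain k where k: "2 powi (- k) < \<epsilon>" using small_power[OF \<epsilon>] by blast
  have "vd (\<sigma> n) z < \<epsilon>" if "N k \<le> n" for n
   using vd_le[OF \<sigma> z, of n k] agree[OF that] k by auto
  then show ?thesis using \<sigma> unfolding eventually_sequentially by blast
 qed
 then show "\<exists>x. limitin vd.mtopology \<sigma> x sequentially"
  using z by (intro exI[of _ z]) (simp add: vd.limitin_metric)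
qed

theorem LF_local_field: "nonarch_local_field LF laurent_val"
 unfolding nonarch_local_field_def
proof (intro conjI ballI impI)
 show "field LF" by (rule LF_field)
 show "laurent_val ` (carrier LF - {\<zero>[LF]}) = UNIV"
 proof (intro equalityI subset_UNIV subsetI)
  fix n :: int
  have "\<not> int p dvd fls_X_intpow n $$ n" using p_prime_int not_prime_unit by auto
  then have "laurent_val (cd (fls_X_intpow n)) = n" "fls_X_intpow n \<notin> PI"
   by (auto intro!: val_eq simp: laurent_ideal_def)
  then show "n \<in> laurent_val ` (carrier LF - {\<zero>[LF]})"
   using code_in by (intro image_eqI[of _ _ "cd (fls_X_intpow n)"]) (auto simp: code_zero_iff)
 qed
 show "vd.mcomplete" by (rule LF_complete)
 let ?O = "{x \<in> carrier LF. x = \<zero>[LF] \<or> 0 \<le> laurent_val x}"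
 let ?m = "{x \<in> carrier LF. x = \<zero>[LF] \<or> 0 < laurent_val x}"
 let ?c = "\<lambda>x. {h \<oplus>[LF] x | h. h \<in> ?m}"
 have m: "x \<in> ?m \<longleftrightarrow> (\<forall>m\<le>0. x (int_encode m) = 0)" if x: "x \<in> carrier LF" for x
 proof -
  have "x \<ominus>[LF] \<zero>[LF] = x" using x by (simp add: LF.minus_eq)
  then have "(x = \<zero>[LF] \<or> 1 \<le> laurent_val x) \<longleftrightarrow> (\<forall>m<1. x (int_encode m) = 0)"
   using agree_iff[OF x LF.zero_closed, of 1] by (simp add: LF_zero code_nth)
  moreover have "1 \<le> laurent_val x \<longleftrightarrow> 0 < laurent_val x" by linarith
  moreover have "m < 1 \<longleftrightarrow> m \<le> 0" for m :: int by linarith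
  ultimately show ?thesis using x by simp
 qed
 have O: "x \<in> ?O \<longleftrightarrow> (\<forall>m<0. x (int_encode m) = 0)" if x: "x \<in> carrier LF" for x
 proof -
  have "x \<ominus>[LF] \<zero>[LF] = x" using x by (simp add: LF.minus_eq)
  then show ?thesis using agree_iff[OF x LF.zero_closed, of 0] x by (simp add: LF_zero code_nth)
 qed
 have cong: "x \<ominus>[LF] y \<in> ?m" if xy: "x \<in> ?O" "y \<in> ?O" "x (int_encode 0) = y (int_encode 0)" for x y
 proof -
  have c: "x \<in> carrier LF" "y \<in> carrier LF" using xy by auto
  have "x (int_encode m) = y (int_encode m)" if "m < 1" for m
  proof (cases "m = 0")
   case False
   then have "m < 0" using that by linarith
   then show ?thesis using O[OF c(1)] O[OF c(2)] xy(1,2) by simp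
  qed (use xy in simp)
  then have "\<forall>m<1. x (int_encode m) = y (int_encode m)" by blast
  then have "x = y \<or> 1 \<le> laurent_val (x \<ominus>[LF] y)" using agree_iff[OF c] by simp
  then show ?thesis using c by (auto simp: LF.r_neg LF.minus_eq)
 qed
 have madd: "h \<oplus>[LF] k \<in> ?m" if "h \<in> ?m" "k \<in> ?m" for h k
  using that val_add[of h k] by (cases "h = \<zero>[LF]"; cases "k = \<zero>[LF]"; cases "h \<oplus>[LF] k = \<zero>[LF]") auto
 have sub: "?c x \<subseteq> ?c y" if xy: "x \<in> ?O" "y \<in> ?O" "x (int_encode 0) = y (int_encode 0)" for x y
 proof
  fix w assume "w \<in> ?c x"
  then obtain h where h: "h \<in> ?m" "w = h \<oplus>[LF] x" by blast
  have "w = (h \<oplus>[LF] (x \<ominus>[LF] y)) \<oplus>[LF] y" using h xy by (simp add: LF.minus_eq LF.a_assoc LF.l_neg)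
  then show "w \<in> ?c y" using madd[OF h(1) cong[OF xy]] by blast
 qed
 let ?Q = "(LF \<lparr> carrier := ?O \<rparr>) Quot ?m"
 have Q: "carrier ?Q = ?c ` ?O"
  by (auto simp: FactRing_def A_RCOSETS_def' a_r_coset_def')
 \<comment> \<open>A residue class of the valuation ring is determined by its digit at index 0,
   which takes at most p values; \<open>r\<close> chooses a representative for each.\<close>
 define r where "r n = (SOME x. x \<in> ?O \<and> x (int_encode 0) = n)" for n :: nat
 have "carrier ?Q \<subseteq> (\<lambda>n. ?c (r n)) ` {..<p}"
 proof
  fix q assume "q \<in> carrier ?Q"
  then obtain x where x: "x \<in> ?O" "q = ?c x" unfolding Q by blast
  have "x (int_encode 0) < p" using x LF_carrier_iff by blast
  moreover have "r (x (int_encode 0)) \<in> ?O \<and> r (x (int_encode 0)) (int_encode 0) = x (int_encode 0)"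
   unfolding r_def by (rule someI[of _ x]) (use x in simp)
  then have "?c x = ?c (r (x (int_encode 0)))" using x by (intro equalityI sub) auto
  ultimately show "q \<in> (\<lambda>n. ?c (r n)) ` {..<p}" using x by blast
 qed
 then show "finite (carrier ?Q)" by (rule finite_subset) simp
 fix x y assume "x \<in> carrier LF - {\<zero>[LF]}" "y \<in> carrier LF - {\<zero>[LF]}"
 then show "laurent_val (x \<otimes>[LF] y) = laurent_val x + laurent_val y"
  "x \<oplus>[LF] y \<noteq> \<zero>[LF] \<Longrightarrow> min (laurent_val x) (laurent_val y) \<le> laurent_val (x \<oplus>[LF] y)"
  using val_mult val_add by auto
qed

lemma LF_char: "has_char LF p"
proof -
 have "add_pow LF n \<one>[LF] = cd (of_nat n)" for n
  by (induction n) (simp_all add: LF_zero code_add code_one LF.a_comm)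
 moreover have "(of_nat p :: int fls) \<in> PI" by (auto simp: laurent_ideal_def fls_of_nat)
 ultimately show ?thesis by (simp add: has_char_def code_zero_iff)
qed

end

section \<open>Linear combinations\<close>

definition lin_comb :: "('a, 'm, 'c) module_scheme \<Rightarrow> 'i set \<Rightarrow> ('i \<Rightarrow> 'a) \<Rightarrow> ('i \<Rightarrow> 'm) \<Rightarrow> 'm"
 where "lin_comb M I c w = (\<Oplus>\<^bsub>M\<^esub>i\<in>I. c i \<odot>[M] w i)"

abbreviation lin_endo :: "('a, 'b) ring_scheme \<Rightarrow> ('a, 'm) module \<Rightarrow> ('m \<Rightarrow> 'm) \<Rightarrow> bool"
 where "lin_endo A M \<equiv> semilinear A (\<lambda>a. a) M M"

context module
begin

lemma lc_empty [simp]: "lin_comb M {} c w = \<zero>[M]" by (simp add: lin_comb_def)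

lemma lc_insert:
 assumes "finite I" "i \<notin> I" "c i \<in> carrier R" "\<And>i. i \<in> I \<Longrightarrow> c i \<in> carrier R"
  "w i \<in> carrier M" "\<And>i. i \<in> I \<Longrightarrow> w i \<in> carrier M"
 shows "lin_comb M (insert i I) c w = c i \<odot>[M] w i \<oplus>[M] lin_comb M I c w"
 unfolding lin_comb_def by (rule M.finsum_insert) (use assms in auto)

lemma lc_closed [intro]:
 "(\<And>i. i \<in> I \<Longrightarrow> c i \<in> carrier R) \<Longrightarrow> (\<And>i. i \<in> I \<Longrightarrow> w i \<in> carrier M) \<Longrightarrow> lin_comb M I c w \<in> carrier M"
 unfolding lin_comb_def by (rule M.finsum_closed) auto

lemma lc_cong:
 "(\<And>i. i \<in> I \<Longrightarrow> c i = d i) \<Longrightarrow> (\<And>i. i \<in> I \<Longrightarrow> w i = v i) \<Longrightarrow>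
  (\<And>i. i \<in> I \<Longrightarrow> d i \<in> carrier R) \<Longrightarrow> (\<And>i. i \<in> I \<Longrightarrow> v i \<in> carrier M) \<Longrightarrow> lin_comb M I c w = lin_comb M I d v"
 unfolding lin_comb_def by (rule M.finsum_cong') auto

lemma lc_add:
 assumes "\<And>i. i \<in> I \<Longrightarrow> c i \<in> carrier R" "\<And>i. i \<in> I \<Longrightarrow> d i \<in> carrier R" "\<And>i. i \<in> I \<Longrightarrow> w i \<in> carrier M"
 shows "lin_comb M I (\<lambda>i. c i \<oplus> d i) w = lin_comb M I c w \<oplus>[M] lin_comb M I d w"
proof -
 have "lin_comb M I (\<lambda>i. c i \<oplus> d i) w = (\<Oplus>\<^bsub>M\<^esub>i\<in>I. c i \<odot>[M] w i \<oplus>[M] d i \<odot>[M] w i)"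
  unfolding lin_comb_def by (rule M.finsum_cong') (use assms in \<open>auto simp: smult_l_distr\<close>)
 also have "\<dots> = lin_comb M I c w \<oplus>[M] lin_comb M I d w"
  unfolding lin_comb_def by (rule M.finsum_addf) (use assms in auto)
 finally show ?thesis .
qed

lemma lc_add_vec:
 assumes "\<And>i. i \<in> I \<Longrightarrow> c i \<in> carrier R" "\<And>i. i \<in> I \<Longrightarrow> v i \<in> carrier M" "\<And>i. i \<in> I \<Longrightarrow> w i \<in> carrier M"
 shows "lin_comb M I c (\<lambda>i. v i \<oplus>[M] w i) = lin_comb M I c v \<oplus>[M] lin_comb M I c w"
proof -
 have "lin_comb M I c (\<lambda>i. v i \<oplus>[M] w i) = (\<Oplus>\<^bsub>M\<^esub>i\<in>I. c i \<odot>[M] v i \<oplus>[M] c i \<odot>[M] w i)"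
  unfolding lin_comb_def by (rule M.finsum_cong') (use assms in \<open>auto simp: smult_r_distr\<close>)
 also have "\<dots> = lin_comb M I c v \<oplus>[M] lin_comb M I c w"
  unfolding lin_comb_def by (rule M.finsum_addf) (use assms in auto)
 finally show ?thesis .
qed

lemma lc_smult:
 assumes "finite I" "a \<in> carrier R" "\<And>i. i \<in> I \<Longrightarrow> c i \<in> carrier R" "\<And>i. i \<in> I \<Longrightarrow> w i \<in> carrier M"
 shows "lin_comb M I (\<lambda>i. a \<otimes> c i) w = a \<odot>[M] lin_comb M I c w"
  and "lin_comb M I c (\<lambda>i. a \<odot>[M] w i) = a \<odot>[M] lin_comb M I c w"
proof -
 have "a \<odot>[M] lin_comb M I c w = (\<Oplus>\<^bsub>M\<^esub>i\<in>I. a \<odot>[M] (c i \<odot>[M] w i))"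
  unfolding lin_comb_def by (rule finsum_smult_ldistr) (use assms in auto)
 moreover have "\<dots> = lin_comb M I (\<lambda>i. a \<otimes> c i) w" unfolding lin_comb_def
  by (rule M.finsum_cong') (use assms in \<open>auto simp: smult_assoc1\<close>)
 moreover have "lin_comb M I (\<lambda>i. a \<otimes> c i) w = lin_comb M I c (\<lambda>i. a \<odot>[M] w i)" unfolding lin_comb_def
  by (rule M.finsum_cong') (use assms in \<open>auto simp: smult_assoc1[symmetric] m_comm\<close>)
 ultimately show "lin_comb M I (\<lambda>i. a \<otimes> c i) w = a \<odot>[M] lin_comb M I c w"
  "lin_comb M I c (\<lambda>i. a \<odot>[M] w i) = a \<odot>[M] lin_comb M I c w" by simp_all
qed

lemma lc_minus:
 assumes "finite I" "\<And>i. i \<in> I \<Longrightarrow> c i \<in> carrier R" "\<And>i. i \<in> I \<Longrightarrow> d i \<in> carrier R" "\<And>i. i \<in> I \<Longrightarrow> w i \<in> carrier M"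
 shows "lin_comb M I (\<lambda>i. c i \<ominus> d i) w = lin_comb M I c w \<ominus>[M] lin_comb M I d w"
proof -
 have "lin_comb M I (\<lambda>i. (\<ominus> \<one>) \<otimes> d i) w = \<ominus>[M] lin_comb M I d w"
  using lc_smult(1)[of I "\<ominus> \<one>" d w] assms lc_closed[of I d w] by (simp add: smult_l_minus)
 moreover have "lin_comb M I (\<lambda>i. c i \<ominus> d i) w = lin_comb M I (\<lambda>i. c i \<oplus> (\<ominus> \<one>) \<otimes> d i) w"
  by (rule lc_cong) (use assms in \<open>auto simp: R.minus_eq l_minus\<close>)
 moreover have "\<dots> = lin_comb M I c w \<oplus>[M] lin_comb M I (\<lambda>i. (\<ominus> \<one>) \<otimes> d i) w"
  by (rule lc_add) (use assms in auto)
 ultimately show ?thesis by (simp add: M.minus_eq)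
qed

lemma lc_delta:
 assumes "finite I" "j \<in> I" "\<And>i. i \<in> I \<Longrightarrow> w i \<in> carrier M"
 shows "lin_comb M I (\<lambda>i. if i = j then \<one> else \<zero>) w = w j"
proof -
 have "lin_comb M I (\<lambda>i. if i = j then \<one> else \<zero>) w = (\<Oplus>\<^bsub>M\<^esub>i\<in>I. if j = i then w i else \<zero>[M])"
  unfolding lin_comb_def by (rule M.finsum_cong') (use assms in auto)
 also have "\<dots> = w j" by (rule M.finsum_singleton) (use assms in auto)
 finally show ?thesis .
qed

lemma lc_lc:
 assumes "finite I" "finite J" "\<And>i j. i \<in> I \<Longrightarrow> j \<in> J \<Longrightarrow> t i j \<in> carrier R"
  "\<And>j. j \<in> J \<Longrightarrow> c j \<in> carrier R" "\<And>i. i \<in> I \<Longrightarrow> w i \<in> carrier M"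
 shows "lin_comb M J c (\<lambda>j. lin_comb M I (\<lambda>i. t i j) w) = lin_comb M I (\<lambda>i. \<Oplus>j\<in>J. t i j \<otimes> c j) w"
 using assms(2,3,4)
proof (induction J)
 case empty
 have "lin_comb M I (\<lambda>i. \<zero>) w = lin_comb M I (\<lambda>i. \<zero> \<otimes> \<zero>) w" by simp
 also have "\<dots> = \<zero>[M]" using lc_smult(1)[OF assms(1), of \<zero> "\<lambda>_. \<zero>" w] assms(5) lc_closed[of I "\<lambda>_. \<zero>" w] by simp
 finally show ?case by simp
next
 case (insert j J)
 have "lin_comb M (insert j J) c (\<lambda>j. lin_comb M I (\<lambda>i. t i j) w) =
   c j \<odot>[M] lin_comb M I (\<lambda>i. t i j) w \<oplus>[M] lin_comb M J c (\<lambda>j. lin_comb M I (\<lambda>i. t i j) w)"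
  by (rule lc_insert) (use insert assms(5) in auto)
 also have "c j \<odot>[M] lin_comb M I (\<lambda>i. t i j) w = lin_comb M I (\<lambda>i. c j \<otimes> t i j) w"
  by (rule lc_smult(1)[symmetric]) (use insert assms in auto)
 also have "lin_comb M J c (\<lambda>j. lin_comb M I (\<lambda>i. t i j) w) = lin_comb M I (\<lambda>i. \<Oplus>j\<in>J. t i j \<otimes> c j) w"
  by (rule insert.IH) (use insert in auto)
 also have "lin_comb M I (\<lambda>i. c j \<otimes> t i j) w \<oplus>[M] \<dots> = lin_comb M I (\<lambda>i. c j \<otimes> t i j \<oplus> (\<Oplus>j\<in>J. t i j \<otimes> c j)) w"
  by (rule lc_add[symmetric]) (use insert assms in \<open>auto intro!: R.finsum_closed\<close>)
 also have "\<dots> = lin_comb M I (\<lambda>i. \<Oplus>j\<in>insert j J. t i j \<otimes> c j) w"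
 proof (rule lc_cong)
  fix i assume i: "i \<in> I"
  have "(\<Oplus>j\<in>insert j J. t i j \<otimes> c j) = t i j \<otimes> c j \<oplus> (\<Oplus>j\<in>J. t i j \<otimes> c j)"
   by (rule R.finsum_insert) (use insert i in auto)
  then show "c j \<otimes> t i j \<oplus> (\<Oplus>j\<in>J. t i j \<otimes> c j) = (\<Oplus>j\<in>insert j J. t i j \<otimes> c j)"
   using insert i by (simp add: m_comm)
  show "(\<Oplus>j\<in>insert j J. t i j \<otimes> c j) \<in> carrier R" using insert i by (auto intro!: R.finsum_closed)
 qed (use assms in auto)
 finally show ?case .
qed

end

lemma semilinear_lc:
 assumes "module A M" "module B N" "semilinear A h M N T" "finite I" and h: "\<And>a. a \<in> carrier A \<Longrightarrow> h a \<in> carrier B"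
  and "h \<zero>[A] = \<zero>[B]"
  and "\<And>i. i \<in> I \<Longrightarrow> c i \<in> carrier A" "\<And>i. i \<in> I \<Longrightarrow> w i \<in> carrier M"
 shows "T (lin_comb M I c w) = lin_comb N I (\<lambda>i. h (c i)) (\<lambda>i. T (w i))"
 using assms(4,7,8)
proof (induction I)
 interpret M: module A M by fact
 interpret N: module B N by fact
 note T = assms(3)[unfolded semilinear_def]
 case empty
 have "T \<zero>[M] = T (\<zero>\<^bsub>A\<^esub> \<odot>[M] \<zero>[M])" by simp
 also have "\<dots> = h \<zero>[A] \<odot>[N] T \<zero>[M]" using T by blast
 also have "\<dots> = \<zero>[N]" unfolding assms(6) by (rule N.smult_l_null) (use T in auto)
 finally show ?case by simp
next
 interpret M: module A M by fact
 interpret N: module B N by fact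
 note T = assms(3)[unfolded semilinear_def]
 case (insert i I)
 have "T (lin_comb M (insert i I) c w) = T (c i \<odot>[M] w i \<oplus>[M] lin_comb M I c w)"
  using insert by (subst M.lc_insert) auto
 also have "\<dots> = T (c i \<odot>[M] w i) \<oplus>[N] T (lin_comb M I c w)"
  using T insert M.smult_closed[of "c i" "w i"] M.lc_closed[of I c w] by blast
 also have "T (c i \<odot>[M] w i) = h (c i) \<odot>[N] T (w i)" using T insert by blast
 also have "T (lin_comb M I c w) = lin_comb N I (\<lambda>i. h (c i)) (\<lambda>i. T (w i))" using insert by auto
 also have "h (c i) \<odot>[N] T (w i) \<oplus>[N] \<dots> = lin_comb N (insert i I) (\<lambda>i. h (c i)) (\<lambda>i. T (w i))"
  using insert T h by (subst N.lc_insert) auto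
 finally show ?case .
qed

section \<open>Modules over a power series subring\<close>

text \<open>In characteristic \<open>p\<close> such a module is free of finite rank over power series in \<open>x\<close> with
 coefficients modulo \<open>p\<close>; series are represented by their truncations at all orders.\<close>

locale x_module = laurent p + module R M for p and R :: "('a, 'b) ring_scheme" (structure) and M :: "('a, 'm) module" (structure) +
 fixes x
 assumes x: "x \<in> carrier R"
  and char_p: "add_pow R p \<one> = \<zero>"
  and x_inj: "z \<in> carrier M \<Longrightarrow> x \<odot>[M] z = \<zero>[M] \<Longrightarrow> z = \<zero>[M]"
  and x_sep: "y \<in> carrier M \<Longrightarrow> (\<And>k. \<exists>z\<in>carrier M. y = (x [^] (k::nat)) \<odot>[M] z) \<Longrightarrow> y = \<zero>[M]"
  and x_fin: "\<exists>W\<subseteq>carrier M. finite W \<and> (\<forall>y\<in>carrier M. \<exists>w\<in>W. \<exists>z\<in>carrier M. y = w \<oplus>[M] x \<odot>[M] z)"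
begin

definition "\<iota> i = add_pow R (i::int) \<one>"

lemma iota: "\<iota> i \<in> carrier R" "\<iota> 0 = \<zero>" "\<iota> 1 = \<one>" "\<iota> (i + j) = \<iota> i \<oplus> \<iota> j" "\<iota> (i * j) = \<iota> i \<otimes> \<iota> j"
proof -
 show c: "\<iota> i \<in> carrier R" for i by (simp add: \<iota>_def)
 show "\<iota> 0 = \<zero>" "\<iota> 1 = \<one>" "\<iota> (i + j) = \<iota> i \<oplus> \<iota> j"
  by (simp_all add: \<iota>_def R.add.int_pow_mult add_pow_int_ge)
 have "\<iota> i \<otimes> \<iota> j = add_pow R i (\<one> \<otimes> \<iota> j)" unfolding \<iota>_def using R.add_pow_ldistr_int[of \<one> "add_pow R j \<one>" i] by simp
 also have "\<dots> = \<iota> (i * j)" unfolding \<iota>_def by (simp add: R.add.int_pow_pow mult.commute)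
 finally show "\<iota> (i * j) = \<iota> i \<otimes> \<iota> j" ..
qed

lemma iota_dvd: "int p dvd i \<Longrightarrow> \<iota> i = \<zero>"
proof -
 assume "int p dvd i"
 then obtain j where "i = int p * j" by blast
 moreover have "\<iota> (int p) = \<zero>" using char_p by (simp add: \<iota>_def add_pow_int_ge)
 ultimately show "\<iota> i = \<zero>" by (simp add: iota)
qed

lemma iota_eq: "int p dvd i - j \<Longrightarrow> \<iota> i = \<iota> j"
 using iota(4)[of "i - j" j] by (simp add: iota_dvd iota)

lemma iota_minus: "\<iota> (- i) = \<ominus> \<iota> i"
proof -
 have "\<iota> (- i) \<oplus> \<iota> i = \<zero>" unfolding iota(4)[symmetric] by (simp add: iota)
 then show ?thesis using R.minus_equality[of "\<iota> (- i)" "\<iota> i"] by (simp add: iota)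
qed

text \<open>Horner's rule for the terms of degree below K, evaluated at x; recursion on the shifted
  series matches division by x in M.\<close>

primrec trunc :: "nat \<Rightarrow> int fps \<Rightarrow> 'a"
 where "trunc 0 f = \<zero>" | "trunc (Suc K) f = \<iota> (fps_nth f 0) \<oplus> x \<otimes> trunc K (fps_shift 1 f)"

lemma trunc_closed [simp]: "trunc K f \<in> carrier R"
 by (induction K arbitrary: f) (auto simp: iota x)

lemma trunc_add: "trunc K (f + g) = trunc K f \<oplus> trunc K g"
proof (induction K arbitrary: f g)
 case (Suc K)
 have "fps_shift 1 (f + g) = fps_shift 1 f + fps_shift 1 g" by (simp add: fps_eq_iff)
 then show ?case by (simp add: Suc iota x r_distr R.a_ac)
qed simp

lemma trunc_zero [simp]: "trunc K 0 = \<zero>" by (induction K) (simp_all add: iota x)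

lemma trunc_sum: "finite I \<Longrightarrow> trunc K (\<Sum>i\<in>I. f i) = (\<Oplus>i\<in>I. trunc K (f i))"
 by (induction I rule: finite_induct) (simp_all add: trunc_add)

lemma trunc_one: "trunc (Suc K) 1 = \<one>"
proof -
 have "fps_shift 1 (1 :: int fps) = 0" by (simp add: fps_eq_iff)
 then show ?thesis by (simp add: iota x)
qed

lemma trunc_const: "trunc K (fps_const c * g) = \<iota> c \<otimes> trunc K g"
proof (induction K arbitrary: g)
 case (Suc K)
 have "fps_shift 1 (fps_const c * g) = fps_const c * fps_shift 1 g" by (simp add: fps_eq_iff)
 then show ?case by (simp add: Suc iota x r_distr m_lcomm m_assoc)
qed (simp add: iota)

lemma trunc_Suc: "\<exists>c\<in>carrier R. trunc (Suc K) f = trunc K f \<oplus> x [^] K \<otimes> c"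
proof (induction K arbitrary: f)
 case 0
 show ?case by (rule bexI[of _ "trunc (Suc 0) f"]) (simp_all add: iota x)
next
 case (Suc K)
 from Suc[of "fps_shift 1 f"] obtain c where c: "c \<in> carrier R"
  "trunc (Suc K) (fps_shift 1 f) = trunc K (fps_shift 1 f) \<oplus> x [^] K \<otimes> c" by blast
 have "trunc (Suc (Suc K)) f = \<iota> (fps_nth f 0) \<oplus> x \<otimes> trunc (Suc K) (fps_shift 1 f)" by (rule trunc.simps)
 also have "\<dots> = trunc (Suc K) f \<oplus> x [^] Suc K \<otimes> c"
  unfolding c(2) using c(1) by (simp add: x iota r_distr R.a_assoc m_ac)
 finally show ?case using c(1) by blast
qed


text \<open>Truncation is multiplicative only modulo x^K. Splitting f into its constant term and X
  times the shifted series reduces the claim to the preceding order.\<close>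

lemma trunc_mult: "\<exists>c\<in>carrier R. trunc K (f * g) = trunc K f \<otimes> trunc K g \<oplus> x [^] K \<otimes> c"
proof (induction K arbitrary: f)
 case 0
 show ?case by (rule bexI[of _ \<zero>]) simp_all
next
 case (Suc K)
 let ?f = "fps_shift 1 f"
 obtain c where c: "c \<in> carrier R" "trunc K (?f * g) = trunc K ?f \<otimes> trunc K g \<oplus> x [^] K \<otimes> c"
  using Suc by blast
 obtain d where d: "d \<in> carrier R" "trunc (Suc K) g = trunc K g \<oplus> x [^] K \<otimes> d" using trunc_Suc by blast
 have f: "f = fps_const (fps_nth f 0) + fps_X * ?f"
 proof (rule fps_ext)
  fix n show "fps_nth f n = fps_nth (fps_const (fps_nth f 0) + fps_X * ?f) n" by (cases n) simp_all
 qed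
 have fg: "f * g = fps_const (fps_nth f 0) * g + fps_X * (?f * g)"
  by (subst f) (simp add: algebra_simps)
 have X: "trunc (Suc K) (fps_X * h) = x \<otimes> trunc K h" for h
 proof -
  have "fps_shift 1 (fps_X * h) = h" by (simp add: fps_eq_iff)
  then show ?thesis by (simp add: iota x)
 qed
 have "trunc (Suc K) (f * g) = \<iota> (fps_nth f 0) \<otimes> trunc (Suc K) g \<oplus> x \<otimes> trunc K (?f * g)"
  unfolding fg trunc_add trunc_const X ..
 also have "\<dots> = (\<iota> (fps_nth f 0) \<oplus> x \<otimes> trunc K ?f) \<otimes> trunc (Suc K) g \<oplus> x [^] Suc K \<otimes> (c \<ominus> trunc K ?f \<otimes> d)"
 proof -
  define a where "a = \<iota> (fps_nth f 0)"
  define t where "t = trunc K ?f"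
  define b where "b = trunc K g"
  define q where "q = x [^] K"
  have cl: "a \<in> carrier R" "t \<in> carrier R" "b \<in> carrier R" "q \<in> carrier R" by (simp_all add: a_def t_def b_def q_def iota x)
  have "x \<otimes> (t \<otimes> b \<oplus> q \<otimes> c) = (x \<otimes> t) \<otimes> (b \<oplus> q \<otimes> d) \<oplus> x \<otimes> q \<otimes> (c \<ominus> t \<otimes> d)"
   using cl c(1) d(1) x by algebra
  then show ?thesis unfolding d(2) c(2) R.nat_pow_Suc using cl c(1) d(1) x
   by (simp add: a_def[symmetric] t_def[symmetric] b_def[symmetric] q_def[symmetric] l_distr R.a_assoc m_comm[of q x] del: trunc.simps One_nat_def)
 qed
 finally show ?case using c(1) d(1) by (intro bexI[of _ "c \<ominus> trunc K ?f \<otimes> d"]) simp_all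
qed

lemma trunc_eq: "(\<And>k. k < K \<Longrightarrow> int p dvd fps_nth f k - fps_nth g k) \<Longrightarrow> trunc K f = trunc K g"
proof (induction K arbitrary: f g)
 case (Suc K)
 have "\<iota> (fps_nth f 0) = \<iota> (fps_nth g 0)" by (rule iota_eq) (rule Suc.prems, simp)
 moreover have "trunc K (fps_shift 1 f) = trunc K (fps_shift 1 g)"
  by (rule Suc.IH) (use Suc.prems in auto)
 ultimately show ?case by simp
qed simp


lemma spanning_set:
 "\<exists>W\<subseteq>carrier M. finite W \<and> (\<forall>y\<in>carrier M. \<exists>c. \<exists>z\<in>carrier M. y = lin_comb M W (\<lambda>w. \<iota> (c w)) (\<lambda>w. w) \<oplus>[M] x \<odot>[M] z)"
proof -
 obtain W where W: "W \<subseteq> carrier M" "finite W"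
  "\<And>y. y \<in> carrier M \<Longrightarrow> \<exists>w\<in>W. \<exists>z\<in>carrier M. y = w \<oplus>[M] x \<odot>[M] z" using x_fin by blast
 have "\<exists>c. \<exists>z\<in>carrier M. y = lin_comb M W (\<lambda>w. \<iota> (c w)) (\<lambda>w. w) \<oplus>[M] x \<odot>[M] z" if y: "y \<in> carrier M" for y
 proof -
  obtain w z where wz: "w \<in> W" "z \<in> carrier M" "y = w \<oplus>[M] x \<odot>[M] z" using W(3)[OF y] by blast
  have "lin_comb M W (\<lambda>v. \<iota> (if v = w then 1 else 0)) (\<lambda>w. w) = lin_comb M W (\<lambda>v. if v = w then \<one> else \<zero>) (\<lambda>w. w)"
   by (rule lc_cong) (use W in \<open>auto simp: iota\<close>)
  also have "\<dots> = w" by (rule lc_delta) (use W wz in auto)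
  finally show ?thesis using wz(2,3) by (intro exI[of _ "\<lambda>v. if v = w then 1 else 0"] bexI[of _ z]) simp_all
 qed
 then show ?thesis using W(1,2) by (intro exI[of _ W]) simp
qed

text \<open>Take a set of least size that spans M/xM over the integers modulo p. If a relation had a
  coefficient prime to p, Bezout would invert it modulo p and the vector carrying it could be
  removed.\<close>

lemma independent_spanning:
 "\<exists>(m::nat) w. (\<forall>i<m. w i \<in> carrier M) \<and>
  (\<forall>y\<in>carrier M. \<exists>c. \<exists>z\<in>carrier M. y = lin_comb M {..<m} (\<lambda>i. \<iota> (c i)) w \<oplus>[M] x \<odot>[M] z) \<and>
  (\<forall>c. \<forall>z\<in>carrier M. lin_comb M {..<m} (\<lambda>i. \<iota> (c i)) w = x \<odot>[M] z \<longrightarrow> (\<forall>i<m. int p dvd c i))"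
proof -
 define P where "P W \<longleftrightarrow> W \<subseteq> carrier M \<and> finite W \<and>
  (\<forall>y\<in>carrier M. \<exists>c. \<exists>z\<in>carrier M. y = lin_comb M W (\<lambda>w. \<iota> (c w)) (\<lambda>w. w) \<oplus>[M] x \<odot>[M] z)" for W
 have "\<exists>W. P W" using spanning_set unfolding P_def .
 then obtain W0 where "P W0" ..
 define W where "W = arg_min card P"
 have W: "P W" "P V \<Longrightarrow> card W \<le> card V" for V
  using arg_min_nat_lemma[of P W0 card] \<open>P W0\<close> by (simp_all add: W_def)
 have Wc: "W \<subseteq> carrier M" and fin: "finite W"
  and span: "\<And>y. y \<in> carrier M \<Longrightarrow> \<exists>c. \<exists>z\<in>carrier M. y = lin_comb M W (\<lambda>w. \<iota> (c w)) (\<lambda>w. w) \<oplus>[M] x \<odot>[M] z"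
  using W(1) by (auto simp: P_def)
 have indep: "int p dvd c v" if c: "z \<in> carrier M" "lin_comb M W (\<lambda>w. \<iota> (c w)) (\<lambda>w. w) = x \<odot>[M] z" and v: "v \<in> W" for c z v
 proof (rule ccontr)
  assume "\<not> int p dvd c v"
  then have "coprime (c v) (int p)" using p_prime_int by (meson coprime_commute prime_imp_coprime)
  then obtain b e where be: "b * c v + e * int p = 1" using bezout_int[of "c v" "int p"] by auto
  let ?V = "W - {v}"
  have Vf: "finite ?V" "v \<notin> ?V" "insert v ?V = W" and vc: "v \<in> carrier M" using fin v Wc by auto
  have split: "lin_comb M W (\<lambda>w. \<iota> (a w)) (\<lambda>w. w) = \<iota> (a v) \<odot>[M] v \<oplus>[M] lin_comb M ?V (\<lambda>w. \<iota> (a w)) (\<lambda>w. w)" for a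
  proof -
   have "lin_comb M (insert v ?V) (\<lambda>w. \<iota> (a w)) (\<lambda>w. w) = \<iota> (a v) \<odot>[M] v \<oplus>[M] lin_comb M ?V (\<lambda>w. \<iota> (a w)) (\<lambda>w. w)"
    by (rule lc_insert) (use Vf(1,2) Wc vc in \<open>auto simp: iota(1)\<close>)
   then show ?thesis by (simp only: Vf(3))
  qed
  have cl: "lin_comb M ?V (\<lambda>w. \<iota> (a w)) (\<lambda>w. w) \<in> carrier M" for a by (rule lc_closed) (use Wc in \<open>auto simp: iota\<close>)
  have "b * c v - 1 = int p * (- e)" using be by (simp add: algebra_simps)
  then have "int p dvd b * c v - 1" by (simp only: dvd_triv_left)
  from iota_eq[OF this] have "\<iota> (b * c v) = \<one>" by (simp add: iota(3))
  then have vv: "v = \<iota> b \<odot>[M] (\<iota> (c v) \<odot>[M] v)" using vc by (simp add: iota smult_assoc1[symmetric])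
  have "\<iota> (c v) \<odot>[M] v = x \<odot>[M] z \<ominus>[M] lin_comb M ?V (\<lambda>w. \<iota> (c w)) (\<lambda>w. w)"
   unfolding c(2)[symmetric] split using cl[of c] vc by (simp add: iota(1) M.minus_eq M.a_assoc M.r_neg)
  then have v2: "v = x \<odot>[M] (\<iota> b \<odot>[M] z) \<oplus>[M] lin_comb M ?V (\<lambda>w. \<iota> (- b * c w)) (\<lambda>w. w)"
  proof -
   have "lin_comb M ?V (\<lambda>w. \<iota> (- b * c w)) (\<lambda>w. w) = lin_comb M ?V (\<lambda>w. \<ominus> \<iota> b \<otimes> \<iota> (c w)) (\<lambda>w. w)"
    by (rule lc_cong) (use Wc in \<open>auto simp: iota iota_minus l_minus\<close>)
   also have "\<dots> = (\<ominus> \<iota> b) \<odot>[M] lin_comb M ?V (\<lambda>w. \<iota> (c w)) (\<lambda>w. w)"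
    by (rule lc_smult(1)) (use Vf Wc in \<open>auto simp: iota\<close>)
   finally have l: "lin_comb M ?V (\<lambda>w. \<iota> (- b * c w)) (\<lambda>w. w) = \<ominus>[M] (\<iota> b \<odot>[M] lin_comb M ?V (\<lambda>w. \<iota> (c w)) (\<lambda>w. w))"
    using cl[of c] by (simp add: smult_l_minus iota)
   assume "\<iota> (c v) \<odot>[M] v = x \<odot>[M] z \<ominus>[M] lin_comb M ?V (\<lambda>w. \<iota> (c w)) (\<lambda>w. w)"
   with vv have "v = \<iota> b \<odot>[M] (x \<odot>[M] z \<ominus>[M] lin_comb M ?V (\<lambda>w. \<iota> (c w)) (\<lambda>w. w))" by simp
   also have "\<dots> = \<iota> b \<odot>[M] (x \<odot>[M] z) \<ominus>[M] \<iota> b \<odot>[M] lin_comb M ?V (\<lambda>w. \<iota> (c w)) (\<lambda>w. w)"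
    using cl[of c] c(1) x by (simp add: M.minus_eq smult_r_distr smult_r_minus iota)
   also have "\<iota> b \<odot>[M] (x \<odot>[M] z) = x \<odot>[M] (\<iota> b \<odot>[M] z)" using c(1) x by (simp add: smult_assoc1[symmetric] iota m_comm)
   finally show ?thesis unfolding l by (simp add: M.minus_eq)
  qed
  have "P ?V" unfolding P_def
  proof (intro conjI ballI)
   fix y assume "y \<in> carrier M"
   from span[OF this] obtain a u where u: "u \<in> carrier M" "y = lin_comb M W (\<lambda>w. \<iota> (a w)) (\<lambda>w. w) \<oplus>[M] x \<odot>[M] u" by blast
   let ?z = "\<iota> (a v) \<odot>[M] (\<iota> b \<odot>[M] z) \<oplus>[M] u"
   have "\<iota> (a v) \<odot>[M] v = \<iota> (a v) \<odot>[M] (x \<odot>[M] (\<iota> b \<odot>[M] z) \<oplus>[M] lin_comb M ?V (\<lambda>w. \<iota> (- b * c w)) (\<lambda>w. w))"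
    using v2 by simp
   also have "\<dots> = x \<odot>[M] (\<iota> (a v) \<odot>[M] (\<iota> b \<odot>[M] z)) \<oplus>[M] \<iota> (a v) \<odot>[M] lin_comb M ?V (\<lambda>w. \<iota> (- b * c w)) (\<lambda>w. w)"
    using c(1) x cl[of "\<lambda>w. - b * c w"] by (simp add: smult_r_distr iota(1) smult_assoc1[symmetric] m_ac)
   also have "\<iota> (a v) \<odot>[M] lin_comb M ?V (\<lambda>w. \<iota> (- b * c w)) (\<lambda>w. w) = lin_comb M ?V (\<lambda>w. \<iota> (a v * (- b * c w))) (\<lambda>w. w)"
    unfolding iota(5)[of "a v"] by (rule lc_smult(1)[symmetric]) (use Vf Wc in \<open>auto simp: iota(1)\<close>)
   finally have av: "\<iota> (a v) \<odot>[M] v = x \<odot>[M] (\<iota> (a v) \<odot>[M] (\<iota> b \<odot>[M] z)) \<oplus>[M] lin_comb M ?V (\<lambda>w. \<iota> (a v * (- b * c w))) (\<lambda>w. w)" .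
   have "lin_comb M ?V (\<lambda>w. \<iota> (a v * (- b * c w) + a w)) (\<lambda>w. w) =
     lin_comb M ?V (\<lambda>w. \<iota> (a v * (- b * c w))) (\<lambda>w. w) \<oplus>[M] lin_comb M ?V (\<lambda>w. \<iota> (a w)) (\<lambda>w. w)"
    unfolding iota(4) by (rule lc_add) (use Wc in \<open>auto simp: iota(1)\<close>)
   then have "y = lin_comb M ?V (\<lambda>w. \<iota> (a v * (- b * c w) + a w)) (\<lambda>w. w) \<oplus>[M] x \<odot>[M] ?z"
    unfolding u(2) split av using u(1) c(1) x cl[of a] cl[of "\<lambda>w. a v * (- b * c w)"] by (simp add: smult_r_distr iota(1) M.a_ac)
   then show "\<exists>c. \<exists>z\<in>carrier M. y = lin_comb M ?V (\<lambda>w. \<iota> (c w)) (\<lambda>w. w) \<oplus>[M] x \<odot>[M] z"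
    using u(1) c(1) by (intro exI[of _ "\<lambda>w. a v * (- b * c w) + a w"] bexI[of _ ?z]) (simp_all add: iota(1))
  qed (use Wc Vf in auto)
  from W(2)[OF this] show False using v fin by (metis card_Diff1_less linorder_not_le)
 qed
 obtain w where w: "bij_betw w {..<card W} W"
  using ex_bij_betw_nat_finite[OF fin] by (auto simp: atLeast0LessThan)
 have wc: "w i \<in> carrier M" if "i < card W" for i using w that Wc by (auto simp: bij_betw_def)
 have re: "lin_comb M {..<card W} (\<lambda>i. \<iota> (c (w i))) w = lin_comb M W (\<lambda>w. \<iota> (c w)) (\<lambda>w. w)" for c
 proof -
  have "lin_comb M (w ` {..<card W}) (\<lambda>w. \<iota> (c w)) (\<lambda>w. w) = lin_comb M {..<card W} (\<lambda>i. \<iota> (c (w i))) w"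
   unfolding lin_comb_def by (rule M.finsum_reindex) (use w Wc wc in \<open>auto simp: bij_betw_def iota(1)\<close>)
  then show ?thesis using w by (simp add: bij_betw_def)
 qed
 show ?thesis
 proof (rule exI[of _ "card W"], rule exI[of _ w], intro conjI allI impI ballI)
  fix y assume "y \<in> carrier M"
  from span[OF this] obtain a u where "u \<in> carrier M" "y = lin_comb M W (\<lambda>w. \<iota> (a w)) (\<lambda>w. w) \<oplus>[M] x \<odot>[M] u" by blast
  then show "\<exists>c. \<exists>z\<in>carrier M. y = lin_comb M {..<card W} (\<lambda>i. \<iota> (c i)) w \<oplus>[M] x \<odot>[M] z"
   unfolding re[symmetric] by (intro exI[of _ "\<lambda>i. a (w i)"] bexI[of _ u])
 next
  fix c z i assume z: "z \<in> carrier M" "lin_comb M {..<card W} (\<lambda>i. \<iota> (c i)) w = x \<odot>[M] z" and i: "i < card W"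
  define d where "d = (\<lambda>v. c (inv_into {..<card W} w v))"
  have d: "d (w i) = c i" if "i < card W" for i using w that by (simp add: d_def bij_betw_def)
  have "lin_comb M {..<card W} (\<lambda>i. \<iota> (c i)) w = lin_comb M {..<card W} (\<lambda>i. \<iota> (d (w i))) w"
   by (rule lc_cong) (use d wc in \<open>auto simp: iota(1)\<close>)
  then have "lin_comb M W (\<lambda>w. \<iota> (d w)) (\<lambda>w. w) = x \<odot>[M] z" using z(2) re[of d] by simp
  from indep[OF z(1) this] have "int p dvd d (w i)" using w i by (auto simp: bij_betw_def)
  then show "int p dvd c i" using d[OF i] by simp
 qed (use wc in auto)
qed

end

section \<open>Power series coordinates and matrices over the Laurent field\<close>

lemma (in abelian_group) add_diff_cancel:
 assumes "a \<in> carrier G" "b \<in> carrier G"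
 shows "a \<oplus> b \<ominus> a = b" "a \<oplus> (b \<ominus> a) = b"
proof -
 show 1: "a \<oplus> b \<ominus> a = b" using assms by (simp add: minus_eq a_comm[of a b] a_assoc r_neg)
 show "a \<oplus> (b \<ominus> a) = b" using 1 assms by (simp add: minus_eq a_assoc)
qed

text \<open>The vectors w reduce to a basis of M/xM over the integers modulo p; \<open>span\<close>
  and \<open>indep\<close> express this without forming the quotient.\<close>

locale x_basis = x_module p R M x
 for p and R :: "('a, 'b) ring_scheme" (structure) and M :: "('a, 'm) module" (structure) and x +
 fixes m and w :: "nat \<Rightarrow> 'm"
 assumes wc: "\<And>i. i < m \<Longrightarrow> w i \<in> carrier M"
  and span: "\<And>y. y \<in> carrier M \<Longrightarrow>
   \<exists>c. \<exists>z\<in>carrier M. y = lin_comb M {..<m} (\<lambda>i. \<iota> (c i)) w \<oplus>[M] x \<odot>[M] z"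
  and indep: "\<And>c z i. z \<in> carrier M \<Longrightarrow> lin_comb M {..<m} (\<lambda>i. \<iota> (c i)) w = x \<odot>[M] z \<Longrightarrow> i < m \<Longrightarrow> int p dvd c i"
begin

definition "rep K y f \<longleftrightarrow> (\<exists>u\<in>carrier M. y = lin_comb M {..<m} (\<lambda>i. trunc K (f i)) w \<oplus>[M] x [^] K \<odot>[M] u)"

lemma tlc_closed [simp]: "lin_comb M {..<m} (\<lambda>i. trunc K (f i)) w \<in> carrier M"
 by (rule lc_closed) (auto simp: wc)

lemma xK [simp]: "x [^] (K::nat) \<in> carrier R" by (simp add: x)

lemma tlc_Suc: "lin_comb M {..<m} (\<lambda>i. trunc (Suc K) (f i)) w =
  lin_comb M {..<m} (\<lambda>i. \<iota> (fps_nth (f i) 0)) w \<oplus>[M] x \<odot>[M] lin_comb M {..<m} (\<lambda>i. trunc K (fps_shift 1 (f i))) w"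
proof -
 have "lin_comb M {..<m} (\<lambda>i. trunc (Suc K) (f i)) w = lin_comb M {..<m} (\<lambda>i. \<iota> (fps_nth (f i) 0)) w \<oplus>[M]
   lin_comb M {..<m} (\<lambda>i. x \<otimes> trunc K (fps_shift 1 (f i))) w"
  unfolding trunc.simps by (rule lc_add) (auto simp: iota(1) x wc)
 also have "lin_comb M {..<m} (\<lambda>i. x \<otimes> trunc K (fps_shift 1 (f i))) w = x \<odot>[M] lin_comb M {..<m} (\<lambda>i. trunc K (fps_shift 1 (f i))) w"
  by (rule lc_smult(1)) (auto simp: x wc)
 finally show ?thesis .
qed

lemma ilc_closed [simp]: "lin_comb M {..<m} (\<lambda>i. \<iota> (c i)) w \<in> carrier M"
 by (rule lc_closed) (auto simp: wc iota(1))

text \<open>Repeated division by x: the remainders give the digits, and the quotients are divided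
  again. A single family of series serves all precisions K.\<close>

lemma ex_rep:
 assumes y: "y \<in> carrier M"
 shows "\<exists>f. \<forall>K. rep K y f"
proof -
 define step where "step y = (SOME cz. snd cz \<in> carrier M \<and>
  y = lin_comb M {..<m} (\<lambda>i. \<iota> (fst cz i)) w \<oplus>[M] x \<odot>[M] snd cz)" for y
 have step: "snd (step y) \<in> carrier M"
   "y = lin_comb M {..<m} (\<lambda>i. \<iota> (fst (step y) i)) w \<oplus>[M] x \<odot>[M] snd (step y)" if y: "y \<in> carrier M" for y
 proof -
  obtain c z where cz: "z \<in> carrier M" "y = lin_comb M {..<m} (\<lambda>i. \<iota> (c i)) w \<oplus>[M] x \<odot>[M] z" using span[OF y] by (elim exE bexE)
  let ?Q = "\<lambda>cz. snd cz \<in> carrier M \<and> y = lin_comb M {..<m} (\<lambda>i. \<iota> (fst cz i)) w \<oplus>[M] x \<odot>[M] snd cz"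
  have "?Q (c, z)" using cz by simp
  then have "?Q (step y)" unfolding step_def by (rule someI[of ?Q])
  then show "snd (step y) \<in> carrier M"
   "y = lin_comb M {..<m} (\<lambda>i. \<iota> (fst (step y) i)) w \<oplus>[M] x \<odot>[M] snd (step y)" by (rule conjunct1, rule conjunct2)
 qed
 define f where "f y i = Abs_fps (\<lambda>k. fst (step (((snd \<circ> step) ^^ k) y)) i)" for y i
 have f: "fps_shift 1 (f y i) = f (snd (step y)) i" "fps_nth (f y i) 0 = fst (step y) i" for y i
  by (simp_all add: f_def fps_eq_iff funpow_swap1)
 have "rep K y (f y)" if "y \<in> carrier M" for K y using that
 proof (induction K arbitrary: y)
  case 0
  have "lin_comb M {..<m} (\<lambda>i. \<zero>) w = \<zero>[M]"
   using lc_smult(1)[of "{..<m}" \<zero> "\<lambda>_. \<zero>" w] lc_closed[of "{..<m}" "\<lambda>_. \<zero>" w] wc by simp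
  then show ?case using 0 by (auto simp: rep_def)
 next
  case (Suc K)
  from Suc.IH[OF step(1)[OF Suc.prems]] obtain u where u: "u \<in> carrier M"
   "snd (step y) = lin_comb M {..<m} (\<lambda>i. trunc K (f (snd (step y)) i)) w \<oplus>[M] x [^] K \<odot>[M] u" by (auto simp: rep_def)
  have "x \<odot>[M] snd (step y) = x \<odot>[M] (lin_comb M {..<m} (\<lambda>i. trunc K (f (snd (step y)) i)) w \<oplus>[M] x [^] K \<odot>[M] u)"
   by (rule arg_cong[OF u(2)])
  also have "\<dots> = x \<odot>[M] lin_comb M {..<m} (\<lambda>i. trunc K (f (snd (step y)) i)) w \<oplus>[M] x [^] Suc K \<odot>[M] u"
   using u(1) x by (simp add: smult_r_distr smult_assoc1[symmetric] m_comm)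
  finally have "lin_comb M {..<m} (\<lambda>i. \<iota> (fst (step y) i)) w \<oplus>[M] x \<odot>[M] snd (step y) =
    lin_comb M {..<m} (\<lambda>i. trunc (Suc K) (f y i)) w \<oplus>[M] x [^] Suc K \<odot>[M] u"
   unfolding tlc_Suc f using u(1) x by (simp add: M.a_assoc del: R.nat_pow_Suc)
  then show ?case unfolding rep_def using u(1) step(2)[OF Suc.prems] by (intro bexI[of _ u]) simp_all
 qed
 then show ?thesis using y by (intro exI[of _ "f y"]) simp
qed

text \<open>Modulo x, \<open>indep\<close> forces the constant digits to vanish modulo p. They then
  drop out, and \<open>x_inj\<close> cancels a factor x, which lowers K by one.\<close>

lemma trunc_lc_dvd:
 assumes "u \<in> carrier M" "lin_comb M {..<m} (\<lambda>i. trunc K (f i)) w = x [^] K \<odot>[M] u" "k < K" "i < m"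
 shows "int p dvd fps_nth (f i) k"
 using assms
proof (induction K arbitrary: f k u)
 case (Suc K)
 let ?a = "lin_comb M {..<m} (\<lambda>i. \<iota> (fps_nth (f i) 0)) w" and ?b = "lin_comb M {..<m} (\<lambda>i. trunc K (fps_shift 1 (f i))) w"
 have e: "?a \<oplus>[M] x \<odot>[M] ?b = x \<odot>[M] (x [^] K \<odot>[M] u)"
  using Suc.prems(1,2) x unfolding tlc_Suc by (simp add: smult_assoc1[symmetric] m_comm)
 have bc: "?b \<in> carrier M" by simp
 have "?a = (?a \<oplus>[M] x \<odot>[M] ?b) \<ominus>[M] x \<odot>[M] ?b" using x bc by (simp add: M.minus_eq M.a_assoc M.r_neg)
 also have "\<dots> = x \<odot>[M] (x [^] K \<odot>[M] u \<ominus>[M] ?b)"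
  unfolding e using x bc Suc.prems(1) by (simp add: M.minus_eq smult_r_distr smult_r_minus)
 finally have a: "?a = x \<odot>[M] (x [^] K \<odot>[M] u \<ominus>[M] ?b)" .
 have zc: "x [^] K \<odot>[M] u \<ominus>[M] ?b \<in> carrier M" using Suc.prems(1) bc by simp
 have d0: "int p dvd fps_nth (f i) 0" if "i < m" for i by (rule indep[OF zc a that])
 have "?a = lin_comb M {..<m} (\<lambda>i. \<zero> \<otimes> \<zero>) w"
  by (rule lc_cong) (auto simp: wc iota_dvd[OF d0])
 also have "\<dots> = \<zero>[M]" using lc_smult(1)[of "{..<m}" \<zero> "\<lambda>_. \<zero>" w] lc_closed[of "{..<m}" "\<lambda>_. \<zero>" w] wc by simp
 finally have "x \<odot>[M] (x [^] K \<odot>[M] u \<ominus>[M] ?b) = \<zero>[M]" using a by simp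
 from x_inj[OF zc this] have "x [^] K \<odot>[M] u = ?b" by (rule M.diff_zero_eq[OF smult_closed[OF xK Suc.prems(1)] bc])
 note b = this[symmetric]
 show ?case
 proof (cases k)
  case 0 then show ?thesis using d0 Suc.prems by simp
 next
  case (Suc l)
  then have "int p dvd fps_nth (fps_shift 1 (f i)) l" using Suc.IH[OF Suc.prems(1) b, of l] Suc.prems(3,4) by simp
  then show ?thesis using Suc by simp
 qed
qed simp

lemma trunc_diff: "trunc K (f - g) = trunc K f \<ominus> trunc K g"
 using trunc_add[of K "f - g" g] by (simp add: R.minus_eq R.a_assoc R.r_neg)

lemma rep_unique:
 assumes "rep K y f" "rep K z g" "v \<in> carrier M" "y = z \<oplus>[M] x [^] K \<odot>[M] v" "k < K" "i < m"
 shows "int p dvd fps_nth (f i) k - fps_nth (g i) k"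
proof -
 let ?F = "lin_comb M {..<m} (\<lambda>i. trunc K (f i)) w" and ?G = "lin_comb M {..<m} (\<lambda>i. trunc K (g i)) w"
 obtain u u' where u: "u \<in> carrier M" "y = ?F \<oplus>[M] x [^] K \<odot>[M] u"
  "u' \<in> carrier M" "z = ?G \<oplus>[M] x [^] K \<odot>[M] u'" using assms(1,2) by (auto simp: rep_def)
 have F: "?F = y \<ominus>[M] x [^] K \<odot>[M] u" using u(1) by (simp add: u(2) M.minus_eq M.a_assoc M.r_neg)
 have "lin_comb M {..<m} (\<lambda>i. trunc K (f i - g i)) w = ?F \<ominus>[M] ?G"
  unfolding trunc_diff by (rule lc_minus) (auto simp: wc)
 also have "\<dots> = x [^] K \<odot>[M] (u' \<oplus>[M] v \<ominus>[M] u)"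
 proof -
  define a where "a = ?G"
  define b where "b = x [^] K \<odot>[M] u'" define c where "c = x [^] K \<odot>[M] v" define d where "d = x [^] K \<odot>[M] u"
  have cl: "a \<in> carrier M" "b \<in> carrier M" "c \<in> carrier M" "d \<in> carrier M"
   unfolding a_def b_def c_def d_def using u assms(3) by simp_all
  have r: "x [^] K \<odot>[M] (u' \<oplus>[M] v \<ominus>[M] u) = b \<oplus>[M] c \<ominus>[M] d" unfolding b_def c_def d_def
   using u assms(3) by (simp add: M.minus_eq smult_r_distr smult_r_minus)
  have "a \<oplus>[M] b \<oplus>[M] c \<ominus>[M] d \<ominus>[M] a = b \<oplus>[M] c \<ominus>[M] d"
   using cl M.add_diff_cancel(1)[of a "b \<oplus>[M] c \<ominus>[M] d"] by (simp add: M.minus_eq M.a_assoc)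
  then show ?thesis unfolding F r assms(4) u(4) a_def[symmetric] b_def[symmetric] c_def[symmetric] d_def[symmetric] .
 qed
 finally have "int p dvd fps_nth (f i - g i) k"
  by (rule trunc_lc_dvd[rotated]) (use u assms in auto)
 then show ?thesis by simp
qed

lemma rep_map:
 assumes T: "lin_endo R M T" and y: "rep K y f" and t: "\<And>j. j < m \<Longrightarrow> rep K (T (w j)) (t j)"
 shows "rep K (T y) (\<lambda>i. \<Sum>j<m. t j i * f j)"
proof -
 note md = module_axioms
 have Tc: "T z \<in> carrier M" if "z \<in> carrier M" for z using T that by (auto simp: semilinear_def)
 obtain u where u: "u \<in> carrier M" "y = lin_comb M {..<m} (\<lambda>j. trunc K (f j)) w \<oplus>[M] x [^] K \<odot>[M] u" using y by (auto simp: rep_def)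
 have "\<forall>j. \<exists>v. j < m \<longrightarrow> v \<in> carrier M \<and> T (w j) = lin_comb M {..<m} (\<lambda>i. trunc K (t j i)) w \<oplus>[M] x [^] K \<odot>[M] v"
  using t unfolding rep_def by blast
 from choice[OF this] obtain v where v0: "\<forall>j. j < m \<longrightarrow> v j \<in> carrier M \<and>
  T (w j) = lin_comb M {..<m} (\<lambda>i. trunc K (t j i)) w \<oplus>[M] x [^] K \<odot>[M] v j" ..
 have v: "v j \<in> carrier M"
  "T (w j) = lin_comb M {..<m} (\<lambda>i. trunc K (t j i)) w \<oplus>[M] x [^] K \<odot>[M] v j" if "j < m" for j
  using v0 that by auto
 have "\<forall>ij. \<exists>c. c \<in> carrier R \<and> trunc K (t (snd ij) (fst ij) * f (snd ij)) =
   trunc K (t (snd ij) (fst ij)) \<otimes> trunc K (f (snd ij)) \<oplus> x [^] K \<otimes> c"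
  using trunc_mult[unfolded Bex_def] by (rule allI)
 from choice[OF this] obtain c where c0: "\<forall>ij. c ij \<in> carrier R \<and> trunc K (t (snd ij) (fst ij) * f (snd ij)) =
   trunc K (t (snd ij) (fst ij)) \<otimes> trunc K (f (snd ij)) \<oplus> x [^] K \<otimes> c ij" ..
 have c: "c (i, j) \<in> carrier R"
  "trunc K (t j i * f j) = trunc K (t j i) \<otimes> trunc K (f j) \<oplus> x [^] K \<otimes> c (i, j)" for i j
  using spec[OF c0, of "(i, j)"] by simp_all
 \<comment> \<open>L is the main term; C collects the errors made by multiplying truncations, V the
   errors in the expansions of \<open>T (w j)\<close>. Both enter multiplied by x^K.\<close>
 define L where "L = lin_comb M {..<m} (\<lambda>i. \<Oplus>j\<in>{..<m}. trunc K (t j i) \<otimes> trunc K (f j)) w"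
 define C where "C = lin_comb M {..<m} (\<lambda>i. \<Oplus>j\<in>{..<m}. c (i, j)) w"
 define V where "V = lin_comb M {..<m} (\<lambda>j. trunc K (f j)) v"
 have cl: "L \<in> carrier M" "C \<in> carrier M" "V \<in> carrier M"
  unfolding L_def C_def V_def by (auto intro!: lc_closed R.finsum_closed simp: wc c v)
 have "lin_comb M {..<m} (\<lambda>i. trunc K (\<Sum>j<m. t j i * f j)) w =
   lin_comb M {..<m} (\<lambda>i. (\<Oplus>j\<in>{..<m}. trunc K (t j i) \<otimes> trunc K (f j)) \<oplus> x [^] K \<otimes> (\<Oplus>j\<in>{..<m}. c (i, j))) w"
 proof (rule lc_cong)
  fix i
  have "trunc K (\<Sum>j<m. t j i * f j) = (\<Oplus>j\<in>{..<m}. trunc K (t j i) \<otimes> trunc K (f j) \<oplus> x [^] K \<otimes> c (i, j))"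
   by (simp add: trunc_sum c)
  also have "\<dots> = (\<Oplus>j\<in>{..<m}. trunc K (t j i) \<otimes> trunc K (f j)) \<oplus> (\<Oplus>j\<in>{..<m}. x [^] K \<otimes> c (i, j))"
   by (rule R.finsum_addf) (auto simp: c(1))
  also have "(\<Oplus>j\<in>{..<m}. x [^] K \<otimes> c (i, j)) = x [^] K \<otimes> (\<Oplus>j\<in>{..<m}. c (i, j))"
   by (rule R.finsum_rdistr[symmetric]) (auto simp: c(1))
  finally show "trunc K (\<Sum>j<m. t j i * f j) = (\<Oplus>j\<in>{..<m}. trunc K (t j i) \<otimes> trunc K (f j)) \<oplus> x [^] K \<otimes> (\<Oplus>j\<in>{..<m}. c (i, j))" .
 qed (auto simp: wc c(1) intro!: R.finsum_closed R.a_closed R.m_closed)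
 also have "\<dots> = L \<oplus>[M] lin_comb M {..<m} (\<lambda>i. x [^] K \<otimes> (\<Oplus>j\<in>{..<m}. c (i, j))) w"
  unfolding L_def by (rule lc_add) (auto simp: wc c(1) intro!: R.finsum_closed R.m_closed)
 also have "lin_comb M {..<m} (\<lambda>i. x [^] K \<otimes> (\<Oplus>j\<in>{..<m}. c (i, j))) w = x [^] K \<odot>[M] C"
  unfolding C_def by (rule lc_smult(1)) (auto simp: wc c(1) intro!: R.finsum_closed)
 finally have R: "lin_comb M {..<m} (\<lambda>i. trunc K (\<Sum>j<m. t j i * f j)) w = L \<oplus>[M] x [^] K \<odot>[M] C" .
 have "T y = T (lin_comb M {..<m} (\<lambda>j. trunc K (f j)) w) \<oplus>[M] T (x [^] K \<odot>[M] u)"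
  unfolding u(2) using T u(1) by (simp add: semilinear_def)
 also have "T (x [^] K \<odot>[M] u) = x [^] K \<odot>[M] T u" using T u(1) by (simp add: semilinear_def)
 also have "T (lin_comb M {..<m} (\<lambda>j. trunc K (f j)) w) = lin_comb M {..<m} (\<lambda>j. trunc K (f j)) (\<lambda>j. T (w j))"
  by (rule semilinear_lc[OF md md T]) (auto simp: wc)
 also have "\<dots> = lin_comb M {..<m} (\<lambda>j. trunc K (f j)) (\<lambda>j. lin_comb M {..<m} (\<lambda>i. trunc K (t j i)) w \<oplus>[M] x [^] K \<odot>[M] v j)"
  by (rule lc_cong) (auto simp: v)
 also have "\<dots> = lin_comb M {..<m} (\<lambda>j. trunc K (f j)) (\<lambda>j. lin_comb M {..<m} (\<lambda>i. trunc K (t j i)) w) \<oplus>[M]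
   lin_comb M {..<m} (\<lambda>j. trunc K (f j)) (\<lambda>j. x [^] K \<odot>[M] v j)"
  by (rule lc_add_vec) (auto simp: v)
 also have "lin_comb M {..<m} (\<lambda>j. trunc K (f j)) (\<lambda>j. lin_comb M {..<m} (\<lambda>i. trunc K (t j i)) w) = L"
  unfolding L_def by (rule lc_lc) (auto simp: wc)
 also have "lin_comb M {..<m} (\<lambda>j. trunc K (f j)) (\<lambda>j. x [^] K \<odot>[M] v j) = x [^] K \<odot>[M] V"
  unfolding V_def by (rule lc_smult(2)) (auto simp: v)
 finally have Ty: "T y = L \<oplus>[M] x [^] K \<odot>[M] V \<oplus>[M] x [^] K \<odot>[M] T u" .
 have Tu: "T u \<in> carrier M" by (rule Tc[OF u(1)])
 have "T y = lin_comb M {..<m} (\<lambda>i. trunc K (\<Sum>j<m. t j i * f j)) w \<oplus>[M] x [^] K \<odot>[M] (V \<oplus>[M] T u \<ominus>[M] C)"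
 proof -
  define c where "c = x [^] K \<odot>[M] C" define v where "v = x [^] K \<odot>[M] V" define d where "d = x [^] K \<odot>[M] T u"
  have k: "c \<in> carrier M" "v \<in> carrier M" "d \<in> carrier M" unfolding c_def v_def d_def using cl Tu by simp_all
  have r: "x [^] K \<odot>[M] (V \<oplus>[M] T u \<ominus>[M] C) = v \<oplus>[M] d \<ominus>[M] c" unfolding c_def v_def d_def
   using cl Tu by (simp add: M.minus_eq smult_r_distr smult_r_minus)
  have "L \<oplus>[M] v \<oplus>[M] d = L \<oplus>[M] c \<oplus>[M] (v \<oplus>[M] d \<ominus>[M] c)"
   using k cl M.add_diff_cancel(2)[of c "v \<oplus>[M] d"] by (simp add: M.a_assoc)
  then show ?thesis unfolding Ty R r c_def[symmetric] v_def[symmetric] d_def[symmetric] .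
 qed
 then show ?thesis unfolding rep_def using cl Tu by (intro bexI[of _ "V \<oplus>[M] T u \<ominus>[M] C"]) simp_all
qed

text \<open>Expansions are unique only modulo p, so \<open>dig\<close> involves a choice; passing to
  the Laurent field by \<open>lf\<close> removes it.\<close>

definition "dig y = (SOME f. \<forall>K. rep K y f)"
definition "lf f = cd (fps_to_fls f)"
definition "matof T = (\<lambda>(i, j)\<in>{..<m} \<times> {..<m}. lf (dig (T (w j)) i))"

lemma dig: "y \<in> carrier M \<Longrightarrow> rep K y (dig y)"
 unfolding dig_def by (rule someI_ex[OF ex_rep, THEN spec])

lemma lf_nth: "(\<And>k. k < K \<Longrightarrow> int p dvd fps_nth f k - fps_nth g k) \<Longrightarrow> n < int K \<Longrightarrow>
  lf f (int_encode n) = lf g (int_encode n)"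
 unfolding lf_def code_eq_nth by (cases "n < 0") auto

lemma lf_eq: "lf f = lf g \<longleftrightarrow> (\<forall>k. int p dvd fps_nth f k - fps_nth g k)"
proof
 assume "lf f = lf g"
 then have "lf f (int_encode (int k)) = lf g (int_encode (int k))" for k by simp
 then show "\<forall>k. int p dvd fps_nth f k - fps_nth g k" unfolding lf_def code_eq_nth by simp
next
 assume *: "\<forall>k. int p dvd fps_nth f k - fps_nth g k"
 have "lf f (int_encode n) = lf g (int_encode n)" for n
  by (rule lf_nth[of "nat (n + 1)"]) (use * in auto)
 then show "lf f = lf g" by (metis ext int_decode_inverse)
qed

lemma lf_hom: "lf f \<in> carrier LF" "lf (f * g) = lf f \<otimes>[LF] lf g" "lf 1 = \<one>[LF]" "lf 0 = \<zero>[LF]"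
  "finite I \<Longrightarrow> lf (\<Sum>i\<in>I. h i) = (\<Oplus>\<^bsub>LF\<^esub>i\<in>I. lf (h i))"
proof -
 show c: "lf f \<in> carrier LF" for f by (simp add: lf_def code_in)
 show "lf (f * g) = lf f \<otimes>[LF] lf g" "lf 1 = \<one>[LF]"
  by (simp_all add: lf_def fls_times_fps_to_fls code_mult code_one)
 show 0: "lf 0 = \<zero>[LF]" by (simp add: lf_def code_zero_iff laurent_ideal_def)
 show "finite I \<Longrightarrow> lf (\<Sum>i\<in>I. h i) = (\<Oplus>\<^bsub>LF\<^esub>i\<in>I. lf (h i))"
 proof (induction I rule: finite_induct)
  case (insert i I)
  have "lf (h i + (\<Sum>i\<in>I. h i)) = lf (h i) \<oplus>[LF] lf (\<Sum>i\<in>I. h i)" by (simp add: lf_def code_add)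
  then show ?case using insert c by simp
 qed (simp add: 0)
qed

lemma matof_entry: "i < m \<Longrightarrow> j < m \<Longrightarrow> matof T (i, j) = lf (dig (T (w j)) i)" by (simp add: matof_def)

lemma matof_closed: "matof T \<in> carrier (Mat m LF)"
 by (rule mat_carrierI) (auto simp: matof_def lf_hom(1) extensional_def)

lemma matof_cong: "(\<And>y. y \<in> carrier M \<Longrightarrow> T y = S y) \<Longrightarrow> matof T = matof S"
 unfolding matof_def by (rule restrict_ext) (auto simp: wc)

text \<open>\<open>rep_map\<close> computes one expansion of the composite on a basis vector, and
  uniqueness modulo p identifies it with the chosen one.\<close>

lemma matof_mult:
 assumes T: "lin_endo R M T" and S: "lin_endo R M S"
 shows "matof (\<lambda>y. T (S y)) = matof T \<otimes>[Mat m LF] matof S"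
proof (rule mat_eqI[OF matof_closed LF.mat_closed(1)[OF matof_closed matof_closed]])
 have Tc: "T z \<in> carrier M" "S z \<in> carrier M" if "z \<in> carrier M" for z using T S that by (auto simp: semilinear_def)
 fix i j assume ij: "i < m" "j < m"
 let ?h = "\<lambda>i. \<Sum>k<m. dig (T (w k)) i * dig (S (w j)) k"
 have r: "rep K (T (S (w j))) ?h" for K
  by (rule rep_map[OF T dig[OF Tc(2)[OF wc[OF ij(2)]]]]) (rule dig[OF Tc(1)[OF wc]])
 have c: "T (S (w j)) \<in> carrier M" using Tc wc ij by blast
 have "int p dvd fps_nth (dig (T (S (w j))) i) k - fps_nth (?h i) k" for k
  by (rule rep_unique[OF dig[OF c] r M.zero_closed _ _ ij(1), of "Suc k"]) (use c x in auto)
 then have "lf (dig (T (S (w j))) i) = lf (?h i)" unfolding lf_eq ..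
 also have "\<dots> = (\<Oplus>\<^bsub>LF\<^esub>k\<in>{..<m}. lf (dig (T (w k)) i) \<otimes>[LF] lf (dig (S (w j)) k))"
  by (simp add: lf_hom(5) lf_hom(2))
 also have "\<dots> = (matof T \<otimes>[Mat m LF] matof S) (i, j)"
  unfolding mat_entries(1)[OF ij] by (rule LF.finsum_cong') (use ij in \<open>auto simp: matof_entry lf_hom(1)\<close>)
 finally show "matof (\<lambda>y. T (S y)) (i, j) = (matof T \<otimes>[Mat m LF] matof S) (i, j)"
  using ij by (simp add: matof_entry)
qed

lemma matof_id: "matof (\<lambda>y. y) = \<one>[Mat m LF]"
proof (rule mat_eqI[OF matof_closed LF.mat_const_closed(1)])
 fix i j assume ij: "i < m" "j < m"
 define h :: "nat \<Rightarrow> int fps" where "h i = (if i = j then 1 else 0)" for i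
 have r: "rep (Suc K) (w j) h" for K
 proof -
  have "lin_comb M {..<m} (\<lambda>i. trunc (Suc K) (h i)) w = lin_comb M {..<m} (\<lambda>i. if i = j then \<one> else \<zero>) w"
   by (rule lc_cong) (auto simp: h_def wc trunc_one simp del: trunc.simps)
  also have "\<dots> = w j" by (rule lc_delta) (use ij wc in auto)
  finally show ?thesis unfolding rep_def using wc[OF ij(2)] x by (intro bexI[of _ "\<zero>[M]"]) simp_all
 qed
 have "int p dvd fps_nth (dig (w j) i) k - fps_nth (h i) k" for k
  by (rule rep_unique[OF dig[OF wc[OF ij(2)]] r M.zero_closed _ _ ij(1), of k]) (use wc ij x in auto)
 then have "lf (dig (w j) i) = lf (h i)" unfolding lf_eq ..
 then show "matof (\<lambda>y. y) (i, j) = \<one>[Mat m LF] (i, j)" using ij by (simp add: matof_entry mat_entries h_def lf_hom)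
qed

text \<open>Elements with the same digits are equal by \<open>x_sep\<close>, so the matrix
  determines T on the basis and hence, by \<open>rep_map\<close>, on all of M. This faithfulness
  carries finiteness from matrices back to operators.\<close>

lemma matof_inj:
 assumes T: "lin_endo R M T" and S: "lin_endo R M S" and eq: "matof T = matof S" and y: "y \<in> carrier M"
 shows "T y = S y"
proof -
 note md = module_axioms
 have Tc: "T z \<in> carrier M" "S z \<in> carrier M" if "z \<in> carrier M" for z using T S that by (auto simp: semilinear_def)
 have sep: "a = b" if ab: "a \<in> carrier M" "b \<in> carrier M" "\<And>K. rep K a f" "\<And>K. rep K b g"
  and fg: "\<And>i k. i < m \<Longrightarrow> int p dvd fps_nth (f i) k - fps_nth (g i) k" for a b f g
 proof -
  have "\<exists>z\<in>carrier M. a \<ominus>[M] b = x [^] K \<odot>[M] z" for K :: nat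
  proof -
   let ?F = "lin_comb M {..<m} (\<lambda>i. trunc K (f i)) w"
   have "lin_comb M {..<m} (\<lambda>i. trunc K (g i)) w = ?F"
    by (rule lc_cong) (auto simp: wc intro!: trunc_eq[symmetric] fg)
   then obtain u v where uv: "u \<in> carrier M" "a = ?F \<oplus>[M] x [^] K \<odot>[M] u" "v \<in> carrier M" "b = ?F \<oplus>[M] x [^] K \<odot>[M] v"
    using ab(3)[of K] ab(4)[of K] unfolding rep_def by auto
   have "a \<ominus>[M] b = x [^] K \<odot>[M] (u \<ominus>[M] v)" unfolding uv(2,4)
    using uv(1,3) tlc_closed[of K f] smult_closed[OF xK uv(1), of K] smult_closed[OF xK uv(3), of K]
    by (simp add: M.minus_eq smult_r_distr smult_r_minus M.minus_add M.a_ac M.r_neg M.r_neg1 M.r_neg2)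
   then show ?thesis using uv by blast
  qed
  then have "a \<ominus>[M] b = \<zero>[M]" by (rule x_sep[OF M.minus_closed[OF ab(1,2)]])
  then show "a = b" by (rule M.diff_zero_eq[OF ab(1,2)])
 qed
 have TS: "T (w j) = S (w j)" if j: "j < m" for j
 proof (rule sep[OF Tc(1)[OF wc[OF j]] Tc(2)[OF wc[OF j]] dig[OF Tc(1)[OF wc[OF j]]] dig[OF Tc(2)[OF wc[OF j]]]])
  fix i k assume i: "i < m"
  have "lf (dig (T (w j)) i) = lf (dig (S (w j)) i)" using arg_cong[OF eq, of "\<lambda>f. f (i, j)"] i j by (simp add: matof_entry)
  then show "int p dvd fps_nth (dig (T (w j)) i) k - fps_nth (dig (S (w j)) i) k" unfolding lf_eq ..
 qed
 let ?h = "\<lambda>i. \<Sum>j<m. dig (T (w j)) i * dig y j"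
 have "rep K (T y) ?h" for K by (rule rep_map[OF T dig[OF y]]) (rule dig[OF Tc(1)[OF wc]])
 moreover have "rep K (S y) ?h" for K
  by (rule rep_map[OF S dig[OF y]]) (use dig[OF Tc(1)[OF wc]] TS in auto)
 ultimately show ?thesis by (rule sep[OF Tc(1)[OF y] Tc(2)[OF y]]) simp
qed

end

section \<open>Free modules\<close>

locale free_basis = module R M for R :: "('a, 'b) ring_scheme" (structure) and M :: "('a, 'm) module" (structure) +
 fixes n b
 assumes basis: "module_basis R M n b"
begin

definition "crd y = (THE c. c \<in> {..<n} \<rightarrow>\<^sub>E carrier R \<and> y = (\<Oplus>\<^bsub>M\<^esub>i\<in>{..<n}. c i \<odot>[M] b i))"

lemma bc: "i < n \<Longrightarrow> b i \<in> carrier M" using basis by (auto simp: module_basis_def)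

lemma crd_ex1:
 "y \<in> carrier M \<Longrightarrow> \<exists>!c. c \<in> {..<n} \<rightarrow>\<^sub>E carrier R \<and> y = (\<Oplus>\<^bsub>M\<^esub>i\<in>{..<n}. c i \<odot>[M] b i)"
 using basis by (simp add: module_basis_def)

lemma crd_spec:
 "y \<in> carrier M \<Longrightarrow> crd y \<in> {..<n} \<rightarrow>\<^sub>E carrier R \<and> y = (\<Oplus>\<^bsub>M\<^esub>i\<in>{..<n}. crd y i \<odot>[M] b i)"
 unfolding crd_def by (rule theI'[OF crd_ex1])

lemma crd_vec: "y \<in> carrier M \<Longrightarrow> crd y \<in> carrier (vec_module n R)"
 using crd_spec by (simp add: vec_carrier)

lemma crd_closed: "y \<in> carrier M \<Longrightarrow> i < n \<Longrightarrow> crd y i \<in> carrier R"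
 using crd_spec[of y] by auto

lemma crd_lc: "y \<in> carrier M \<Longrightarrow> lin_comb M {..<n} (crd y) b = y"
 using crd_spec[of y] by (simp add: lin_comb_def)

lemma crd_unique:
 assumes c: "\<And>i. i < n \<Longrightarrow> c i \<in> carrier R" and y: "y = lin_comb M {..<n} c b" and i: "i < n"
 shows "crd y i = c i"
proof -
 have yc: "y \<in> carrier M" unfolding y by (rule lc_closed) (auto simp: c bc)
 have "lin_comb M {..<n} (restrict c {..<n}) b = y" unfolding y by (rule lc_cong) (auto simp: c bc)
 then have "restrict c {..<n} \<in> {..<n} \<rightarrow>\<^sub>E carrier R \<and> y = (\<Oplus>\<^bsub>M\<^esub>i\<in>{..<n}. restrict c {..<n} i \<odot>[M] b i)"
  using c by (auto simp: lin_comb_def)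
 then have "crd y = restrict c {..<n}" unfolding crd_def by (rule the1_equality[OF crd_ex1[OF yc]])
 then show ?thesis using i by simp
qed

lemma crd_eqI: "y \<in> carrier M \<Longrightarrow> z \<in> carrier M \<Longrightarrow> (\<And>i. i < n \<Longrightarrow> crd y i = crd z i) \<Longrightarrow> y = z"
 using crd_lc[of y] crd_lc[of z] lc_cong[of "{..<n}" "crd y" "crd z" b b] bc crd_closed by auto

lemma crd_add:
 assumes "y \<in> carrier M" "z \<in> carrier M" "i < n"
 shows "crd (y \<oplus>[M] z) i = crd y i \<oplus> crd z i"
proof (rule crd_unique[OF _ _ assms(3)])
 show "y \<oplus>[M] z = lin_comb M {..<n} (\<lambda>i. crd y i \<oplus> crd z i) b"
  by (subst lc_add) (auto simp: crd_lc crd_closed bc assms)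
qed (auto simp: crd_closed assms)

lemma crd_smult:
 assumes "a \<in> carrier R" "z \<in> carrier M" "i < n"
 shows "crd (a \<odot>[M] z) i = a \<otimes> crd z i"
proof (rule crd_unique[OF _ _ assms(3)])
 show "a \<odot>[M] z = lin_comb M {..<n} (\<lambda>i. a \<otimes> crd z i) b"
  by (subst lc_smult(1)) (auto simp: crd_lc crd_closed bc assms)
qed (auto simp: crd_closed assms)

lemma crd_zero: "i < n \<Longrightarrow> crd \<zero>[M] i = \<zero>"
 using crd_smult[of \<zero> "\<zero>[M]" i] crd_closed[of "\<zero>[M]" i] by simp

lemma crd_basis: "i < n \<Longrightarrow> j < n \<Longrightarrow> crd (b j) i = (if i = j then \<one> else \<zero>)"
 by (rule crd_unique[of "\<lambda>i. if i = j then \<one> else \<zero>"]) (use lc_delta[of "{..<n}" j b] bc in auto)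

text \<open>The generators of IM have coordinates in I, and I is additively closed. This turns adic
  neighbourhoods into congruences between coordinates.\<close>

lemma crd_ideal:
 assumes I: "ideal I R" and y: "y \<in> ideal_smult I M"
 shows "y \<in> carrier M \<and> (\<forall>i<n. crd y i \<in> I)"
 using y unfolding ideal_smult_def
proof (induction rule: generate.induct)
 interpret I: ideal I R by (rule I)
 case one
 then show ?case by (simp add: crd_zero)
next
 interpret I: ideal I R by (rule I)
 case (incl h)
 then show ?case using I.I_r_closed I.Icarr by (auto simp: crd_smult crd_closed)
next
 interpret I: ideal I R by (rule I)
 case (inv h)
 then obtain a z where az: "a \<in> I" "z \<in> carrier M" "h = a \<odot>[M] z" by auto
 then have "inv\<^bsub>add_monoid M\<^esub> h = (\<ominus> a) \<odot>[M] z" using I.Icarr by (simp add: smult_l_minus a_inv_def[symmetric])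
 then show ?case using az I.a_inv_closed[of a] I.Icarr I.I_r_closed[of "\<ominus> a"] by (auto simp: crd_smult crd_closed)
next
 interpret I: ideal I R by (rule I)
 case (eng h g)
 then show ?case by (auto simp: crd_add)
qed

lemma basis_change:
 assumes U: "U \<in> Units (Mat n R)"
 shows "module_basis R M n (\<lambda>j. lin_comb M {..<n} (\<lambda>i. U (i, j)) b)"
 unfolding module_basis_def
proof (intro conjI ballI)
 interpret MR: ring "Mat n R" by (rule Mat)
 define v where "v j = lin_comb M {..<n} (\<lambda>i. U (i, j)) b" for j
 have Uc: "U \<in> carrier (Mat n R)" using U by blast
 obtain V where V: "V \<in> carrier (Mat n R)" "V \<otimes>[Mat n R] U = \<one>[Mat n R]"
  "U \<otimes>[Mat n R] V = \<one>[Mat n R]" using U by (auto simp: Units_def)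
 show vc: "(\<lambda>j. lin_comb M {..<n} (\<lambda>i. U (i, j)) b) \<in> {..<n} \<rightarrow> carrier M"
  using mat_entry[OF Uc] bc by (auto intro!: lc_closed)
 have lv: "lin_comb M {..<n} c v = lin_comb M {..<n} (mat_vec n R U c) b" if c: "c \<in> carrier (vec_module n R)" for c
 proof -
  have "lin_comb M {..<n} c v = lin_comb M {..<n} (\<lambda>i. \<Oplus>j\<in>{..<n}. U (i, j) \<otimes> c j) b"
   unfolding v_def by (rule lc_lc) (use mat_entry[OF Uc] vec_entry[OF c] bc in auto)
  also have "\<dots> = lin_comb M {..<n} (mat_vec n R U c) b"
   by (rule lc_cong) (use vec_entry[OF vec_closed(3)[OF c Uc]] bc in \<open>auto simp: vec_entries\<close>)
  finally show ?thesis .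
 qed
 fix y assume y: "y \<in> carrier M"
 note cv = crd_vec[OF y]
 show "\<exists>!c. c \<in> {..<n} \<rightarrow>\<^sub>E carrier R \<and> y = (\<Oplus>\<^bsub>M\<^esub>i\<in>{..<n}. c i \<odot>[M] lin_comb M {..<n} (\<lambda>ia. U (ia, i)) b)"
  unfolding v_def[symmetric] lin_comb_def[symmetric] vec_carrier[symmetric]
 proof (rule ex1I[of _ "mat_vec n R V (crd y)"], intro conjI)
  show Vy: "mat_vec n R V (crd y) \<in> carrier (vec_module n R)" by (rule vec_closed(3)[OF cv V(1)])
  have "mat_vec n R U (mat_vec n R V (crd y)) = crd y"
   using mat_vec_mult[OF Uc V(1) cv] V(3) mat_vec_mat(3)[OF Uc Uc cv] by simp
  then show "y = lin_comb M {..<n} (mat_vec n R V (crd y)) v" unfolding lv[OF Vy] using crd_lc[OF y] by simp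
  fix c assume "c \<in> carrier (vec_module n R) \<and> y = lin_comb M {..<n} c v"
  then have c: "c \<in> carrier (vec_module n R)" "y = lin_comb M {..<n} (mat_vec n R U c) b" using lv by auto
  have "crd y = mat_vec n R U c"
   by (rule vec_eqI[OF cv vec_closed(3)[OF c(1) Uc]]) (rule crd_unique[OF _ c(2)], auto intro: vec_entry[OF vec_closed(3)[OF c(1) Uc]])
  then have "mat_vec n R V (crd y) = mat_vec n R (V \<otimes>[Mat n R] U) c"
   using mat_vec_mult[OF V(1) Uc c(1)] by simp
  then show "c = mat_vec n R V (crd y)" using V(2) mat_vec_mat(3)[OF Uc Uc c(1)] by simp
 qed
qed

definition "mx T = (\<lambda>(i, j)\<in>{..<n} \<times> {..<n}. crd (T (b j)) i)"

lemma mx_entry: "i < n \<Longrightarrow> j < n \<Longrightarrow> mx T (i, j) = crd (T (b j)) i" by (simp add: mx_def)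

lemma mx_closed: "(\<And>y. y \<in> carrier M \<Longrightarrow> T y \<in> carrier M) \<Longrightarrow> mx T \<in> carrier (Mat n R)"
 by (rule mat_carrierI) (auto simp: mx_def crd_closed bc extensional_def)

lemma mx_lc:
 assumes "\<And>y. y \<in> carrier M \<Longrightarrow> T y \<in> carrier M" "j < n"
 shows "T (b j) = lin_comb M {..<n} (\<lambda>i. mx T (i, j)) b"
proof -
 have "lin_comb M {..<n} (\<lambda>i. mx T (i, j)) b = lin_comb M {..<n} (crd (T (b j))) b"
  by (rule lc_cong) (auto simp: mx_entry assms bc crd_closed)
 then show ?thesis using crd_lc[OF assms(1)[OF bc[OF assms(2)]]] by simp
qed

lemma endo_lc:
 assumes T: "lin_endo R M T" and c: "\<And>i. i < n \<Longrightarrow> c i \<in> carrier R" and i: "i < n"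
 shows "crd (T (lin_comb M {..<n} c b)) i = (\<Oplus>k\<in>{..<n}. mx T (i, k) \<otimes> c k)"
proof -
 have Tc: "T z \<in> carrier M" if "z \<in> carrier M" for z using T that by (auto simp: semilinear_def)
 note e = mat_entry[OF mx_closed[of T, OF Tc]]
 have "T (lin_comb M {..<n} c b) = lin_comb M {..<n} c (\<lambda>k. T (b k))"
  by (rule semilinear_lc[OF module_axioms module_axioms T]) (auto simp: bc c)
 also have "\<dots> = lin_comb M {..<n} c (\<lambda>k. lin_comb M {..<n} (\<lambda>i. mx T (i, k)) b)"
  by (rule lc_cong) (auto simp: c bc e intro!: lc_closed mx_lc[of T, OF Tc])
 also have "\<dots> = lin_comb M {..<n} (\<lambda>i. \<Oplus>k\<in>{..<n}. mx T (i, k) \<otimes> c k) b"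
  by (rule lc_lc) (auto simp: e c bc)
 finally show ?thesis by (rule crd_unique[rotated]) (auto simp: i e c intro!: R.finsum_closed)
qed

lemma mx_mult:
 assumes T: "lin_endo R M T" and S: "\<And>y. y \<in> carrier M \<Longrightarrow> S y \<in> carrier M"
 shows "mx (\<lambda>y. T (S y)) = mx T \<otimes>[Mat n R] mx S"
proof -
 have Tc: "T z \<in> carrier M" if "z \<in> carrier M" for z using T that by (auto simp: semilinear_def)
 show ?thesis
 proof (rule mat_eqI[OF mx_closed mat_closed(1)[OF mx_closed mx_closed]])
  fix i j assume ij: "i < n" "j < n"
  have sb: "S (b j) = lin_comb M {..<n} (\<lambda>i. mx S (i, j)) b" by (rule mx_lc[of S]) (use S ij in auto)
  have "crd (T (S (b j))) i = (\<Oplus>k\<in>{..<n}. mx T (i, k) \<otimes> mx S (k, j))"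
   by (subst sb) (rule endo_lc[OF T _ ij(1)], rule mat_entry[OF mx_closed[of S, OF S] _ ij(2)])
  then show "mx (\<lambda>y. T (S y)) (i, j) = (mx T \<otimes>[Mat n R] mx S) (i, j)"
   using ij by (simp add: mx_entry mat_entries(1))
 qed (use Tc S in auto)
qed

lemma mx_cong: "(\<And>y. y \<in> carrier M \<Longrightarrow> T y = S y) \<Longrightarrow> mx T = mx S"
 unfolding mx_def by (rule restrict_ext) (auto simp: bc)

lemma smult_crd:
 assumes q: "q \<in> carrier R" and y: "y \<in> carrier M" and c: "\<And>i. i < n \<Longrightarrow> \<exists>a\<in>carrier R. crd y i = q \<otimes> a"
 shows "\<exists>z\<in>carrier M. y = q \<odot>[M] z"
proof -
 have "\<forall>i. \<exists>a. i < n \<longrightarrow> a \<in> carrier R \<and> crd y i = q \<otimes> a" using c by blast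
 from choice[OF this] obtain a where a0: "\<forall>i. i < n \<longrightarrow> a i \<in> carrier R \<and> crd y i = q \<otimes> a i" ..
 have a: "a i \<in> carrier R" "crd y i = q \<otimes> a i" if "i < n" for i using a0 that by auto
 have "y = lin_comb M {..<n} (crd y) b" using crd_lc[OF y] by simp
 also have "\<dots> = lin_comb M {..<n} (\<lambda>i. q \<otimes> a i) b" by (rule lc_cong) (auto simp: a q bc)
 also have "\<dots> = q \<odot>[M] lin_comb M {..<n} a b" by (rule lc_smult(1)) (auto simp: a q bc)
 finally show ?thesis by (rule bexI) (auto intro!: lc_closed simp: a bc)
qed

text \<open>The conditions are checked in coordinates: R is a domain, its x-adic topology is
  separated, and R/xR is finite because R is just infinite.\<close>

lemma x_module:
 assumes p: "Factorial_Ring.prime p" and ji: "just_infinite R" and x: "x \<in> max_ideal R" "x \<noteq> \<zero>"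
  and char: "add_pow R p \<one> = \<zero>"
 shows "x_module p R M x"
proof -
 interpret J: just_infinite R by (rule ji)
 have xc: "x \<in> carrier R" by (rule J.x_closed[OF x])
 show ?thesis
 proof (intro x_module.intro x_module_axioms.intro laurent.intro p module_axioms xc char)
  fix z assume z: "z \<in> carrier M" "x \<odot>[M] z = \<zero>[M]"
  show "z = \<zero>[M]"
  proof (rule crd_eqI[OF z(1) M.zero_closed])
   fix i assume i: "i < n"
   have "x \<otimes> crd z i = \<zero>" using crd_smult[OF xc z(1) i] z(2) crd_zero[OF i] by simp
   then show "crd z i = crd \<zero>[M] i" using J.integral_iff[OF xc crd_closed[OF z(1) i]] x(2) crd_zero[OF i] by simp
  qed
 next
  fix y assume y: "y \<in> carrier M" and s: "\<And>k. \<exists>z\<in>carrier M. y = (x [^] (k::nat)) \<odot>[M] z"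
  show "y = \<zero>[M]"
  proof (rule crd_eqI[OF y M.zero_closed])
   fix i assume i: "i < n"
   have "crd y i \<in> J.xpow x k" for k
   proof -
    obtain z where "z \<in> carrier M" "y = (x [^] k) \<odot>[M] z" using s by blast
    then show ?thesis using crd_smult[of "x [^] k" z i] crd_closed[of z i] i xc by (auto simp: J.xpow_def)
   qed
   from J.xpow_sep[OF x this] show "crd y i = crd \<zero>[M] i" using crd_zero[OF i] by simp
  qed
 next
  from J.xpow_fin_index[OF x, of 1] obtain T where T: "finite T" "T \<subseteq> carrier R"
   "\<And>r. r \<in> carrier R \<Longrightarrow> \<exists>t\<in>T. r \<ominus> t \<in> J.xpow x 1" by (rule fin_indexE) blast
  define W where "W = (\<lambda>c. lin_comb M {..<n} c b) ` ({..<n} \<rightarrow>\<^sub>E T)"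
  have "\<exists>w\<in>W. \<exists>z\<in>carrier M. y = w \<oplus>[M] x \<odot>[M] z" if y: "y \<in> carrier M" for y
  proof -
   have "\<forall>i. \<exists>t. i < n \<longrightarrow> t \<in> T \<and> crd y i \<ominus> t \<in> J.xpow x 1" using T(3)[OF crd_closed[OF y]] by blast
   from choice[OF this] obtain t where t0: "\<forall>i. i < n \<longrightarrow> t i \<in> T \<and> crd y i \<ominus> t i \<in> J.xpow x 1" ..
   have t: "t i \<in> T" "crd y i \<ominus> t i \<in> J.xpow x 1" "t i \<in> carrier R" if "i < n" for i using t0 T(2) that by auto
   let ?w = "lin_comb M {..<n} t b"
   have wc: "?w \<in> carrier M" by (rule lc_closed) (auto simp: t bc)
   have wW: "?w \<in> W" unfolding W_def
   proof (rule image_eqI[of _ _ "restrict t {..<n}"])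
    show "?w = lin_comb M {..<n} (restrict t {..<n}) b" by (rule lc_cong) (auto simp: t bc)
   qed (auto simp: t)
   have "\<exists>z\<in>carrier M. y \<ominus>[M] ?w = x \<odot>[M] z"
   proof (rule smult_crd[OF xc M.minus_closed[OF y wc]])
    fix i assume i: "i < n"
    have "y \<ominus>[M] ?w = lin_comb M {..<n} (\<lambda>i. crd y i \<ominus> t i) b"
     by (subst lc_minus) (auto simp: crd_lc[OF y] crd_closed[OF y] t bc)
    from crd_unique[OF _ this i] have "crd (y \<ominus>[M] ?w) i = crd y i \<ominus> t i" using crd_closed[OF y] t by simp
    then show "\<exists>a\<in>carrier R. crd (y \<ominus>[M] ?w) i = x \<otimes> a" using t(2)[OF i] xc by (auto simp: J.xpow_def)
   qed
   then obtain z where z: "z \<in> carrier M" "y \<ominus>[M] ?w = x \<odot>[M] z" by blast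
   have "y = ?w \<oplus>[M] (y \<ominus>[M] ?w)" by (rule M.add_diff_cancel(2)[OF wc y, symmetric])
   then show ?thesis unfolding z(2) using wW z(1) by blast
  qed
  moreover have "W \<subseteq> carrier M" unfolding W_def using T(2) bc by (auto intro!: lc_closed)
  moreover have "finite W" unfolding W_def using T(1) by (intro finite_imageI finite_PiE) auto
  ultimately show "\<exists>W\<subseteq>carrier M. finite W \<and> (\<forall>y\<in>carrier M. \<exists>w\<in>W. \<exists>z\<in>carrier M. y = w \<oplus>[M] x \<odot>[M] z)"
   by (intro exI[of _ W]) simp
 qed
qed

end

subsection \<open>The adic topology\<close>

lemma ideal_smult_mono:
 assumes "module A M" "I \<subseteq> J" "J \<subseteq> carrier A"
 shows "ideal_smult I M \<subseteq> ideal_smult J M"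
proof -
 interpret module A M by fact
 show ?thesis unfolding ideal_smult_def
  by (rule group.mono_generate[OF M.a_group]) (use assms(2,3) in auto)
qed

lemma ideal_smult_carrier:
 assumes "module A M" "I \<subseteq> carrier A"
 shows "ideal_smult I M \<subseteq> carrier M"
proof -
 interpret module A M by fact
 show ?thesis unfolding ideal_smult_def
  using group.generate_incl[OF M.a_group, of "{a \<odot>[M] x |a x. a \<in> I \<and> x \<in> carrier M}"] assms(2) by auto
qed

context local_noeth
begin

text \<open>\<open>adic_topology\<close> is built with \<open>topology\<close>, which has the
  intended open sets only after \<open>istopology\<close> is verified; nestedness of the powers of
  \<mm> handles intersections.\<close>

lemma openin_adic:
 assumes M: "module R M"
 shows "openin (adic_topology R M) U \<longleftrightarrow> U \<subseteq> carrier M \<and>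
  (\<forall>x\<in>U. \<exists>k. \<forall>y\<in>ideal_smult (mpow k) M. x \<oplus>[M] y \<in> U)"
proof -
 let ?P = "\<lambda>U. U \<subseteq> carrier M \<and> (\<forall>x\<in>U. \<exists>k. \<forall>y\<in>ideal_smult (mpow k) M. x \<oplus>[M] y \<in> U)"
 have mono: "ideal_smult (mpow l) M \<subseteq> ideal_smult (mpow k) M" if "k \<le> l" for k l
  by (rule ideal_smult_mono[OF M mpow_antimono[OF that] mpow_carrier])
 have "istopology ?P" unfolding istopology_def
 proof (intro conjI allI impI)
  fix S T assume S: "?P S" and T: "?P T"
  show "S \<inter> T \<subseteq> carrier M" using S by blast
  show "\<forall>x\<in>S \<inter> T. \<exists>k. \<forall>y\<in>ideal_smult (mpow k) M. x \<oplus>[M] y \<in> S \<inter> T"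
  proof
   fix x assume "x \<in> S \<inter> T"
   then obtain k l where "\<forall>y\<in>ideal_smult (mpow k) M. x \<oplus>[M] y \<in> S" "\<forall>y\<in>ideal_smult (mpow l) M. x \<oplus>[M] y \<in> T"
    using S T by blast
   then show "\<exists>k. \<forall>y\<in>ideal_smult (mpow k) M. x \<oplus>[M] y \<in> S \<inter> T"
    using mono[of k "max k l"] mono[of l "max k l"] by (intro exI[of _ "max k l"]) auto
  qed
 next
  fix \<K> assume K: "\<forall>S\<in>\<K>. ?P S"
  then show "\<Union>\<K> \<subseteq> carrier M" by blast
  show "\<forall>x\<in>\<Union>\<K>. \<exists>k. \<forall>y\<in>ideal_smult (mpow k) M. x \<oplus>[M] y \<in> \<Union>\<K>"
  proof
   fix x assume "x \<in> \<Union>\<K>"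
   then obtain S where S: "S \<in> \<K>" "x \<in> S" by blast
   then obtain k where "\<forall>y\<in>ideal_smult (mpow k) M. x \<oplus>[M] y \<in> S" using K by blast
   then show "\<exists>k. \<forall>y\<in>ideal_smult (mpow k) M. x \<oplus>[M] y \<in> \<Union>\<K>" using S(1) by (intro exI[of _ k]) blast
  qed
 qed
 then show ?thesis unfolding adic_topology_def by (subst topology_inverse') simp_all
qed

lemma topspace_adic:
 assumes M: "module R M"
 shows "topspace (adic_topology R M) = carrier M"
proof -
 interpret module R M by (rule M)
 have "openin (adic_topology R M) (carrier M)"
  unfolding openin_adic[OF M] using ideal_smult_carrier[OF M mpow_carrier] by blast
 moreover have "U \<subseteq> carrier M" if "openin (adic_topology R M) U" for U using that openin_adic[OF M] by blast
 ultimately show ?thesis by (meson openin_topspace openin_subset subset_antisym)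
qed

end

subsection \<open>Galois groups\<close>

lemma galois_group_group:
 assumes ne: "carrier (galois_group K E) \<noteq> {}" and E: "1 \<in> E" "\<And>x y. x \<in> E \<Longrightarrow> y \<in> E \<Longrightarrow> x + y \<in> E"
  "\<And>x y. x \<in> E \<Longrightarrow> y \<in> E \<Longrightarrow> x * y \<in> E"
 shows "group (galois_group K E)"
proof -
 let ?H = "carrier (galois_group K E)"
 interpret B: group "BijGroup E" by (rule group_BijGroup)
 have H: "\<sigma> \<in> ?H \<longleftrightarrow> \<sigma> \<in> Bij E \<and> \<sigma> 1 = 1 \<and> (\<forall>x\<in>E. \<forall>y\<in>E. \<sigma> (x + y) = \<sigma> x + \<sigma> y \<and> \<sigma> (x * y) = \<sigma> x * \<sigma> y) \<and>
   (\<forall>x\<in>K. \<sigma> x = x)" for \<sigma>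
  by (auto simp: galois_group_def ring_hom_def ring_of_type_algebra_def dest: Bij_imp_funcset)
 \<comment> \<open>The fixing condition ranges over all x in K, also over those outside E, where an
   extensional map takes the value \<open>undefined\<close>. The existence of a single group element
   forces such an x to be \<open>undefined\<close> itself, and then every extensional map fixes
   it.\<close>
 have out: "x = undefined" if "x \<in> K" "x \<notin> E" for x
 proof -
  obtain \<sigma> where "\<sigma> \<in> ?H" using ne by blast
  then have "\<sigma> x = x" "\<sigma> \<in> extensional E" using H that by (auto simp: Bij_def)
  then show ?thesis using that by (simp add: extensional_def)
 qed
 have fx: "(\<lambda>x\<in>E. f x) x = x" if "x \<in> K" "x \<in> E \<Longrightarrow> f x = x" for f x
  using that out by (cases "x \<in> E") auto
 have "subgroup ?H (BijGroup E)"
 proof (rule B.subgroupI)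
  show "?H \<subseteq> carrier (BijGroup E)" using H by (auto simp: BijGroup_def)
  show "?H \<noteq> {}" by (rule ne)
  fix \<sigma> assume s: "\<sigma> \<in> ?H"
  then have sB: "\<sigma> \<in> Bij E" and sf: "\<sigma> 1 = 1" "\<And>x y. x \<in> E \<Longrightarrow> y \<in> E \<Longrightarrow> \<sigma> (x + y) = \<sigma> x + \<sigma> y"
   "\<And>x y. x \<in> E \<Longrightarrow> y \<in> E \<Longrightarrow> \<sigma> (x * y) = \<sigma> x * \<sigma> y" "\<And>x. x \<in> K \<Longrightarrow> \<sigma> x = x" using H by auto
  have inj: "inj_on \<sigma> E" using sB by (simp add: Bij_def bij_betw_def)
  have iE: "inv_into E \<sigma> (\<sigma> x) = x" if "x \<in> E" for x by (rule inv_into_f_f[OF inj that])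
  have "(\<lambda>x\<in>E. inv_into E \<sigma> x) \<in> ?H" unfolding H
  proof (intro conjI ballI)
   show "(\<lambda>x\<in>E. inv_into E \<sigma> x) \<in> Bij E" by (rule restrict_inv_into_Bij[OF sB])
   show "(\<lambda>x\<in>E. inv_into E \<sigma> x) 1 = 1" using iE[OF E(1)] sf(1) E(1) by simp
   show "(\<lambda>x\<in>E. inv_into E \<sigma> x) x = x" if "x \<in> K" for x
    by (rule fx[OF that]) (use iE[of x] sf(4)[OF that] in simp)
   fix x y assume xy: "x \<in> E" "y \<in> E"
   have "inv_into E \<sigma> (x + y) = inv_into E \<sigma> x + inv_into E \<sigma> y"
    by (rule Bij_inv_into_lemma[OF _ sB]) (use sf E xy in auto)
   moreover have "inv_into E \<sigma> (x * y) = inv_into E \<sigma> x * inv_into E \<sigma> y"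
    by (rule Bij_inv_into_lemma[OF _ sB]) (use sf E xy in auto)
   ultimately show "(\<lambda>x\<in>E. inv_into E \<sigma> x) (x + y) = (\<lambda>x\<in>E. inv_into E \<sigma> x) x + (\<lambda>x\<in>E. inv_into E \<sigma> x) y"
    "(\<lambda>x\<in>E. inv_into E \<sigma> x) (x * y) = (\<lambda>x\<in>E. inv_into E \<sigma> x) x * (\<lambda>x\<in>E. inv_into E \<sigma> x) y"
    using E xy by simp_all
  qed
  then show "inv\<^bsub>BijGroup E\<^esub> \<sigma> \<in> ?H" by (simp add: inv_BijGroup[OF sB])
  fix \<tau> assume t: "\<tau> \<in> ?H"
  then have tB: "\<tau> \<in> Bij E" and tE: "\<And>x. x \<in> E \<Longrightarrow> \<tau> x \<in> E" using H Bij_imp_funcset by (auto dest!: Bij_imp_funcset)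
  have "compose E \<sigma> \<tau> \<in> ?H" unfolding H
  proof (intro conjI ballI)
   show "compose E \<sigma> \<tau> \<in> Bij E" by (rule compose_Bij[OF sB tB])
   show "compose E \<sigma> \<tau> x = x" if "x \<in> K" for x
    unfolding compose_def by (rule fx[OF that]) (use t sf(4)[OF that] that in \<open>simp add: H\<close>)
  qed (use t sf E tE in \<open>auto simp: compose_def H\<close>)
  then show "\<sigma> \<otimes>[BijGroup E] \<tau> \<in> ?H" using sB tB by (simp add: BijGroup_def)
 qed
 from B.subgroup_imp_group[OF this] show ?thesis by (simp add: galois_group_def BijGroup_def)
qed

lemma GKS_group:
 assumes "carrier (GKS K S) \<noteq> {}"
 shows "group (GKS K S)"
 unfolding GKS_def
proof (rule galois_group_group)
 have op: "\<one>[CC] = 1" "x \<oplus>[CC] y = x + y" "x \<otimes>[CC] y = x * y" for x y :: complex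
  by (simp_all add: ring_of_type_algebra_def)
 show "1 \<in> max_unramified_outside K S"
  unfolding max_unramified_outside_def by (rule generate_field.one[where R = CC, unfolded op])
 fix x y assume xy: "x \<in> max_unramified_outside K S" "y \<in> max_unramified_outside K S"
 show "x + y \<in> max_unramified_outside K S" "x * y \<in> max_unramified_outside K S"
  using generate_field.eng_add[OF xy[unfolded max_unramified_outside_def]]
   generate_field.eng_mult[OF xy[unfolded max_unramified_outside_def]]
  unfolding max_unramified_outside_def op by simp_all
qed (use assms in \<open>simp add: GKS_def\<close>)

lemma GKS_topspace: "topspace (GKS_topology K S) \<subseteq> carrier (GKS K S)"
 by (auto simp: GKS_topology_def krull_topology_def GKS_def)

section \<open>Finite image\<close>

lemma (in x_module) ex_x_basis: "\<exists>m w. x_basis p R M x m w"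
 using independent_spanning
proof (elim exE conjE)
 fix m :: nat and w
 assume c: "\<forall>i<m. w i \<in> carrier M"
  and s: "\<forall>y\<in>carrier M. \<exists>c. \<exists>z\<in>carrier M. y = lin_comb M {..<m} (\<lambda>i. \<iota> (c i)) w \<oplus>[M] x \<odot>[M] z"
  and i: "\<forall>c. \<forall>z\<in>carrier M. lin_comb M {..<m} (\<lambda>i. \<iota> (c i)) w = x \<odot>[M] z \<longrightarrow> (\<forall>i<m. int p dvd c i)"
 have "x_basis p R M x m w"
 proof (intro x_basis.intro x_module_axioms x_basis_axioms.intro)
  show "w i \<in> carrier M" if "i < m" for i using c that by simp
  show "\<exists>c. \<exists>z\<in>carrier M. y = lin_comb M {..<m} (\<lambda>i. \<iota> (c i)) w \<oplus>[M] x \<odot>[M] z" if "y \<in> carrier M" for y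
   by (rule bspec[OF s that])
  show "int p dvd c j" if z: "z \<in> carrier M" "lin_comb M {..<m} (\<lambda>i. \<iota> (c i)) w = x \<odot>[M] z" "j < m" for c z j
   using mp[OF bspec[OF spec[OF i] z(1)] z(2)] z(3) by simp
 qed
 then show ?thesis by (intro exI)
qed

text \<open>The representation handed to the conjecture has dimension m, the rank of M over power
  series in x, rather than n. It is faithful on operators by \<open>matof_inj\<close>, so finiteness
  transfers back to the action.\<close>

lemma UFM_finite_image:
 fixes R :: "('a, 'b) ring_scheme" and M :: "('a, 'm) module" and K S
 defines "G \<equiv> GKS K S" and "TG \<equiv> GKS_topology K S"
 assumes p: "Factorial_Ring.prime p" and UFM: "conjecture_UFM p" and K: "number_field K"
  and S: "finite S" "S \<subseteq> primes_of K" "\<forall>P\<in>S. \<not> prime_above p P"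
  and ji: "just_infinite R" and char: "add_pow R p \<one>[R] = \<zero>[R]" and fb: "free_basis R M n b"
  and lin: "\<And>g. g \<in> carrier G \<Longrightarrow> lin_endo R M (\<alpha> g)"
  and one: "\<And>y. y \<in> carrier M \<Longrightarrow> \<alpha> \<one>[G] y = y"
  and mult: "\<And>g h y. g \<in> carrier G \<Longrightarrow> h \<in> carrier G \<Longrightarrow> y \<in> carrier M \<Longrightarrow> \<alpha> (g \<otimes>[G] h) y = \<alpha> g (\<alpha> h y)"
  and cont: "\<And>y. y \<in> carrier M \<Longrightarrow> continuous_map TG (adic_topology R M) (\<lambda>g. \<alpha> g y)"
 shows "finite ((\<lambda>g. restrict (\<alpha> g) (carrier M)) ` carrier G)"
proof (cases "carrier G = {}")
 case False
 interpret G: group G using GKS_group False unfolding G_def by blast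
 interpret J: just_infinite R by (rule ji)
 interpret free_basis R M n b by (rule fb)
 obtain x where x: "x \<in> max_ideal R" "x \<noteq> \<zero>[R]" using J.exists_parameter by blast
 interpret xm: x_module p R M x by (rule x_module[OF p ji x char])
 obtain m w where "x_basis p R M x m w" using xm.ex_x_basis by (elim exE)
 then interpret xb: x_basis p R M x m w .
 have ac: "\<alpha> g y \<in> carrier M" if "g \<in> carrier G" "y \<in> carrier M" for g y
  using lin[OF that(1)] that(2) by (auto simp: semilinear_def)
 define \<phi> where "\<phi> g = xb.matof (\<alpha> g)" for g
 have \<phi>c: "\<phi> g \<in> carrier (Mat m xm.LF)" for g unfolding \<phi>_def by (rule xb.matof_closed)
 have fin: "finite (\<phi> ` carrier G)"
 \<comment> \<open>The conjecture speaks of dimension at least 1; in dimension 0 there is only one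
   matrix.\<close>
 proof (cases "m = 0")
  case True
  then have "\<phi> ` carrier G \<subseteq> {\<lambda>_. undefined}" using \<phi>c by (auto simp: mat_carrier)
  then show ?thesis by (rule finite_subset) simp
 next
  case m: False
  have \<phi>m: "\<phi> (g \<otimes>[G] h) = \<phi> g \<otimes>[Mat m xm.LF] \<phi> h" if "g \<in> carrier G" "h \<in> carrier G" for g h
  proof -
   have "\<phi> (g \<otimes>[G] h) = xb.matof (\<lambda>y. \<alpha> g (\<alpha> h y))" unfolding \<phi>_def by (rule xb.matof_cong[OF mult[OF that]])
   then show ?thesis using xb.matof_mult[OF lin[OF that(1)] lin[OF that(2)]] by (simp add: \<phi>_def)
  qed
  have \<phi>1: "\<phi> \<one>[G] = \<one>[Mat m xm.LF]"
   unfolding \<phi>_def xb.matof_id[symmetric] by (rule xb.matof_cong[OF one])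
  have unit: "\<phi> g \<in> Units (Mat m xm.LF)" if g: "g \<in> carrier G" for g
  proof -
   have "\<phi> g \<otimes>[Mat m xm.LF] \<phi> (inv\<^bsub>G\<^esub> g) = \<one>[Mat m xm.LF]"
    "\<phi> (inv\<^bsub>G\<^esub> g) \<otimes>[Mat m xm.LF] \<phi> g = \<one>[Mat m xm.LF]"
    using \<phi>m[OF g G.inv_closed[OF g]] \<phi>m[OF G.inv_closed[OF g] g] \<phi>1 g by simp_all
   then show ?thesis unfolding Units_def using \<phi>c by blast
  qed
  have GL: "\<phi> g \<in> carrier (GL m xm.LF)" if "g \<in> carrier G" for g
   using unit[OF that] by (simp add: GL_def units_of_carrier units_mat_monoid)
  have hom: "\<phi> \<in> hom G (GL m xm.LF)"
  proof (rule homI)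
   fix g h assume "g \<in> carrier G" "h \<in> carrier G"
   then show "\<phi> (g \<otimes>[G] h) = \<phi> g \<otimes>[GL m xm.LF] \<phi> h"
    using \<phi>m by (simp add: GL_def units_of_mult Mat_def)
  qed (rule GL)
  have TGc: "topspace TG \<subseteq> carrier G" unfolding TG_def G_def by (rule GKS_topspace)
  have "continuous_map TG xm.vd.mtopology (\<lambda>g. \<phi> g (i, j))" if ij: "i < m" "j < m" for i j
   unfolding xm.vd.continuous_map_to_metric
  proof (intro ballI allI impI)
   fix g0 and \<epsilon> :: real assume g0: "g0 \<in> topspace TG" and \<epsilon>: "0 < \<epsilon>"
   obtain k :: int where k: "2 powi (- k) < \<epsilon>" using xm.small_power[OF \<epsilon>] by blast
   \<comment> \<open>For k \<le> 0 no congruence has to be imposed, since power series have no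
     nonzero digits at negative indices.\<close>
   define N where "N = nat k"
   have g0c: "g0 \<in> carrier G" using g0 TGc by blast
   \<comment> \<open>The coset of x^N M through the image of \<open>w j\<close> under g0 is open
     because x^N R contains a power of the maximal ideal. Every g mapping \<open>w j\<close> into it
     shares with g0 the first N digits of column j.\<close>
   define B where "B j = {y \<in> carrier M. \<exists>u\<in>carrier M. y = \<alpha> g0 (w j) \<oplus>[M] x [^]\<^bsub>R\<^esub> N \<odot>[M] u}" for j
   have Bo: "openin (adic_topology R M) (B j)" if j: "j < m" for j
    unfolding J.openin_adic[OF module_axioms]
   proof (intro conjI ballI)
    fix y assume "y \<in> B j"
    then obtain u where u: "y \<in> carrier M" "u \<in> carrier M" "y = \<alpha> g0 (w j) \<oplus>[M] x [^]\<^bsub>R\<^esub> N \<odot>[M] u" by (auto simp: B_def)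
    obtain l where l: "max_ideal_pow R l \<subseteq> J.xpow x N" using J.mpow_sub_xpow[OF x] by blast
    have "y \<oplus>[M] v \<in> B j" if v: "v \<in> ideal_smult (max_ideal_pow R l) M" for v
    proof -
     have v': "v \<in> carrier M" "\<forall>i<n. crd v i \<in> max_ideal_pow R l" using crd_ideal[OF J.mpow_ideal v] by auto
     have "\<exists>z\<in>carrier M. v = x [^]\<^bsub>R\<^esub> N \<odot>[M] z"
     proof (rule smult_crd[OF xb.xK v'(1)])
      fix i assume "i < n"
      then have "crd v i \<in> J.xpow x N" using v'(2) l by blast
      then show "\<exists>a\<in>carrier R. crd v i = x [^]\<^bsub>R\<^esub> N \<otimes>[R] a" by (auto simp: J.xpow_def)
     qed
     then obtain z where z: "z \<in> carrier M" "v = x [^]\<^bsub>R\<^esub> N \<odot>[M] z" by blast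
     have "y \<oplus>[M] v = \<alpha> g0 (w j) \<oplus>[M] x [^]\<^bsub>R\<^esub> N \<odot>[M] (u \<oplus>[M] z)"
      unfolding z(2) u(3) using ac[OF g0c xb.wc[OF j]] u(2) z(1) by (simp add: smult_r_distr M.a_assoc)
     then show ?thesis unfolding B_def using u(1,2) z(1) v'(1) ac[OF g0c xb.wc[OF j]] by (auto intro!: bexI[of _ "u \<oplus>[M] z"])
    qed
    then show "\<exists>l. \<forall>v\<in>ideal_smult (max_ideal_pow R l) M. y \<oplus>[M] v \<in> B j" by (intro exI[of _ l] ballI)
   qed (auto simp: B_def)
   define V where "V = {g \<in> topspace TG. \<alpha> g (w j) \<in> B j}"
   have "openin TG V" unfolding V_def
    by (rule openin_continuous_map_preimage[OF cont[OF xb.wc[OF ij(2)]] Bo[OF ij(2)]])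
   moreover have "g0 \<in> V"
    unfolding V_def B_def using g0 ac[OF g0c xb.wc[OF ij(2)]] by (auto intro!: bexI[of _ "\<zero>[M]"])
   moreover have "\<phi> g (i, j) \<in> xm.vd.mball (\<phi> g0 (i, j)) \<epsilon>" if g: "g \<in> V" for g
   proof -
    have gc: "g \<in> carrier G" using g TGc by (auto simp: V_def)
    obtain u where u: "u \<in> carrier M" "\<alpha> g (w j) = \<alpha> g0 (w j) \<oplus>[M] x [^]\<^bsub>R\<^esub> N \<odot>[M] u"
     using g by (auto simp: V_def B_def)
    have "\<phi> g0 (i, j) (int_encode l) = \<phi> g (i, j) (int_encode l)" if "l < k" for l
     unfolding \<phi>_def xb.matof_entry[OF ij]
     by (rule xb.lf_nth[symmetric, OF xb.rep_unique[OF xb.dig xb.dig u _ ij(1)], of N l])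
      (use that ac[OF gc xb.wc[OF ij(2)]] ac[OF g0c xb.wc[OF ij(2)]] in \<open>auto simp: N_def\<close>)
    then have "\<forall>l<k. \<phi> g0 (i, j) (int_encode l) = \<phi> g (i, j) (int_encode l)" by blast
    then have "xm.vd (\<phi> g0 (i, j)) (\<phi> g (i, j)) \<le> 2 powi (- k)"
     using xm.vd_le[OF mat_entry[OF \<phi>c ij] mat_entry[OF \<phi>c ij]] by simp
    then show ?thesis using k mat_entry[OF \<phi>c ij] by (simp add: xm.vd.in_mball)
   qed
   ultimately show "\<exists>U. openin TG U \<and> g0 \<in> U \<and> (\<forall>g\<in>U. \<phi> g (i, j) \<in> xm.vd.mball (\<phi> g0 (i, j)) \<epsilon>)"
    by (intro exI[of _ V]) simp
  qed
  then have "continuous_map TG (GL_topology m xm.LF (local_field_topology xm.LF laurent_val)) \<phi>"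
   unfolding GL_topology_def continuous_map_in_subtopology continuous_map_componentwise local_field_topology_def
   using GL TGc \<phi>c by (auto simp: mat_carrier PiE_def)
  then have rep: "continuous_rep G TG m xm.LF (local_field_topology xm.LF laurent_val) \<phi>"
   using hom by (simp add: continuous_rep_def)
  show ?thesis
   by (rule UFM[unfolded conjecture_UFM_def, rule_format, of K S xm.LF laurent_val m, folded G_def TG_def])
    (use K S rep m xm.LF_local_field xm.LF_char in auto)
 qed
 have eq: "restrict (\<alpha> g) (carrier M) = restrict (\<alpha> h) (carrier M)"
  if "g \<in> carrier G" "h \<in> carrier G" "\<phi> g = \<phi> h" for g h
  by (rule restrict_ext) (use xb.matof_inj[OF lin[OF that(1)] lin[OF that(2)]] that(3) in \<open>simp add: \<phi>_def\<close>)
 have "(\<lambda>g. restrict (\<alpha> g) (carrier M)) ` carrier G \<subseteq>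
   (\<lambda>v. restrict (\<alpha> (inv_into (carrier G) \<phi> v)) (carrier M)) ` (\<phi> ` carrier G)"
 proof
  fix f assume "f \<in> (\<lambda>g. restrict (\<alpha> g) (carrier M)) ` carrier G"
  then obtain g where g: "g \<in> carrier G" "f = restrict (\<alpha> g) (carrier M)" by blast
  have "f = restrict (\<alpha> (inv_into (carrier G) \<phi> (\<phi> g))) (carrier M)"
   unfolding g(2) by (rule eq) (use g in \<open>auto intro!: inv_into_into simp: f_inv_into_f\<close>)
  then show "f \<in> (\<lambda>v. restrict (\<alpha> (inv_into (carrier G) \<phi> v)) (carrier M)) ` (\<phi> ` carrier G)" using g(1) by blast
 qed
 then show ?thesis using fin by (rule finite_subset[OF _ finite_imageI])
qed simp

section \<open>Descent of a deformation\<close>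

context free_basis
begin

lemma crd_lin_comb:
 fixes l :: nat
 assumes v: "\<And>j. j < l \<Longrightarrow> v j \<in> carrier M" and c: "\<And>j. j < l \<Longrightarrow> c j \<in> carrier R" and i: "i < n"
 shows "crd (lin_comb M {..<l} c v) i = (\<Oplus>j\<in>{..<l}. crd (v j) i \<otimes> c j)"
proof -
 have "lin_comb M {..<l} c v = lin_comb M {..<l} c (\<lambda>j. lin_comb M {..<n} (\<lambda>i. crd (v j) i) b)"
  by (rule lc_cong) (auto simp: v c crd_lc)
 also have "\<dots> = lin_comb M {..<n} (\<lambda>i. \<Oplus>j\<in>{..<l}. crd (v j) i \<otimes> c j) b"
  by (rule lc_lc) (auto simp: v c bc crd_closed)
 finally show ?thesis by (rule crd_unique[rotated]) (auto simp: i v c crd_closed intro!: R.finsum_closed)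
qed

end

lemma (in cring) vec_lin_comb_entry:
 fixes l :: nat
 assumes "\<And>j. j < l \<Longrightarrow> v j \<in> carrier (vec_module n R)" "\<And>j. j < l \<Longrightarrow> c j \<in> carrier R" "i < n"
 shows "lin_comb (vec_module n R) {..<l} c v i = (\<Oplus>j\<in>{..<l}. c j \<otimes> v j i)"
proof -
 have "(\<Oplus>\<^bsub>vec_module n R\<^esub>j\<in>{..<l}. c j \<odot>[vec_module n R] v j) i = (\<Oplus>j\<in>{..<l}. (c j \<odot>[vec_module n R] v j) i)"
  by (rule vec_finsum_entry) (use assms in \<open>auto intro!: vec_closed\<close>)
 also have "\<dots> = (\<Oplus>j\<in>{..<l}. c j \<otimes> v j i)"
  by (rule finsum_cong') (use assms vec_entry[OF assms(1)] in \<open>auto simp: vec_entries\<close>)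
 finally show ?thesis by (simp add: lin_comb_def)
qed

context char_p_coeff
begin

text \<open>The coordinate matrix Q of chosen preimages of the unit vectors and the lifted matrix P
  of \<pi> are inverse to each other modulo \<mm>: PQ by semilinearity of \<pi>, QP because the
  kernel of \<pi> is \<mm>M. The Neumann series makes both products units, hence Q is a
  unit.\<close>

lemma lift_basis:
 assumes fb: "free_basis A M n b" and \<pi>: "semilinear A res M (vec_module n F) \<pi>"
  and surj: "\<pi> ` carrier M = carrier (vec_module n F)"
  and kern: "{x \<in> carrier M. \<pi> x = \<zero>[vec_module n F]} = ideal_smult \<mm> M"
 shows "\<exists>c. module_basis A M n c \<and> (\<forall>i<n. \<pi> (c i) = unit_vec n F i)"
proof -
 note A_cong = finsum_cong'
 interpret free_basis A M n b by (rule fb)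
 interpret V: module F "vec_module n F" by (rule F.vec_module)
 interpret MR: ring "Mat n A" by (rule Mat)
 have \<pi>c: "\<pi> y \<in> carrier (vec_module n F)" if "y \<in> carrier M" for y using surj that by blast
 have "\<forall>j. \<exists>y. y \<in> carrier M \<and> \<pi> y = unit_vec n F j"
  using surj F.vec_const_closed(2)[of n] by (metis (no_types, lifting) imageE)
 from choice[OF this] obtain c where c0: "\<forall>j. c j \<in> carrier M \<and> \<pi> (c j) = unit_vec n F j" ..
 then have c: "c j \<in> carrier M" "\<pi> (c j) = unit_vec n F j" for j by auto
 define Q where "Q = (\<lambda>(i, j)\<in>{..<n} \<times> {..<n}. crd (c j) i)"
 define P where "P = (\<lambda>(i, j)\<in>{..<n} \<times> {..<n}. \<tau> (\<pi> (b j) i))"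
 have Qe: "Q (i, j) = crd (c j) i" if "i < n" "j < n" for i j using that by (simp add: Q_def)
 have Pe: "P (i, j) = \<tau> (\<pi> (b j) i)" if "i < n" "j < n" for i j using that by (simp add: P_def)
 have be: "\<pi> (b j) i \<in> carrier F" if "i < n" "j < n" for i j by (rule vec_entry[OF \<pi>c[OF bc[OF that(2)]] that(1)])
 have Qc: "Q \<in> carrier (Mat n A)" by (rule mat_carrierI) (auto simp: Q_def extensional_def crd_closed c)
 have Pc: "P \<in> carrier (Mat n A)" by (rule mat_carrierI) (auto simp: P_def extensional_def be)
 have \<pi>lc: "\<pi> (lin_comb M {..<n} d v) i = (\<Oplus>\<^bsub>F\<^esub>j\<in>{..<n}. res (d j) \<otimes>[F] \<pi> (v j) i)"
  if d: "\<And>j. j < n \<Longrightarrow> d j \<in> carrier A" and v: "\<And>j. j < n \<Longrightarrow> v j \<in> carrier M" and i: "i < n" for d v i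
 proof -
  have "\<pi> (lin_comb M {..<n} d v) = lin_comb (vec_module n F) {..<n} (\<lambda>j. res (d j)) (\<lambda>j. \<pi> (v j))"
   by (rule semilinear_lc[OF module_axioms F.vec_module \<pi>]) (auto simp: d v)
  then show ?thesis using F.vec_lin_comb_entry[of n "\<lambda>j. \<pi> (v j)" n "\<lambda>j. res (d j)" i] d v \<pi>c i by simp
 qed
 have unitI: "M \<in> Units (Mat n A)"
  if M: "M \<in> carrier (Mat n A)" "\<And>i j. i < n \<Longrightarrow> j < n \<Longrightarrow> \<one>[Mat n A] (i, j) \<ominus> M (i, j) \<in> \<mm>" for M
  by (rule neumann[OF complete M(1)])
   (use M MR.minus_closed[OF MR.one_closed M(1)] in \<open>auto simp: mat_in_def mat_minus_entry[OF MR.one_closed M(1)]\<close>)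
 have PQ: "P \<otimes>[Mat n A] Q \<in> Units (Mat n A)"
 proof (rule unitI)
  fix i j assume ij: "i < n" "j < n"
  have o: "\<one>[Mat n A] (i, j) \<in> carrier A" "(P \<otimes>[Mat n A] Q) (i, j) \<in> carrier A"
   using mat_entry[OF MR.one_closed ij] mat_entry[OF MR.m_closed[OF Pc Qc] ij] .
  have "res ((P \<otimes>[Mat n A] Q) (i, j)) = (\<Oplus>\<^bsub>F\<^esub>k\<in>{..<n}. res (P (i, k) \<otimes> Q (k, j)))"
   unfolding mat_entries(1)[OF ij]
   by (rule ring_hom_finsum[OF res_hom is_cring F.is_cring]) (use mat_entry[OF Pc ij(1)] mat_entry[OF Qc _ ij(2)] in auto)
  also have "\<dots> = (\<Oplus>\<^bsub>F\<^esub>k\<in>{..<n}. res (crd (c j) k) \<otimes>[F] \<pi> (b k) i)"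
   by (rule F.finsum_cong') (use ij be crd_closed c in \<open>auto simp: Pe Qe res_tau F.m_comm\<close>)
  also have "\<dots> = \<pi> (lin_comb M {..<n} (crd (c j)) b) i" by (rule \<pi>lc[symmetric]) (auto simp: crd_closed c bc ij)
  also have "\<dots> = (if i = j then \<one>[F] else \<zero>[F])" using ij by (simp add: crd_lc c vec_entries)
  finally show "\<one>[Mat n A] (i, j) \<ominus> (P \<otimes>[Mat n A] Q) (i, j) \<in> \<mm>"
   using o ij by (subst res_zero_iff[symmetric]) (auto simp: a_minus_def mat_entries(3) F.r_neg F.r_zero)
 qed (use Pc Qc in simp)
 have QP: "Q \<otimes>[Mat n A] P \<in> Units (Mat n A)"
 proof (rule unitI)
  fix i j assume ij: "i < n" "j < n"
  let ?s = "lin_comb M {..<n} (\<lambda>k. P (k, j)) c"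
  have Pj: "P (k, j) \<in> carrier A" if "k < n" for k by (rule mat_entry[OF Pc that ij(2)])
  have sc: "?s \<in> carrier M" by (rule lc_closed) (auto simp: c Pj)
  have "\<pi> ?s = \<pi> (b j)"
  proof (rule vec_eqI[OF \<pi>c[OF sc] \<pi>c[OF bc[OF ij(2)]]])
   fix a assume a: "a < n"
   have "\<pi> ?s a = (\<Oplus>\<^bsub>F\<^esub>k\<in>{..<n}. res (P (k, j)) \<otimes>[F] \<pi> (c k) a)" by (rule \<pi>lc) (auto simp: c Pj a)
   also have "\<dots> = (\<Oplus>\<^bsub>F\<^esub>k\<in>{..<n}. if a = k then \<pi> (b j) k else \<zero>[F])"
    by (rule F.finsum_cong') (use ij a be in \<open>auto simp: Pe c vec_entries res_tau\<close>)
   also have "\<dots> = \<pi> (b j) a" by (rule F.finsum_singleton) (use a ij be in auto)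
   finally show "\<pi> ?s a = \<pi> (b j) a" .
  qed
  moreover have "\<pi> (b j \<oplus>[M] (\<ominus> \<one>) \<odot>[M] ?s) = \<pi> (b j) \<oplus>[vec_module n F] (\<ominus>\<^bsub>F\<^esub> \<one>[F]) \<odot>[vec_module n F] \<pi> ?s"
   using \<pi> bc[OF ij(2)] sc by (simp add: semilinear_def)
  ultimately have "\<pi> (b j \<ominus>[M] ?s) = \<zero>[vec_module n F]"
   using \<pi>c[OF bc[OF ij(2)]] sc by (simp add: smult_l_minus V.smult_l_minus M.minus_eq V.M.r_neg)
  then have "b j \<ominus>[M] ?s \<in> ideal_smult \<mm> M" using kern bc[OF ij(2)] sc by auto
  from crd_ideal[OF mpow_ideal[of 1, simplified] this] have m: "crd (b j \<ominus>[M] ?s) i \<in> \<mm>" using ij by blast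
  have "crd (b j \<ominus>[M] ?s) i = crd (b j \<oplus>[M] (\<ominus> \<one>) \<odot>[M] ?s) i"
   using sc by (simp add: smult_l_minus M.minus_eq)
  also have "\<dots> = crd (b j) i \<ominus> crd ?s i"
   using sc bc[OF ij(2)] ij crd_closed[OF sc ij(1)] by (simp add: crd_add crd_smult a_minus_def l_minus)
  also have "crd ?s i = (\<Oplus>k\<in>{..<n}. crd (c k) i \<otimes> P (k, j))" by (rule crd_lin_comb) (auto simp: c Pj ij)
  also have "\<dots> = (Q \<otimes>[Mat n A] P) (i, j)"
   unfolding mat_entries(1)[OF ij] by (rule A_cong) (use ij Pj mat_entry[OF Qc ij(1)] in \<open>auto simp: Qe\<close>)
  finally show "\<one>[Mat n A] (i, j) \<ominus> (Q \<otimes>[Mat n A] P) (i, j) \<in> \<mm>"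
   using m ij by (simp add: crd_basis mat_entries(3))
 qed (use Pc Qc in simp)
 have "Q \<in> Units (Mat n A)"
 proof -
  let ?l = "inv\<^bsub>Mat n A\<^esub> (P \<otimes>[Mat n A] Q) \<otimes>[Mat n A] P"
  let ?r = "P \<otimes>[Mat n A] inv\<^bsub>Mat n A\<^esub> (Q \<otimes>[Mat n A] P)"
  have lc: "?l \<in> carrier (Mat n A)" "?r \<in> carrier (Mat n A)" using PQ QP Pc by auto
  have l: "?l \<otimes>[Mat n A] Q = \<one>[Mat n A]" using MR.Units_l_inv[OF PQ] PQ Pc Qc by (simp add: MR.m_assoc)
  have r: "Q \<otimes>[Mat n A] ?r = \<one>[Mat n A]" using MR.Units_r_inv[OF QP] QP Pc Qc by (simp add: MR.m_assoc[symmetric])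
  have "?l = ?l \<otimes>[Mat n A] (Q \<otimes>[Mat n A] ?r)" unfolding r using lc(1) by simp
  also have "\<dots> = ?r" unfolding MR.m_assoc[OF lc(1) Qc lc(2), symmetric] l using lc(2) by simp
  finally have "?l = ?r" .
  then show ?thesis unfolding Units_def using l r lc Qc by (metis (mono_tags, lifting) mem_Collect_eq)
 qed
 moreover have "lin_comb M {..<n} (\<lambda>i. Q (i, j)) b = c j" if j: "j < n" for j
 proof -
  have "lin_comb M {..<n} (\<lambda>i. Q (i, j)) b = lin_comb M {..<n} (crd (c j)) b"
   by (rule lc_cong) (use j c in \<open>auto simp: Qe crd_closed bc\<close>)
  then show ?thesis using crd_lc[OF c(1)] by simp
 qed
 ultimately show ?thesis using basis_change[of Q] c(2)
  by (intro exI[of _ "\<lambda>j. lin_comb M {..<n} (\<lambda>i. Q (i, j)) b"]) simp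
qed

end

context char_p_coeff
begin

text \<open>In a basis lifting the standard one the action matrices reduce to \<rho>. They are
  finite in number, so \<open>descend_finite_matrices\<close> supplies a change of basis after which
  all entries lie in the coefficient field.\<close>

lemma descend_deformation:
 fixes K S and \<rho> and D :: "('a, 'm, complex \<Rightarrow> complex, 'f) deformation_data"
 defines "G \<equiv> GKS K S" and "TG \<equiv> GKS_topology K S"
 assumes UFM: "conjecture_UFM p" and K: "number_field K"
  and S: "finite S" "S \<subseteq> primes_of K" "\<forall>P\<in>S. \<not> prime_above p P"
  and \<rho>: "\<rho> \<in> hom G (GL n F)" and irr: "absolutely_irreducible_rep G n F \<rho>"
  and D: "deformation G TG n F \<rho> A D"
 shows "\<exists>v. module_basis A (dmod D) n v \<and> (\<forall>i<n. dred D (v i) = unit_vec n F i) \<and>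
  (\<forall>g\<in>carrier G. \<forall>j<n. dact D g (v j) = lin_comb (dmod D) {..<n} (\<lambda>i. \<tau> (\<rho> g (i, j))) v)"
proof -
 define M where "M = dmod D"
 define \<alpha> where "\<alpha> = dact D"
 define \<pi> where "\<pi> = dred D"
 note Du = D[unfolded deformation_def Let_def, folded M_def \<alpha>_def \<pi>_def]
 have md: "module A M" and lin: "\<And>g. g \<in> carrier G \<Longrightarrow> lin_endo A M (\<alpha> g)"
  and one: "\<And>y. y \<in> carrier M \<Longrightarrow> \<alpha> \<one>[G] y = y"
  and mult: "\<And>g h y. g \<in> carrier G \<Longrightarrow> h \<in> carrier G \<Longrightarrow> y \<in> carrier M \<Longrightarrow> \<alpha> (g \<otimes>[G] h) y = \<alpha> g (\<alpha> h y)"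
  and cont: "continuous_map (prod_topology TG (adic_topology A M)) (adic_topology A M) (\<lambda>(g, x). \<alpha> g x)"
  and \<pi>: "semilinear A res M (vec_module n F) \<pi>" "\<pi> ` carrier M = carrier (vec_module n F)"
   "{x \<in> carrier M. \<pi> x = \<zero>[vec_module n F]} = ideal_smult \<mm> M"
  and eqv: "\<And>g x. g \<in> carrier G \<Longrightarrow> x \<in> carrier M \<Longrightarrow> \<pi> (\<alpha> g x) = mat_vec n F (\<rho> g) (\<pi> x)"
  using Du by simp_all
 obtain b0 where b0: "module_basis A M n b0" using Du by (elim conjE exE)
 have "free_basis A M n b0" by (intro free_basis.intro free_basis_axioms.intro md b0)
 from lift_basis[OF this \<pi>] obtain c where c: "module_basis A M n c" "\<And>i. i < n \<Longrightarrow> \<pi> (c i) = unit_vec n F i" by (elim exE conjE) simp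
 interpret V: module F "vec_module n F" by (rule F.vec_module)
 interpret MR: ring "Mat n A" by (rule Mat)
 interpret MF: ring "Mat n F" by (rule F.Mat)
 note A_cong = finsum_cong'
 have fb: "free_basis A M n c" by (intro free_basis.intro free_basis_axioms.intro md c(1))
 interpret free_basis A M n c by (rule fb)
 have ac: "\<alpha> g y \<in> carrier M" if "g \<in> carrier G" "y \<in> carrier M" for g y
  using lin[OF that(1)] that(2) by (auto simp: semilinear_def)
 have cont1: "continuous_map TG (adic_topology A M) (\<lambda>g. \<alpha> g y)" if y: "y \<in> carrier M" for y
 proof -
  have "continuous_map TG (prod_topology TG (adic_topology A M)) (\<lambda>g. (g, y))"
   by (simp add: continuous_map_paired topspace_adic[OF md] y)
  from continuous_map_compose[OF this cont] show ?thesis by (simp add: o_def)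
 qed
 have "finite ((\<lambda>g. restrict (\<alpha> g) (carrier M)) ` carrier G)"
  unfolding G_def
  by (rule UFM_finite_image[OF p UFM K S ji _ fb])
   (use Ap lin one mult cont1 in \<open>simp_all add: has_char_def G_def TG_def\<close>)
 then have "finite (mx ` ((\<lambda>g. restrict (\<alpha> g) (carrier M)) ` carrier G))" by (rule finite_imageI)
 moreover have "mx (restrict (\<alpha> g) (carrier M)) = mx (\<alpha> g)" for g by (rule mx_cong) simp
 ultimately have fin: "finite ((\<lambda>g. mx (\<alpha> g)) ` carrier G)" by (simp add: image_image)
 define H where "H = insert \<one>[Mat n A] ((\<lambda>g. mx (\<alpha> g)) ` carrier G)"
 have mxc: "mx (\<alpha> g) \<in> carrier (Mat n A)" if "g \<in> carrier G" for g by (rule mx_closed[OF ac[OF that]])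
 have Gm: "g \<otimes>[G] h \<in> carrier G" if "g \<in> carrier G" "h \<in> carrier G" for g h
 proof -
  interpret group G unfolding G_def by (rule GKS_group) (use that(1) in \<open>auto simp: G_def\<close>)
  show ?thesis using that by simp
 qed
 have mxm: "mx (\<alpha> g) \<otimes>[Mat n A] mx (\<alpha> h) = mx (\<alpha> (g \<otimes>[G] h))" if gh: "g \<in> carrier G" "h \<in> carrier G" for g h
  using mx_mult[OF lin[OF gh(1)], of "\<alpha> h"] ac[OF gh(2)] mx_cong[OF mult[OF gh]] by simp
 have H: "H \<subseteq> carrier (Mat n A)" "finite H" "\<one>[Mat n A] \<in> H" using mxc fin by (auto simp: H_def)
 have Hm: "g \<otimes>[Mat n A] h \<in> H" if gh: "g \<in> H" "h \<in> H" for g h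
 proof -
  consider "g = \<one>[Mat n A]" | "h = \<one>[Mat n A]" | g' h' where "g' \<in> carrier G" "h' \<in> carrier G" "g = mx (\<alpha> g')" "h = mx (\<alpha> h')"
   using gh by (auto simp: H_def)
  then show ?thesis
  proof cases
   case 3
   then have "g \<otimes>[Mat n A] h = mx (\<alpha> (g' \<otimes>[G] h'))" by (simp add: mxm)
   then show ?thesis using Gm[OF 3(1,2)] by (auto simp: H_def)
  qed (use gh H(1) in auto)
 qed
 have \<rho>c: "\<rho> g \<in> carrier (Mat n F)" if "g \<in> carrier G" for g
  using hom_in_carrier[OF \<rho> that] by (simp add: GL_def units_of_carrier units_mat_monoid MF.Units_closed)
 \<comment> \<open>Because c lifts the standard basis, \<pi> is coordinatewise reduction in this
   basis.\<close>
 have \<pi>c: "\<pi> y i = res (crd y i)" if y: "y \<in> carrier M" and i: "i < n" for y i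
 proof -
  have "\<pi> (lin_comb M {..<n} (crd y) c) = lin_comb (vec_module n F) {..<n} (\<lambda>j. res (crd y j)) (\<lambda>j. \<pi> (c j))"
   by (rule semilinear_lc[OF md F.vec_module \<pi>(1)]) (auto simp: crd_closed y bc)
  then have "\<pi> y i = lin_comb (vec_module n F) {..<n} (\<lambda>j. res (crd y j)) (\<lambda>j. \<pi> (c j)) i" by (simp add: crd_lc y)
  also have "\<dots> = (\<Oplus>\<^bsub>F\<^esub>j\<in>{..<n}. res (crd y j) \<otimes>[F] \<pi> (c j) i)"
   by (rule F.vec_lin_comb_entry) (use c i in \<open>auto simp: crd_closed y F.vec_const_closed\<close>)
  also have "\<dots> = (\<Oplus>\<^bsub>F\<^esub>j\<in>{..<n}. if i = j then res (crd y j) else \<zero>[F])"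
   by (rule F.finsum_cong') (use c i in \<open>auto simp: crd_closed y vec_entries\<close>)
  also have "\<dots> = res (crd y i)" by (rule F.finsum_singleton) (use i in \<open>auto simp: crd_closed y\<close>)
  finally show ?thesis .
 qed
 have resm: "mat_map n res (mx (\<alpha> g)) = \<rho> g" if g: "g \<in> carrier G" for g
 proof (rule mat_eqI[OF ring_hom_closed[OF mat_map_hom[OF res_hom is_cring F.is_cring] mxc[OF g]] \<rho>c[OF g]])
  fix i j assume ij: "i < n" "j < n"
  have "mat_map n res (mx (\<alpha> g)) (i, j) = \<pi> (\<alpha> g (c j)) i"
   using ij by (simp add: mx_entry \<pi>c ac[OF g] bc)
  also have "\<dots> = \<rho> g (i, j)" unfolding eqv[OF g bc[OF ij(2)]] c(2)[OF ij(2)] by (rule F.mat_vec_unit[OF \<rho>c[OF g] ij])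
  finally show "mat_map n res (mx (\<alpha> g)) (i, j) = \<rho> g (i, j)" .
 qed
 have res1: "mat_map n res \<one>[Mat n A] = \<one>[Mat n F]" by (rule ring_hom_one[OF mat_map_hom[OF res_hom is_cring F.is_cring]])
 let ?H = "mat_map n res ` H"
 have full: "carrier (Mat n F) \<subseteq> mat_span n F (carrier F) ?H"
 proof -
  let ?\<Omega> = "field.alg_closure F" and ?\<iota> = "ring.indexed_const F"
  interpret AC: algebraic_closure ?\<Omega> "?\<iota> ` carrier F" by (rule F.alg_closureE(1))
  have ir: "0 < n" "\<And>V. submodule V ?\<Omega> (vec_module n ?\<Omega>) \<Longrightarrow>
    (\<And>g x. g \<in> carrier G \<Longrightarrow> x \<in> V \<Longrightarrow> mat_vec n ?\<Omega> (mat_map n ?\<iota> (\<rho> g)) x \<in> V) \<Longrightarrow>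
    V = {\<zero>\<^bsub>vec_module n ?\<Omega>\<^esub>} \<or> V = carrier (vec_module n ?\<Omega>)"
   using irr unfolding absolutely_irreducible_rep_def irreducible_rep_def mat_map_def[symmetric] by simp_all
  have "abs_irr F n ?H ?\<Omega> ?\<iota>"
  proof (intro abs_irr.intro abs_irr_axioms.intro mat_subalgebra.intro mat_subalgebra_axioms.intro)
   show "field F" by (rule Ff)
   show "cring F" by (rule F.is_cring)
   show "?H \<subseteq> carrier (Mat n F)"
    using H(1) ring_hom_closed[OF mat_map_hom[OF res_hom is_cring F.is_cring]] by blast
   show "g \<otimes>[Mat n F] h \<in> ?H" if gh: "g \<in> ?H" "h \<in> ?H" for g h
   proof -
    obtain g' h' where g': "g' \<in> H" "h' \<in> H" "g = mat_map n res g'" "h = mat_map n res h'" using gh by blast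
    then have "g \<otimes>[Mat n F] h = mat_map n res (g' \<otimes>[Mat n A] h')"
     using ring_hom_mult[OF mat_map_hom[OF res_hom is_cring F.is_cring] subsetD[OF H(1) g'(1)] subsetD[OF H(1) g'(2)]] by simp
    then show ?thesis using Hm[OF g'(1,2)] by blast
   qed
   show "finite (carrier F)" by (rule finF)
   show "0 < n" by (rule ir(1))
   show "\<one>[Mat n F] \<in> ?H" unfolding res1[symmetric] using H(3) by blast
   show "algebraically_closed ?\<Omega>" by unfold_locales
   show "?\<iota> \<in> ring_hom F ?\<Omega>" by (rule F.alg_closureE(2))
   fix V assume V: "submodule V ?\<Omega> (vec_module n ?\<Omega>)"
    "\<And>h x. h \<in> ?H \<Longrightarrow> x \<in> V \<Longrightarrow> mat_vec n ?\<Omega> (mat_map n ?\<iota> h) x \<in> V"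
   show "V = {\<zero>\<^bsub>vec_module n ?\<Omega>\<^esub>} \<or> V = carrier (vec_module n ?\<Omega>)"
   proof (rule ir(2)[OF V(1)])
    fix g x assume g: "g \<in> carrier G" and x: "x \<in> V"
    have "\<rho> g \<in> ?H" unfolding resm[OF g, symmetric] using g by (auto simp: H_def)
    then show "mat_vec n ?\<Omega> (mat_map n ?\<iota> (\<rho> g)) x \<in> V" using V(2) x by blast
   qed
  qed simp_all
  then show ?thesis by (rule abs_irr.burnside)
 qed
 have n0: "0 < n" using irr by (simp add: absolutely_irreducible_rep_def irreducible_rep_def)
 have "\<exists>U\<in>Units (Mat n A). mat_map n res U = \<one>[Mat n F] \<and>
  (\<forall>h\<in>H. h \<otimes>[Mat n A] U = U \<otimes>[Mat n A] mat_map n \<tau> (mat_map n res h))"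
  by (rule descend_finite_matrices[OF n0 H _ full]) (rule Hm)
 then obtain U where U: "U \<in> Units (Mat n A)" "mat_map n res U = \<one>[Mat n F]"
  "\<And>h. h \<in> H \<Longrightarrow> h \<otimes>[Mat n A] U = U \<otimes>[Mat n A] mat_map n \<tau> (mat_map n res h)"
  by (elim bexE conjE) simp
 have Uc: "U \<in> carrier (Mat n A)" by (rule MR.Units_closed[OF U(1)])
 \<comment> \<open>The columns of U, read as coordinates in c. Since U reduces to the identity,
   \<pi> still sends v to the standard basis, and the intertwining relation becomes the formula for
   the action on v.\<close>
 define v where "v j = lin_comb M {..<n} (\<lambda>i. U (i, j)) c" for j
 have vc: "v j \<in> carrier M" if "j < n" for j
  unfolding v_def by (rule lc_closed) (use mat_entry[OF Uc _ that] bc in auto)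
 have crdv: "crd (v j) i = U (i, j)" if "i < n" "j < n" for i j
  by (rule crd_unique[OF _ v_def that(1)]) (rule mat_entry[OF Uc _ that(2)])
 have "module_basis A M n v" using basis_change[OF U(1)] unfolding v_def .
 moreover have "\<pi> (v j) = unit_vec n F j" if j: "j < n" for j
 proof (rule vec_eqI[of _ n F])
  show "\<pi> (v j) \<in> carrier (vec_module n F)" using \<pi>(2) vc[OF j] by blast
  fix i assume i: "i < n"
  have "\<pi> (v j) i = mat_map n res U (i, j)" using i j by (simp add: \<pi>c vc crdv)
  then show "\<pi> (v j) i = unit_vec n F j i" unfolding U(2) using i j by (simp add: mat_entries(3) vec_entries)
 qed (rule F.vec_const_closed)
 moreover have "\<alpha> g (v j) = lin_comb M {..<n} (\<lambda>i. \<tau> (\<rho> g (i, j))) v" if g: "g \<in> carrier G" and j: "j < n" for g j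
 proof (rule crd_eqI[OF ac[OF g vc[OF j]]])
  have tc: "\<tau> (\<rho> g (i, j)) \<in> carrier A" if "i < n" for i using mat_entry[OF \<rho>c[OF g] that j] by simp
  show "lin_comb M {..<n} (\<lambda>i. \<tau> (\<rho> g (i, j))) v \<in> carrier M" by (rule lc_closed) (auto simp: tc vc)
  fix i assume i: "i < n"
  have "crd (\<alpha> g (v j)) i = (mx (\<alpha> g) \<otimes>[Mat n A] U) (i, j)"
   unfolding v_def mat_entries(1)[OF i j] by (rule endo_lc[OF lin[OF g] _ i]) (rule mat_entry[OF Uc _ j])
  also have "\<dots> = (U \<otimes>[Mat n A] mat_map n \<tau> (\<rho> g)) (i, j)"
   using U(3)[of "mx (\<alpha> g)"] g by (simp add: H_def resm)
  also have "\<dots> = (\<Oplus>k\<in>{..<n}. crd (v k) i \<otimes> \<tau> (\<rho> g (k, j)))"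
   unfolding mat_entries(1)[OF i j] by (rule A_cong) (use i j tc mat_entry[OF Uc i] in \<open>auto simp: crdv\<close>)
  also have "\<dots> = crd (lin_comb M {..<n} (\<lambda>i. \<tau> (\<rho> g (i, j))) v) i"
   by (rule crd_lin_comb[symmetric]) (auto simp: vc tc i)
  finally show "crd (\<alpha> g (v j)) i = crd (lin_comb M {..<n} (\<lambda>i. \<tau> (\<rho> g (i, j))) v) i" .
 qed
 ultimately show ?thesis unfolding M_def \<alpha>_def \<pi>_def by (intro exI[of _ v]) simp
qed

end

lemma (in cring) vec_basis: "module_basis R (vec_module n R) n (unit_vec n R)"
 unfolding module_basis_def
proof (intro conjI ballI)
 show "unit_vec n R \<in> {..<n} \<rightarrow> carrier (vec_module n R)" using vec_const_closed(2) by blast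
 interpret V: module R "vec_module n R" by (rule vec_module)
 have e: "lin_comb (vec_module n R) {..<n} c (unit_vec n R) = c" if c: "c \<in> carrier (vec_module n R)" for c
 proof (rule vec_eqI[OF V.lc_closed c])
  fix i assume i: "i < n"
  have "lin_comb (vec_module n R) {..<n} c (unit_vec n R) i = (\<Oplus>j\<in>{..<n}. c j \<otimes> unit_vec n R j i)"
   by (rule vec_lin_comb_entry) (auto simp: vec_const_closed vec_entry[OF c] i)
  also have "\<dots> = (\<Oplus>j\<in>{..<n}. if i = j then c j else \<zero>)"
   by (rule finsum_cong') (auto simp: vec_entries i vec_entry[OF c])
  also have "\<dots> = c i" by (rule finsum_singleton) (auto simp: i vec_entry[OF c])
  finally show "lin_comb (vec_module n R) {..<n} c (unit_vec n R) i = c i" .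
 qed (auto simp: vec_const_closed vec_entry[OF c])
 fix x assume x: "x \<in> carrier (vec_module n R)"
 show "\<exists>!c. c \<in> {..<n} \<rightarrow>\<^sub>E carrier R \<and> x = (\<Oplus>\<^bsub>vec_module n R\<^esub>i\<in>{..<n}. c i \<odot>[vec_module n R] unit_vec n R i)"
  unfolding vec_carrier[symmetric] lin_comb_def[symmetric] by (rule ex1I[of _ x]) (use e x in auto)
qed

lemma module_basis_cong:
 assumes "module A M" "module_basis A M n b" "\<And>i. i < n \<Longrightarrow> b i = b' i"
 shows "module_basis A M n b'"
proof -
 interpret module A M by fact
 have b: "b i \<in> carrier M" if "i < n" for i using assms(2) that by (auto simp: module_basis_def)
 have "(\<Oplus>\<^bsub>M\<^esub>i\<in>{..<n}. c i \<odot>[M] b' i) = (\<Oplus>\<^bsub>M\<^esub>i\<in>{..<n}. c i \<odot>[M] b i)" if "c \<in> {..<n} \<rightarrow>\<^sub>E carrier A" for c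
  by (rule M.finsum_cong') (use that b assms(3) in auto)
 then show ?thesis using assms(2) b unfolding module_basis_def by (auto simp: assms(3)[symmetric] cong: conj_cong)
qed

context char_p_coeff
begin

subsection \<open>The coefficient field as an object\<close>

text \<open>The residue field realised inside \<open>A\<close>; it keeps the structure and residue
  maps of \<open>A\<close>, which makes the inclusion a morphism of coefficient algebras.\<close>

definition "k = A \<lparr>carrier := C\<rparr>"

lemma k_simps [simp]: "carrier k = C" "\<one>[k] = \<one>" "\<zero>[k] = \<zero>" "a \<otimes>[k] b = a \<otimes> b" "a \<oplus>[k] b = a \<oplus> b"
  "struct_map k = struct_map A" "residue_map k = res"
 by (simp_all add: k_def)

lemma k_field: "field k"
proof -
 have "cring k" unfolding k_def C_eq by (rule ring_hom_ring.img_is_cring[OF ring_hom_ringI2[OF F.ring_axioms ring_axioms tau_hom] is_cring])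
 moreover have "\<exists>b\<in>C. a \<otimes> b = \<one>" if a: "a \<in> C" "a \<noteq> \<zero>" for a
 proof -
  obtain f where f: "f \<in> carrier F" "a = \<tau> f" using a(1) by (auto simp: C_eq)
  then have "f \<noteq> \<zero>[F]" using a(2) by auto
  then have "f \<in> Units F" using f by (simp add: F.field_Units)
  then have "\<tau> f \<otimes> \<tau> (inv\<^bsub>F\<^esub> f) = \<one>" "inv\<^bsub>F\<^esub> f \<in> carrier F"
   using f(1) by (simp_all add: \<tau>.hom_mult[symmetric] F.Units_r_inv)
  then show ?thesis using f tau_C by blast
 qed
 ultimately show ?thesis by (intro cring.cring_fieldI2) simp_all
qed

sublocale k: field k by (rule k_field)

lemma k_max: "maximalideal I k \<longleftrightarrow> I = {\<zero>}"
proof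
 assume I: "maximalideal I k"
 then interpret maximalideal I k .
 have "I = {\<zero>[k]} \<or> I = carrier k" using k.all_ideals is_ideal by blast
 then show "I = {\<zero>}" using I_notcarr by simp
qed (use k.zeromaximalideal in simp)

lemma k_max_ideal: "max_ideal k = {\<zero>}"
 unfolding max_ideal_def by (rule the_equality) (simp_all add: k_max)

lemma k_noeth: "noetherian_ring k"
proof (intro noetherian_ring.intro noetherian_ring_axioms.intro k.ring_axioms)
 fix I assume "ideal I k"
 then have "I = {\<zero>[k]} \<or> I = carrier k" using k.all_ideals by blast
 then show "\<exists>B\<subseteq>carrier k. finite B \<and> I = Idl\<^bsub>k\<^esub> B"
 proof
  assume "I = {\<zero>[k]}" then show ?thesis using k.genideal_zero k.zero_closed by (intro exI[of _ "{\<zero>[k]}"]) simp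
 next
  assume "I = carrier k" then show ?thesis using k.genideal_one k.one_closed by (intro exI[of _ "{\<one>[k]}"]) simp
 qed
qed

sublocale kn: local_noeth k
 by (intro local_noeth.intro local_noeth_axioms.intro noeth_cring.intro k.is_cring k_noeth) (simp add: k_max)

lemma k_mpow: "max_ideal_pow k (Suc j) = {\<zero>}"
proof -
 have "max_ideal_pow k (Suc j) \<subseteq> {\<zero>}" using kn.mpow_antimono[of "Suc 0" "Suc j"] by (simp add: k_max_ideal)
 moreover have "\<zero> \<in> max_ideal_pow k (Suc j)"
  using additive_subgroup.zero_closed[OF ideal.axioms(1)[OF kn.mpow_ideal[of "Suc j"]]] by simp
 ultimately show ?thesis by blast
qed

lemma k_complete: "complete_local k"
 unfolding complete_local_def local_cring_def
proof (intro conjI allI impI)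
 show "cring k" by (rule k.is_cring)
 show "\<exists>!I. maximalideal I k" by (simp add: k_max)
 have "(\<Inter>j. max_ideal_pow k j) \<subseteq> max_ideal_pow k (Suc 0)" by blast
 moreover have "\<zero> \<in> max_ideal_pow k j" for j
  using additive_subgroup.zero_closed[OF ideal.axioms(1)[OF kn.mpow_ideal[of j]]] by simp
 ultimately show "(\<Inter>j. max_ideal_pow k j) = {\<zero>[k]}" unfolding k_mpow by auto
 fix s assume s: "\<forall>j. s j \<in> carrier k \<and> s (Suc j) \<ominus>[k] s j \<in> max_ideal_pow k j"
 have sc: "s j \<in> carrier k" for j using s by blast
 \<comment> \<open>The zeroth power of the maximal ideal is the whole ring, so the step from index 0
   to 1 is unconstrained and the sequence is constant only from index 1 on.\<close>
 have st: "s (Suc j) = s (Suc 0)" for j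
 proof (induction j)
  case (Suc j)
  have "s (Suc (Suc j)) \<ominus>[k] s (Suc j) = \<zero>[k]" using s k_mpow[of j] by (auto dest!: spec[of _ "Suc j"])
  from k.diff_zero_eq[OF sc sc this] show ?case using Suc by simp
 qed simp
 have "s (Suc 0) \<ominus>[k] s j \<in> max_ideal_pow k j" for j
 proof (cases j)
  case 0 then show ?thesis using k.minus_closed[OF sc sc] by simp
 next
  case (Suc i)
  have "s (Suc 0) \<ominus>[k] s (Suc i) = \<zero>[k]" unfolding st[of i] using k.r_right_minus_eq[OF sc sc] by simp
  then show ?thesis unfolding Suc k_mpow by simp
 qed
 then show "\<exists>x\<in>carrier k. \<forall>j. x \<ominus>[k] s j \<in> max_ideal_pow k j" using sc by (intro bexI[of _ "s (Suc 0)"]) auto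
qed

lemma C_A: "a \<in> C \<Longrightarrow> a \<in> carrier A" using C_closed(1) by blast

lemma res_k: "res \<in> ring_hom k F"
 by (rule ring_hom_memI) (use C_A res.hom_closed in auto)

lemma tau_k: "\<tau> \<in> ring_hom F k"
 by (rule ring_hom_memI) (auto simp: tau_C)

lemma incl_k: "(\<lambda>a. a) \<in> ring_hom k A"
 by (rule ring_hom_memI) (auto simp: C_A)

lemma res_zero_C: "a \<in> C \<Longrightarrow> res a = \<zero>[F] \<Longrightarrow> a = \<zero>"
 using C_res[of a] by simp

lemma k_coeff: "coeff_algebra p F k"
 unfolding coeff_algebra_def k_simps
proof (intro conjI ballI)
 show "complete_local k" by (rule k_complete)
 show "noetherian_ring k" by (rule k_noeth)
 note h = struct_hom[OF p Ff finF char A]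
 show "struct_map A \<in> ring_hom (witt_ring p F) k"
 proof (rule ring_hom_memI)
  show "struct_map A w \<in> carrier k" if "w \<in> carrier (witt_ring p F)" for w using that by (simp add: C_def)
 qed (simp_all add: ring_hom_mult[OF h] ring_hom_add[OF h] ring_hom_one[OF h])
 show "res \<in> ring_hom k F" by (rule res_k)
 show "res ` C = carrier F" unfolding C_eq image_image by (simp add: res_tau cong: image_cong_simp)
 show "a_kernel k F res = max_ideal k"
 proof (rule Set.set_eqI)
  fix a
  have "a \<in> C \<and> res a = \<zero>[F] \<longleftrightarrow> a = \<zero>" using res_zero_C[of a] C_closed(3) res.hom_zero by blast
  then show "a \<in> a_kernel k F res \<longleftrightarrow> a \<in> max_ideal k"
   by (simp only: a_kernel_def' k_max_ideal k_simps mem_Collect_eq singleton_iff)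
 qed
 show "res (struct_map A w) = w 0" if "w \<in> carrier (witt_ring p F)" for w by (rule res_struct[OF that])
qed


subsection \<open>The descended deformation\<close>

text \<open>Off the carrier the action is the identity, so that the unit law of a deformation holds
  even if the carrier is empty.\<close>

definition "act0 G n \<rho> g = (if g \<in> carrier G then mat_vec n k (mat_map n \<tau> (\<rho> g)) else (\<lambda>x. x))"
definition "red0 n x = (\<lambda>i\<in>{..<n}. res (x i))"
definition "D0 G n \<rho> = \<lparr>dmod = vec_module n k, dact = act0 G n \<rho>, dred = red0 n\<rparr>"

text \<open>The maximal ideal of \<open>k\<close> is zero, so the adic topology on the free module
  is discrete, and continuity of the action comes down to local constancy of \<rho>.\<close>

lemma deformation_D0:
 fixes G :: "('g, 'c) monoid_scheme"
 assumes gr: "carrier G \<noteq> {} \<Longrightarrow> group G" and top: "topspace TG \<subseteq> carrier G"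
  and \<rho>: "continuous_rep G TG n F (discrete_topology (carrier F)) \<rho>"
 shows "deformation G TG n F \<rho> k (D0 G n \<rho>)"
proof -
 let ?V = "vec_module n k" and ?m = "\<lambda>g. mat_map n \<tau> (\<rho> g)"
 interpret MF: ring "Mat n F" by (rule F.Mat)
 have hom: "\<rho> \<in> hom G (GL n F)" and cont: "continuous_map TG (GL_topology n F (discrete_topology (carrier F))) \<rho>"
  using \<rho> by (simp_all add: continuous_rep_def)
 have GLc: "carrier (GL n F) \<subseteq> carrier (Mat n F)"
  by (auto simp: GL_def units_of_carrier units_mat_monoid MF.Units_closed)
 have \<rho>c: "\<rho> g \<in> carrier (Mat n F)" if "g \<in> carrier G" for g using hom_in_carrier[OF hom that] GLc by blast
 have th: "mat_map n \<tau> \<in> ring_hom (Mat n F) (Mat n k)" by (rule mat_map_hom[OF tau_k F.is_cring k.is_cring])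
 have mc: "?m g \<in> carrier (Mat n k)" if "g \<in> carrier G" for g by (rule ring_hom_closed[OF th \<rho>c[OF that]])
 have md: "module k ?V" by (rule k.vec_module)
 interpret fb: free_basis k ?V n "unit_vec n k" by (intro free_basis.intro free_basis_axioms.intro md k.vec_basis)
 have zero: "ideal_smult {\<zero>} ?V = {\<zero>[?V]}"
 proof
  show "ideal_smult {\<zero>} ?V \<subseteq> {\<zero>[?V]}"
  proof
   fix y assume "y \<in> ideal_smult {\<zero>} ?V"
   from fb.crd_ideal[OF k.zeroideal[unfolded k_simps] this]
   have y: "y \<in> carrier ?V" "\<And>i. i < n \<Longrightarrow> fb.crd y i = \<zero>" by auto
   have "y = \<zero>[?V]" by (rule fb.crd_eqI[OF y(1) k.vec_const_closed(1)]) (simp add: y(2) fb.crd_zero)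
   then show "y \<in> {\<zero>[?V]}" by simp
  qed
  show "{\<zero>[?V]} \<subseteq> ideal_smult {\<zero>} ?V"
   using generate.one[of "add_monoid ?V"] by (simp add: ideal_smult_def)
 qed
 have disc: "openin (adic_topology k ?V) U" if U: "U \<subseteq> carrier ?V" for U
  unfolding kn.openin_adic[OF md]
 proof (intro conjI ballI U)
  fix y assume y: "y \<in> U"
  have "y \<oplus>[?V] \<zero>[?V] = y" by (rule fb.M.r_zero) (use U y in blast)
  then have "\<forall>z\<in>ideal_smult (max_ideal_pow k (Suc 0)) ?V. y \<oplus>[?V] z \<in> U"
   unfolding k_mpow zero using y by simp
  then show "\<exists>j. \<forall>z\<in>ideal_smult (max_ideal_pow k j) ?V. y \<oplus>[?V] z \<in> U" by (rule exI)
 qed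
 have ac: "act0 G n \<rho> g x \<in> carrier ?V" if "x \<in> carrier ?V" for g x
  using k.vec_closed(3)[OF that mc] that by (simp add: act0_def)
 have act: "act0 G n \<rho> g x = mat_vec n k (?m g) x" if "g \<in> carrier G" for g x using that by (simp add: act0_def)
 have one: "act0 G n \<rho> \<one>[G] x = x" if x: "x \<in> carrier ?V" for x
 proof (cases "\<one>[G] \<in> carrier G")
  case True
  then have G: "group G" using gr by blast
  have eq: "carrier (mat_monoid n F) = carrier (Mat n F)" "\<one>[mat_monoid n F] = \<one>[Mat n F]"
   "monoid.mult (mat_monoid n F) = monoid.mult (Mat n F)" by (simp_all add: Mat_def)
  have mon: "monoid (mat_monoid n F)" by (rule monoidI) (simp_all add: eq MF.m_assoc)
  have "\<rho> \<one>[G] = \<one>[GL n F]" by (rule hom_one[OF hom G]) (simp add: GL_def monoid.units_group[OF mon])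
  then have "?m \<one>[G] = mat_map n \<tau> \<one>[Mat n F]" by (simp add: GL_def units_of_one Mat_def)
  then have "?m \<one>[G] = \<one>[Mat n k]" using ring_hom_one[OF th] by simp
  then show ?thesis using act[OF True] k.mat_vec_mat(3)[OF mc[OF True] mc[OF True] x] by simp
 qed (simp add: act0_def)
 have mult: "act0 G n \<rho> (g \<otimes>[G] h) x = act0 G n \<rho> g (act0 G n \<rho> h x)"
  if gh: "g \<in> carrier G" "h \<in> carrier G" and x: "x \<in> carrier ?V" for g h x
 proof -
  have G: "group G" using gr gh by blast
  have c: "g \<otimes>[G] h \<in> carrier G" using gh by (rule monoid.m_closed[OF group.is_monoid[OF G]])
  have "\<rho> (g \<otimes>[G] h) = \<rho> g \<otimes>[Mat n F] \<rho> h"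
   using hom_mult[OF hom gh] by (simp add: GL_def units_of_mult Mat_def)
  then have "?m (g \<otimes>[G] h) = ?m g \<otimes>[Mat n k] ?m h"
   using ring_hom_mult[OF th \<rho>c[OF gh(1)] \<rho>c[OF gh(2)]] by simp
  then show ?thesis using act gh c k.mat_vec_mult[OF mc[OF gh(1)] mc[OF gh(2)] x] by simp
 qed
 have cnt: "continuous_map (prod_topology TG (adic_topology k ?V)) (adic_topology k ?V) (\<lambda>(g, x). act0 G n \<rho> g x)"
  unfolding continuous_map_def
 proof (intro conjI allI impI)
  show "(\<lambda>(g, x). act0 G n \<rho> g x) \<in> topspace (prod_topology TG (adic_topology k ?V)) \<rightarrow> topspace (adic_topology k ?V)"
   using ac by (auto simp: kn.topspace_adic[OF md])
  fix U
  let ?S = "{z \<in> topspace (prod_topology TG (adic_topology k ?V)). (case z of (g, x) \<Rightarrow> act0 G n \<rho> g x) \<in> U}"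
  show "openin (prod_topology TG (adic_topology k ?V)) ?S"
  proof (subst openin_subopen, rule ballI)
   fix z assume z: "z \<in> ?S"
   obtain g x where gx: "z = (g, x)" by (cases z)
   have g: "g \<in> topspace TG" "x \<in> carrier ?V" "act0 G n \<rho> g x \<in> U" using z by (auto simp: gx kn.topspace_adic[OF md])
   let ?G = "{h \<in> topspace TG. \<rho> h \<in> {\<rho> g}}"
   have rg: "\<rho> g \<in> carrier (GL n F)" using hom_in_carrier[OF hom] g(1) top by blast
   have "({..<n} \<times> {..<n}) \<rightarrow>\<^sub>E carrier F = carrier (Mat n F)" by (simp add: mat_carrier)
   then have rp: "\<rho> g \<in> ({..<n} \<times> {..<n}) \<rightarrow>\<^sub>E carrier F" using rg GLc by blast
   have "PiE ({..<n} \<times> {..<n}) (\<lambda>ij. {\<rho> g ij}) = {\<rho> g}" by (rule PiE_singleton) (use rp in \<open>simp add: PiE_def\<close>)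
   moreover have "openin (product_topology (\<lambda>_. discrete_topology (carrier F)) ({..<n} \<times> {..<n}))
     (PiE ({..<n} \<times> {..<n}) (\<lambda>ij. {\<rho> g ij}))"
    by (subst openin_PiE) (use rp in auto)
   ultimately have "openin (GL_topology n F (discrete_topology (carrier F))) {\<rho> g}"
    unfolding GL_topology_def openin_subtopology using rg by (intro exI[of _ "{\<rho> g}"]) auto
   from openin_continuous_map_preimage[OF cont this] have "openin TG ?G" .
   then have "openin (prod_topology TG (adic_topology k ?V)) (?G \<times> {x})"
    using disc[of "{x}"] g(2) by (simp add: openin_prod_Times_iff)
   moreover have "z \<in> ?G \<times> {x}" using g gx by simp
   moreover have "?G \<times> {x} \<subseteq> ?S"
   proof
    fix y assume y: "y \<in> ?G \<times> {x}"
    then obtain h where h: "y = (h, x)" "h \<in> topspace TG" "\<rho> h = \<rho> g" by blast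
    have "act0 G n \<rho> h x = act0 G n \<rho> g x" using act[OF subsetD[OF top h(2)]] act[OF subsetD[OF top g(1)]] h(3) by simp
    then show "y \<in> ?S" using h g by (simp add: kn.topspace_adic[OF md])
   qed
   ultimately show "\<exists>T. openin (prod_topology TG (adic_topology k ?V)) T \<and> z \<in> T \<and> T \<subseteq> ?S" by blast
  qed
 qed
 have rc: "red0 n x \<in> carrier (vec_module n F)" if x: "x \<in> carrier ?V" for x
  by (rule vec_carrierI) (use vec_entry[OF x] C_A in \<open>auto simp: red0_def\<close>)
 have lin: "lin_endo k ?V (act0 G n \<rho> g)" if g: "g \<in> carrier G" for g
  unfolding semilinear_def using k.vec_closed(3)[OF _ mc[OF g]] k.mat_vec_linear[OF mc[OF g]] by (auto simp: act[OF g])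
 have sl: "semilinear k res ?V (vec_module n F) (red0 n)"
  unfolding semilinear_def
 proof (intro conjI ballI)
  show "red0 n \<in> carrier ?V \<rightarrow> carrier (vec_module n F)" using rc by blast
  fix x assume x: "x \<in> carrier ?V"
  fix y assume y: "y \<in> carrier ?V"
  note e = C_A[OF vec_entry[OF x, unfolded k_simps]] C_A[OF vec_entry[OF y, unfolded k_simps]]
  show "red0 n (x \<oplus>[?V] y) = red0 n x \<oplus>[vec_module n F] red0 n y"
   by (rule vec_eqI[OF rc[OF k.vec_closed(1)[OF x y]] F.vec_closed(1)[OF rc[OF x] rc[OF y]]])
    (use e in \<open>auto simp: red0_def vec_entries\<close>)
 next
  fix a x assume a: "a \<in> carrier k" and x: "x \<in> carrier ?V"
  note e = C_A[OF vec_entry[OF x, unfolded k_simps]] C_A[OF a[unfolded k_simps]]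
  show "red0 n (a \<odot>[?V] x) = res a \<odot>[vec_module n F] red0 n x"
   by (rule vec_eqI[OF rc[OF k.vec_closed(2)[OF x a]] F.vec_closed(2)[OF rc[OF x]]])
    (use e in \<open>auto simp: red0_def vec_entries\<close>)
 qed
 have surj: "red0 n ` carrier ?V = carrier (vec_module n F)"
 proof
  show "carrier (vec_module n F) \<subseteq> red0 n ` carrier ?V"
  proof
   fix y assume y: "y \<in> carrier (vec_module n F)"
   let ?x = "\<lambda>i\<in>{..<n}. \<tau> (y i)"
   have xc: "?x \<in> carrier ?V" by (rule vec_carrierI) (use vec_entry[OF y] tau_C in auto)
   have "red0 n ?x = y" by (rule vec_eqI[OF rc[OF xc] y]) (use vec_entry[OF y] in \<open>simp add: red0_def res_tau\<close>)
   then show "y \<in> red0 n ` carrier ?V" using xc by (intro image_eqI[of _ _ ?x]) simp_all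
  qed
 qed (use rc in blast)
 have ker: "{x \<in> carrier ?V. red0 n x = \<zero>[vec_module n F]} = {\<zero>[?V]}"
 proof (rule Set.set_eqI)
  fix x
  have "x = \<zero>[?V]" if x: "x \<in> carrier ?V" "red0 n x = \<zero>[vec_module n F]"
  proof (rule vec_eqI[OF x(1) k.vec_const_closed(1)])
   fix i assume i: "i < n"
   have "res (x i) = \<zero>[F]" using arg_cong[OF x(2), of "\<lambda>f. f i"] i by (simp add: red0_def vec_entries)
   then show "x i = \<zero>[?V] i" using res_zero_C vec_entry[OF x(1) i] i by (simp add: vec_entries)
  qed
  moreover have "red0 n \<zero>[?V] = \<zero>[vec_module n F]"
   by (rule vec_eqI[OF rc[OF k.vec_const_closed(1)] F.vec_const_closed(1)]) (simp add: red0_def vec_entries)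
  ultimately show "x \<in> {x \<in> carrier ?V. red0 n x = \<zero>[vec_module n F]} \<longleftrightarrow> x \<in> {\<zero>[?V]}"
   using k.vec_const_closed(1)[of n] by blast
 qed
 have eqv: "red0 n (act0 G n \<rho> g x) = mat_vec n F (\<rho> g) (red0 n x)" if g: "g \<in> carrier G" and x: "x \<in> carrier ?V" for g x
 proof (rule vec_eqI[OF rc[OF ac[OF x]] F.vec_closed(3)[OF rc[OF x] \<rho>c[OF g]]])
  fix i assume i: "i < n"
  note e = C_A[OF vec_entry[OF x, unfolded k_simps]] mat_entry[OF \<rho>c[OF g] i]
  have "red0 n (act0 G n \<rho> g x) i = res (\<Oplus>\<^bsub>k\<^esub>j\<in>{..<n}. ?m g (i, j) \<otimes>[k] x j)"
   using i by (simp add: red0_def act[OF g] vec_entries)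
  also have "\<dots> = (\<Oplus>\<^bsub>F\<^esub>j\<in>{..<n}. res (?m g (i, j) \<otimes>[k] x j))"
   by (rule ring_hom_finsum[OF res_k k.is_cring F.is_cring]) (use k.m_closed mat_entry[OF mc[OF g] i] vec_entry[OF x] in auto)
  also have "\<dots> = (\<Oplus>\<^bsub>F\<^esub>j\<in>{..<n}. \<rho> g (i, j) \<otimes>[F] red0 n x j)"
   by (rule F.finsum_cong') (use e i in \<open>auto simp: red0_def res_tau\<close>)
  finally show "red0 n (act0 G n \<rho> g x) i = mat_vec n F (\<rho> g) (red0 n x) i" using i by (simp add: vec_entries)
 qed
 show ?thesis
  unfolding deformation_def Let_def D0_def
  using md k.vec_basis[of n] lin one mult cnt sl surj ker eqv by (auto simp: k_max_ideal zero)
qed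

text \<open>The base change map sends a coordinate vector to the corresponding combination of v; its
  equivariance is the hypothesis \<open>act\<close>, its compatibility with reduction the hypothesis
  \<open>red\<close>.\<close>

lemma base_change_D0:
 assumes fb: "free_basis A (dmod D) n v" and dl: "deformation G TG n F \<rho> A D"
  and \<rho>: "\<And>g. g \<in> carrier G \<Longrightarrow> \<rho> g \<in> carrier (Mat n F)"
  and red: "\<And>i. i < n \<Longrightarrow> dred D (v i) = unit_vec n F i"
  and act: "\<And>g j. g \<in> carrier G \<Longrightarrow> j < n \<Longrightarrow> dact D g (v j) = lin_comb (dmod D) {..<n} (\<lambda>i. \<tau> (\<rho> g (i, j))) v"
 shows "is_base_change G n k A (\<lambda>a\<in>C. a) (D0 G n \<rho>) D"
proof -
 define M where "M = dmod D"
 let ?V = "vec_module n k"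
 note Du = dl[unfolded deformation_def Let_def, folded M_def]
 have lin: "\<And>g. g \<in> carrier G \<Longrightarrow> lin_endo A M (dact D g)" and sl: "semilinear A res M (vec_module n F) (dred D)"
  and surj: "dred D ` carrier M = carrier (vec_module n F)" using Du by simp_all
 interpret V: module F "vec_module n F" by (rule F.vec_module)
 note A_closed = finsum_closed
 interpret free_basis A M n v using fb unfolding M_def .
 define h where "h x = lin_comb M {..<n} x v" for x
 have cA: "x i \<in> carrier A" "x i \<in> C" if "x \<in> carrier ?V" "i < n" for x i
  using vec_entry[OF that] C_A by simp_all
 have hc: "h x \<in> carrier M" if "x \<in> carrier ?V" for x unfolding h_def by (rule lc_closed) (auto simp: cA that bc)
 have "deformation_map G k (\<lambda>a\<in>C. a) (D0 G n \<rho>) D h"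
  unfolding deformation_map_def semilinear_def D0_def deformation_data.simps M_def[symmetric]
 proof (intro conjI ballI)
  show "h \<in> carrier ?V \<rightarrow> carrier M" using hc by blast
  fix x assume x: "x \<in> carrier ?V"
  fix y assume y: "y \<in> carrier ?V"
  have "h (x \<oplus>[?V] y) = lin_comb M {..<n} (\<lambda>i. x i \<oplus> y i) v"
   unfolding h_def by (rule lc_cong) (auto simp: vec_entries cA x y bc)
  also have "\<dots> = h x \<oplus>[M] h y" unfolding h_def by (rule lc_add) (auto simp: cA x y bc)
  finally show "h (x \<oplus>[?V] y) = h x \<oplus>[M] h y" .
 next
  fix a x assume a: "a \<in> carrier k" and x: "x \<in> carrier ?V"
  have aA: "a \<in> carrier A" "a \<in> C" using a C_A by simp_all
  have "h (a \<odot>[?V] x) = lin_comb M {..<n} (\<lambda>i. a \<otimes> x i) v"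
   unfolding h_def by (rule lc_cong) (auto simp: vec_entries cA x aA bc)
  also have "\<dots> = a \<odot>[M] h x" unfolding h_def by (rule lc_smult(1)) (auto simp: cA x aA bc)
  finally show "h (a \<odot>[?V] x) = (\<lambda>a\<in>C. a) a \<odot>[M] h x" using aA by simp
 next
  fix g x assume g: "g \<in> carrier G" and x: "x \<in> carrier ?V"
  have tc: "\<tau> (\<rho> g (i, j)) \<in> carrier A" "\<tau> (\<rho> g (i, j)) \<in> C" if "i < n" "j < n" for i j
   using mat_entry[OF \<rho>[OF g] that] tau_C by simp_all
  have dv: "dact D g (v j) \<in> carrier M" if "j < n" for j using lin[OF g] bc[OF that] by (auto simp: semilinear_def)
  have fs: "(\<Oplus>\<^bsub>k\<^esub>j\<in>{..<n}. \<tau> (\<rho> g (i, j)) \<otimes>[k] x j) = (\<Oplus>j\<in>{..<n}. \<tau> (\<rho> g (i, j)) \<otimes> x j)" if i: "i < n" for i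
   using ring_hom_finsum[OF incl_k k.is_cring is_cring, of "\<lambda>j. \<tau> (\<rho> g (i, j)) \<otimes>[k] x j" "{..<n}"]
    tc[OF i] cA[OF x] C_closed(4) by auto
  have "h (act0 G n \<rho> g x) = lin_comb M {..<n} (\<lambda>i. \<Oplus>j\<in>{..<n}. \<tau> (\<rho> g (i, j)) \<otimes> x j) v"
   unfolding h_def
  proof (rule lc_cong)
   fix i assume "i \<in> {..<n}"
   then have i: "i < n" by simp
   have "act0 G n \<rho> g x i = (\<Oplus>\<^bsub>k\<^esub>j\<in>{..<n}. mat_map n \<tau> (\<rho> g) (i, j) \<otimes>[k] x j)"
    using g i by (simp add: act0_def vec_entries)
   also have "\<dots> = (\<Oplus>\<^bsub>k\<^esub>j\<in>{..<n}. \<tau> (\<rho> g (i, j)) \<otimes>[k] x j)"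
    by (rule k.finsum_cong') (use i tc[OF i] cA[OF x] C_closed(4) in auto)
   finally show "act0 G n \<rho> g x i = (\<Oplus>j\<in>{..<n}. \<tau> (\<rho> g (i, j)) \<otimes> x j)" using fs[OF i] by simp
  qed (use tc cA[OF x] bc in \<open>auto intro!: A_closed\<close>)
  also have "\<dots> = lin_comb M {..<n} x (\<lambda>j. lin_comb M {..<n} (\<lambda>i. \<tau> (\<rho> g (i, j))) v)"
   by (rule lc_lc[symmetric]) (auto simp: tc cA[OF x] bc)
  also have "\<dots> = lin_comb M {..<n} x (\<lambda>j. dact D g (v j))"
   by (rule lc_cong) (auto simp: act[OF g, folded M_def, symmetric] cA[OF x] dv)
  also have "\<dots> = dact D g (h x)"
   unfolding h_def by (rule semilinear_lc[OF module_axioms module_axioms lin[OF g], symmetric]) (auto simp: cA[OF x] bc)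
  finally show "h (act0 G n \<rho> g x) = dact D g (h x)" .
 next
  fix x assume x: "x \<in> carrier ?V"
  show "dred D (h x) = red0 n x"
  proof (rule vec_eqI[of _ n F])
   show "dred D (h x) \<in> carrier (vec_module n F)" using surj hc[OF x] by blast
   show "red0 n x \<in> carrier (vec_module n F)" by (rule vec_carrierI) (auto simp: red0_def cA[OF x])
   fix i assume i: "i < n"
   have "dred D (h x) = lin_comb (vec_module n F) {..<n} (\<lambda>j. res (x j)) (\<lambda>j. dred D (v j))"
    unfolding h_def by (rule semilinear_lc[OF module_axioms F.vec_module sl]) (auto simp: cA[OF x] bc)
   then have "dred D (h x) i = (\<Oplus>\<^bsub>F\<^esub>j\<in>{..<n}. res (x j) \<otimes>[F] dred D (v j) i)"
    using F.vec_lin_comb_entry[of n "\<lambda>j. dred D (v j)" n "\<lambda>j. res (x j)" i] i red cA[OF x] F.vec_const_closed(2)[of n] by simp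
   also have "\<dots> = (\<Oplus>\<^bsub>F\<^esub>j\<in>{..<n}. if i = j then res (x j) else \<zero>[F])"
    by (rule F.finsum_cong') (use red i cA[OF x] in \<open>auto simp: vec_entries\<close>)
   also have "\<dots> = red0 n x i" unfolding red0_def using i cA[OF x] by (subst F.finsum_singleton) auto
   finally show "dred D (h x) i = red0 n x i" .
  qed
 qed
 moreover have "h (unit_vec n k j) = v j" if j: "j < n" for j
 proof -
  have "h (unit_vec n k j) = lin_comb M {..<n} (\<lambda>i. if i = j then \<one> else \<zero>) v"
   unfolding h_def by (rule lc_cong) (auto simp: vec_entries bc)
  also have "\<dots> = v j" by (rule lc_delta) (auto simp: j bc)
  finally show ?thesis .
 qed
 then have "module_basis A M n (h \<circ> unit_vec n k)" by (intro module_basis_cong[OF module_axioms basis]) simp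
 ultimately show ?thesis unfolding is_base_change_def
  using k.vec_basis[of n] by (intro exI[of _ h] exI[of _ "unit_vec n k"]) (simp add: D0_def M_def)
qed

end

section \<open>Isomorphism classes and universality\<close>

text \<open>Values of \<open>deformation_functor\<close> are classes of a quotient; the equivalence
  property ensures that two classes with a common member coincide.\<close>

lemma deformation_iso_equiv:
 fixes G :: "('g, 'c) monoid_scheme" and A :: "('a, 'f) witt_alg"
 shows "equiv {D :: ('a, 'g, 'f) small_deformation. deformation G TG n F \<rho> A D} (deformation_iso G TG n F \<rho> A)"
  (is "equiv ?S _")
proof (rule equivI)
 show "deformation_iso G TG n F \<rho> A \<subseteq> ?S \<times> ?S"
  by (auto simp: deformation_iso_def)
 show "refl_on ?S (deformation_iso G TG n F \<rho> A)"
 proof (rule refl_onI)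
  fix D assume D: "D \<in> ?S"
  have "deformation_map G A (\<lambda>a. a) D D (\<lambda>x. x) \<and> bij_betw (\<lambda>x. x) (carrier (dmod D)) (carrier (dmod D))"
   by (auto simp: deformation_map_def semilinear_def bij_betw_def)
  then show "(D, D) \<in> deformation_iso G TG n F \<rho> A" using D unfolding deformation_iso_def by blast
 qed
 show "sym (deformation_iso G TG n F \<rho> A)"
 proof (rule symI)
  fix D D' assume "(D, D') \<in> deformation_iso G TG n F \<rho> A"
  then obtain h where d: "deformation G TG n F \<rho> A D" "deformation G TG n F \<rho> A D'"
   and h: "deformation_map G A (\<lambda>a. a) D D' h" "bij_betw h (carrier (dmod D)) (carrier (dmod D'))"
   unfolding deformation_iso_def by blast
  let ?i = "inv_into (carrier (dmod D)) h"
  interpret M: module A "dmod D" using d(1) by (simp add: deformation_def Let_def)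
  have act: "dact D g x \<in> carrier (dmod D)" if "g \<in> carrier G" "x \<in> carrier (dmod D)" for g x
   using d(1) that by (auto simp: deformation_def Let_def semilinear_def)
  have hi: "h (?i y) = y" "?i y \<in> carrier (dmod D)" if "y \<in> carrier (dmod D')" for y
   using h(2) that by (auto simp: bij_betw_def f_inv_into_f inv_into_into)
  have ih: "?i (h x) = x" if "x \<in> carrier (dmod D)" for x using h(2) that by (simp add: bij_betw_def)
  note hs = h(1)[unfolded deformation_map_def semilinear_def]
  have "?i (x \<oplus>[dmod D'] y) = ?i x \<oplus>[dmod D] ?i y" if "x \<in> carrier (dmod D')" "y \<in> carrier (dmod D')" for x y
  proof -
   have "h (?i x \<oplus>[dmod D] ?i y) = x \<oplus>[dmod D'] y" using hs hi that by simp
   then show ?thesis using ih[of "?i x \<oplus>[dmod D] ?i y"] hi that by simp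
  qed
  moreover have "?i (a \<odot>[dmod D'] x) = a \<odot>[dmod D] ?i x" if "a \<in> carrier A" "x \<in> carrier (dmod D')" for a x
  proof -
   have "h (a \<odot>[dmod D] ?i x) = a \<odot>[dmod D'] x" using hs hi that by simp
   then show ?thesis using ih[of "a \<odot>[dmod D] ?i x"] hi that by simp
  qed
  moreover have "?i (dact D' g x) = dact D g (?i x)" if "g \<in> carrier G" "x \<in> carrier (dmod D')" for g x
  proof -
   have "h (dact D g (?i x)) = dact D' g x" using hs hi that by simp
   then show ?thesis using ih[of "dact D g (?i x)"] act hi that by simp
  qed
  moreover have "dred D (?i x) = dred D' x" if "x \<in> carrier (dmod D')" for x using hs hi[OF that] by metis
  ultimately have "deformation_map G A (\<lambda>a. a) D' D ?i" unfolding deformation_map_def semilinear_def using hi(2) by simp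
  then show "(D', D) \<in> deformation_iso G TG n F \<rho> A"
   unfolding deformation_iso_def using d bij_betw_inv_into[OF h(2)] by blast
 qed
 show "trans (deformation_iso G TG n F \<rho> A)"
 proof (rule transI)
  fix D D' D'' assume "(D, D') \<in> deformation_iso G TG n F \<rho> A" "(D', D'') \<in> deformation_iso G TG n F \<rho> A"
  then obtain h h' where d: "deformation G TG n F \<rho> A D" "deformation G TG n F \<rho> A D''"
   and h: "deformation_map G A (\<lambda>a. a) D D' h" "bij_betw h (carrier (dmod D)) (carrier (dmod D'))"
   and h': "deformation_map G A (\<lambda>a. a) D' D'' h'" "bij_betw h' (carrier (dmod D')) (carrier (dmod D''))"
   unfolding deformation_iso_def by blast
  have m: "h x \<in> carrier (dmod D')" if "x \<in> carrier (dmod D)" for x using h(2) that by (auto simp: bij_betw_def)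
  have m': "h' x \<in> carrier (dmod D'')" if "x \<in> carrier (dmod D')" for x using h'(2) that by (auto simp: bij_betw_def)
  have "deformation_map G A (\<lambda>a. a) D D'' (h' \<circ> h)"
   unfolding deformation_map_def semilinear_def
  proof (intro conjI ballI)
   show "h' \<circ> h \<in> carrier (dmod D) \<rightarrow> carrier (dmod D'')" using m m' by auto
  qed (use h(1) h'(1) m in \<open>simp_all add: deformation_map_def semilinear_def\<close>)
  then show "(D, D'') \<in> deformation_iso G TG n F \<rho> A"
   unfolding deformation_iso_def using d bij_betw_trans[OF h(2) h'(2)] by blast
 qed
qed

theorem theorem8p8:
  fixes p n :: nat
    and K :: "complex set" and S :: "nf_prime set"
    and F :: "'f ring"
    and \<rho> :: "(complex \<Rightarrow> complex) \<Rightarrow> nat \<times> nat \<Rightarrow> 'f"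
    and R :: "('r, 'f) witt_alg"
  assumes "Factorial_Ring.prime p"
    and "conjecture_UFM p"
    and "number_field K"
    and "finite S" and "S \<subseteq> primes_of K" and "\<forall>P \<in> S. \<not> prime_above p P"
    and "field F" and "finite (carrier F)" and "has_char F p"
    and "continuous_rep (GKS K S) (GKS_topology K S) n F (discrete_topology (carrier F)) \<rho>"
    and "absolutely_irreducible_rep (GKS K S) n F \<rho>"
    and "universal_deformation_ring p (GKS K S) (GKS_topology K S) n F \<rho> R"
  shows "finite_over_witt p F R"
proof (rule ccontr)
 let ?G = "GKS K S" and ?TG = "GKS_topology K S"
 note p = assms(1) and F = assms(7,8) and char = assms(9)
 have R: "coeff_algebra p F R" using assms(12) by (simp add: universal_deformation_ring_def)
 assume "\<not> finite_over_witt p F R"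
 then have inf: "\<not> fin_index R (PIdl\<^bsub>R\<^esub> (add_pow R p \<one>[R]))"
  using finite_over_witt_of_fin_index[OF p F char R] by blast
 from exists_just_infinite_quotient[OF R F inf] obtain A :: "(continuum, 'f) witt_alg" and e0
  where A: "coeff_algebra p F A" "just_infinite A" "has_char A p"
   and e0: "e0 \<in> ring_hom R A" "e0 ` carrier R = carrier A"
    "\<forall>w\<in>carrier (witt_ring p F). e0 (struct_map R w) = struct_map A w"
    "\<forall>x\<in>carrier R. residue_map A (e0 x) = residue_map R x" by (elim exE conjE)
 interpret char_p_coeff p F A by (intro char_p_coeff.intro p F char A)
 interpret Rr: ring R using coeff_algebra_local_noeth[OF R] by (simp add: local_noeth_def noeth_cring_def cring_def)
 have struct_R: "struct_map R w \<in> carrier R" if "w \<in> carrier (witt_ring p F)" for w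
  using R that by (auto simp: coeff_algebra_def dest: ring_hom_closed)
 \<comment> \<open>\<open>coeff_hom\<close> consists of extensional maps, so the quotient map is
   restricted to R before two such maps are compared.\<close>
 define e where "e = restrict e0 (carrier R)"
 have e: "e \<in> coeff_hom p F R A"
  unfolding coeff_hom_def e_def using e0 struct_R
  by (auto simp: ring_hom_def Rr.m_closed Rr.a_closed)
 obtain \<Phi> :: "(continuum, 'f) witt_alg \<Rightarrow> ('r \<Rightarrow> continuum) \<Rightarrow> (continuum, complex \<Rightarrow> complex, 'f) small_deformation set"
  where bij0: "\<forall>B. coeff_algebra p F B \<longrightarrow>
    bij_betw (\<Phi> B) (coeff_hom p F R B) (deformation_functor ?G ?TG n F \<rho> B)"
   and nat0: "\<forall>B B' f h. coeff_algebra p F B \<and> coeff_algebra p F B' \<and> f \<in> coeff_hom p F B B' \<and>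
    h \<in> coeff_hom p F R B \<longrightarrow>
    \<Phi> B' (compose (carrier R) f h) = deformation_functor_map ?G ?TG n F \<rho> B B' f (\<Phi> B h)"
  using assms(12) unfolding universal_deformation_ring_def by (elim conjE exE)
 have bij: "bij_betw (\<Phi> B) (coeff_hom p F R B) (deformation_functor ?G ?TG n F \<rho> B)" if "coeff_algebra p F B" for B
  using bij0 that by simp
 let ?iso = "\<lambda>B. deformation_iso ?G ?TG n F \<rho> B"
 have "\<Phi> A e \<in> deformation_functor ?G ?TG n F \<rho> A" using bij_betwE[OF bij[OF A(1)]] e by blast
 then obtain D where D: "deformation ?G ?TG n F \<rho> A D" "\<Phi> A e = ?iso A `` {D}"
  unfolding deformation_functor_def by (elim quotientE) simp
 have hom: "\<rho> \<in> hom ?G (GL n F)" using assms(10) by (simp add: continuous_rep_def)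
 obtain v where v: "module_basis A (dmod D) n v" "\<And>i. i < n \<Longrightarrow> dred D (v i) = unit_vec n F i"
  "\<And>g j. g \<in> carrier ?G \<Longrightarrow> j < n \<Longrightarrow> dact D g (v j) = lin_comb (dmod D) {..<n} (\<lambda>i. \<tau> (\<rho> g (i, j))) v"
  using descend_deformation[OF assms(2-6) hom assms(11) D(1)] by (elim exE conjE) simp
 have D0: "deformation ?G ?TG n F \<rho> k (D0 ?G n \<rho>)"
  by (rule deformation_D0[OF GKS_group GKS_topspace assms(10)])
 have fb: "free_basis A (dmod D) n v"
  using D(1) v(1) by (simp add: free_basis_def free_basis_axioms_def deformation_def Let_def)
 interpret MF: ring "Mat n F" by (rule F.Mat)
 have \<rho>c: "\<rho> g \<in> carrier (Mat n F)" if "g \<in> carrier ?G" for g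
  using hom_in_carrier[OF hom that] by (simp add: GL_def units_of_carrier units_mat_monoid MF.Units_closed)
 have bc: "is_base_change ?G n k A (\<lambda>a\<in>C. a) (D0 ?G n \<rho>) D"
  by (rule base_change_D0[OF fb D(1) \<rho>c v(2,3)])
 have eqk: "equiv {D. deformation ?G ?TG n F \<rho> k D} (?iso k)" by (rule deformation_iso_equiv)
 have eqA: "equiv {D. deformation ?G ?TG n F \<rho> A D} (?iso A)" by (rule deformation_iso_equiv)
 have "?iso k `` {D0 ?G n \<rho>} \<in> deformation_functor ?G ?TG n F \<rho> k"
  unfolding deformation_functor_def by (rule quotientI) (use D0 in simp)
 \<comment> \<open>Surjectivity of \<Phi> over the coefficient field: the descended deformation
   comes from a homomorphism h0 from R to \<open>k\<close>.\<close>
 then obtain h0 where h0: "h0 \<in> coeff_hom p F R k" "\<Phi> k h0 = ?iso k `` {D0 ?G n \<rho>}"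
  using bij_betw_imp_surj_on[OF bij[OF k_coeff]] by (metis (no_types, lifting) imageE)
 let ?f = "\<lambda>a\<in>C. a"
 have f: "?f \<in> coeff_hom p F k A"
  unfolding coeff_hom_def by (auto simp: ring_hom_def C_A C_closed C_def[symmetric]) (auto simp: C_def)
 let ?e = "compose (carrier R) ?f h0"
 have h0C: "h0 x \<in> C" if "x \<in> carrier R" for x
  using h0(1) that by (auto simp: coeff_hom_def ring_hom_def)
 have ce: "?e = restrict h0 (carrier R)" unfolding compose_def by (rule restrict_ext) (simp add: h0C)
 have e': "?e \<in> coeff_hom p F R A"
  unfolding ce coeff_hom_def using h0(1) h0C struct_R
  by (auto simp: ring_hom_def coeff_hom_def C_A Rr.m_closed Rr.a_closed)
 have \<Phi>e': "\<Phi> A ?e = deformation_functor_map ?G ?TG n F \<rho> k A ?f (?iso k `` {D0 ?G n \<rho>})"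
  using nat0[rule_format, of k A ?f h0] k_coeff A(1) f h0(1) unfolding h0(2) by simp
 have "D0 ?G n \<rho> \<in> ?iso k `` {D0 ?G n \<rho>}" by (rule equiv_class_self[OF eqk]) (use D0 in simp)
 \<comment> \<open>\<open>D\<close> is a base change of the descended deformation along the
   inclusion of \<open>k\<close>, so by naturality it lies in the class attached to the composite
   from R through \<open>k\<close> to \<open>A\<close>.\<close>
 then have DD: "D \<in> \<Phi> A ?e" unfolding \<Phi>e' deformation_functor_map_def using D(1) bc by blast
 have "\<Phi> A ?e \<in> deformation_functor ?G ?TG n F \<rho> A" using bij_betwE[OF bij[OF A(1)]] e' by blast
 then obtain D' where D': "\<Phi> A ?e = ?iso A `` {D'}" unfolding deformation_functor_def by (elim quotientE) simp
 have "(D', D) \<in> ?iso A" using DD D' by blast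
 from equiv_class_eq[OF eqA this] have "\<Phi> A ?e = \<Phi> A e" using D(2) D' by simp
 \<comment> \<open>Injectivity of \<Phi> over \<open>A\<close>: the quotient map and the composite
   through \<open>k\<close> give the same class, so they coincide, and the image of the quotient map
   lies in the finite field \<open>C\<close>.\<close>
 from inj_onD[OF bij_betw_imp_inj_on[OF bij[OF A(1)]] this e' e] have "?e = e" .
 then have "e = restrict h0 (carrier R)" using ce by simp
 then have "e ` carrier R \<subseteq> C" using h0C by auto
 then have "carrier A \<subseteq> C" using e0(2) by (simp add: e_def)
 then show False using infinite_carrier C_finite finite_subset by blast
qed

end
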